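(* Given a cartesian category $\mathcal{S}$ with weak pullbacks, let $\Psi:\mathcal{S}^{op}\to\mathbf{InfSL}$ be the elementary doctrine of weak subobjects. Then the doctrine $(\Psi)_r:\mathcal{D}_\Psi^{op}\to\mathbf{InfSL}$ is equivalent to the doctrine $S:\mathcal{S}_{reg}^{op}\to\mathbf{InfSL}$ of subobjects on the regular completion $\mathcal{S}_{reg}$ of $\mathcal{S}$.
   Context: $\mathbf{InfSL}$ is the category of inf-semilattices (with top element $\top$) and homomorphisms. A cartesian category is a category with finite products. An elementary doctrine is a functor $P:\mathcal{C}^{op}\to\mathbf{InfSL}$, $\mathcal{C}$ a category with binary products (the action of $P$ on an arrow $f$ is written $P_f$), such that for every object $A$ of $\mathcal{C}$ there is $\delta_A\in P(A\times A)$ with: (i) $\alpha\mapsto P_{pr_1}(\alpha)\wedge\delta_A$, for $\alpha\in P(A)$, is left adjoint to $P_{\langle id_A,id_A\rangle}:P(A\times A)\to P(A)$; (ii) for every map $e=\langle pr_1,pr_2,pr_2\rangle:X\times A\to X\times A\times A$, the assignment $\alpha\mapsto P_{\langle pr_1,pr_2\rangle}(\alpha)\wedge P_{\langle pr_2,pr_3\rangle}(\delta_A)$, for $\alpha\in P(X\times A)$, is left adjoint to $P_e:P(X\times A\times A)\to P(X\times A)$. Doctrines $P:\mathcal{C}^{op}\to\mathbf{InfSL}$ and $R:\mathcal{D}^{op}\to\mathbf{InfSL}$ are compared in the 2-category $\mathbf{ED}$ of elementary doctrines, whose 1-arrows are pairs $(F,b)$ with $F:\mathcal{C}\to\mathcal{D}$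 preserving binary products and $b:P\to R\circ F^{op}$ natural, with each $b_A$ preserving finite meets and $b_{A\times A}(\delta_A)=R_{\langle F(pr_1),F(pr_2)\rangle}(\delta_{F(A)})$, and whose 2-arrows $(F,b)\Rightarrow(G,c)$ are natural transformations $\theta:F\to G$ with $b_A(\alpha)\le R_{\theta_A}(c_A(\alpha))$. The doctrine of weak subobjects $\Psi:\mathcal{S}^{op}\to\mathbf{InfSL}$: $\Psi(A)$ is the poset reflection of the comma category $\mathcal{S}/A$, and $\Psi_f$ is given by weak pullback along $f$; $\delta_A$ is the class of the diagonal $A\to A\times A$. The doctrine of subobjects $S$ on a category with finite limits sends $A$ to the poset of subobjects of $A$, acting by pullback. For $\rho\in P(X\times X)$ a $P$-equivalence relation on $X$ (that is, reflexive: $\delta_X\le\rho$; symmetric: $\rho\le P_{\langle pr_2,pr_1\rangle}(\rho)$; transitive: $P_{\langle pr_1,pr_2\rangle}(\rho)\wedge P_{\langle pr_2,pr_3\rangle}(\rho)\le P_{\langle pr_1,pr_3\rangle}(\rho)$), $\mathcal{D}es_\rho$ is the sub-poset of $P(X)$ of those $\alpha$ with $P_{pr_1}(\alpha)\wedge\rho\le P_{pr_2}(\alpha)$. A weak comprehension of $\alpha\in P(A)$ is an arrow $c:X\to A$ such that $\top_X\le P_c(\alpha)$ and for every $g:Y\to A$ with $\top_Y\le P_g(\alpha)$ there is a (not necessarily unique) $h:Y\to X$ with $g=c\circ h$. For an elementary doctrine $P:\mathcal{C}^{op}\to\mathbf{InfSL}$ with weak comprehensions, the category $\mathcal{D}_P$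 is defined as follows: objects are triples $(A,\alpha,c)$ with $A$ in $\mathcal{C}$, $\alpha\in P(A)$ and $c:X\to A$ a weak comprehension of $\alpha$; an arrow $[f]:(A,\alpha,c:X\to A)\to(B,\beta,d:Y\to B)$ is an equivalence class of arrows $f:X\to Y$ of $\mathcal{C}$ such that $P_{c\times c}(\delta_A)\le P_{f\times f}(P_{d\times d}(\delta_B))$, with respect to the relation $f\sim f'$ determined by $P_{c\times c}(\delta_A)\le P_{f\times f'}(P_{d\times d}(\delta_B))$; composition is $[g]\circ[f]=[g\circ f]$. The doctrine $(P)_r:\mathcal{D}_P^{op}\to\mathbf{InfSL}$ is $(P)_r(A,\alpha,c)=\mathcal{D}es_{P_{c\times c}(\delta_A)}\subseteq P(X)$, acting on $[f]$ by restriction of $P_f$. The doctrine $\Psi$ has weak comprehensions. The regular completion $\mathcal{S}_{reg}$ of $\mathcal{S}$ is the free regular category on the weakly lex category $\mathcal{S}$ in the sense of Carboni–Vitale. *)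

theory Defs
  imports "HOL-Algebra.Galois_Connection"
begin

section \<open>Categories\<close>

record ('o, 'a) cat =
  Ob   :: "'o set"
  Arr  :: "'a set"
  Dom  :: "'a \<Rightarrow> 'o"
  Cod  :: "'a \<Rightarrow> 'o"
  Id   :: "'o \<Rightarrow> 'a"
  Comp :: "'a \<Rightarrow> 'a \<Rightarrow> 'a" (infixl \<open>\<cdot>\<index>\<close> 70)

definition hom :: "('o, 'a) cat \<Rightarrow> 'o \<Rightarrow> 'o \<Rightarrow> 'a set" where
  "hom C A B = {f \<in> Arr C. Dom C f = A \<and> Cod C f = B}"

locale category =
  fixes C :: "('o, 'a) cat" (structure)
  assumes Dom_closed: "f \<in> Arr C \<Longrightarrow> Dom C f \<in> Ob C"
    and Cod_closed: "f \<in> Arr C \<Longrightarrow> Cod C f \<in> Ob C"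
    and Id_hom: "A \<in> Ob C \<Longrightarrow> Id C A \<in> hom C A A"
    and Comp_hom: "\<lbrakk>f \<in> hom C A B; g \<in> hom C B D\<rbrakk> \<Longrightarrow> g \<cdot> f \<in> hom C A D"
    and Comp_Id: "f \<in> hom C A B \<Longrightarrow> f \<cdot> Id C A = f"
    and Id_Comp: "f \<in> hom C A B \<Longrightarrow> Id C B \<cdot> f = f"
    and Comp_assoc: "\<lbrakk>f \<in> hom C A B; g \<in> hom C B D; h \<in> hom C D E\<rbrakk>
           \<Longrightarrow> h \<cdot> (g \<cdot> f) = (h \<cdot> g) \<cdot> f"

definition monic :: "('o, 'a) cat \<Rightarrow> 'a \<Rightarrow> bool" where
  "monic C m \<longleftrightarrow> m \<in> Arr C \<and>
     (\<forall>X. \<forall>u\<in>hom C X (Dom C m). \<forall>v\<in>hom C X (Dom C m). m \<cdot>\<^bsub>C\<^esub> u = m \<cdot>\<^bsub>C\<^esub> v \<longrightarrow> u = v)"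

definition coequalizer :: "('o, 'a) cat \<Rightarrow> 'a \<Rightarrow> 'a \<Rightarrow> 'a \<Rightarrow> bool" where
  "coequalizer C f g e \<longleftrightarrow>
     f \<in> Arr C \<and> g \<in> hom C (Dom C f) (Cod C f) \<and> e \<in> Arr C \<and> Dom C e = Cod C f \<and>
     e \<cdot>\<^bsub>C\<^esub> f = e \<cdot>\<^bsub>C\<^esub> g \<and>
     (\<forall>k\<in>Arr C. Dom C k = Cod C f \<and> k \<cdot>\<^bsub>C\<^esub> f = k \<cdot>\<^bsub>C\<^esub> g \<longrightarrow>
        (\<exists>!h. h \<in> hom C (Cod C e) (Cod C k) \<and> h \<cdot>\<^bsub>C\<^esub> e = k))"

definition regular_epi :: "('o, 'a) cat \<Rightarrow> 'a \<Rightarrow> bool" where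
  "regular_epi C e \<longleftrightarrow> (\<exists>f g. coequalizer C f g e)"


subsection \<open>Finite products and (weak) pullbacks\<close>

definition is_terminal :: "('o, 'a) cat \<Rightarrow> 'o \<Rightarrow> bool" where
  "is_terminal C T \<longleftrightarrow> T \<in> Ob C \<and> (\<forall>A\<in>Ob C. \<exists>!f. f \<in> hom C A T)"

definition is_product :: "('o, 'a) cat \<Rightarrow> 'o \<Rightarrow> 'o \<Rightarrow> 'o \<Rightarrow> 'a \<Rightarrow> 'a \<Rightarrow> bool" where
  "is_product C A B V p q \<longleftrightarrow>
     V \<in> Ob C \<and> p \<in> hom C V A \<and> q \<in> hom C V B \<and>
     (\<forall>X\<in>Ob C. \<forall>f\<in>hom C X A. \<forall>g\<in>hom C X B.
        \<exists>!h. h \<in> hom C X V \<and> p \<cdot>\<^bsub>C\<^esub> h = f \<and> q \<cdot>\<^bsub>C\<^esub> h = g)"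

definition has_binary_products :: "('o, 'a) cat \<Rightarrow> bool" where
  "has_binary_products C \<longleftrightarrow> (\<forall>A\<in>Ob C. \<forall>B\<in>Ob C. \<exists>V p q. is_product C A B V p q)"

definition cartesian_category :: "('o, 'a) cat \<Rightarrow> bool" where
  "cartesian_category C \<longleftrightarrow> category C \<and> (\<exists>T. is_terminal C T) \<and> has_binary_products C"

text \<open>Products are only assumed to exist. An arbitrary choice of binary products is fixed to
  write down \<open>A \<times> B\<close>, \<open>pr\<^sub>1\<close>, \<open>pr\<^sub>2\<close>, \<open>\<langle>f, g\<rangle>\<close> and \<open>f \<times> g\<close>; ternary products are \<open>(X \<times> A) \<times> A\<close>.\<close>

definition chosen_product :: "('o, 'a) cat \<Rightarrow> 'o \<Rightarrow> 'o \<Rightarrow> 'o \<times> 'a \<times> 'a" where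
  "chosen_product C A B = (SOME (V, p, q). is_product C A B V p q)"

definition prd :: "('o, 'a) cat \<Rightarrow> 'o \<Rightarrow> 'o \<Rightarrow> 'o" where
  "prd C A B = fst (chosen_product C A B)"

definition pr1 :: "('o, 'a) cat \<Rightarrow> 'o \<Rightarrow> 'o \<Rightarrow> 'a" where
  "pr1 C A B = fst (snd (chosen_product C A B))"

definition pr2 :: "('o, 'a) cat \<Rightarrow> 'o \<Rightarrow> 'o \<Rightarrow> 'a" where
  "pr2 C A B = snd (snd (chosen_product C A B))"

definition pair :: "('o, 'a) cat \<Rightarrow> 'a \<Rightarrow> 'a \<Rightarrow> 'a" where
  "pair C f g = (THE h. h \<in> hom C (Dom C f) (prd C (Cod C f) (Cod C g)) \<and>
     pr1 C (Cod C f) (Cod C g) \<cdot>\<^bsub>C\<^esub> h = f \<and> pr2 C (Cod C f) (Cod C g) \<cdot>\<^bsub>C\<^esub> h = g)"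

definition prod_arr :: "('o, 'a) cat \<Rightarrow> 'a \<Rightarrow> 'a \<Rightarrow> 'a" where
  "prod_arr C f g = pair C (f \<cdot>\<^bsub>C\<^esub> pr1 C (Dom C f) (Dom C g)) (g \<cdot>\<^bsub>C\<^esub> pr2 C (Dom C f) (Dom C g))"

definition commuting_square :: "('o, 'a) cat \<Rightarrow> 'a \<Rightarrow> 'a \<Rightarrow> 'a \<Rightarrow> 'a \<Rightarrow> bool" where
  "commuting_square C f g p q \<longleftrightarrow>
     f \<in> Arr C \<and> g \<in> Arr C \<and> p \<in> Arr C \<and> q \<in> Arr C \<and> Cod C f = Cod C g \<and>
     Dom C p = Dom C q \<and> Cod C p = Dom C f \<and> Cod C q = Dom C g \<and> f \<cdot>\<^bsub>C\<^esub> p = g \<cdot>\<^bsub>C\<^esub> q"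

definition is_weak_pullback :: "('o, 'a) cat \<Rightarrow> 'a \<Rightarrow> 'a \<Rightarrow> 'a \<Rightarrow> 'a \<Rightarrow> bool" where
  "is_weak_pullback C f g p q \<longleftrightarrow> commuting_square C f g p q \<and>
     (\<forall>u v. commuting_square C f g u v \<longrightarrow>
        (\<exists>h. h \<in> hom C (Dom C u) (Dom C p) \<and> p \<cdot>\<^bsub>C\<^esub> h = u \<and> q \<cdot>\<^bsub>C\<^esub> h = v))"

definition is_pullback :: "('o, 'a) cat \<Rightarrow> 'a \<Rightarrow> 'a \<Rightarrow> 'a \<Rightarrow> 'a \<Rightarrow> bool" where
  "is_pullback C f g p q \<longleftrightarrow> commuting_square C f g p q \<and>
     (\<forall>u v. commuting_square C f g u v \<longrightarrow>
        (\<exists>!h. h \<in> hom C (Dom C u) (Dom C p) \<and> p \<cdot>\<^bsub>C\<^esub> h = u \<and> q \<cdot>\<^bsub>C\<^esub> h = v))"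

definition has_weak_pullbacks :: "('o, 'a) cat \<Rightarrow> bool" where
  "has_weak_pullbacks C \<longleftrightarrow>
     (\<forall>f\<in>Arr C. \<forall>g\<in>Arr C. Cod C f = Cod C g \<longrightarrow> (\<exists>p q. is_weak_pullback C f g p q))"

definition has_pullbacks :: "('o, 'a) cat \<Rightarrow> bool" where
  "has_pullbacks C \<longleftrightarrow>
     (\<forall>f\<in>Arr C. \<forall>g\<in>Arr C. Cod C f = Cod C g \<longrightarrow> (\<exists>p q. is_pullback C f g p q))"

definition has_finite_limits :: "('o, 'a) cat \<Rightarrow> bool" where
  "has_finite_limits C \<longleftrightarrow> (\<exists>T. is_terminal C T) \<and> has_pullbacks C"

definition regular_category :: "('o, 'a) cat \<Rightarrow> bool" where
  "regular_category C \<longleftrightarrow> category C \<and> has_finite_limits C \<and>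
     (\<forall>f\<in>Arr C. \<exists>e m. regular_epi C e \<and> monic C m \<and> Cod C e = Dom C m \<and> f = m \<cdot>\<^bsub>C\<^esub> e) \<and>
     (\<forall>f e p q. is_pullback C f e p q \<and> regular_epi C e \<longrightarrow> regular_epi C p)"


subsection \<open>Functors and natural transformations\<close>

record ('o, 'a, 'p, 'b) functr =
  onOb  :: "'o \<Rightarrow> 'p"
  onArr :: "'a \<Rightarrow> 'b"

definition is_functor :: "('o, 'a) cat \<Rightarrow> ('p, 'b) cat \<Rightarrow> ('o, 'a, 'p, 'b) functr \<Rightarrow> bool" where
  "is_functor C D F \<longleftrightarrow> category C \<and> category D \<and>
     onOb F \<in> Ob C \<rightarrow> Ob D \<and>
     (\<forall>f\<in>Arr C. onArr F f \<in> hom D (onOb F (Dom C f)) (onOb F (Cod C f))) \<and>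
     (\<forall>A\<in>Ob C. onArr F (Id C A) = Id D (onOb F A)) \<and>
     (\<forall>f\<in>Arr C. \<forall>g\<in>Arr C. Cod C f = Dom C g \<longrightarrow>
        onArr F (g \<cdot>\<^bsub>C\<^esub> f) = onArr F g \<cdot>\<^bsub>D\<^esub> onArr F f)"

definition id_functor :: "('o, 'a, 'o, 'a) functr" where
  "id_functor = \<lparr>onOb = id, onArr = id\<rparr>"

definition comp_functor ::
  "('p, 'b, 'q, 'c) functr \<Rightarrow> ('o, 'a, 'p, 'b) functr \<Rightarrow> ('o, 'a, 'q, 'c) functr" where
  "comp_functor G F = \<lparr>onOb = onOb G \<circ> onOb F, onArr = onArr G \<circ> onArr F\<rparr>"

definition nat_trans :: "('o, 'a) cat \<Rightarrow> ('p, 'b) cat \<Rightarrow>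
    ('o, 'a, 'p, 'b) functr \<Rightarrow> ('o, 'a, 'p, 'b) functr \<Rightarrow> ('o \<Rightarrow> 'b) \<Rightarrow> bool" where
  "nat_trans C D F G \<theta> \<longleftrightarrow>
     (\<forall>A\<in>Ob C. \<theta> A \<in> hom D (onOb F A) (onOb G A)) \<and>
     (\<forall>f\<in>Arr C. \<theta> (Cod C f) \<cdot>\<^bsub>D\<^esub> onArr F f = onArr G f \<cdot>\<^bsub>D\<^esub> \<theta> (Dom C f))"

definition inverse_transformations :: "('o, 'a) cat \<Rightarrow> ('p, 'b) cat \<Rightarrow>
    ('o, 'a, 'p, 'b) functr \<Rightarrow> ('o, 'a, 'p, 'b) functr \<Rightarrow> ('o \<Rightarrow> 'b) \<Rightarrow> ('o \<Rightarrow> 'b) \<Rightarrow> bool" where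
  "inverse_transformations C D F G \<theta> \<theta>' \<longleftrightarrow>
     (\<forall>A\<in>Ob C. \<theta>' A \<cdot>\<^bsub>D\<^esub> \<theta> A = Id D (onOb F A) \<and> \<theta> A \<cdot>\<^bsub>D\<^esub> \<theta>' A = Id D (onOb G A))"

definition nat_isomorphic :: "('o, 'a) cat \<Rightarrow> ('p, 'b) cat \<Rightarrow>
    ('o, 'a, 'p, 'b) functr \<Rightarrow> ('o, 'a, 'p, 'b) functr \<Rightarrow> bool" where
  "nat_isomorphic C D F G \<longleftrightarrow> (\<exists>\<theta> \<theta>'. nat_trans C D F G \<theta> \<and> nat_trans C D G F \<theta>' \<and>
     inverse_transformations C D F G \<theta> \<theta>')"

definition preserves_binary_products ::
  "('o, 'a) cat \<Rightarrow> ('p, 'b) cat \<Rightarrow> ('o, 'a, 'p, 'b) functr \<Rightarrow> bool" where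
  "preserves_binary_products C D F \<longleftrightarrow> (\<forall>A B V p q. A \<in> Ob C \<and> B \<in> Ob C \<and>
     is_product C A B V p q \<longrightarrow>
     is_product D (onOb F A) (onOb F B) (onOb F V) (onArr F p) (onArr F q))"

definition regular_functor ::
  "('o, 'a) cat \<Rightarrow> ('p, 'b) cat \<Rightarrow> ('o, 'a, 'p, 'b) functr \<Rightarrow> bool" where
  "regular_functor C D F \<longleftrightarrow> is_functor C D F \<and>
     (\<forall>T. is_terminal C T \<longrightarrow> is_terminal D (onOb F T)) \<and>
     (\<forall>f g p q. is_pullback C f g p q \<longrightarrow>
        is_pullback D (onArr F f) (onArr F g) (onArr F p) (onArr F q)) \<and>
     (\<forall>e. regular_epi C e \<longrightarrow> regular_epi D (onArr F e))"


section \<open>The regular completion\<close>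

definition is_cone :: "('j, 'i) cat \<Rightarrow> ('o, 'a) cat \<Rightarrow> ('j, 'i, 'o, 'a) functr \<Rightarrow>
    'o \<Rightarrow> ('j \<Rightarrow> 'a) \<Rightarrow> bool" where
  "is_cone J C L W \<pi> \<longleftrightarrow> W \<in> Ob C \<and>
     (\<forall>j\<in>Ob J. \<pi> j \<in> hom C W (onOb L j)) \<and>
     (\<forall>f\<in>Arr J. onArr L f \<cdot>\<^bsub>C\<^esub> \<pi> (Dom J f) = \<pi> (Cod J f))"

definition is_weak_limit :: "('j, 'i) cat \<Rightarrow> ('o, 'a) cat \<Rightarrow> ('j, 'i, 'o, 'a) functr \<Rightarrow>
    'o \<Rightarrow> ('j \<Rightarrow> 'a) \<Rightarrow> bool" where
  "is_weak_limit J C L W \<pi> \<longleftrightarrow> is_cone J C L W \<pi> \<and>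
     (\<forall>V \<rho>. is_cone J C L V \<rho> \<longrightarrow> (\<exists>h. h \<in> hom C V W \<and> (\<forall>j\<in>Ob J. \<pi> j \<cdot>\<^bsub>C\<^esub> h = \<rho> j)))"

definition is_limit :: "('j, 'i) cat \<Rightarrow> ('o, 'a) cat \<Rightarrow> ('j, 'i, 'o, 'a) functr \<Rightarrow>
    'o \<Rightarrow> ('j \<Rightarrow> 'a) \<Rightarrow> bool" where
  "is_limit J C L W \<pi> \<longleftrightarrow> is_cone J C L W \<pi> \<and>
     (\<forall>V \<rho>. is_cone J C L V \<rho> \<longrightarrow> (\<exists>!h. h \<in> hom C V W \<and> (\<forall>j\<in>Ob J. \<pi> j \<cdot>\<^bsub>C\<^esub> h = \<rho> j)))"

text \<open>Left covering functors (Carboni--Vitale): for every finite diagram \<open>L\<close> in \<open>S\<close>, the canonical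
  arrow from the image of a weak limit of \<open>L\<close> to the limit of \<open>F \<circ> L\<close> is a regular epimorphism.
  Every finite category is isomorphic to one whose objects and arrows are natural numbers.\<close>

definition left_covering ::
  "('o, 'a) cat \<Rightarrow> ('p, 'b) cat \<Rightarrow> ('o, 'a, 'p, 'b) functr \<Rightarrow> bool" where
  "left_covering S D F \<longleftrightarrow> is_functor S D F \<and>
     (\<forall>(J :: (nat, nat) cat) L W \<pi> M \<mu> k.
        category J \<and> finite (Ob J) \<and> finite (Arr J) \<and> is_functor J S L \<and>
        is_weak_limit J S L W \<pi> \<and> is_limit J D (comp_functor F L) M \<mu> \<and>
        k \<in> hom D (onOb F W) M \<and> (\<forall>j\<in>Ob J. \<mu> j \<cdot>\<^bsub>D\<^esub> k = onArr F (\<pi> j)) \<longrightarrow>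
        regular_epi D k)"

text \<open>\<open>\<Gamma> : S \<rightarrow> R\<close> is the free regular category on the weakly lex category \<open>S\<close>: it is left covering,
  and for each regular category \<open>E\<close> composition with \<open>\<Gamma>\<close> is an equivalence from regular functors
  \<open>R \<rightarrow> E\<close> to left covering functors \<open>S \<rightarrow> E\<close>, i.e. it is essentially surjective and fully
  faithful. A formula of HOL cannot quantify over types, so the types of objects and arrows of
  the categories \<open>E\<close> are a parameter. The free regular category satisfies every instance, so a
  theorem that assumes particular instances covers it.\<close>

definition free_regular_wrt :: "('x, 'y) cat itself \<Rightarrow>
    ('o, 'a) cat \<Rightarrow> ('p, 'b) cat \<Rightarrow> ('o, 'a, 'p, 'b) functr \<Rightarrow> bool" where
  "free_regular_wrt U S R \<Gamma> \<longleftrightarrow> regular_category R \<and> left_covering S R \<Gamma> \<and>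
     (\<forall>E :: ('x, 'y) cat. regular_category E \<longrightarrow>
        (\<forall>F. left_covering S E F \<longrightarrow>
           (\<exists>H. regular_functor R E H \<and> nat_isomorphic S E (comp_functor H \<Gamma>) F)) \<and>
        (\<forall>H K \<theta>. regular_functor R E H \<and> regular_functor R E K \<and>
           nat_trans S E (comp_functor H \<Gamma>) (comp_functor K \<Gamma>) \<theta> \<longrightarrow>
           (\<exists>\<tau>. nat_trans R E H K \<tau> \<and> (\<forall>X\<in>Ob S. \<tau> (onOb \<Gamma> X) = \<theta> X) \<and>
              (\<forall>\<sigma>. nat_trans R E H K \<sigma> \<and> (\<forall>X\<in>Ob S. \<sigma> (onOb \<Gamma> X) = \<theta> X) \<longrightarrow>
                 (\<forall>Y\<in>Ob R. \<sigma> Y = \<tau> Y)))))"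


section \<open>Elementary doctrines\<close>

definition inf_semilattice :: "'l gorder \<Rightarrow> bool" where
  "inf_semilattice L \<longleftrightarrow> lower_semilattice L \<and> weak_partial_order_top L"

definition infsl_hom :: "'l gorder \<Rightarrow> 'm gorder \<Rightarrow> ('l \<Rightarrow> 'm) \<Rightarrow> bool" where
  "infsl_hom L M h \<longleftrightarrow> h \<in> carrier L \<rightarrow> carrier M \<and> h \<top>\<^bsub>L\<^esub> = \<top>\<^bsub>M\<^esub> \<and>
     (\<forall>x\<in>carrier L. \<forall>y\<in>carrier L. h (x \<sqinter>\<^bsub>L\<^esub> y) = h x \<sqinter>\<^bsub>M\<^esub> h y)"

text \<open>\<open>fib P A\<close> is the inf-semilattice \<open>P(A)\<close> and \<open>re P f\<close> is the reindexing \<open>P\<^sub>f\<close>.\<close>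

record ('o, 'a, 'l) doctrine =
  base :: "('o, 'a) cat"
  fib  :: "'o \<Rightarrow> 'l gorder"
  re   :: "'a \<Rightarrow> 'l \<Rightarrow> 'l"

definition is_doctrine :: "('o, 'a, 'l) doctrine \<Rightarrow> bool" where
  "is_doctrine P \<longleftrightarrow> category (base P) \<and> has_binary_products (base P) \<and>
     (\<forall>A\<in>Ob (base P). inf_semilattice (fib P A)) \<and>
     (\<forall>f\<in>Arr (base P). infsl_hom (fib P (Cod (base P) f)) (fib P (Dom (base P) f)) (re P f)) \<and>
     (\<forall>A\<in>Ob (base P). \<forall>\<alpha>\<in>carrier (fib P A). re P (Id (base P) A) \<alpha> = \<alpha>) \<and>
     (\<forall>f\<in>Arr (base P). \<forall>g\<in>Arr (base P). Cod (base P) f = Dom (base P) g \<longrightarrow>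
        (\<forall>\<alpha>\<in>carrier (fib P (Cod (base P) g)). re P (g \<cdot>\<^bsub>base P\<^esub> f) \<alpha> = re P f (re P g \<alpha>)))"

abbreviation left_adjoint :: "'l gorder \<Rightarrow> 'm gorder \<Rightarrow> ('l \<Rightarrow> 'm) \<Rightarrow> ('m \<Rightarrow> 'l) \<Rightarrow> bool" where
  "left_adjoint L M f g \<equiv> galois_connection \<lparr>orderA = L, orderB = M, lower = f, upper = g\<rparr>"

definition is_equality :: "('o, 'a, 'l) doctrine \<Rightarrow> 'o \<Rightarrow> 'l \<Rightarrow> bool" where
  "is_equality P A \<delta> \<longleftrightarrow> (let C = base P in
     \<delta> \<in> carrier (fib P (prd C A A)) \<and>
     left_adjoint (fib P A) (fib P (prd C A A))
       (\<lambda>\<alpha>. re P (pr1 C A A) \<alpha> \<sqinter>\<^bsub>fib P (prd C A A)\<^esub> \<delta>)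
       (re P (pair C (Id C A) (Id C A))) \<and>
     (\<forall>X\<in>Ob C.
        let XA = prd C X A; XAA = prd C XA A;
            p1 = pr1 C X A; p2 = pr2 C X A;
            q1 = p1 \<cdot>\<^bsub>C\<^esub> pr1 C XA A; q2 = p2 \<cdot>\<^bsub>C\<^esub> pr1 C XA A; q3 = pr2 C XA A
        in left_adjoint (fib P XA) (fib P XAA)
             (\<lambda>\<alpha>. re P (pair C q1 q2) \<alpha> \<sqinter>\<^bsub>fib P XAA\<^esub> re P (pair C q2 q3) \<delta>)
             (re P (pair C (pair C p1 p2) p2))))"

definition elementary_doctrine :: "('o, 'a, 'l) doctrine \<Rightarrow> bool" where
  "elementary_doctrine P \<longleftrightarrow> is_doctrine P \<and> (\<forall>A\<in>Ob (base P). \<exists>\<delta>. is_equality P A \<delta>)"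

text \<open>In an elementary doctrine \<open>\<delta>\<^sub>A\<close> is unique, being the value at the top element of a left
  adjoint. For \<open>weak_subobjects\<close> it is the class of the diagonal.\<close>

definition eqp :: "('o, 'a, 'l) doctrine \<Rightarrow> 'o \<Rightarrow> 'l" where
  "eqp P A = (THE \<delta>. is_equality P A \<delta>)"


subsection \<open>Equivalence in the 2-category of elementary doctrines\<close>

type_synonym ('o, 'a, 'l, 'p, 'b, 'm) doctrine_arrow =
  "('o, 'a, 'p, 'b) functr \<times> ('o \<Rightarrow> 'l \<Rightarrow> 'm)"

definition ED_1arrow :: "('o, 'a, 'l) doctrine \<Rightarrow> ('p, 'b, 'm) doctrine \<Rightarrow>
    ('o, 'a, 'l, 'p, 'b, 'm) doctrine_arrow \<Rightarrow> bool" where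
  "ED_1arrow P Q = (\<lambda>(F, b). let C = base P; D = base Q in
     is_functor C D F \<and> preserves_binary_products C D F \<and>
     (\<forall>A\<in>Ob C. infsl_hom (fib P A) (fib Q (onOb F A)) (b A)) \<and>
     (\<forall>f\<in>Arr C. \<forall>\<beta>\<in>carrier (fib P (Cod C f)).
        b (Dom C f) (re P f \<beta>) = re Q (onArr F f) (b (Cod C f) \<beta>)) \<and>
     (\<forall>A\<in>Ob C. b (prd C A A) (eqp P A) =
        re Q (pair D (onArr F (pr1 C A A)) (onArr F (pr2 C A A))) (eqp Q (onOb F A))))"

definition ED_id :: "('o, 'a, 'l, 'o, 'a, 'l) doctrine_arrow" where
  "ED_id = (id_functor, \<lambda>_. id)"

definition ED_comp :: "('p, 'b, 'm, 'q, 'c, 'n) doctrine_arrow \<Rightarrow>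
    ('o, 'a, 'l, 'p, 'b, 'm) doctrine_arrow \<Rightarrow> ('o, 'a, 'l, 'q, 'c, 'n) doctrine_arrow" where
  "ED_comp = (\<lambda>(G, c) (F, b). (comp_functor G F, \<lambda>A. c (onOb F A) \<circ> b A))"

definition ED_2arrow :: "('o, 'a, 'l) doctrine \<Rightarrow> ('p, 'b, 'm) doctrine \<Rightarrow>
    ('o, 'a, 'l, 'p, 'b, 'm) doctrine_arrow \<Rightarrow> ('o, 'a, 'l, 'p, 'b, 'm) doctrine_arrow \<Rightarrow>
    ('o \<Rightarrow> 'b) \<Rightarrow> bool" where
  "ED_2arrow P Q = (\<lambda>(F, b) (G, c) \<theta>.
     nat_trans (base P) (base Q) F G \<theta> \<and>
     (\<forall>A\<in>Ob (base P). \<forall>\<alpha>\<in>carrier (fib P A).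
        b A \<alpha> \<sqsubseteq>\<^bsub>fib Q (onOb F A)\<^esub> re Q (\<theta> A) (c A \<alpha>)))"

definition ED_isomorphic_1arrows :: "('o, 'a, 'l) doctrine \<Rightarrow> ('p, 'b, 'm) doctrine \<Rightarrow>
    ('o, 'a, 'l, 'p, 'b, 'm) doctrine_arrow \<Rightarrow> ('o, 'a, 'l, 'p, 'b, 'm) doctrine_arrow \<Rightarrow> bool" where
  "ED_isomorphic_1arrows P Q h k \<longleftrightarrow> (\<exists>\<theta> \<theta>'. ED_2arrow P Q h k \<theta> \<and> ED_2arrow P Q k h \<theta>' \<and>
     inverse_transformations (base P) (base Q) (fst h) (fst k) \<theta> \<theta>')"

definition ED_equivalent :: "('o, 'a, 'l) doctrine \<Rightarrow> ('p, 'b, 'm) doctrine \<Rightarrow> bool" where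
  "ED_equivalent P Q \<longleftrightarrow> elementary_doctrine P \<and> elementary_doctrine Q \<and>
     (\<exists>h k. ED_1arrow P Q h \<and> ED_1arrow Q P k \<and>
        ED_isomorphic_1arrows P P (ED_comp k h) ED_id \<and>
        ED_isomorphic_1arrows Q Q (ED_comp h k) ED_id)"


section \<open>Weak subobjects and subobjects\<close>

definition factors_through :: "('o, 'a) cat \<Rightarrow> 'a \<Rightarrow> 'a \<Rightarrow> bool" where
  "factors_through C f g \<longleftrightarrow> Cod C f = Cod C g \<and> (\<exists>h\<in>hom C (Dom C f) (Dom C g). f = g \<cdot>\<^bsub>C\<^esub> h)"

text \<open>\<open>slice_poset C M A\<close> is the poset reflection of the full subcategory of the comma category
  \<open>C/A\<close> on the arrows in \<open>M\<close>; its elements are the equivalence classes of mutual factorization.\<close>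

definition slice_class :: "('o, 'a) cat \<Rightarrow> 'a set \<Rightarrow> 'a \<Rightarrow> 'a set" where
  "slice_class C M f = {g \<in> M. factors_through C f g \<and> factors_through C g f}"

definition slice_poset :: "('o, 'a) cat \<Rightarrow> 'a set \<Rightarrow> 'o \<Rightarrow> 'a set gorder" where
  "slice_poset C M A =
     \<lparr>carrier = slice_class C M ` {f \<in> M. Cod C f = A},
      eq = (=),
      le = (\<lambda>\<alpha> \<beta>. \<exists>f\<in>\<alpha>. \<exists>g\<in>\<beta>. factors_through C f g)\<rparr>"

definition weak_subobjects :: "('o, 'a) cat \<Rightarrow> ('o, 'a, 'a set) doctrine" where
  "weak_subobjects C =
     \<lparr>base = C,
      fib = slice_poset C (Arr C),
      re = (\<lambda>f \<alpha>. \<Union>{slice_class C (Arr C) p | p. \<exists>a\<in>\<alpha>. \<exists>q. is_weak_pullback C f a p q})\<rparr>"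

definition subobjects :: "('o, 'a) cat \<Rightarrow> ('o, 'a, 'a set) doctrine" where
  "subobjects C =
     \<lparr>base = C,
      fib = slice_poset C {m. monic C m},
      re = (\<lambda>f \<alpha>. \<Union>{slice_class C {m. monic C m} p | p. \<exists>m\<in>\<alpha>. \<exists>q. is_pullback C f m p q})\<rparr>"


section \<open>The doctrine \<open>(P)\<^sub>r\<close>\<close>

definition Des :: "('o, 'a, 'l) doctrine \<Rightarrow> 'o \<Rightarrow> 'l \<Rightarrow> 'l set" where
  "Des P X \<rho> = (let C = base P; XX = prd C X X in
     {\<alpha> \<in> carrier (fib P X).
        re P (pr1 C X X) \<alpha> \<sqinter>\<^bsub>fib P XX\<^esub> \<rho> \<sqsubseteq>\<^bsub>fib P XX\<^esub> re P (pr2 C X X) \<alpha>})"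

definition weak_comprehension :: "('o, 'a, 'l) doctrine \<Rightarrow> 'o \<Rightarrow> 'l \<Rightarrow> 'a \<Rightarrow> bool" where
  "weak_comprehension P A \<alpha> c \<longleftrightarrow> (let C = base P in
     c \<in> Arr C \<and> Cod C c = A \<and>
     \<top>\<^bsub>fib P (Dom C c)\<^esub> \<sqsubseteq>\<^bsub>fib P (Dom C c)\<^esub> re P c \<alpha> \<and>
     (\<forall>g\<in>Arr C. Cod C g = A \<and> \<top>\<^bsub>fib P (Dom C g)\<^esub> \<sqsubseteq>\<^bsub>fib P (Dom C g)\<^esub> re P g \<alpha> \<longrightarrow>
        (\<exists>h\<in>hom C (Dom C g) (Dom C c). g = c \<cdot>\<^bsub>C\<^esub> h)))"

text \<open>Arrows of \<open>\<D>\<^sub>P\<close> carry their domain and codomain.\<close>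

type_synonym ('o, 'a, 'l) dp_ob = "'o \<times> 'l \<times> 'a"
type_synonym ('o, 'a, 'l) dp_arr = "('o, 'a, 'l) dp_ob \<times> ('o, 'a, 'l) dp_ob \<times> 'a set"

text \<open>The kernel relation \<open>P\<^bsub>c \<times> c\<^esub>(\<delta>\<^sub>A)\<close> of \<open>c : X \<rightarrow> A\<close>.\<close>

definition ker :: "('o, 'a, 'l) doctrine \<Rightarrow> 'a \<Rightarrow> 'l" where
  "ker P c = re P (prod_arr (base P) c c) (eqp P (Cod (base P) c))"

definition dp_rel :: "('o, 'a, 'l) doctrine \<Rightarrow> 'a \<Rightarrow> 'a \<Rightarrow> 'a \<Rightarrow> 'a \<Rightarrow> bool" where
  "dp_rel P c d f f' \<longleftrightarrow> (let C = base P; X = Dom C c in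
     ker P c \<sqsubseteq>\<^bsub>fib P (prd C X X)\<^esub> re P (prod_arr C f f') (ker P d))"

definition dp_maps :: "('o, 'a, 'l) doctrine \<Rightarrow> 'a \<Rightarrow> 'a \<Rightarrow> 'a set" where
  "dp_maps P c d = {f \<in> hom (base P) (Dom (base P) c) (Dom (base P) d). dp_rel P c d f f}"

definition dp_class :: "('o, 'a, 'l) doctrine \<Rightarrow> 'a \<Rightarrow> 'a \<Rightarrow> 'a \<Rightarrow> 'a set" where
  "dp_class P c d f = {f' \<in> dp_maps P c d. dp_rel P c d f f'}"

definition dp_obs :: "('o, 'a, 'l) doctrine \<Rightarrow> ('o, 'a, 'l) dp_ob set" where
  "dp_obs P = {(A, \<alpha>, c). A \<in> Ob (base P) \<and> \<alpha> \<in> carrier (fib P A) \<and> weak_comprehension P A \<alpha> c}"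

abbreviation dp_incl :: "('o, 'a, 'l) dp_ob \<Rightarrow> 'a" where
  "dp_incl x \<equiv> snd (snd x)"

definition dp_cat :: "('o, 'a, 'l) doctrine \<Rightarrow> (('o, 'a, 'l) dp_ob, ('o, 'a, 'l) dp_arr) cat" where
  "dp_cat P =
     \<lparr>Ob = dp_obs P,
      Arr = {(x, y, dp_class P (dp_incl x) (dp_incl y) f) | x y f.
               x \<in> dp_obs P \<and> y \<in> dp_obs P \<and> f \<in> dp_maps P (dp_incl x) (dp_incl y)},
      Dom = (\<lambda>(x, y, \<phi>). x),
      Cod = (\<lambda>(x, y, \<phi>). y),
      Id = (\<lambda>x. (x, x, dp_class P (dp_incl x) (dp_incl x)
                        (Id (base P) (Dom (base P) (dp_incl x))))),
      Comp = (\<lambda>(y', z, \<psi>) (x, y, \<phi>).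
                (x, z, \<Union>{dp_class P (dp_incl x) (dp_incl z) (g \<cdot>\<^bsub>base P\<^esub> f) | g f. g \<in> \<psi> \<and> f \<in> \<phi>}))\<rparr>"

definition doctrine_r ::
  "('o, 'a, 'l) doctrine \<Rightarrow> (('o, 'a, 'l) dp_ob, ('o, 'a, 'l) dp_arr, 'l) doctrine" where
  "doctrine_r P =
     \<lparr>base = dp_cat P,
      fib = (\<lambda>(A, \<alpha>, c). (fib P (Dom (base P) c))
               \<lparr>carrier := Des P (Dom (base P) c) (ker P c)\<rparr>),
      re = (\<lambda>(x, y, \<phi>) \<beta>. the_elem ((\<lambda>f. re P f \<beta>) ` \<phi>))\<rparr>"

end

theory Submission
  imports Defs "HOL-Library.Nat_Bijection"
begin

text \<open>
  Write \<open>D\<close> for the category \<open>\<D>\<^sub>\<Psi>\<close>. An object of \<open>D\<close> amounts to an arrow \<open>c : X \<rightarrow> A\<close> of \<open>S\<close>, to be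
  thought of as its future image; an arrow from \<open>c\<close> to \<open>d : Y \<rightarrow> B\<close> is given by an \<open>f : X \<rightarrow> Y\<close> such
  that \<open>d \<cdot> f\<close> identifies whatever \<open>c\<close> identifies, and two such arrows are equal iff their composites
  with \<open>d\<close> are. This is the classical construction of the regular completion, so the theorem
  splits into two facts: \<open>D\<close> is equivalent to the free regular category \<open>R\<close>, and under this
  equivalence descent data become subobjects.

  Everything about \<open>\<Psi>\<close> is read through generalized elements: the class of \<open>a : Y \<rightarrow> A\<close> is determined
  by the arrows into \<open>A\<close> that factor through \<open>a\<close> (\<open>belongs\<close>). In these terms reindexing is substitution,
  meets are conjunctions and \<open>\<delta>\<close> is equality, both for weak subobjects and for subobjects. Hence both
  doctrines are elementary (\<open>Doc_elementary\<close>), and the hom-sets and fibres of \<open>(\<Psi>)\<^sub>r\<close> have the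
  elementary description above (\<open>rel_iff\<close>, \<open>Des_iff\<close>).

  In \<open>D\<close> an arrow \<open>[f]\<close> is a regular epimorphism iff there is \<open>s\<close> with \<open>d \<cdot> f \<cdot> s = d\<close>
  (\<open>regular_epi_D_iff\<close>); images and pullbacks are explicit (\<open>image_D\<close>, \<open>pullback_D\<close>), and so \<open>D\<close> is
  regular. The embedding \<open>J : S \<rightarrow> D\<close>, \<open>A \<mapsto> id\<^sub>A\<close>, is full and faithful, and every object \<open>c\<close> is
  the image of \<open>J c\<close>. It follows that \<open>J\<close> is left covering (\<open>J_left_covering\<close>), and that regular functors
  out of \<open>D\<close> are determined by their restrictions along \<open>J\<close> (\<open>extension_unique\<close>). Conversely, a left
  covering \<open>G : S \<rightarrow> E\<close> extends to \<open>D\<close> by sending \<open>c\<close> to the image of \<open>G c\<close>: left covering makes the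
  weak kernel pair of \<open>c\<close> cover the kernel pair of \<open>G c\<close>, which gives the action on arrows
  (\<open>Fext_arr_ex\<close>), and the same argument for pullbacks shows that the extension is regular
  (\<open>Fext_regular\<close>).

  Applied to \<open>\<Gamma>\<close> this yields a regular \<open>F : D \<rightarrow> R\<close> with \<open>F J \<cong> \<Gamma>\<close>, while freeness of \<open>R\<close> yields a regular
  \<open>H : R \<rightarrow> D\<close> with \<open>H \<Gamma> \<cong> J\<close>. Uniqueness on both sides makes \<open>F\<close> and \<open>H\<close> mutually inverse up to isomorphism.

  A descent datum, the class of \<open>a : Y \<rightarrow> X\<close>, corresponds to the subobject of \<open>c\<close> given by \<open>c \<cdot> a\<close>, and
  every subobject arises from exactly one descent datum (\<open>sub_of_order_iso\<close>). Composing with the action of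
  \<open>F\<close> on subobjects gives order isomorphisms between the fibres, natural in the object. Since
  equality, meets and top elements are determined by the order, such a family over an equivalence of
  categories is an equivalence of elementary doctrines (\<open>ED_equivalentI\<close>).
\<close>

section \<open>Categories, images and pullbacks\<close>

lemma hom_iff [simp]: "f \<in> hom C A B \<longleftrightarrow> f \<in> Arr C \<and> Dom C f = A \<and> Cod C f = B"
  by (auto simp: hom_def)

definition epic :: "('o, 'a) cat \<Rightarrow> 'a \<Rightarrow> bool" where
  "epic C e \<longleftrightarrow> e \<in> Arr C \<and>
     (\<forall>u\<in>Arr C. \<forall>v\<in>Arr C. Dom C u = Cod C e \<and> Dom C v = Cod C e \<and> Cod C u = Cod C v \<and>
        u \<cdot>\<^bsub>C\<^esub> e = v \<cdot>\<^bsub>C\<^esub> e \<longrightarrow> u = v)"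

definition inverse_arrows :: "('o, 'a) cat \<Rightarrow> 'a \<Rightarrow> 'a \<Rightarrow> bool" where
  "inverse_arrows C f g \<longleftrightarrow> f \<in> Arr C \<and> g \<in> hom C (Cod C f) (Dom C f) \<and>
     g \<cdot>\<^bsub>C\<^esub> f = Id C (Dom C f) \<and> f \<cdot>\<^bsub>C\<^esub> g = Id C (Cod C f)"

definition iso :: "('o, 'a) cat \<Rightarrow> 'a \<Rightarrow> bool" where
  "iso C f \<longleftrightarrow> (\<exists>g. inverse_arrows C f g)"

context category
begin

lemma Dom_Ob [simp]: "f \<in> Arr C \<Longrightarrow> Dom C f \<in> Ob C"
  by (rule Dom_closed)

lemma Cod_Ob [simp]: "f \<in> Arr C \<Longrightarrow> Cod C f \<in> Ob C"
  by (rule Cod_closed)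

lemma Id_simps [simp]:
  "A \<in> Ob C \<Longrightarrow> Id C A \<in> Arr C" "A \<in> Ob C \<Longrightarrow> Dom C (Id C A) = A"
  "A \<in> Ob C \<Longrightarrow> Cod C (Id C A) = A"
  using Id_hom[of A] by auto

lemma comp_simps [simp]:
  assumes "f \<in> Arr C" "g \<in> Arr C" "Cod C f = Dom C g"
  shows "g \<cdot> f \<in> Arr C" "Dom C (g \<cdot> f) = Dom C f" "Cod C (g \<cdot> f) = Cod C g"
  using Comp_hom[of f "Dom C f" "Dom C g" g "Cod C g"] assms by auto

lemma comp_Id_simps [simp]:
  "\<lbrakk>f \<in> Arr C; Dom C f = A\<rbrakk> \<Longrightarrow> f \<cdot> Id C A = f"
  "\<lbrakk>f \<in> Arr C; Cod C f = A\<rbrakk> \<Longrightarrow> Id C A \<cdot> f = f"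
  using Comp_Id[of f "Dom C f" "Cod C f"] Id_Comp[of f "Dom C f" "Cod C f"] by auto

lemma assoc [simp]:
  "\<lbrakk>f \<in> Arr C; g \<in> Arr C; h \<in> Arr C; Cod C f = Dom C g; Cod C g = Dom C h\<rbrakk>
     \<Longrightarrow> (h \<cdot> g) \<cdot> f = h \<cdot> (g \<cdot> f)"
  using Comp_assoc[of f "Dom C f" "Dom C g" g "Dom C h" h "Cod C h"] by auto

text \<open>Composites are kept bracketed to the right, so an equation between composites also has to
  be applied when it is followed by a further arrow.\<close>

lemma extend_eq:
  assumes "g \<cdot> f = g' \<cdot> f'" "f \<in> Arr C" "g \<in> Arr C" "Cod C f = Dom C g"
    "f' \<in> Arr C" "g' \<in> Arr C" "Cod C f' = Dom C g'" "x \<in> Arr C" "Cod C x = Dom C f"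
    "Dom C f' = Dom C f"
  shows "g \<cdot> (f \<cdot> x) = g' \<cdot> (f' \<cdot> x)"
  using assms assoc[of x f g] assoc[of x f' g'] by simp

lemma extend_eq1:
  assumes "g \<cdot> f = k" "f \<in> Arr C" "g \<in> Arr C" "Cod C f = Dom C g" "x \<in> Arr C" "Cod C x = Dom C f"
  shows "g \<cdot> (f \<cdot> x) = k \<cdot> x"
  using assms assoc[of x f g] by simp

lemma monicD:
  "\<lbrakk>monic C m; m \<cdot> u = m \<cdot> v; u \<in> Arr C; v \<in> Arr C; Cod C u = Dom C m; Cod C v = Dom C m;
    Dom C u = Dom C v\<rbrakk> \<Longrightarrow> u = v"
  unfolding monic_def by auto

lemma monicI:
  assumes "m \<in> Arr C"
    and "\<And>u v. \<lbrakk>u \<in> Arr C; v \<in> Arr C; Cod C u = Dom C m; Cod C v = Dom C m; Dom C u = Dom C v;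
            m \<cdot> u = m \<cdot> v\<rbrakk> \<Longrightarrow> u = v"
  shows "monic C m"
  unfolding monic_def using assms by auto

lemma epicD:
  "\<lbrakk>epic C e; u \<cdot> e = v \<cdot> e; u \<in> Arr C; v \<in> Arr C; Dom C u = Cod C e; Dom C v = Cod C e;
    Cod C u = Cod C v\<rbrakk> \<Longrightarrow> u = v"
  unfolding epic_def by auto

lemma monic_comp:
  assumes m: "monic C m" and n: "monic C n" and "Cod C n = Dom C m"
  shows "monic C (m \<cdot> n)"
proof -
  have a: "m \<in> Arr C" "n \<in> Arr C" using m n by (auto simp: monic_def)
  show ?thesis
  proof (rule monicI)
    show "m \<cdot> n \<in> Arr C" using a assms by simp
    fix u v assume *: "u \<in> Arr C" "v \<in> Arr C" "Cod C u = Dom C (m \<cdot> n)" "Cod C v = Dom C (m \<cdot> n)"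
      "Dom C u = Dom C v" "(m \<cdot> n) \<cdot> u = (m \<cdot> n) \<cdot> v"
    have "m \<cdot> (n \<cdot> u) = m \<cdot> (n \<cdot> v)" using * a assms by simp
    then have "n \<cdot> u = n \<cdot> v" using * a assms by - (rule monicD[OF m], auto)
    then show "u = v" using * a assms by - (rule monicD[OF n], auto)
  qed
qed

lemma monic_cancel:
  assumes mn: "monic C (m \<cdot> n)" and a: "m \<in> Arr C" "n \<in> Arr C" "Cod C n = Dom C m"
  shows "monic C n"
proof (rule monicI)
  fix u v assume *: "u \<in> Arr C" "v \<in> Arr C" "Cod C u = Dom C n" "Cod C v = Dom C n"
      "Dom C u = Dom C v" "n \<cdot> u = n \<cdot> v"
  have "(m \<cdot> n) \<cdot> u = (m \<cdot> n) \<cdot> v" using * a by simp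
  then show "u = v" using * a by - (rule monicD[OF mn], auto)
qed (use a in auto)

lemma split_monic:
  assumes a: "m \<in> Arr C" "r \<in> hom C (Cod C m) (Dom C m)" and r: "r \<cdot> m = Id C (Dom C m)"
  shows "monic C m"
proof (rule monic_cancel[of r])
  show "monic C (r \<cdot> m)" unfolding r using a by (intro monicI) auto
qed (use a in auto)

lemma inverse_arrows_sym: "inverse_arrows C f g \<Longrightarrow> inverse_arrows C g f"
  by (auto simp: inverse_arrows_def)

lemma iso_monic: "iso C f \<Longrightarrow> monic C f"
  unfolding iso_def inverse_arrows_def using split_monic by blast

lemma monic_split_epi_iso:
  assumes m: "monic C m" and t: "t \<in> hom C (Cod C m) (Dom C m)" and 1: "m \<cdot> t = Id C (Cod C m)"
  shows "inverse_arrows C m t"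
proof -
  have a: "m \<in> Arr C" using m by (auto simp: monic_def)
  have "m \<cdot> (t \<cdot> m) = m \<cdot> Id C (Dom C m)" using extend_eq1[OF 1, of m] a t by simp
  then have "t \<cdot> m = Id C (Dom C m)" using a t by - (rule monicD[OF m], auto)
  then show ?thesis using a t 1 by (simp add: inverse_arrows_def)
qed

lemma coequalizer_epic:
  assumes "coequalizer C a b e"
  shows "epic C e"
  unfolding epic_def
proof (intro conjI ballI impI)
  have a: "a \<in> Arr C" "b \<in> Arr C" "e \<in> Arr C" "Dom C e = Cod C a" "Dom C b = Dom C a" "Cod C b = Cod C a"
    "e \<cdot> a = e \<cdot> b"
    using assms by (auto simp: coequalizer_def)
  show "e \<in> Arr C" by fact
  fix u v assume u: "u \<in> Arr C" "v \<in> Arr C"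
    "Dom C u = Cod C e \<and> Dom C v = Cod C e \<and> Cod C u = Cod C v \<and> u \<cdot> e = v \<cdot> e"
  have "(v \<cdot> e) \<cdot> a = (v \<cdot> e) \<cdot> b" using a u by simp
  then have "\<exists>!h. h \<in> hom C (Cod C e) (Cod C (v \<cdot> e)) \<and> h \<cdot> e = v \<cdot> e"
    using assms a u unfolding coequalizer_def by (metis comp_simps)
  then show "u = v" using a u by (auto simp del: assoc)
qed

lemma regular_epi_epic: "regular_epi C e \<Longrightarrow> epic C e"
  using coequalizer_epic by (auto simp: regular_epi_def)

lemma regular_epi_Arr [simp]: "regular_epi C e \<Longrightarrow> e \<in> Arr C"
  by (auto simp: regular_epi_def coequalizer_def)

lemma monic_Arr [simp]: "monic C e \<Longrightarrow> e \<in> Arr C"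
  by (auto simp: monic_def)

text \<open>An arrow that identifies whatever the regular epimorphism \<open>e\<close> identifies factors through
  \<open>e\<close>; the two arrows of which \<open>e\<close> is the coequalizer are one instance of the hypothesis.\<close>

lemma regular_epi_descend:
  assumes e: "regular_epi C e" and f: "f \<in> Arr C" "Dom C f = Dom C e"
    and id: "\<And>u v. \<lbrakk>u \<in> Arr C; v \<in> Arr C; Cod C u = Dom C e; Cod C v = Dom C e; Dom C u = Dom C v;
            e \<cdot> u = e \<cdot> v\<rbrakk> \<Longrightarrow> f \<cdot> u = f \<cdot> v"
  obtains w where "w \<in> Arr C" "Dom C w = Cod C e" "Cod C w = Cod C f" "w \<cdot> e = f"
proof -
  obtain a b where c: "coequalizer C a b e" using e by (auto simp: regular_epi_def)
  then have a: "a \<in> Arr C" "b \<in> Arr C" "e \<in> Arr C" "Dom C e = Cod C a" "Dom C b = Dom C a"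
    "Cod C b = Cod C a" "e \<cdot> a = e \<cdot> b" by (auto simp: coequalizer_def)
  have "f \<cdot> a = f \<cdot> b" by (rule id) (use a in auto)
  then have "\<exists>h. h \<in> hom C (Cod C e) (Cod C f) \<and> h \<cdot> e = f"
    using c a f unfolding coequalizer_def by metis
  then show thesis using that by auto
qed

text \<open>Regular epimorphisms are orthogonal to monomorphisms: what \<open>e\<close> identifies is identified by
  \<open>m \<cdot> u\<close>, hence already by \<open>u\<close>.\<close>

lemma regular_epi_fill:
  assumes e: "regular_epi C e" and m: "monic C m"
    and a: "u \<in> hom C (Dom C e) (Dom C m)" "v \<in> hom C (Cod C e) (Cod C m)" and sq: "m \<cdot> u = v \<cdot> e"
  obtains w where "w \<in> Arr C" "Dom C w = Cod C e" "Cod C w = Dom C m" "w \<cdot> e = u" "m \<cdot> w = v"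
proof -
  have ea: "e \<in> Arr C" "m \<in> Arr C" using e m by auto
  obtain w where w: "w \<in> Arr C" "Dom C w = Cod C e" "Cod C w = Cod C u" "w \<cdot> e = u"
  proof (rule regular_epi_descend[OF e, of u])
    fix x y assume *: "x \<in> Arr C" "y \<in> Arr C" "Cod C x = Dom C e" "Cod C y = Dom C e" "Dom C x = Dom C y"
      "e \<cdot> x = e \<cdot> y"
    have "m \<cdot> (u \<cdot> x) = v \<cdot> (e \<cdot> x)" "m \<cdot> (u \<cdot> y) = v \<cdot> (e \<cdot> y)"
      using *(1-5) a ea by (auto intro!: extend_eq[OF sq])
    then have "m \<cdot> (u \<cdot> x) = m \<cdot> (u \<cdot> y)" using * by simp
    then show "u \<cdot> x = u \<cdot> y" using * a ea by - (rule monicD[OF m], auto)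
  qed (use a in auto)
  have "(m \<cdot> w) \<cdot> e = v \<cdot> e" using w a ea sq by simp
  then have "m \<cdot> w = v" using w a ea by - (rule epicD[OF regular_epi_epic[OF e]], auto)
  then show thesis using that w a by auto
qed

lemma regular_epi_extremal:
  assumes e: "regular_epi C (m \<cdot> h)" and m: "monic C m" and h: "h \<in> Arr C" "Cod C h = Dom C m"
  shows "iso C m"
proof -
  have ma: "m \<in> Arr C" using m by simp
  obtain w where w: "w \<in> Arr C" "Dom C w = Cod C (m \<cdot> h)" "Cod C w = Dom C m" "m \<cdot> w = Id C (Cod C m)"
    by (rule regular_epi_fill[OF e m, of h "Id C (Cod C m)"]) (use ma h in auto)
  then show ?thesis using monic_split_epi_iso[OF m, of w] ma h by (auto simp: iso_def)
qed

lemma regular_epi_monic_iso: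
  assumes "regular_epi C m" and m: "monic C m" shows "iso C m"
  using regular_epi_extremal[of m "Id C (Dom C m)"] assms by simp

text \<open>Regular epimorphisms are closed under isomorphism of the codomain; with images this turns
  extremality into regularity.\<close>

lemma coequalizer_iso_comp:
  assumes c: "coequalizer C a b e" and i: "inverse_arrows C i j" and d: "Dom C i = Cod C e"
  shows "coequalizer C a b (i \<cdot> e)"
proof -
  have a: "a \<in> Arr C" "b \<in> Arr C" "e \<in> Arr C" "Dom C e = Cod C a" "Dom C b = Dom C a"
    "Cod C b = Cod C a" "e \<cdot> a = e \<cdot> b" using c by (auto simp: coequalizer_def)
  have ij: "i \<in> Arr C" "j \<in> Arr C" "Dom C j = Cod C i" "Cod C j = Dom C i"
    "j \<cdot> i = Id C (Dom C i)" "i \<cdot> j = Id C (Cod C i)"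
    using i by (auto simp: inverse_arrows_def)
  show ?thesis
    unfolding coequalizer_def
  proof (intro conjI ballI impI)
    fix k assume k: "k \<in> Arr C" "Dom C k = Cod C a \<and> k \<cdot> a = k \<cdot> b"
    obtain h where h: "h \<in> Arr C" "Dom C h = Cod C e" "Cod C h = Cod C k" "h \<cdot> e = k"
      using c k unfolding coequalizer_def by (metis hom_iff)
    have ji: "j \<cdot> (i \<cdot> e) = e" using extend_eq1[OF ij(5), of e] a ij d by simp
    show "\<exists>!h. h \<in> hom C (Cod C (i \<cdot> e)) (Cod C k) \<and> h \<cdot> (i \<cdot> e) = k"
    proof (rule ex1I[of _ "h \<cdot> j"])
      show "h \<cdot> j \<in> hom C (Cod C (i \<cdot> e)) (Cod C k) \<and> (h \<cdot> j) \<cdot> (i \<cdot> e) = k"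
        using h ij a d ji by simp
      fix h' assume h': "h' \<in> hom C (Cod C (i \<cdot> e)) (Cod C k) \<and> h' \<cdot> (i \<cdot> e) = k"
      then have "(h' \<cdot> i) \<cdot> e = h \<cdot> e" using h ij a d by simp
      then have "h' \<cdot> i = h" using h h' ij a d by - (rule epicD[OF coequalizer_epic[OF c]], auto)
      then have "(h' \<cdot> i) \<cdot> j = h \<cdot> j" by simp
      then show "h' = h \<cdot> j" using h' ij a d by simp
    qed
  qed (use a ij d in auto)
qed

lemma iso_comp_regular_epi: "\<lbrakk>iso C i; regular_epi C e; Dom C i = Cod C e\<rbrakk> \<Longrightarrow> regular_epi C (i \<cdot> e)"
  unfolding regular_epi_def iso_def using coequalizer_iso_comp by blast

lemma weak_pullbackE:
  assumes "is_weak_pullback C f g p q" "u \<in> Arr C" "v \<in> Arr C" "Dom C u = Dom C v" "Cod C u = Dom C f"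
    "Cod C v = Dom C g" "f \<cdot> u = g \<cdot> v"
  obtains h where "h \<in> Arr C" "Dom C h = Dom C u" "Cod C h = Dom C p" "p \<cdot> h = u" "q \<cdot> h = v"
proof -
  have "commuting_square C f g u v" using assms by (auto simp: is_weak_pullback_def commuting_square_def)
  then show thesis using assms(1) that unfolding is_weak_pullback_def by (metis hom_iff)
qed

lemma pullback_weak: "is_pullback C f g p q \<Longrightarrow> is_weak_pullback C f g p q"
  unfolding is_pullback_def is_weak_pullback_def by blast

lemma pullback_square: "is_pullback C f g p q \<Longrightarrow> commuting_square C f g p q"
  by (simp add: is_pullback_def)

lemma weak_pullback_square: "is_weak_pullback C f g p q \<Longrightarrow> commuting_square C f g p q"
  by (simp add: is_weak_pullback_def)

lemma pullback_joint_monic: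
  assumes pb: "is_pullback C f g p q" and a: "u \<in> Arr C" "v \<in> Arr C" "Cod C u = Dom C p" "Cod C v = Dom C p"
    "Dom C u = Dom C v" and e: "p \<cdot> u = p \<cdot> v" "q \<cdot> u = q \<cdot> v"
  shows "u = v"
proof -
  have s: "commuting_square C f g p q" using pb by (rule pullback_square)
  have "f \<cdot> (p \<cdot> u) = g \<cdot> (q \<cdot> u)"
    by (rule extend_eq) (use s a in \<open>auto simp: commuting_square_def\<close>)
  then have "commuting_square C f g (p \<cdot> u) (q \<cdot> u)"
    using s a by (auto simp: commuting_square_def)
  then have "\<exists>!h. h \<in> hom C (Dom C (p \<cdot> u)) (Dom C p) \<and> p \<cdot> h = p \<cdot> u \<and> q \<cdot> h = q \<cdot> u"
    using pb by (auto simp: is_pullback_def)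
  moreover have "Dom C (p \<cdot> u) = Dom C u" using s a by (auto simp: commuting_square_def)
  ultimately show ?thesis using a e by auto
qed

lemma pullbackI:
  assumes s: "commuting_square C f g p q"
    and ex: "\<And>u v. \<lbrakk>u \<in> Arr C; v \<in> Arr C; Dom C u = Dom C v; Cod C u = Dom C f; Cod C v = Dom C g;
          f \<cdot> u = g \<cdot> v\<rbrakk> \<Longrightarrow> \<exists>h. h \<in> hom C (Dom C u) (Dom C p) \<and> p \<cdot> h = u \<and> q \<cdot> h = v"
    and jm: "\<And>u v. \<lbrakk>u \<in> Arr C; v \<in> Arr C; Cod C u = Dom C p; Cod C v = Dom C p; Dom C u = Dom C v;
          p \<cdot> u = p \<cdot> v; q \<cdot> u = q \<cdot> v\<rbrakk> \<Longrightarrow> u = v"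
  shows "is_pullback C f g p q"
  unfolding is_pullback_def
proof (intro conjI allI impI s)
  fix u v assume uv: "commuting_square C f g u v"
  then obtain h where h: "h \<in> hom C (Dom C u) (Dom C p) \<and> p \<cdot> h = u \<and> q \<cdot> h = v"
    using ex[of u v] by (auto simp: commuting_square_def)
  then show "\<exists>!h. h \<in> hom C (Dom C u) (Dom C p) \<and> p \<cdot> h = u \<and> q \<cdot> h = v"
    by (intro ex1I[of _ h]) (auto intro!: jm)
qed

lemma pullback_iso_comparison:
  assumes pb: "is_pullback C f g p q" and t: "inverse_arrows C t t'" "Cod C t = Dom C p"
  shows "is_pullback C f g (p \<cdot> t) (q \<cdot> t)"
proof (rule pullbackI)
  have s: "f \<in> Arr C" "g \<in> Arr C" "p \<in> Arr C" "q \<in> Arr C" "Cod C f = Cod C g"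
     "Dom C p = Dom C q" "Cod C p = Dom C f" "Cod C q = Dom C g" "f \<cdot> p = g \<cdot> q"
    using pullback_square[OF pb] by (auto simp: commuting_square_def)
  have tt: "t \<in> Arr C" "t' \<in> Arr C" "Dom C t' = Cod C t" "Cod C t' = Dom C t" "t \<cdot> t' = Id C (Cod C t)"
    "t' \<cdot> t = Id C (Dom C t)"
    using t by (auto simp: inverse_arrows_def)
  have "f \<cdot> (p \<cdot> t) = g \<cdot> (q \<cdot> t)" by (rule extend_eq) (use s tt t in auto)
  then show "commuting_square C f g (p \<cdot> t) (q \<cdot> t)"
    using s tt t by (auto simp: commuting_square_def)
  show "\<exists>h. h \<in> hom C (Dom C u) (Dom C (p \<cdot> t)) \<and> (p \<cdot> t) \<cdot> h = u \<and> (q \<cdot> t) \<cdot> h = v"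
    if *: "u \<in> Arr C" "v \<in> Arr C" "Dom C u = Dom C v" "Cod C u = Dom C f" "Cod C v = Dom C g"
      "f \<cdot> u = g \<cdot> v" for u v
  proof -
    obtain h where h: "h \<in> Arr C" "Dom C h = Dom C u" "Cod C h = Dom C p" "p \<cdot> h = u" "q \<cdot> h = v"
      using weak_pullbackE[OF pullback_weak[OF pb], of u v] * by metis
    have "t \<cdot> (t' \<cdot> h) = h" using extend_eq1[OF tt(5), of h] h tt t by simp
    then show ?thesis using h s tt t by (intro exI[of _ "t' \<cdot> h"]) simp
  qed
  show "u = v" if *: "u \<in> Arr C" "v \<in> Arr C" "Cod C u = Dom C (p \<cdot> t)" "Cod C v = Dom C (p \<cdot> t)"
    "Dom C u = Dom C v" "(p \<cdot> t) \<cdot> u = (p \<cdot> t) \<cdot> v" "(q \<cdot> t) \<cdot> u = (q \<cdot> t) \<cdot> v" for u v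
  proof -
    have "t \<cdot> u = t \<cdot> v"
      by (rule pullback_joint_monic[OF pb]) (use * s tt t in auto)
    then show ?thesis using * s tt t iso_monic[of t]
      by - (rule monicD[of t], auto simp: iso_def)
  qed
qed

lemma pullback_compare:
  assumes pb: "is_pullback C f g p q" and pb': "is_pullback C f g p' q'"
  obtains t t' where "inverse_arrows C t t'" "Dom C t = Dom C p'" "Cod C t = Dom C p" "p \<cdot> t = p'" "q \<cdot> t = q'"
proof -
  have s: "f \<in> Arr C" "g \<in> Arr C" "p \<in> Arr C" "q \<in> Arr C" "Cod C f = Cod C g"
     "Dom C p = Dom C q" "Cod C p = Dom C f" "Cod C q = Dom C g" "f \<cdot> p = g \<cdot> q"
    using pullback_square[OF pb] by (auto simp: commuting_square_def)
  have s': "p' \<in> Arr C" "q' \<in> Arr C"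
     "Dom C p' = Dom C q'" "Cod C p' = Dom C f" "Cod C q' = Dom C g" "f \<cdot> p' = g \<cdot> q'"
    using pullback_square[OF pb'] by (auto simp: commuting_square_def)
  obtain t where t: "t \<in> Arr C" "Dom C t = Dom C p'" "Cod C t = Dom C p" "p \<cdot> t = p'" "q \<cdot> t = q'"
    using weak_pullbackE[OF pullback_weak[OF pb], of p' q'] s' by metis
  obtain r where r: "r \<in> Arr C" "Dom C r = Dom C p" "Cod C r = Dom C p'" "p' \<cdot> r = p" "q' \<cdot> r = q"
    using weak_pullbackE[OF pullback_weak[OF pb'], of p q] s by metis
  have "t \<cdot> r = Id C (Dom C p)"
    by (rule pullback_joint_monic[OF pb])
       (use t r s in \<open>auto simp: extend_eq1[OF t(4)] extend_eq1[OF t(5)]\<close>)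
  moreover have "r \<cdot> t = Id C (Dom C p')"
    by (rule pullback_joint_monic[OF pb'])
       (use t r s s' in \<open>auto simp: extend_eq1[OF r(4)] extend_eq1[OF r(5)]\<close>)
  ultimately show thesis using t r that by (auto simp: inverse_arrows_def)
qed

lemma pullback_monic:
  assumes pb: "is_pullback C f m p q" and m: "monic C m" shows "monic C p"
proof -
  have s: "f \<in> Arr C" "m \<in> Arr C" "p \<in> Arr C" "q \<in> Arr C" "Cod C f = Cod C m"
     "Dom C p = Dom C q" "Cod C p = Dom C f" "Cod C q = Dom C m" "f \<cdot> p = m \<cdot> q"
    using pullback_square[OF pb] by (auto simp: commuting_square_def)
  show ?thesis
  proof (rule monicI)
    fix u v assume *: "u \<in> Arr C" "v \<in> Arr C" "Cod C u = Dom C p" "Cod C v = Dom C p"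
      "Dom C u = Dom C v" "p \<cdot> u = p \<cdot> v"
    have "m \<cdot> (q \<cdot> u) = f \<cdot> (p \<cdot> u)" "m \<cdot> (q \<cdot> v) = f \<cdot> (p \<cdot> v)"
      using *(1-5) s by (auto intro!: extend_eq)
    then have "q \<cdot> u = q \<cdot> v" using * s by - (rule monicD[OF m], auto)
    then show "u = v" using * s by - (rule pullback_joint_monic[OF pb], auto)
  qed (use s in auto)
qed

lemma terminal_unique:
  "\<lbrakk>is_terminal C T; u \<in> Arr C; v \<in> Arr C; Dom C u = Dom C v; Cod C u = T; Cod C v = T\<rbrakk> \<Longrightarrow> u = v"
  unfolding is_terminal_def by (metis Dom_Ob hom_iff)

lemma terminal_ex:
  assumes "is_terminal C T" "A \<in> Ob C" obtains t where "t \<in> Arr C" "Dom C t = A" "Cod C t = T"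
  using assms unfolding is_terminal_def by (metis hom_iff)

lemma terminal_Ob: "is_terminal C T \<Longrightarrow> T \<in> Ob C"
  by (simp add: is_terminal_def)

lemma terminal_iso:
  assumes T: "is_terminal C T" and i: "inverse_arrows C i j" "Dom C i = T"
  shows "is_terminal C (Cod C i)"
  unfolding is_terminal_def
proof (intro conjI ballI)
  have ij: "i \<in> Arr C" "j \<in> Arr C" "Dom C j = Cod C i" "Cod C j = Dom C i" "j \<cdot> i = Id C (Dom C i)"
    "i \<cdot> j = Id C (Cod C i)"
    using i by (auto simp: inverse_arrows_def)
  then show "Cod C i \<in> Ob C" by simp
  fix A assume "A \<in> Ob C"
  then obtain t where t: "t \<in> Arr C" "Dom C t = A" "Cod C t = T" using terminal_ex[OF T] by metis
  show "\<exists>!f. f \<in> hom C A (Cod C i)"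
  proof (rule ex1I[of _ "i \<cdot> t"])
    show "i \<cdot> t \<in> hom C A (Cod C i)" using t ij i by simp
    fix f assume f: "f \<in> hom C A (Cod C i)"
    then have "j \<cdot> f = t" using t ij i by - (rule terminal_unique[OF T], auto)
    then have "i \<cdot> (j \<cdot> f) = i \<cdot> t" by simp
    then show "f = i \<cdot> t" using extend_eq1[OF ij(6), of f] f ij by simp
  qed
qed

lemma productD:
  assumes "is_product C A B V p q"
  shows "V \<in> Ob C" "p \<in> Arr C" "q \<in> Arr C" "Dom C p = V" "Dom C q = V" "Cod C p = A" "Cod C q = B"
  using assms by (auto simp: is_product_def)

lemma product_ex:
  assumes "is_product C A B V p q" "f \<in> Arr C" "g \<in> Arr C" "Dom C f = Dom C g" "Cod C f = A" "Cod C g = B"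
  obtains h where "h \<in> Arr C" "Dom C h = Dom C f" "Cod C h = V" "p \<cdot> h = f" "q \<cdot> h = g"
  using assms unfolding is_product_def by (metis Dom_Ob hom_iff)

lemma product_unique:
  assumes P: "is_product C A B V p q" and a: "u \<in> Arr C" "v \<in> Arr C" "Dom C u = Dom C v"
    "Cod C u = V" "Cod C v = V" and e: "p \<cdot> u = p \<cdot> v" "q \<cdot> u = q \<cdot> v"
  shows "u = v"
proof -
  have "\<exists>!h. h \<in> hom C (Dom C u) V \<and> p \<cdot> h = p \<cdot> u \<and> q \<cdot> h = q \<cdot> u"
    using P a productD[OF P] unfolding is_product_def by (auto simp del: hom_iff simp: hom_def)
  then show ?thesis using a e by auto
qed

text \<open>Pullbacks over a terminal object are products, so that functors preserving pullbacks and
  terminal objects preserve products.\<close>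

lemma product_iff_pullback:
  assumes T: "is_terminal C T" and a: "a \<in> hom C A T" and b: "b \<in> hom C B T"
  shows "is_product C A B V p q \<longleftrightarrow>
     p \<in> hom C V A \<and> q \<in> hom C V B \<and> is_pullback C a b p q"
proof (intro iffI conjI; (elim conjE)?)
  assume P: "is_product C A B V p q"
  note pq = productD[OF P]
  show "p \<in> hom C V A" "q \<in> hom C V B" using pq by auto
  show "is_pullback C a b p q"
  proof (rule pullbackI)
    have "a \<cdot> p = b \<cdot> q" using pq a b by - (rule terminal_unique[OF T], auto)
    then show "commuting_square C a b p q" using pq a b by (simp add: commuting_square_def)
    show "\<exists>h. h \<in> hom C (Dom C u) (Dom C p) \<and> p \<cdot> h = u \<and> q \<cdot> h = v"
      if "u \<in> Arr C" "v \<in> Arr C" "Dom C u = Dom C v" "Cod C u = Dom C a" "Cod C v = Dom C b" for u v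
      using product_ex[OF P, of u v] that a b pq by (metis hom_iff)
    show "u = v" if "u \<in> Arr C" "v \<in> Arr C" "Cod C u = Dom C p" "Cod C v = Dom C p" "Dom C u = Dom C v"
      "p \<cdot> u = p \<cdot> v" "q \<cdot> u = q \<cdot> v" for u v
      using that pq by - (rule product_unique[OF P], auto)
  qed
next
  assume pq: "p \<in> hom C V A" "q \<in> hom C V B" and pb: "is_pullback C a b p q"
  show "is_product C A B V p q"
    unfolding is_product_def
  proof (intro conjI ballI pq)
    show "V \<in> Ob C" using pq by auto
    fix X f g assume *: "X \<in> Ob C" "f \<in> hom C X A" "g \<in> hom C X B"
    have "a \<cdot> f = b \<cdot> g" using * a b by - (rule terminal_unique[OF T], auto)
    then have "commuting_square C a b f g" using * a b by (simp add: commuting_square_def)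
    then have "\<exists>!h. h \<in> hom C (Dom C f) (Dom C p) \<and> p \<cdot> h = f \<and> q \<cdot> h = g"
      using pb unfolding is_pullback_def by blast
    then show "\<exists>!h. h \<in> hom C X V \<and> p \<cdot> h = f \<and> q \<cdot> h = g"
      using pq * by simp
  qed
qed

end

locale with_products = category +
  assumes products: "has_binary_products C"
begin

lemma chosen_product: "\<lbrakk>A \<in> Ob C; B \<in> Ob C\<rbrakk> \<Longrightarrow> is_product C A B (prd C A B) (pr1 C A B) (pr2 C A B)"
proof -
  assume "A \<in> Ob C" "B \<in> Ob C"
  then have "\<exists>x. (case x of (V, p, q) \<Rightarrow> is_product C A B V p q)"
    using products by (auto simp: has_binary_products_def)
  then have "case chosen_product C A B of (V, p, q) \<Rightarrow> is_product C A B V p q"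
    unfolding chosen_product_def by (rule someI_ex)
  then show ?thesis by (auto simp: prd_def pr1_def pr2_def split: prod.splits)
qed

lemma pr_simps [simp]:
  assumes "A \<in> Ob C" "B \<in> Ob C"
  shows "prd C A B \<in> Ob C" "pr1 C A B \<in> Arr C" "pr2 C A B \<in> Arr C"
    "Dom C (pr1 C A B) = prd C A B" "Dom C (pr2 C A B) = prd C A B"
    "Cod C (pr1 C A B) = A" "Cod C (pr2 C A B) = B"
  using productD[OF chosen_product[OF assms]] by auto

lemma pair_simps [simp]:
  assumes "f \<in> Arr C" "g \<in> Arr C" "Dom C f = Dom C g"
  shows "pair C f g \<in> Arr C" "Dom C (pair C f g) = Dom C g" "Cod C (pair C f g) = prd C (Cod C f) (Cod C g)"
    "pr1 C (Cod C f) (Cod C g) \<cdot> pair C f g = f" "pr2 C (Cod C f) (Cod C g) \<cdot> pair C f g = g"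
proof -
  have "\<exists>!h. h \<in> hom C (Dom C f) (prd C (Cod C f) (Cod C g)) \<and>
     pr1 C (Cod C f) (Cod C g) \<cdot> h = f \<and> pr2 C (Cod C f) (Cod C g) \<cdot> h = g"
    using chosen_product[of "Cod C f" "Cod C g"] assms unfolding is_product_def
    by (auto simp del: hom_iff simp: hom_def)
  then have "pair C f g \<in> hom C (Dom C f) (prd C (Cod C f) (Cod C g)) \<and>
     pr1 C (Cod C f) (Cod C g) \<cdot> pair C f g = f \<and> pr2 C (Cod C f) (Cod C g) \<cdot> pair C f g = g"
    unfolding pair_def by (rule theI')
  then show "pair C f g \<in> Arr C" "Dom C (pair C f g) = Dom C g" "Cod C (pair C f g) = prd C (Cod C f) (Cod C g)"
    "pr1 C (Cod C f) (Cod C g) \<cdot> pair C f g = f" "pr2 C (Cod C f) (Cod C g) \<cdot> pair C f g = g"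
    using assms by auto
qed

lemma pr_pair:
  assumes "f \<in> Arr C" "g \<in> Arr C" "Dom C f = Dom C g" "Cod C f = A" "Cod C g = B"
  shows "pr1 C A B \<cdot> pair C f g = f" "pr2 C A B \<cdot> pair C f g = g"
  using pair_simps(4,5)[of f g] assms by auto

lemma pr_pair_comp:
  assumes "f \<in> Arr C" "g \<in> Arr C" "Dom C f = Dom C g" "Cod C f = A" "Cod C g = B"
    "x \<in> Arr C" "Cod C x = Dom C g"
  shows "pr1 C A B \<cdot> (pair C f g \<cdot> x) = f \<cdot> x" "pr2 C A B \<cdot> (pair C f g \<cdot> x) = g \<cdot> x"
  using assms pr_pair[of f g A B] by (auto intro!: extend_eq1)

lemma prd_eqI:
  assumes "u \<in> Arr C" "v \<in> Arr C" "Dom C u = Dom C v" "Cod C u = prd C A B" "Cod C v = prd C A B"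
    "A \<in> Ob C" "B \<in> Ob C" "pr1 C A B \<cdot> u = pr1 C A B \<cdot> v" "pr2 C A B \<cdot> u = pr2 C A B \<cdot> v"
  shows "u = v"
  using product_unique[OF chosen_product] assms by metis

lemma prod_arr_simps [simp]:
  assumes "f \<in> Arr C" "g \<in> Arr C"
  shows "prod_arr C f g \<in> Arr C" "Dom C (prod_arr C f g) = prd C (Dom C f) (Dom C g)"
    "Cod C (prod_arr C f g) = prd C (Cod C f) (Cod C g)"
  using assms by (auto simp: prod_arr_def)

lemma pr_prod_arr:
  assumes "f \<in> Arr C" "g \<in> Arr C" "Cod C f = A" "Cod C g = B" "x \<in> Arr C" "Cod C x = prd C (Dom C f) (Dom C g)"
  shows "pr1 C A B \<cdot> (prod_arr C f g \<cdot> x) = f \<cdot> (pr1 C (Dom C f) (Dom C g) \<cdot> x)"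
    "pr2 C A B \<cdot> (prod_arr C f g \<cdot> x) = g \<cdot> (pr2 C (Dom C f) (Dom C g) \<cdot> x)"
  using assms by (auto simp: prod_arr_def pr_pair_comp)

end

lemma (in category) finite_limits_products:
  assumes "has_finite_limits C" shows "has_binary_products C"
  unfolding has_binary_products_def
proof (intro ballI)
  fix A B assume AB: "A \<in> Ob C" "B \<in> Ob C"
  obtain T where T: "is_terminal C T" using assms by (auto simp: has_finite_limits_def)
  obtain a b where ab: "a \<in> Arr C" "Dom C a = A" "Cod C a = T" "b \<in> Arr C" "Dom C b = B" "Cod C b = T"
    using terminal_ex[OF T] AB by metis
  obtain p q where pb: "is_pullback C a b p q"
    using assms ab by (metis has_finite_limits_def has_pullbacks_def)
  then have "is_product C A B (Dom C p) p q"
    using product_iff_pullback[OF T, of a A b B "Dom C p" p q] ab pullback_square[OF pb]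
    by (auto simp: commuting_square_def)
  then show "\<exists>V p q. is_product C A B V p q" by blast
qed

locale regular_cat = category +
  assumes regular: "regular_category C"
begin

lemma finite_limits: "has_finite_limits C"
  using regular by (simp add: regular_category_def)

sublocale with_products
  using finite_limits_products[OF finite_limits] by unfold_locales

lemma pullback_ex:
  assumes "f \<in> Arr C" "g \<in> Arr C" "Cod C f = Cod C g" obtains p q where "is_pullback C f g p q"
  using finite_limits assms by (metis has_finite_limits_def has_pullbacks_def)

lemma image_ex:
  assumes "f \<in> Arr C"
  obtains e m where "regular_epi C e" "monic C m" "Cod C e = Dom C m" "f = m \<cdot> e"
  using regular assms by (metis regular_category_def)

lemma pullback_regular_epi: "\<lbrakk>is_pullback C f e p q; regular_epi C e\<rbrakk> \<Longrightarrow> regular_epi C p"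
  using regular unfolding regular_category_def by blast

text \<open>In a regular category the regular epimorphisms are exactly the extremal ones, and
  extremality passes to a last factor by inspection.\<close>

lemma extremal_regular_epi:
  assumes g: "g \<in> Arr C"
    and ext: "\<And>m h. \<lbrakk>monic C m; h \<in> Arr C; Cod C h = Dom C m; g = m \<cdot> h\<rbrakk> \<Longrightarrow> iso C m"
  shows "regular_epi C g"
proof -
  obtain e m where em: "regular_epi C e" "monic C m" "Cod C e = Dom C m" "g = m \<cdot> e"
    using image_ex[OF g] by metis
  then have "iso C m" using ext[of m e] by simp
  then show ?thesis using em by (auto intro: iso_comp_regular_epi)
qed

lemma regular_epi_last_factor:
  assumes gf: "regular_epi C (g \<cdot> f)" and a: "f \<in> Arr C" "g \<in> Arr C" "Cod C f = Dom C g"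
  shows "regular_epi C g"
proof (rule extremal_regular_epi[OF a(2)])
  fix m h assume m: "monic C m" "h \<in> Arr C" "Cod C h = Dom C m" "g = m \<cdot> h"
  have "Dom C g = Dom C h" using m by simp
  then have "g \<cdot> f = m \<cdot> (h \<cdot> f)" "Cod C (h \<cdot> f) = Dom C m" "h \<cdot> f \<in> Arr C" using m a by auto
  then show "iso C m" using regular_epi_extremal[of m "h \<cdot> f"] gf m by simp
qed

lemma regular_epi_comp:
  assumes g: "regular_epi C g" and f: "regular_epi C f" and a: "Cod C f = Dom C g"
  shows "regular_epi C (g \<cdot> f)"
proof (rule extremal_regular_epi)
  show "g \<cdot> f \<in> Arr C" using f g a by simp
  fix m h assume m: "monic C m" "h \<in> Arr C" "Cod C h = Dom C m" "g \<cdot> f = m \<cdot> h"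
  have fg: "f \<in> Arr C" "g \<in> Arr C" "m \<in> Arr C" using f g m by auto
  have d: "Dom C h = Dom C f" "Cod C m = Cod C g"
    using m fg a comp_simps(2,3)[of f g] comp_simps(2,3)[of h m] by auto
  obtain w where w: "w \<in> Arr C" "Dom C w = Cod C f" "Cod C w = Dom C m" "w \<cdot> f = h" "m \<cdot> w = g"
    by (rule regular_epi_fill[OF f m(1), of h g]) (use m fg a d in auto)
  show "iso C m" using regular_epi_extremal[of m w] g m w a by simp
qed

end

lemma regular_catI: "regular_category C \<Longrightarrow> regular_cat C"
  by (simp add: regular_cat_def regular_cat_axioms_def regular_category_def)

section \<open>Doctrines of (weak) subobjects through generalized elements\<close>

lemma inf_semilatticeD:
  assumes "inf_semilattice L"
  shows "partial_order L" "\<top>\<^bsub>L\<^esub> \<in> carrier L" "x \<in> carrier L \<Longrightarrow> x \<sqsubseteq>\<^bsub>L\<^esub> \<top>\<^bsub>L\<^esub>"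
    "\<lbrakk>x \<in> carrier L; y \<in> carrier L\<rbrakk> \<Longrightarrow> x \<sqinter>\<^bsub>L\<^esub> y \<in> carrier L"
    "\<lbrakk>x \<in> carrier L; y \<in> carrier L\<rbrakk> \<Longrightarrow> x \<sqinter>\<^bsub>L\<^esub> y \<sqsubseteq>\<^bsub>L\<^esub> x"
    "\<lbrakk>x \<in> carrier L; y \<in> carrier L\<rbrakk> \<Longrightarrow> x \<sqinter>\<^bsub>L\<^esub> y \<sqsubseteq>\<^bsub>L\<^esub> y"
    "\<lbrakk>z \<sqsubseteq>\<^bsub>L\<^esub> x; z \<sqsubseteq>\<^bsub>L\<^esub> y; x \<in> carrier L; y \<in> carrier L; z \<in> carrier L\<rbrakk> \<Longrightarrow> z \<sqsubseteq>\<^bsub>L\<^esub> x \<sqinter>\<^bsub>L\<^esub> y"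
proof -
  interpret L: lower_semilattice L using assms by (simp add: inf_semilattice_def)
  interpret T: weak_partial_order_top L using assms by (simp add: inf_semilattice_def)
  show "partial_order L" by unfold_locales
  show "\<top>\<^bsub>L\<^esub> \<in> carrier L" "x \<in> carrier L \<Longrightarrow> x \<sqsubseteq>\<^bsub>L\<^esub> \<top>\<^bsub>L\<^esub>" by (auto intro: T.top_higher)
  show "\<lbrakk>x \<in> carrier L; y \<in> carrier L\<rbrakk> \<Longrightarrow> x \<sqinter>\<^bsub>L\<^esub> y \<in> carrier L"
    "\<lbrakk>x \<in> carrier L; y \<in> carrier L\<rbrakk> \<Longrightarrow> x \<sqinter>\<^bsub>L\<^esub> y \<sqsubseteq>\<^bsub>L\<^esub> x"
    "\<lbrakk>x \<in> carrier L; y \<in> carrier L\<rbrakk> \<Longrightarrow> x \<sqinter>\<^bsub>L\<^esub> y \<sqsubseteq>\<^bsub>L\<^esub> y"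
    "\<lbrakk>z \<sqsubseteq>\<^bsub>L\<^esub> x; z \<sqsubseteq>\<^bsub>L\<^esub> y; x \<in> carrier L; y \<in> carrier L; z \<in> carrier L\<rbrakk> \<Longrightarrow> z \<sqsubseteq>\<^bsub>L\<^esub> x \<sqinter>\<^bsub>L\<^esub> y"
    by (auto intro: L.meet_closed L.meet_left L.meet_right L.meet_le)
qed

lemma partial_orderI:
  assumes "eq L = (=)" "\<And>x. x \<in> carrier L \<Longrightarrow> x \<sqsubseteq>\<^bsub>L\<^esub> x"
    "\<And>x y. \<lbrakk>x \<in> carrier L; y \<in> carrier L; x \<sqsubseteq>\<^bsub>L\<^esub> y; y \<sqsubseteq>\<^bsub>L\<^esub> x\<rbrakk> \<Longrightarrow> x = y"
    "\<And>x y z. \<lbrakk>x \<in> carrier L; y \<in> carrier L; z \<in> carrier L; x \<sqsubseteq>\<^bsub>L\<^esub> y; y \<sqsubseteq>\<^bsub>L\<^esub> z\<rbrakk> \<Longrightarrow> x \<sqsubseteq>\<^bsub>L\<^esub> z"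
  shows "partial_order L"
proof -
  note [simp] = assms(1) assms(2)
  show ?thesis by unfold_locales (simp, simp, simp, simp, simp add: assms(3), metis assms(4), simp, simp)
qed

lemma inf_semilatticeI:
  assumes po: "partial_order L" and t: "t \<in> carrier L" "\<And>x. x \<in> carrier L \<Longrightarrow> x \<sqsubseteq>\<^bsub>L\<^esub> t"
    and m: "\<And>x y. \<lbrakk>x \<in> carrier L; y \<in> carrier L\<rbrakk> \<Longrightarrow> \<exists>z\<in>carrier L. z \<sqsubseteq>\<^bsub>L\<^esub> x \<and> z \<sqsubseteq>\<^bsub>L\<^esub> y \<and>
          (\<forall>w\<in>carrier L. w \<sqsubseteq>\<^bsub>L\<^esub> x \<and> w \<sqsubseteq>\<^bsub>L\<^esub> y \<longrightarrow> w \<sqsubseteq>\<^bsub>L\<^esub> z)"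
  shows "inf_semilattice L"
proof -
  interpret partial_order L by (rule po)
  have "lower_semilattice L"
  proof
    fix x y assume xy: "x \<in> carrier L" "y \<in> carrier L"
    obtain z where "z \<in> carrier L" "z \<sqsubseteq>\<^bsub>L\<^esub> x" "z \<sqsubseteq>\<^bsub>L\<^esub> y"
      "\<And>w. \<lbrakk>w \<in> carrier L; w \<sqsubseteq>\<^bsub>L\<^esub> x; w \<sqsubseteq>\<^bsub>L\<^esub> y\<rbrakk> \<Longrightarrow> w \<sqsubseteq>\<^bsub>L\<^esub> z"
      using m[OF xy] by auto
    then show "\<exists>s. greatest L s (Lower L {x, y})"
      using xy by (intro exI[of _ z]) (auto simp: greatest_def Lower_def)
  qed
  moreover have "weak_partial_order_top L"
    by unfold_locales (use t in \<open>auto simp: greatest_def\<close>)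
  ultimately show ?thesis by (simp add: inf_semilattice_def)
qed

lemma left_adjointI:
  assumes "partial_order L" "partial_order M" "\<And>x. x \<in> carrier L \<Longrightarrow> f x \<in> carrier M"
    "\<And>y. y \<in> carrier M \<Longrightarrow> g y \<in> carrier L"
    "\<And>x y. \<lbrakk>x \<in> carrier L; y \<in> carrier M\<rbrakk> \<Longrightarrow> f x \<sqsubseteq>\<^bsub>M\<^esub> y \<longleftrightarrow> x \<sqsubseteq>\<^bsub>L\<^esub> g y"
  shows "left_adjoint L M f g"
  using assms by (simp add: galois_connection_def connection_def galois_connection_axioms_def)

lemma left_adjointD:
  assumes "left_adjoint L M f g"
  shows "partial_order L" "partial_order M" "x \<in> carrier L \<Longrightarrow> f x \<in> carrier M"
    "y \<in> carrier M \<Longrightarrow> g y \<in> carrier L"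
    "\<lbrakk>x \<in> carrier L; y \<in> carrier M\<rbrakk> \<Longrightarrow> f x \<sqsubseteq>\<^bsub>M\<^esub> y \<longleftrightarrow> x \<sqsubseteq>\<^bsub>L\<^esub> g y"
  using assms by (auto simp: galois_connection_def connection_def galois_connection_axioms_def)

lemma antisymD: "\<lbrakk>partial_order L; x \<in> carrier L; y \<in> carrier L; x \<sqsubseteq>\<^bsub>L\<^esub> y; y \<sqsubseteq>\<^bsub>L\<^esub> x\<rbrakk> \<Longrightarrow> x = y"
  by (rule partial_order.le_antisym)

lemma transD: "\<lbrakk>partial_order L; x \<sqsubseteq>\<^bsub>L\<^esub> y; y \<sqsubseteq>\<^bsub>L\<^esub> z; x \<in> carrier L; y \<in> carrier L; z \<in> carrier L\<rbrakk> \<Longrightarrow> x \<sqsubseteq>\<^bsub>L\<^esub> z"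
  using weak_partial_order.le_trans[of L x y z] by (simp add: partial_order_def)

lemma reflD: "\<lbrakk>partial_order L; x \<in> carrier L\<rbrakk> \<Longrightarrow> x \<sqsubseteq>\<^bsub>L\<^esub> x"
  using weak_partial_order.le_refl[of L x] by (simp add: partial_order_def)

text \<open>The adjunction at the top element: \<open>\<delta>\<^sub>A\<close> is the least predicate that holds on the diagonal. This
  makes it unique, and shows that it is preserved by anything that preserves the order.\<close>

lemma equality_least:
  assumes P: "is_doctrine P" and d: "is_equality P A \<delta>" and A: "A \<in> Ob (base P)"
    and \<beta>: "\<beta> \<in> carrier (fib P (prd (base P) A A))"
  shows "\<delta> \<sqsubseteq>\<^bsub>fib P (prd (base P) A A)\<^esub> \<beta> \<longleftrightarrow>
     \<top>\<^bsub>fib P A\<^esub> \<sqsubseteq>\<^bsub>fib P A\<^esub> re P (pair (base P) (Id (base P) A) (Id (base P) A)) \<beta>"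
proof -
  let ?C = "base P"
  interpret with_products ?C
    using P by (simp add: is_doctrine_def with_products_def with_products_axioms_def)
  let ?AA = "prd ?C A A"
  let ?l = "\<lambda>\<alpha>. re P (pr1 ?C A A) \<alpha> \<sqinter>\<^bsub>fib P ?AA\<^esub> \<delta>"
  have adj: "left_adjoint (fib P A) (fib P ?AA) ?l (re P (pair ?C (Id ?C A) (Id ?C A)))"
    and dc: "\<delta> \<in> carrier (fib P ?AA)"
    using d by (auto simp: is_equality_def Let_def)
  have sl: "inf_semilattice (fib P A)" "inf_semilattice (fib P ?AA)"
    using P A by (auto simp: is_doctrine_def)
  note L = inf_semilatticeD[OF sl(1)] and LL = inf_semilatticeD[OF sl(2)]
  have "infsl_hom (fib P A) (fib P ?AA) (re P (pr1 ?C A A))"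
    using P A pr_simps[of A A] unfolding is_doctrine_def by metis
  then have "re P (pr1 ?C A A) \<top>\<^bsub>fib P A\<^esub> = \<top>\<^bsub>fib P ?AA\<^esub>" by (simp add: infsl_hom_def)
  then have "?l \<top>\<^bsub>fib P A\<^esub> = \<delta>"
    using LL dc by (intro antisymD[OF LL(1)]) (auto intro: LL(7) reflD[OF LL(1)])
  then show ?thesis using left_adjointD(5)[OF adj L(2) \<beta>] by simp
qed

lemma eqp_is_equality:
  assumes P: "is_doctrine P" and d: "is_equality P A \<delta>" and A: "A \<in> Ob (base P)"
  shows "eqp P A = \<delta>"
  unfolding eqp_def
proof (rule the_equality)
  show "is_equality P A \<delta>" by (rule d)
  fix \<delta>' assume d': "is_equality P A \<delta>'"
  let ?L = "fib P (prd (base P) A A)"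
  have c: "\<delta> \<in> carrier ?L" "\<delta>' \<in> carrier ?L"
    using d d' by (auto simp: is_equality_def Let_def)
  have po: "partial_order ?L"
    using d by (auto simp: is_equality_def Let_def dest: left_adjointD(2))
  have "\<delta> \<sqsubseteq>\<^bsub>?L\<^esub> \<delta>'" "\<delta>' \<sqsubseteq>\<^bsub>?L\<^esub> \<delta>"
    using equality_least[OF P d A] equality_least[OF P d' A] c reflD[OF po] by blast+
  then show "\<delta>' = \<delta>" using antisymD[OF po] c by blast
qed

lemma eqp_equality:
  assumes "elementary_doctrine P" "A \<in> Ob (base P)" shows "is_equality P A (eqp P A)"
proof -
  obtain \<delta> where "is_equality P A \<delta>" using assms by (auto simp: elementary_doctrine_def)
  moreover from this have "eqp P A = \<delta>"
    using assms by (intro eqp_is_equality) (auto simp: elementary_doctrine_def)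
  ultimately show ?thesis by simp
qed

text \<open>The generalized elements of a (weak) subobject. They do not depend on the representative, and
  they turn the operations of the doctrine into logical ones.\<close>

definition belongs :: "('o, 'a) cat \<Rightarrow> 'a set \<Rightarrow> 'a \<Rightarrow> bool" where
  "belongs C \<alpha> x \<longleftrightarrow> (\<exists>a\<in>\<alpha>. factors_through C x a)"

definition slice_doc :: "('o, 'a) cat \<Rightarrow> 'a set \<Rightarrow> ('a \<Rightarrow> 'a \<Rightarrow> 'a \<Rightarrow> 'a \<Rightarrow> bool) \<Rightarrow> ('o, 'a, 'a set) doctrine" where
  "slice_doc C M PB =
     \<lparr>base = C, fib = slice_poset C M,
      re = (\<lambda>f \<alpha>. \<Union>{slice_class C M p | p. \<exists>a\<in>\<alpha>. \<exists>q. PB f a p q})\<rparr>"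

lemma slice_doc_simps [simp]: "base (slice_doc C M PB) = C" "fib (slice_doc C M PB) = slice_poset C M"
  by (auto simp: slice_doc_def)

lemma factors_throughI:
  "\<lbrakk>f = g \<cdot>\<^bsub>C\<^esub> h; h \<in> Arr C; Dom C h = Dom C f; Cod C h = Dom C g; Cod C f = Cod C g\<rbrakk> \<Longrightarrow> factors_through C f g"
  by (auto simp: factors_through_def)

lemma factors_throughE:
  assumes "factors_through C f g"
  obtains h where "g \<cdot>\<^bsub>C\<^esub> h = f" "h \<in> Arr C" "Dom C h = Dom C f" "Cod C h = Dom C g" "Cod C f = Cod C g"
  using assms by (auto simp: factors_through_def)

lemma (in category) factors_refl: "f \<in> Arr C \<Longrightarrow> factors_through C f f"
  by (rule factors_throughI[of _ _ _ "Id C (Dom C f)"]) auto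

lemma (in category) factors_trans:
  assumes "factors_through C f g" "factors_through C g h" "f \<in> Arr C" "g \<in> Arr C" "h \<in> Arr C"
  shows "factors_through C f h"
proof -
  obtain u where u: "g \<cdot> u = f" "u \<in> Arr C" "Dom C u = Dom C f" "Cod C u = Dom C g" "Cod C f = Cod C g"
    by (rule factors_throughE[OF assms(1)])
  obtain v where v: "h \<cdot> v = g" "v \<in> Arr C" "Dom C v = Dom C g" "Cod C v = Dom C h" "Cod C g = Cod C h"
    by (rule factors_throughE[OF assms(2)])
  have "h \<cdot> (v \<cdot> u) = f" using extend_eq1[OF v(1), of u] u v assms by simp
  then show ?thesis using u v by (intro factors_throughI[of f _ h "v \<cdot> u"]) auto
qed

text \<open>Weak subobjects (all arrows, weak pullbacks) and subobjects (monomorphisms, pullbacks) are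
  two instances of one construction, in which \<open>M\<close> collects the representatives and \<open>PB\<close> is the kind
  of square that computes reindexing. Any square that is weakly universal serves this purpose,
  because only the factorizations through the reindexed arrow matter.\<close>

locale slice_doctrine = with_products +
  fixes M :: "'b set" and PB :: "'b \<Rightarrow> 'b \<Rightarrow> 'b \<Rightarrow> 'b \<Rightarrow> bool"
  assumes M_Arr: "M \<subseteq> Arr C"
    and PB_ex: "\<lbrakk>f \<in> Arr C; a \<in> M; Cod C f = Cod C a\<rbrakk> \<Longrightarrow> \<exists>p q. PB f a p q"
    and PB_weak: "PB f a p q \<Longrightarrow> is_weak_pullback C f a p q"
    and PB_M: "\<lbrakk>PB f a p q; a \<in> M\<rbrakk> \<Longrightarrow> p \<in> M"
    and split_M: "\<lbrakk>m \<in> Arr C; r \<in> hom C (Cod C m) (Dom C m); r \<cdot> m = Id C (Dom C m)\<rbrakk> \<Longrightarrow> m \<in> M"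
    and comp_M: "\<lbrakk>a \<in> M; b \<in> M; Cod C b = Dom C a\<rbrakk> \<Longrightarrow> a \<cdot> b \<in> M"
begin

abbreviation "cls \<equiv> slice_class C M"
abbreviation "Sub \<equiv> slice_poset C M"
abbreviation "Doc \<equiv> slice_doc C M PB"

lemma M_ArrD: "a \<in> M \<Longrightarrow> a \<in> Arr C" using M_Arr by auto

lemma Id_M: "A \<in> Ob C \<Longrightarrow> Id C A \<in> M"
  by (rule split_M[of _ "Id C A"]) auto

lemma cls_self: "a \<in> M \<Longrightarrow> a \<in> cls a"
  using M_ArrD by (auto simp: slice_class_def intro: factors_refl)

lemma clsD: "b \<in> cls a \<Longrightarrow> b \<in> M \<and> factors_through C a b \<and> factors_through C b a"
  by (auto simp: slice_class_def)

lemma cls_eqI: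
  assumes "a \<in> M" "b \<in> M" "factors_through C a b" "factors_through C b a"
  shows "cls a = cls b"
proof -
  have "c \<in> cls a \<longleftrightarrow> c \<in> cls b" for c
    unfolding slice_class_def mem_Collect_eq using assms factors_trans M_ArrD by metis
  then show ?thesis by blast
qed

lemma belongs_cls [simp]: "\<lbrakk>a \<in> M; x \<in> Arr C\<rbrakk> \<Longrightarrow> belongs C (cls a) x \<longleftrightarrow> factors_through C x a"
  unfolding belongs_def using cls_self clsD factors_trans M_ArrD by metis

lemma cls_carrier [simp]: "\<lbrakk>a \<in> M; Cod C a = A\<rbrakk> \<Longrightarrow> cls a \<in> carrier (Sub A)"
  by (auto simp: slice_poset_def)

lemma carrierE:
  assumes "\<alpha> \<in> carrier (Sub A)"
  obtains a where "a \<in> M" "a \<in> Arr C" "Cod C a = A" "\<alpha> = cls a" "A \<in> Ob C"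
  using assms M_ArrD by (auto simp: slice_poset_def)

lemma carrier_mem:
  assumes "\<alpha> \<in> carrier (Sub A)" "a \<in> \<alpha>"
  shows "a \<in> M" "a \<in> Arr C" "Cod C a = A" "\<alpha> = cls a"
proof -
  obtain b where b: "b \<in> M" "b \<in> Arr C" "Cod C b = A" "\<alpha> = cls b" using assms by (auto elim: carrierE)
  have a: "a \<in> M" "factors_through C b a" "factors_through C a b" using assms(2) clsD unfolding b(4) by blast+
  show "a \<in> M" "a \<in> Arr C" "Cod C a = A" using a b M_ArrD by (auto simp: factors_through_def)
  show "\<alpha> = cls a" unfolding b(4) by (rule cls_eqI) (use a b in auto)
qed

text \<open>The representative of \<open>\<alpha>\<close> is itself one of its generalized elements, so inclusion of elements
  gives back a factorization.\<close>

lemma le_iff: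
  assumes "\<alpha> \<in> carrier (Sub A)" "\<beta> \<in> carrier (Sub A)"
  shows "\<alpha> \<sqsubseteq>\<^bsub>Sub A\<^esub> \<beta> \<longleftrightarrow> (\<forall>x\<in>Arr C. Cod C x = A \<longrightarrow> belongs C \<alpha> x \<longrightarrow> belongs C \<beta> x)"
proof -
  obtain a where a: "a \<in> M" "a \<in> Arr C" "Cod C a = A" "\<alpha> = cls a" using assms by (auto elim: carrierE)
  have "\<alpha> \<sqsubseteq>\<^bsub>Sub A\<^esub> \<beta> \<longleftrightarrow> (\<exists>f\<in>\<alpha>. belongs C \<beta> f)"
    by (auto simp: slice_poset_def belongs_def)
  also have "\<dots> \<longleftrightarrow> (\<forall>x\<in>Arr C. Cod C x = A \<longrightarrow> belongs C \<alpha> x \<longrightarrow> belongs C \<beta> x)"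
  proof (intro iffI)
    assume "\<exists>f\<in>\<alpha>. belongs C \<beta> f"
    then obtain f b where fb: "f \<in> \<alpha>" "b \<in> \<beta>" "factors_through C f b" by (auto simp: belongs_def)
    have b: "b \<in> M" "b \<in> Arr C" "\<beta> = cls b" using carrier_mem[OF assms(2) fb(2)] by auto
    have f: "f \<in> M" "f \<in> Arr C" "\<alpha> = cls f" using carrier_mem[OF assms(1) fb(1)] by auto
    show "\<forall>x\<in>Arr C. Cod C x = A \<longrightarrow> belongs C \<alpha> x \<longrightarrow> belongs C \<beta> x"
      unfolding b(3) f(3) using b f fb factors_trans[of _ f b] by auto
  next
    assume "\<forall>x\<in>Arr C. Cod C x = A \<longrightarrow> belongs C \<alpha> x \<longrightarrow> belongs C \<beta> x"
    then have "belongs C \<beta> a" using a by (auto intro: factors_refl)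
    then show "\<exists>f\<in>\<alpha>. belongs C \<beta> f" using a cls_self by auto
  qed
  finally show ?thesis .
qed

lemma Sub_eqI:
  assumes "\<alpha> \<in> carrier (Sub A)" "\<beta> \<in> carrier (Sub A)"
    and "\<And>x. \<lbrakk>x \<in> Arr C; Cod C x = A\<rbrakk> \<Longrightarrow> belongs C \<alpha> x \<longleftrightarrow> belongs C \<beta> x"
  shows "\<alpha> = \<beta>"
proof -
  obtain a where a: "a \<in> M" "a \<in> Arr C" "Cod C a = A" "\<alpha> = cls a" using assms by (auto elim: carrierE)
  obtain b where b: "b \<in> M" "b \<in> Arr C" "Cod C b = A" "\<beta> = cls b" using assms by (auto elim: carrierE)
  have ab: "factors_through C a b" "factors_through C b a"
    using assms(3)[of a] assms(3)[of b] a b factors_refl[of a] factors_refl[of b] by simp_all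
  show ?thesis unfolding a(4) b(4) by (rule cls_eqI) (use a b ab in auto)
qed

lemma Sub_eq [simp]: "eq (Sub A) = (=)" by (simp add: slice_poset_def)

lemma Sub_po: "partial_order (Sub A)"
proof (rule partial_orderI)
  show "x = y" if "x \<in> carrier (Sub A)" "y \<in> carrier (Sub A)" "x \<sqsubseteq>\<^bsub>Sub A\<^esub> y" "y \<sqsubseteq>\<^bsub>Sub A\<^esub> x" for x y
    by (rule Sub_eqI[of _ A]) (use that in \<open>auto simp: le_iff\<close>)
qed (auto simp: le_iff)

lemma PB_belongs:
  assumes pb: "PB f a p q" and a: "a \<in> M" and x: "x \<in> Arr C" "Cod C x = Dom C f"
  shows "factors_through C x p \<longleftrightarrow> factors_through C (f \<cdot> x) a"
proof -
  have w: "is_weak_pullback C f a p q" using pb by (rule PB_weak)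
  have s: "f \<in> Arr C" "a \<in> Arr C" "p \<in> Arr C" "q \<in> Arr C" "Cod C f = Cod C a" "Dom C p = Dom C q"
     "Cod C p = Dom C f" "Cod C q = Dom C a" "f \<cdot> p = a \<cdot> q"
    using weak_pullback_square[OF w] by (auto simp: commuting_square_def)
  show ?thesis
  proof
    assume "factors_through C x p"
    then obtain h where h: "p \<cdot> h = x" "h \<in> Arr C" "Dom C h = Dom C x" "Cod C h = Dom C p"
      by (auto elim: factors_throughE)
    have "f \<cdot> (p \<cdot> h) = a \<cdot> (q \<cdot> h)" by (rule extend_eq) (use s h in auto)
    then show "factors_through C (f \<cdot> x) a"
      using s h by (intro factors_throughI[of _ _ _ "q \<cdot> h"]) auto
  next
    assume "factors_through C (f \<cdot> x) a"
    then obtain h where h: "a \<cdot> h = f \<cdot> x" "h \<in> Arr C" "Dom C h = Dom C (f \<cdot> x)" "Cod C h = Dom C a"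
      by (rule factors_throughE)
    have h3: "Dom C x = Dom C h" using h(3) s x by simp
    obtain k where "k \<in> Arr C" "Dom C k = Dom C x" "Cod C k = Dom C p" "p \<cdot> k = x"
      using weak_pullbackE[OF w x(1) h(2) h3 x(2) h(4) h(1)[symmetric]] by metis
    then show "factors_through C x p" using s x by (intro factors_throughI[of _ _ _ k]) auto
  qed
qed

text \<open>The union in the definition of reindexing runs over classes that are all equal, since the
  elements of each are the \<open>x\<close> with \<open>f \<cdot> x\<close> in the class of \<open>a\<close>.\<close>

lemma re_cls:
  assumes pb: "PB f a p q" and a: "a \<in> M"
  shows "re Doc f (cls a) = cls p"
proof -
  have s: "f \<in> Arr C" "Cod C a = Cod C f" "Cod C p = Dom C f"
    using weak_pullback_square[OF PB_weak[OF pb]] by (auto simp: commuting_square_def)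
  have "cls p' = cls p" if "a' \<in> cls a" "PB f a' p' q'" for a' p' q'
  proof -
    have a': "a' \<in> M" "Cod C a' = Cod C a" "cls a' = cls a"
      using carrier_mem[of "cls a" "Cod C a" a'] that(1) a by auto
    have s': "Cod C p' = Dom C f"
      using weak_pullback_square[OF PB_weak[OF that(2)]] by (auto simp: commuting_square_def)
    have "factors_through C (f \<cdot> x) a' \<longleftrightarrow> factors_through C (f \<cdot> x) a"
      if "x \<in> Arr C" "Cod C x = Dom C f" for x
      using that s a a' by (simp flip: belongs_cls)
    then show ?thesis
      using PB_M[OF pb a] PB_M[OF that(2) a'(1)] s s' PB_belongs[OF pb a] PB_belongs[OF that(2) a'(1)]
      by (intro Sub_eqI[of _ "Dom C f"]) auto
  qed
  moreover have "\<exists>a'\<in>cls a. \<exists>q. PB f a' p q" using pb cls_self[OF a] by auto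
  ultimately have "{cls p' | p'. \<exists>a'\<in>cls a. \<exists>q. PB f a' p' q} = {cls p}" by fast
  then show ?thesis by (simp add: slice_doc_def)
qed

lemma belongs_re:
  assumes "f \<in> Arr C" "\<alpha> \<in> carrier (Sub (Cod C f))" "x \<in> Arr C" "Cod C x = Dom C f"
  shows "belongs C (re Doc f \<alpha>) x \<longleftrightarrow> belongs C \<alpha> (f \<cdot> x)"
proof -
  obtain a where a: "a \<in> M" "a \<in> Arr C" "Cod C a = Cod C f" "\<alpha> = cls a" using assms by (auto elim: carrierE)
  obtain p q where pb: "PB f a p q" using PB_ex[of f a] a assms by auto
  show ?thesis using PB_M[OF pb a(1)] PB_belongs[OF pb a(1)] assms a re_cls[OF pb a(1)] by simp
qed

lemma re_closed:
  assumes "f \<in> Arr C" "\<alpha> \<in> carrier (Sub (Cod C f))" "A = Dom C f"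
  shows "re Doc f \<alpha> \<in> carrier (Sub A)"
proof -
  obtain a where a: "a \<in> M" "a \<in> Arr C" "Cod C a = Cod C f" "\<alpha> = cls a" using assms by (auto elim: carrierE)
  obtain p q where pb: "PB f a p q" using PB_ex[of f a] a assms by auto
  have "Cod C p = Dom C f"
    using weak_pullback_square[OF PB_weak[OF pb]] by (auto simp: commuting_square_def)
  then show ?thesis using re_cls[OF pb a(1)] a PB_M[OF pb a(1)] assms by simp
qed

lemma meet_ex:
  assumes "\<alpha> \<in> carrier (Sub A)" "\<beta> \<in> carrier (Sub A)"
  obtains \<gamma> where "\<gamma> \<in> carrier (Sub A)"
    "\<And>x. \<lbrakk>x \<in> Arr C; Cod C x = A\<rbrakk> \<Longrightarrow> belongs C \<gamma> x \<longleftrightarrow> belongs C \<alpha> x \<and> belongs C \<beta> x"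
proof -
  obtain a where a: "a \<in> M" "a \<in> Arr C" "Cod C a = A" "\<alpha> = cls a" using assms by (auto elim: carrierE)
  obtain b where b: "b \<in> M" "b \<in> Arr C" "Cod C b = A" "\<beta> = cls b" using assms by (auto elim: carrierE)
  obtain p q where pb: "PB a b p q" using PB_ex[of a b] a b by auto
  have p: "p \<in> M" "p \<in> Arr C" "Cod C p = Dom C a"
    using PB_M[OF pb b(1)] weak_pullback_square[OF PB_weak[OF pb]] by (auto simp: commuting_square_def)
  then have ap: "a \<cdot> p \<in> M" "a \<cdot> p \<in> Arr C" "Cod C (a \<cdot> p) = A" using a comp_M by auto
  show thesis
  proof (rule that[of "cls (a \<cdot> p)"])
    fix x assume x: "x \<in> Arr C" "Cod C x = A"
    have "factors_through C x (a \<cdot> p) \<longleftrightarrow> factors_through C x a \<and> factors_through C x b"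
    proof (intro iffI conjI; (elim conjE)?)
      assume "factors_through C x (a \<cdot> p)"
      then obtain h where h: "(a \<cdot> p) \<cdot> h = x" "h \<in> Arr C" "Dom C h = Dom C x" "Cod C h = Dom C (a \<cdot> p)"
        by (rule factors_throughE)
      have k: "a \<cdot> (p \<cdot> h) = x" "p \<cdot> h \<in> Arr C" "Dom C (p \<cdot> h) = Dom C h" "Cod C (p \<cdot> h) = Dom C a"
        using h p a by auto
      show "factors_through C x a"
        by (rule factors_throughI[of _ _ _ "p \<cdot> h"]) (use k h(3) x a in auto)
      have "factors_through C (p \<cdot> h) p"
        by (rule factors_throughI[of _ _ _ h]) (use h(2,4) p a in auto)
      then show "factors_through C x b" using PB_belongs[OF pb b(1) k(2,4)] k(1) by simp
    next
      assume "factors_through C x a" and xb: "factors_through C x b"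
      then obtain h where h: "a \<cdot> h = x" "h \<in> Arr C" "Dom C h = Dom C x" "Cod C h = Dom C a"
        by (auto elim: factors_throughE)
      then have "factors_through C h p" using PB_belongs[OF pb b(1) h(2,4)] xb by simp
      then obtain k where k: "p \<cdot> k = h" "k \<in> Arr C" "Dom C k = Dom C h" "Cod C k = Dom C p"
        by (rule factors_throughE)
      show "factors_through C x (a \<cdot> p)"
        by (rule factors_throughI[of _ _ _ k]) (use h k p a x in auto)
    qed
    then show "belongs C (cls (a \<cdot> p)) x \<longleftrightarrow> belongs C \<alpha> x \<and> belongs C \<beta> x"
      using a b ap x by simp
  qed (use ap in auto)
qed

lemma Sub_infsl: assumes "A \<in> Ob C" shows "inf_semilattice (Sub A)"
proof (rule inf_semilatticeI[OF Sub_po, of "cls (Id C A)"])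
  show "cls (Id C A) \<in> carrier (Sub A)" using Id_M assms by simp
  show "\<alpha> \<sqsubseteq>\<^bsub>Sub A\<^esub> cls (Id C A)" if "\<alpha> \<in> carrier (Sub A)" for \<alpha>
    using that assms Id_M by (auto simp: le_iff intro!: factors_throughI)
  fix \<alpha> \<beta> assume ab: "\<alpha> \<in> carrier (Sub A)" "\<beta> \<in> carrier (Sub A)"
  obtain \<gamma> where "\<gamma> \<in> carrier (Sub A)"
    "\<And>x. \<lbrakk>x \<in> Arr C; Cod C x = A\<rbrakk> \<Longrightarrow> belongs C \<gamma> x \<longleftrightarrow> belongs C \<alpha> x \<and> belongs C \<beta> x"
    using meet_ex[OF ab] by metis
  then show "\<exists>\<gamma>\<in>carrier (Sub A). \<gamma> \<sqsubseteq>\<^bsub>Sub A\<^esub> \<alpha> \<and> \<gamma> \<sqsubseteq>\<^bsub>Sub A\<^esub> \<beta> \<and>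
      (\<forall>w\<in>carrier (Sub A). w \<sqsubseteq>\<^bsub>Sub A\<^esub> \<alpha> \<and> w \<sqsubseteq>\<^bsub>Sub A\<^esub> \<beta> \<longrightarrow> w \<sqsubseteq>\<^bsub>Sub A\<^esub> \<gamma>)"
    using ab by (intro bexI[of _ \<gamma>]) (auto simp: le_iff)
qed

lemma belongs_top:
  assumes "A \<in> Ob C" "x \<in> Arr C" "Cod C x = A" shows "belongs C \<top>\<^bsub>Sub A\<^esub> x"
proof -
  note L = inf_semilatticeD[OF Sub_infsl[OF assms(1)]]
  have "cls (Id C A) \<sqsubseteq>\<^bsub>Sub A\<^esub> \<top>\<^bsub>Sub A\<^esub>" using L(3) Id_M assms(1) by simp
  moreover have "belongs C (cls (Id C A)) x" using Id_M assms by (auto intro!: factors_throughI)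
  ultimately show ?thesis using assms L(2) Id_M by (simp add: le_iff del: belongs_cls)
qed

lemma belongs_meet:
  assumes "A \<in> Ob C" "\<alpha> \<in> carrier (Sub A)" "\<beta> \<in> carrier (Sub A)" "x \<in> Arr C" "Cod C x = A"
  shows "belongs C (\<alpha> \<sqinter>\<^bsub>Sub A\<^esub> \<beta>) x \<longleftrightarrow> belongs C \<alpha> x \<and> belongs C \<beta> x"
proof -
  note L = inf_semilatticeD[OF Sub_infsl[OF assms(1)]]
  obtain \<gamma> where g: "\<gamma> \<in> carrier (Sub A)"
    "\<And>x. \<lbrakk>x \<in> Arr C; Cod C x = A\<rbrakk> \<Longrightarrow> belongs C \<gamma> x \<longleftrightarrow> belongs C \<alpha> x \<and> belongs C \<beta> x"
    using meet_ex[OF assms(2,3)] by metis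
  have m: "\<alpha> \<sqinter>\<^bsub>Sub A\<^esub> \<beta> \<in> carrier (Sub A)" by (rule L(4)[OF assms(2,3)])
  have ga: "\<gamma> \<sqsubseteq>\<^bsub>Sub A\<^esub> \<alpha>" "\<gamma> \<sqsubseteq>\<^bsub>Sub A\<^esub> \<beta>"
    unfolding le_iff[OF g(1) assms(2)] le_iff[OF g(1) assms(3)] using g(2) by auto
  have "\<gamma> \<sqsubseteq>\<^bsub>Sub A\<^esub> \<alpha> \<sqinter>\<^bsub>Sub A\<^esub> \<beta>"
    by (rule L(7)[OF ga assms(2,3) g(1)])
  then have "belongs C \<gamma> x \<longrightarrow> belongs C (\<alpha> \<sqinter>\<^bsub>Sub A\<^esub> \<beta>) x"
    unfolding le_iff[OF g(1) m] using assms(4,5) by blast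
  moreover have "belongs C (\<alpha> \<sqinter>\<^bsub>Sub A\<^esub> \<beta>) x \<longrightarrow> belongs C \<alpha> x"
    using L(5)[OF assms(2,3)] unfolding le_iff[OF m assms(2)] using assms(4,5) by blast
  moreover have "belongs C (\<alpha> \<sqinter>\<^bsub>Sub A\<^esub> \<beta>) x \<longrightarrow> belongs C \<beta> x"
    using L(6)[OF assms(2,3)] unfolding le_iff[OF m assms(3)] using assms(4,5) by blast
  ultimately show ?thesis using g(2)[OF assms(4,5)] by blast
qed

lemma meet_closed: "\<lbrakk>A \<in> Ob C; \<alpha> \<in> carrier (Sub A); \<beta> \<in> carrier (Sub A)\<rbrakk> \<Longrightarrow> \<alpha> \<sqinter>\<^bsub>Sub A\<^esub> \<beta> \<in> carrier (Sub A)"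
  using inf_semilatticeD(4)[OF Sub_infsl] by auto

lemma top_closed: "A \<in> Ob C \<Longrightarrow> \<top>\<^bsub>Sub A\<^esub> \<in> carrier (Sub A)"
  using inf_semilatticeD(2)[OF Sub_infsl] by auto

lemma Doc_doctrine: "is_doctrine Doc"
  unfolding is_doctrine_def slice_doc_simps
proof (intro conjI ballI impI)
  show "category C" by (rule category_axioms)
  show "has_binary_products C" by (rule products)
  show "\<And>A. A \<in> Ob C \<Longrightarrow> inf_semilattice (Sub A)" by (rule Sub_infsl)
  show "infsl_hom (Sub (Cod C f)) (Sub (Dom C f)) (re Doc f)" if f: "f \<in> Arr C" for f
    unfolding infsl_hom_def
  proof (intro conjI ballI funcsetI)
    show "re Doc f \<top>\<^bsub>Sub (Cod C f)\<^esub> = \<top>\<^bsub>Sub (Dom C f)\<^esub>"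
      by (rule Sub_eqI[of _ "Dom C f"]) (use f in \<open>auto simp: re_closed top_closed belongs_re belongs_top\<close>)
    show "re Doc f (x \<sqinter>\<^bsub>Sub (Cod C f)\<^esub> y) = re Doc f x \<sqinter>\<^bsub>Sub (Dom C f)\<^esub> re Doc f y"
      if "x \<in> carrier (Sub (Cod C f))" "y \<in> carrier (Sub (Cod C f))" for x y
      by (rule Sub_eqI[of _ "Dom C f"])
         (use f that in \<open>auto simp: re_closed meet_closed belongs_re belongs_meet\<close>)
  qed (use f in \<open>auto intro: re_closed\<close>)
  show "re Doc (Id C A) \<alpha> = \<alpha>" if "A \<in> Ob C" "\<alpha> \<in> carrier (Sub A)" for A \<alpha>
    by (rule Sub_eqI[of _ A]) (use that in \<open>auto simp: re_closed belongs_re\<close>)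
  show "re Doc (g \<cdot> f) \<alpha> = re Doc f (re Doc g \<alpha>)"
    if "f \<in> Arr C" "g \<in> Arr C" "Cod C f = Dom C g" "\<alpha> \<in> carrier (Sub (Cod C g))" for f g \<alpha>
    by (rule Sub_eqI[of _ "Dom C f"]) (use that in \<open>auto simp: re_closed belongs_re\<close>)
qed

lemma diag_M: "A \<in> Ob C \<Longrightarrow> pair C (Id C A) (Id C A) \<in> M"
  by (rule split_M[of _ "pr1 C A A"]) (auto simp: pr_pair)

lemma belongs_diag:
  assumes A: "A \<in> Ob C" and z: "z \<in> Arr C" "Cod C z = prd C A A"
  shows "belongs C (cls (pair C (Id C A) (Id C A))) z \<longleftrightarrow> pr1 C A A \<cdot> z = pr2 C A A \<cdot> z"
proof -
  let ?d = "pair C (Id C A) (Id C A)"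
  have "factors_through C z ?d \<longleftrightarrow> pr1 C A A \<cdot> z = pr2 C A A \<cdot> z"
  proof
    assume "factors_through C z ?d"
    then obtain h where h: "?d \<cdot> h = z" "h \<in> Arr C" "Dom C h = Dom C z" "Cod C h = Dom C ?d"
      by (rule factors_throughE)
    have "pr1 C A A \<cdot> (?d \<cdot> h) = pr2 C A A \<cdot> (?d \<cdot> h)" using A h(2-4) by (simp add: pr_pair_comp)
    then show "pr1 C A A \<cdot> z = pr2 C A A \<cdot> z" unfolding h(1) .
  next
    assume e: "pr1 C A A \<cdot> z = pr2 C A A \<cdot> z"
    have "z = ?d \<cdot> (pr1 C A A \<cdot> z)"
      by (rule prd_eqI[of _ _ A A]) (use A z e in \<open>auto simp: pr_pair_comp\<close>)
    then show "factors_through C z ?d" using A z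
      by (intro factors_throughI[of _ _ _ "pr1 C A A \<cdot> z"]) auto
  qed
  then show ?thesis using diag_M A z by simp
qed

text \<open>Both adjunctions are substitution of equals: an element of the product whose relevant
  coordinates agree is the image of its first projection under the diagonal, and conversely.\<close>

lemma Doc_equality:
  assumes A: "A \<in> Ob C" shows "is_equality Doc A (cls (pair C (Id C A) (Id C A)))"
  unfolding is_equality_def Let_def slice_doc_simps
proof (intro conjI ballI)
  let ?d = "pair C (Id C A) (Id C A)" and ?AA = "prd C A A"
  have d: "?d \<in> M" "?d \<in> Arr C" "Dom C ?d = A" "Cod C ?d = ?AA" using diag_M A by auto
  show dc: "cls ?d \<in> carrier (Sub ?AA)" using d by simp
  note ds = belongs_diag[OF A]
  show "left_adjoint (Sub A) (Sub ?AA) (\<lambda>\<alpha>. re Doc (pr1 C A A) \<alpha> \<sqinter>\<^bsub>Sub ?AA\<^esub> cls ?d) (re Doc ?d)"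
  proof (rule left_adjointI[OF Sub_po Sub_po])
    fix \<alpha> assume a: "\<alpha> \<in> carrier (Sub A)"
    show "re Doc (pr1 C A A) \<alpha> \<sqinter>\<^bsub>Sub ?AA\<^esub> cls ?d \<in> carrier (Sub ?AA)"
      using a A dc by (auto intro!: meet_closed re_closed)
    fix \<beta> assume b: "\<beta> \<in> carrier (Sub ?AA)"
    have "re Doc (pr1 C A A) \<alpha> \<sqinter>\<^bsub>Sub ?AA\<^esub> cls ?d \<sqsubseteq>\<^bsub>Sub ?AA\<^esub> \<beta> \<longleftrightarrow>
      (\<forall>z\<in>Arr C. Cod C z = ?AA \<longrightarrow> belongs C \<alpha> (pr1 C A A \<cdot> z) \<and> pr1 C A A \<cdot> z = pr2 C A A \<cdot> z \<longrightarrow> belongs C \<beta> z)"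
      using a b A dc by (simp add: le_iff meet_closed re_closed belongs_meet belongs_re ds del: belongs_cls)
    also have "\<dots> \<longleftrightarrow> (\<forall>x\<in>Arr C. Cod C x = A \<longrightarrow> belongs C \<alpha> x \<longrightarrow> belongs C \<beta> (?d \<cdot> x))" (is "?l \<longleftrightarrow> ?r")
    proof
      assume l: ?l
      show ?r
      proof (intro ballI impI)
        fix x assume x: "x \<in> Arr C" "Cod C x = A" "belongs C \<alpha> x"
        then have "pr1 C A A \<cdot> (?d \<cdot> x) = x" "pr2 C A A \<cdot> (?d \<cdot> x) = x"
          using A by (auto simp: pr_pair_comp)
        then show "belongs C \<beta> (?d \<cdot> x)" using l x d by simp
      qed
    next
      assume r: ?r
      show ?l
      proof (intro ballI impI; elim conjE)
        fix z assume z: "z \<in> Arr C" "Cod C z = ?AA" "belongs C \<alpha> (pr1 C A A \<cdot> z)" "pr1 C A A \<cdot> z = pr2 C A A \<cdot> z"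
        have "?d \<cdot> (pr1 C A A \<cdot> z) = z"
          by (rule prd_eqI[of _ _ A A]) (use A z in \<open>auto simp: pr_pair_comp\<close>)
        moreover have "belongs C \<beta> (?d \<cdot> (pr1 C A A \<cdot> z))" using r z(1-3) A by simp
        ultimately show "belongs C \<beta> z" by simp
      qed
    qed
    also have "\<dots> \<longleftrightarrow> \<alpha> \<sqsubseteq>\<^bsub>Sub A\<^esub> re Doc ?d \<beta>"
      using a b d by (simp add: le_iff re_closed belongs_re)
    finally show "re Doc (pr1 C A A) \<alpha> \<sqinter>\<^bsub>Sub ?AA\<^esub> cls ?d \<sqsubseteq>\<^bsub>Sub ?AA\<^esub> \<beta> \<longleftrightarrow> \<alpha> \<sqsubseteq>\<^bsub>Sub A\<^esub> re Doc ?d \<beta>" .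
  qed (use d in \<open>auto intro: re_closed\<close>)
  fix X assume X: "X \<in> Ob C"
  let ?XA = "prd C X A"
  let ?XAA = "prd C ?XA A"
  let ?p1 = "pr1 C X A" and ?p2 = "pr2 C X A"
  let ?r1 = "pr1 C ?XA A" and ?r2 = "pr2 C ?XA A"
  let ?w = "pair C (?p2 \<cdot> ?r1) ?r2"
  let ?e = "pair C (pair C ?p1 ?p2) ?p2"
  have id1: "pair C ?p1 ?p2 = Id C ?XA"
    by (rule prd_eqI[of _ _ X A]) (use A X in \<open>auto simp: pr_pair\<close>)
  have id2: "pair C (?p1 \<cdot> ?r1) (?p2 \<cdot> ?r1) = ?r1"
    by (rule prd_eqI[of _ _ X A]) (use A X in \<open>auto simp: pr_pair\<close>)
  have w: "?w \<in> Arr C" "Dom C ?w = ?XAA" "Cod C ?w = ?AA" using A X by auto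
  have e: "?e \<in> Arr C" "Dom C ?e = ?XA" "Cod C ?e = ?XAA" using A X id1 by auto
  have Ob: "?XA \<in> Ob C" "?XAA \<in> Ob C" using A X by auto
  show "left_adjoint (Sub ?XA) (Sub ?XAA)
     (\<lambda>\<alpha>. re Doc (pair C (?p1 \<cdot> ?r1) (?p2 \<cdot> ?r1)) \<alpha> \<sqinter>\<^bsub>Sub ?XAA\<^esub> re Doc ?w (cls ?d)) (re Doc ?e)"
    unfolding id2
  proof (rule left_adjointI[OF Sub_po Sub_po])
    fix \<alpha> assume a: "\<alpha> \<in> carrier (Sub ?XA)"
    have wd: "re Doc ?w (cls ?d) \<in> carrier (Sub ?XAA)" using w dc by (auto intro: re_closed)
    have ra: "re Doc ?r1 \<alpha> \<in> carrier (Sub ?XAA)" using a A X by (auto intro!: re_closed)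
    show "re Doc ?r1 \<alpha> \<sqinter>\<^bsub>Sub ?XAA\<^esub> re Doc ?w (cls ?d) \<in> carrier (Sub ?XAA)"
      using Ob wd ra by (auto intro!: meet_closed)
    fix \<beta> assume b: "\<beta> \<in> carrier (Sub ?XAA)"
    have bw: "belongs C (re Doc ?w (cls ?d)) z \<longleftrightarrow> ?p2 \<cdot> (?r1 \<cdot> z) = ?r2 \<cdot> z"
      if z: "z \<in> Arr C" "Cod C z = ?XAA" for z
    proof -
      have "belongs C (re Doc ?w (cls ?d)) z \<longleftrightarrow> belongs C (cls ?d) (?w \<cdot> z)"
        using w dc z by (intro belongs_re) auto
      also have "\<dots> \<longleftrightarrow> pr1 C A A \<cdot> (?w \<cdot> z) = pr2 C A A \<cdot> (?w \<cdot> z)"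
        using w z by (intro ds) auto
      also have "\<dots> \<longleftrightarrow> ?p2 \<cdot> (?r1 \<cdot> z) = ?r2 \<cdot> z" using z A X by (simp add: pr_pair_comp)
      finally show ?thesis .
    qed
    have "re Doc ?r1 \<alpha> \<sqinter>\<^bsub>Sub ?XAA\<^esub> re Doc ?w (cls ?d) \<sqsubseteq>\<^bsub>Sub ?XAA\<^esub> \<beta> \<longleftrightarrow>
      (\<forall>z\<in>Arr C. Cod C z = ?XAA \<longrightarrow> belongs C \<alpha> (?r1 \<cdot> z) \<and> ?p2 \<cdot> (?r1 \<cdot> z) = ?r2 \<cdot> z \<longrightarrow> belongs C \<beta> z)"
      using a b A X Ob wd ra by (simp add: le_iff meet_closed belongs_meet belongs_re bw)
    also have "\<dots> \<longleftrightarrow> (\<forall>x\<in>Arr C. Cod C x = ?XA \<longrightarrow> belongs C \<alpha> x \<longrightarrow> belongs C \<beta> (?e \<cdot> x))" (is "?l \<longleftrightarrow> ?r")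
    proof
      assume l: ?l
      show ?r
      proof (intro ballI impI)
        fix x assume x: "x \<in> Arr C" "Cod C x = ?XA" "belongs C \<alpha> x"
        then have "?r1 \<cdot> (?e \<cdot> x) = x" "?r2 \<cdot> (?e \<cdot> x) = ?p2 \<cdot> x"
          using A X unfolding id1 by (auto simp: pr_pair_comp)
        then show "belongs C \<beta> (?e \<cdot> x)" using l x e by simp
      qed
    next
      assume r: ?r
      show ?l
      proof (intro ballI impI; elim conjE)
        fix z assume z: "z \<in> Arr C" "Cod C z = ?XAA" "belongs C \<alpha> (?r1 \<cdot> z)" "?p2 \<cdot> (?r1 \<cdot> z) = ?r2 \<cdot> z"
        have "?e \<cdot> (?r1 \<cdot> z) = z" unfolding id1
          by (rule prd_eqI[of _ _ ?XA A]) (use A X z in \<open>auto simp: pr_pair_comp\<close>)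
        moreover have "belongs C \<beta> (?e \<cdot> (?r1 \<cdot> z))" using r z(1-3) A X by simp
        ultimately show "belongs C \<beta> z" by simp
      qed
    qed
    also have "\<dots> \<longleftrightarrow> \<alpha> \<sqsubseteq>\<^bsub>Sub ?XA\<^esub> re Doc ?e \<beta>"
      using a b e by (simp add: le_iff re_closed belongs_re)
    finally show "re Doc ?r1 \<alpha> \<sqinter>\<^bsub>Sub ?XAA\<^esub> re Doc ?w (cls ?d) \<sqsubseteq>\<^bsub>Sub ?XAA\<^esub> \<beta> \<longleftrightarrow> \<alpha> \<sqsubseteq>\<^bsub>Sub ?XA\<^esub> re Doc ?e \<beta>" .
  qed (use e in \<open>auto intro: re_closed\<close>)
qed

lemma Doc_elementary: "elementary_doctrine Doc"
  unfolding elementary_doctrine_def using Doc_doctrine Doc_equality by auto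

lemma eqp_Doc: "A \<in> Ob C \<Longrightarrow> eqp Doc A = cls (pair C (Id C A) (Id C A))"
  by (rule eqp_is_equality) (auto intro: Doc_doctrine Doc_equality)

lemma eqp_closed: "A \<in> Ob C \<Longrightarrow> eqp Doc A \<in> carrier (Sub (prd C A A))"
  using diag_M by (simp add: eqp_Doc)

lemma belongs_eqp:
  "\<lbrakk>A \<in> Ob C; z \<in> Arr C; Cod C z = prd C A A\<rbrakk> \<Longrightarrow> belongs C (eqp Doc A) z \<longleftrightarrow> pr1 C A A \<cdot> z = pr2 C A A \<cdot> z"
  using belongs_diag by (simp add: eqp_Doc)

end

lemma (in with_products) weak_slice:
  assumes "has_weak_pullbacks C" shows "slice_doctrine C (Arr C) (is_weak_pullback C)"
proof
  fix f a p q
  show "f \<in> Arr C \<Longrightarrow> a \<in> Arr C \<Longrightarrow> Cod C f = Cod C a \<Longrightarrow> \<exists>p q. is_weak_pullback C f a p q"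
    using assms by (auto simp: has_weak_pullbacks_def)
qed (auto simp: is_weak_pullback_def commuting_square_def)

lemma (in regular_cat) subobject_slice: "slice_doctrine C {m. monic C m} (is_pullback C)"
proof
  fix f a p q
  show "f \<in> Arr C \<Longrightarrow> a \<in> {m. monic C m} \<Longrightarrow> Cod C f = Cod C a \<Longrightarrow> \<exists>p q. is_pullback C f a p q"
    by (metis mem_Collect_eq monic_Arr pullback_ex)
qed (auto intro: pullback_weak pullback_monic split_monic monic_comp)

lemma weak_subobjects_slice: "weak_subobjects C = slice_doc C (Arr C) (is_weak_pullback C)"
  by (simp add: weak_subobjects_def slice_doc_def)

lemma subobjects_slice: "subobjects C = slice_doc C {m. monic C m} (is_pullback C)"
  by (simp add: subobjects_def slice_doc_def)

section \<open>Equivalence of doctrines from an equivalence of base categories\<close>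

definition order_iso :: "'l gorder \<Rightarrow> 'm gorder \<Rightarrow> ('l \<Rightarrow> 'm) \<Rightarrow> bool" where
  "order_iso L M h \<longleftrightarrow> bij_betw h (carrier L) (carrier M) \<and>
     (\<forall>x\<in>carrier L. \<forall>y\<in>carrier L. x \<sqsubseteq>\<^bsub>L\<^esub> y \<longleftrightarrow> h x \<sqsubseteq>\<^bsub>M\<^esub> h y)"

lemma order_isoI:
  assumes "partial_order L" "partial_order M"
    and cl: "\<And>x. x \<in> carrier L \<Longrightarrow> h x \<in> carrier M"
    and le: "\<And>x y. \<lbrakk>x \<in> carrier L; y \<in> carrier L\<rbrakk> \<Longrightarrow> x \<sqsubseteq>\<^bsub>L\<^esub> y \<longleftrightarrow> h x \<sqsubseteq>\<^bsub>M\<^esub> h y"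
    and surj: "\<And>y. y \<in> carrier M \<Longrightarrow> \<exists>x\<in>carrier L. h x = y"
  shows "order_iso L M h"
proof -
  have "inj_on h (carrier L)"
  proof (rule inj_onI)
    fix x y assume xy: "x \<in> carrier L" "y \<in> carrier L" "h x = h y"
    have "h x \<sqsubseteq>\<^bsub>M\<^esub> h y" "h y \<sqsubseteq>\<^bsub>M\<^esub> h x" using reflD[OF assms(2) cl[OF xy(1)]] xy(3) by auto
    then show "x = y" using le xy(1,2) antisymD[OF assms(1)] by blast
  qed
  moreover have "h ` carrier L = carrier M" using cl surj by force
  ultimately show ?thesis using le by (simp add: order_iso_def bij_betw_def)
qed

lemma order_isoD:
  assumes "order_iso L M h"
  shows "x \<in> carrier L \<Longrightarrow> h x \<in> carrier M"
    "\<lbrakk>x \<in> carrier L; y \<in> carrier L\<rbrakk> \<Longrightarrow> x \<sqsubseteq>\<^bsub>L\<^esub> y \<longleftrightarrow> h x \<sqsubseteq>\<^bsub>M\<^esub> h y"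
    "\<lbrakk>x \<in> carrier L; y \<in> carrier L; h x = h y\<rbrakk> \<Longrightarrow> x = y"
    "z \<in> carrier M \<Longrightarrow> inv_into (carrier L) h z \<in> carrier L"
    "z \<in> carrier M \<Longrightarrow> h (inv_into (carrier L) h z) = z"
    "x \<in> carrier L \<Longrightarrow> inv_into (carrier L) h (h x) = x"
  using assms unfolding order_iso_def
  by (auto simp: bij_betw_def inj_on_def inv_into_into f_inv_into_f)

lemma order_iso_inv:
  assumes "order_iso L M h" shows "order_iso M L (inv_into (carrier L) h)"
  using assms order_isoD[OF assms]
  unfolding order_iso_def by (simp add: bij_betw_inv_into)

lemma order_iso_comp:
  assumes "order_iso L M h" "order_iso M N k" shows "order_iso L N (k \<circ> h)"
  using assms order_isoD(1)[OF assms(1)] unfolding order_iso_def by (auto intro: bij_betw_trans)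

lemma order_iso_infsl_hom:
  assumes L: "inf_semilattice L" and M: "inf_semilattice M" and h: "order_iso L M h"
  shows "infsl_hom L M h"
  unfolding infsl_hom_def
proof (intro conjI ballI funcsetI)
  note l = inf_semilatticeD[OF L] and m = inf_semilatticeD[OF M] and h = order_isoD[OF h]
  show "h x \<in> carrier M" if "x \<in> carrier L" for x using h(1) that .
  show "h \<top>\<^bsub>L\<^esub> = \<top>\<^bsub>M\<^esub>"
  proof (rule antisymD[OF m(1)])
    have "inv_into (carrier L) h \<top>\<^bsub>M\<^esub> \<sqsubseteq>\<^bsub>L\<^esub> \<top>\<^bsub>L\<^esub>" using h(4) l(3) m(2) by blast
    then show "\<top>\<^bsub>M\<^esub> \<sqsubseteq>\<^bsub>M\<^esub> h \<top>\<^bsub>L\<^esub>" using h(2)[OF h(4)[OF m(2)] l(2)] h(5)[OF m(2)] by simp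
  qed (use l(2) m(2) h(1) m(3) in auto)
  fix x y assume xy: "x \<in> carrier L" "y \<in> carrier L"
  have xyc: "x \<sqinter>\<^bsub>L\<^esub> y \<in> carrier L" using l(4) xy .
  have hc: "h x \<in> carrier M" "h y \<in> carrier M" "h (x \<sqinter>\<^bsub>L\<^esub> y) \<in> carrier M" using xy xyc h(1) by auto
  let ?z = "inv_into (carrier L) h (h x \<sqinter>\<^bsub>M\<^esub> h y)"
  have z: "?z \<in> carrier L" "h ?z = h x \<sqinter>\<^bsub>M\<^esub> h y" using h(4,5) m(4) hc by auto
  show "h (x \<sqinter>\<^bsub>L\<^esub> y) = h x \<sqinter>\<^bsub>M\<^esub> h y"
  proof (rule antisymD[OF m(1)])
    show "h (x \<sqinter>\<^bsub>L\<^esub> y) \<sqsubseteq>\<^bsub>M\<^esub> h x \<sqinter>\<^bsub>M\<^esub> h y"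
      using l(5,6) xy xyc h(2) hc by (intro m(7)) blast+
    have "?z \<sqsubseteq>\<^bsub>L\<^esub> x" "?z \<sqsubseteq>\<^bsub>L\<^esub> y"
      using h(2)[OF z(1) xy(1)] h(2)[OF z(1) xy(2)] m(5,6) hc by (auto simp: z(2))
    then have "?z \<sqsubseteq>\<^bsub>L\<^esub> x \<sqinter>\<^bsub>L\<^esub> y" using l(7) xy z(1) by blast
    then show "h x \<sqinter>\<^bsub>M\<^esub> h y \<sqsubseteq>\<^bsub>M\<^esub> h (x \<sqinter>\<^bsub>L\<^esub> y)" using h(2)[OF z(1) xyc] z(2) by simp
  qed (use hc m(4) in auto)
qed

lemma order_iso_po:
  assumes M: "partial_order M" and h: "order_iso L M h" and e: "eq L = (=)"
  shows "partial_order L"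
proof (rule partial_orderI[OF e])
  note h = order_isoD[OF h]
  show "x \<sqsubseteq>\<^bsub>L\<^esub> x" if "x \<in> carrier L" for x
    using that h(1,2) reflD[OF M] by blast
  show "x = y" if "x \<in> carrier L" "y \<in> carrier L" "x \<sqsubseteq>\<^bsub>L\<^esub> y" "y \<sqsubseteq>\<^bsub>L\<^esub> x" for x y
    using that h(1,2,3) antisymD[OF M] by metis
  show "x \<sqsubseteq>\<^bsub>L\<^esub> z" if "x \<in> carrier L" "y \<in> carrier L" "z \<in> carrier L" "x \<sqsubseteq>\<^bsub>L\<^esub> y" "y \<sqsubseteq>\<^bsub>L\<^esub> z" for x y z
    using that h(1,2) transD[OF M] by metis
qed

lemma order_iso_infsl:
  assumes M: "inf_semilattice M" and h: "order_iso L M h" and e: "eq L = (=)"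
  shows "inf_semilattice L"
proof -
  note m = inf_semilatticeD[OF M] and h' = order_isoD[OF h]
  show ?thesis
  proof (rule inf_semilatticeI[OF order_iso_po[OF m(1) h e], of "inv_into (carrier L) h \<top>\<^bsub>M\<^esub>"])
    show t: "inv_into (carrier L) h \<top>\<^bsub>M\<^esub> \<in> carrier L" using h'(4) m(2) .
    show "x \<sqsubseteq>\<^bsub>L\<^esub> inv_into (carrier L) h \<top>\<^bsub>M\<^esub>" if "x \<in> carrier L" for x
      using h'(2)[OF that t] h'(1)[OF that] h'(5)[OF m(2)] m(3) by simp
    fix x y assume xy: "x \<in> carrier L" "y \<in> carrier L"
    then have hc: "h x \<in> carrier M" "h y \<in> carrier M" using h'(1) by auto
    let ?z = "inv_into (carrier L) h (h x \<sqinter>\<^bsub>M\<^esub> h y)"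
    have z: "?z \<in> carrier L" "h ?z = h x \<sqinter>\<^bsub>M\<^esub> h y" using h'(4,5) m(4) hc by auto
    show "\<exists>z\<in>carrier L. z \<sqsubseteq>\<^bsub>L\<^esub> x \<and> z \<sqsubseteq>\<^bsub>L\<^esub> y \<and>
          (\<forall>w\<in>carrier L. w \<sqsubseteq>\<^bsub>L\<^esub> x \<and> w \<sqsubseteq>\<^bsub>L\<^esub> y \<longrightarrow> w \<sqsubseteq>\<^bsub>L\<^esub> z)"
    proof (intro bexI[OF _ z(1)] conjI ballI impI)
      show "?z \<sqsubseteq>\<^bsub>L\<^esub> x" "?z \<sqsubseteq>\<^bsub>L\<^esub> y"
        using h'(2)[OF z(1) xy(1)] h'(2)[OF z(1) xy(2)] m(5,6) hc by (auto simp: z(2))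
      fix w assume "w \<in> carrier L" "w \<sqsubseteq>\<^bsub>L\<^esub> x \<and> w \<sqsubseteq>\<^bsub>L\<^esub> y"
      then show "w \<sqsubseteq>\<^bsub>L\<^esub> ?z"
        using h'(2)[OF _ xy(1)] h'(2)[OF _ xy(2)] h'(2)[OF _ z(1)] h'(1) m(7)[OF _ _ hc] z(2) by simp
    qed
  qed
qed

lemma infsl_hom_transport:
  assumes r: "infsl_hom M1 M2 r" and h1: "order_iso L1 M1 h1" and h2: "order_iso L2 M2 h2"
    and L: "inf_semilattice L1" "inf_semilattice L2" "inf_semilattice M1" "inf_semilattice M2"
    and cl: "\<And>x. x \<in> carrier L1 \<Longrightarrow> r' x \<in> carrier L2"
    and sq: "\<And>x. x \<in> carrier L1 \<Longrightarrow> h2 (r' x) = r (h1 x)"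
  shows "infsl_hom L1 L2 r'"
proof -
  note i1 = order_iso_infsl_hom[OF L(1,3) h1] and i2 = order_iso_infsl_hom[OF L(2,4) h2]
  note c1 = order_isoD(1)[OF h1]
  show ?thesis
    unfolding infsl_hom_def
  proof (intro conjI ballI funcsetI cl)
    show "r' \<top>\<^bsub>L1\<^esub> = \<top>\<^bsub>L2\<^esub>"
      by (rule order_isoD(3)[OF h2])
        (use i1 i2 r sq cl inf_semilatticeD(2)[OF L(1)] inf_semilatticeD(2)[OF L(2)] in
          \<open>simp_all add: infsl_hom_def\<close>)
    fix x y assume xy: "x \<in> carrier L1" "y \<in> carrier L1"
    have c: "x \<sqinter>\<^bsub>L1\<^esub> y \<in> carrier L1" "r' x \<sqinter>\<^bsub>L2\<^esub> r' y \<in> carrier L2"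
      using inf_semilatticeD(4)[OF L(1)] inf_semilatticeD(4)[OF L(2)] xy cl by auto
    show "r' (x \<sqinter>\<^bsub>L1\<^esub> y) = r' x \<sqinter>\<^bsub>L2\<^esub> r' y"
    proof (rule order_isoD(3)[OF h2])
      have "h2 (r' (x \<sqinter>\<^bsub>L1\<^esub> y)) = r (h1 x) \<sqinter>\<^bsub>M2\<^esub> r (h1 y)"
        using sq[OF c(1)] i1 r xy c1 by (simp add: infsl_hom_def)
      also have "\<dots> = h2 (r' x \<sqinter>\<^bsub>L2\<^esub> r' y)"
        using sq i2 xy cl by (simp add: infsl_hom_def)
      finally show "h2 (r' (x \<sqinter>\<^bsub>L1\<^esub> y)) = h2 (r' x \<sqinter>\<^bsub>L2\<^esub> r' y)" .
    qed (use c cl in auto)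
  qed
qed

text \<open>Adjunctions are conditions on the order, so they move along order isomorphisms that commute
  with both maps.\<close>

lemma left_adjoint_transport:
  assumes a: "left_adjoint M1 M2 f g" and h1: "order_iso L1 M1 h1" and h2: "order_iso L2 M2 h2"
    and po: "partial_order L1" "partial_order L2"
    and cl: "\<And>x. x \<in> carrier L1 \<Longrightarrow> f' x \<in> carrier L2" "\<And>y. y \<in> carrier L2 \<Longrightarrow> g' y \<in> carrier L1"
    and sq: "\<And>x. x \<in> carrier L1 \<Longrightarrow> h2 (f' x) = f (h1 x)" "\<And>y. y \<in> carrier L2 \<Longrightarrow> h1 (g' y) = g (h2 y)"
  shows "left_adjoint L1 L2 f' g'"
proof (rule left_adjointI[OF po cl])
  fix x y assume xy: "x \<in> carrier L1" "y \<in> carrier L2"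
  show "f' x \<sqsubseteq>\<^bsub>L2\<^esub> y \<longleftrightarrow> x \<sqsubseteq>\<^bsub>L1\<^esub> g' y"
    using left_adjointD(5)[OF a order_isoD(1)[OF h1 xy(1)] order_isoD(1)[OF h2 xy(2)]]
      order_isoD(2)[OF h2 cl(1)[OF xy(1)] xy(2)] order_isoD(2)[OF h1 xy(1) cl(2)[OF xy(2)]] sq xy by simp
qed auto

lemma doctrineD:
  assumes "is_doctrine P"
  shows "category (base P)" "has_binary_products (base P)"
    "A \<in> Ob (base P) \<Longrightarrow> inf_semilattice (fib P A)"
    "f \<in> Arr (base P) \<Longrightarrow> infsl_hom (fib P (Cod (base P) f)) (fib P (Dom (base P) f)) (re P f)"
    "\<lbrakk>A \<in> Ob (base P); \<alpha> \<in> carrier (fib P A)\<rbrakk> \<Longrightarrow> re P (Id (base P) A) \<alpha> = \<alpha>"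
    "\<lbrakk>f \<in> Arr (base P); g \<in> Arr (base P); Cod (base P) f = Dom (base P) g;
      \<alpha> \<in> carrier (fib P (Cod (base P) g))\<rbrakk> \<Longrightarrow> re P f (re P g \<alpha>) = re P (g \<cdot>\<^bsub>base P\<^esub> f) \<alpha>"
    "\<lbrakk>f \<in> Arr (base P); \<alpha> \<in> carrier (fib P (Cod (base P) f))\<rbrakk> \<Longrightarrow> re P f \<alpha> \<in> carrier (fib P (Dom (base P) f))"
  using assms by (auto simp: is_doctrine_def infsl_hom_def)

lemma infsl_hom_mono:
  assumes "infsl_hom L M h" "inf_semilattice L" "inf_semilattice M" "x \<in> carrier L" "y \<in> carrier L" "x \<sqsubseteq>\<^bsub>L\<^esub> y"
  shows "h x \<sqsubseteq>\<^bsub>M\<^esub> h y"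
proof -
  note l = inf_semilatticeD[OF assms(2)] and m = inf_semilatticeD[OF assms(3)]
  have "x \<sqinter>\<^bsub>L\<^esub> y = x"
    by (rule antisymD[OF l(1)]) (use assms l(4,5,7) reflD[OF l(1)] in auto)
  then have "h x = h x \<sqinter>\<^bsub>M\<^esub> h y" using assms unfolding infsl_hom_def by metis
  moreover have "h x \<in> carrier M" "h y \<in> carrier M" using assms by (auto simp: infsl_hom_def)
  ultimately show ?thesis using m(6) by metis
qed

text \<open>The fibres of \<open>(\<Psi>)\<^sub>r\<close> are cut out of those of \<open>\<Psi>\<close> by a descent condition, and their meets and
  equality predicates are not visible from \<open>\<Psi>\<close> directly. They are obtained by comparison
  with the subobjects of the same base category.\<close>

lemma elementary_transport:
  assumes Q: "elementary_doctrine Q" and base: "base P = base Q"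
    and iso: "\<And>A. A \<in> Ob (base Q) \<Longrightarrow> order_iso (fib P A) (fib Q A) (h A)"
    and eqP: "\<And>A. A \<in> Ob (base Q) \<Longrightarrow> eq (fib P A) = (=)"
    and cl: "\<And>f \<alpha>. \<lbrakk>f \<in> Arr (base Q); \<alpha> \<in> carrier (fib P (Cod (base Q) f))\<rbrakk>
               \<Longrightarrow> re P f \<alpha> \<in> carrier (fib P (Dom (base Q) f))"
    and nat: "\<And>f \<alpha>. \<lbrakk>f \<in> Arr (base Q); \<alpha> \<in> carrier (fib P (Cod (base Q) f))\<rbrakk>
               \<Longrightarrow> h (Dom (base Q) f) (re P f \<alpha>) = re Q f (h (Cod (base Q) f) \<alpha>)"
  shows "elementary_doctrine P"
proof -
  let ?C = "base Q"
  have dQ: "is_doctrine Q" using Q by (simp add: elementary_doctrine_def)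
  note q = doctrineD[OF dQ]
  interpret with_products ?C using q by (simp add: with_products_def with_products_axioms_def)
  have sl: "inf_semilattice (fib P A)" if "A \<in> Ob ?C" for A
    using order_iso_infsl[OF q(3) iso eqP] that by simp
  have po: "partial_order (fib P A)" if "A \<in> Ob ?C" for A
    using sl[OF that] by (rule inf_semilatticeD(1))
  note ic = order_isoD(1)[OF iso] and inj = order_isoD(3)[OF iso]
  have dP: "is_doctrine P"
    unfolding is_doctrine_def base
  proof (intro conjI ballI impI)
    show "category ?C" "has_binary_products ?C" using q by auto
    show "inf_semilattice (fib P A)" if "A \<in> Ob ?C" for A using sl that .
    show "infsl_hom (fib P (Cod ?C f)) (fib P (Dom ?C f)) (re P f)" if f: "f \<in> Arr ?C" for f
      by (rule infsl_hom_transport[OF q(4)[OF f] iso iso]) (use f sl q(3) cl nat in auto)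
    show "re P (Id ?C A) \<alpha> = \<alpha>" if a: "A \<in> Ob ?C" "\<alpha> \<in> carrier (fib P A)" for A \<alpha>
      by (rule inj[of A]) (use a cl[of "Id ?C A" \<alpha>] nat[of "Id ?C A" \<alpha>] q(5) ic in auto)
    show "re P (g \<cdot>\<^bsub>?C\<^esub> f) \<alpha> = re P f (re P g \<alpha>)"
      if a: "f \<in> Arr ?C" "g \<in> Arr ?C" "Cod ?C f = Dom ?C g" "\<alpha> \<in> carrier (fib P (Cod ?C g))" for f g \<alpha>
    proof (rule inj[of "Dom ?C f"])
      have c: "re P g \<alpha> \<in> carrier (fib P (Cod ?C f))" using cl[of g \<alpha>] a by simp
      show "h (Dom ?C f) (re P (g \<cdot>\<^bsub>?C\<^esub> f) \<alpha>) = h (Dom ?C f) (re P f (re P g \<alpha>))"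
        using nat[of "g \<cdot>\<^bsub>?C\<^esub> f" \<alpha>] nat[OF a(1) c] nat[OF a(2,4)] a
          q(6)[OF a(1-3), of "h (Cod ?C g) \<alpha>"] ic[of "Cod ?C g" \<alpha>] by simp
      show "re P (g \<cdot>\<^bsub>?C\<^esub> f) \<alpha> \<in> carrier (fib P (Dom ?C f))" using cl[of "g \<cdot>\<^bsub>?C\<^esub> f" \<alpha>] a by simp
      show "re P f (re P g \<alpha>) \<in> carrier (fib P (Dom ?C f))" using cl[OF a(1) c] .
    qed (use a in auto)
  qed
  have "\<exists>\<delta>. is_equality P A \<delta>" if A: "A \<in> Ob ?C" for A
  proof -
    let ?AA = "prd ?C A A"
    let ?d = "eqp Q A"
    have eq: "is_equality Q A ?d" using eqp_equality[OF Q A] .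
    then have dc: "?d \<in> carrier (fib Q ?AA)" by (simp add: is_equality_def Let_def)
    have AA: "?AA \<in> Ob ?C" using A by simp
    let ?e = "inv_into (carrier (fib P ?AA)) (h ?AA) ?d"
    have e: "?e \<in> carrier (fib P ?AA)" "h ?AA ?e = ?d" using order_isoD(4,5)[OF iso[OF AA] dc] .
    have meet: "h B (x \<sqinter>\<^bsub>fib P B\<^esub> y) = h B x \<sqinter>\<^bsub>fib Q B\<^esub> h B y" "x \<sqinter>\<^bsub>fib P B\<^esub> y \<in> carrier (fib P B)"
      if "B \<in> Ob ?C" "x \<in> carrier (fib P B)" "y \<in> carrier (fib P B)" for B x y
      using order_iso_infsl_hom[OF sl q(3) iso, of B] that inf_semilatticeD(4)[OF sl]
      by (auto simp: infsl_hom_def)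
    have "is_equality P A ?e"
      unfolding is_equality_def Let_def base
    proof (intro conjI ballI)
      show "?e \<in> carrier (fib P ?AA)" by (rule e)
      let ?D = "pair ?C (Id ?C A) (Id ?C A)" and ?p = "pr1 ?C A A"
      have adj: "left_adjoint (fib Q A) (fib Q ?AA) (\<lambda>\<alpha>. re Q ?p \<alpha> \<sqinter>\<^bsub>fib Q ?AA\<^esub> ?d) (re Q ?D)"
        using eq by (simp add: is_equality_def Let_def)
      show "left_adjoint (fib P A) (fib P ?AA) (\<lambda>\<alpha>. re P ?p \<alpha> \<sqinter>\<^bsub>fib P ?AA\<^esub> ?e) (re P ?D)"
      proof (rule left_adjoint_transport[OF adj iso[OF A] iso[OF AA] po[OF A] po[OF AA]])
        fix x assume x: "x \<in> carrier (fib P A)"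
        then have px: "re P ?p x \<in> carrier (fib P ?AA)" using cl[of ?p x] A by simp
        then show "re P ?p x \<sqinter>\<^bsub>fib P ?AA\<^esub> ?e \<in> carrier (fib P ?AA)" using meet e AA by blast
        show "h ?AA (re P ?p x \<sqinter>\<^bsub>fib P ?AA\<^esub> ?e) = re Q ?p (h A x) \<sqinter>\<^bsub>fib Q ?AA\<^esub> ?d"
          using meet(1)[OF AA px e(1)] e(2) nat[of ?p x] x A by simp
      next
        fix y assume y: "y \<in> carrier (fib P ?AA)"
        show "re P ?D y \<in> carrier (fib P A)" "h A (re P ?D y) = re Q ?D (h ?AA y)"
          using cl[of ?D y] nat[of ?D y] A y by auto
      qed
      fix X assume X: "X \<in> Ob ?C"
      let ?XA = "prd ?C X A"
      let ?XAA = "prd ?C ?XA A"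
      let ?p1 = "pr1 ?C X A" and ?p2 = "pr2 ?C X A"
      let ?r1 = "pr1 ?C ?XA A" and ?r2 = "pr2 ?C ?XA A"
      let ?w = "pair ?C (?p2 \<cdot>\<^bsub>?C\<^esub> ?r1) ?r2" and ?v = "pair ?C (?p1 \<cdot>\<^bsub>?C\<^esub> ?r1) (?p2 \<cdot>\<^bsub>?C\<^esub> ?r1)"
      let ?E = "pair ?C (pair ?C ?p1 ?p2) ?p2"
      have Ob: "?XA \<in> Ob ?C" "?XAA \<in> Ob ?C" using A X by auto
      have ar: "?w \<in> Arr ?C" "Dom ?C ?w = ?XAA" "Cod ?C ?w = ?AA"
         "?v \<in> Arr ?C" "Dom ?C ?v = ?XAA" "Cod ?C ?v = ?XA"
         "?E \<in> Arr ?C" "Dom ?C ?E = ?XA" "Cod ?C ?E = ?XAA" using A X by auto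
      have adj: "left_adjoint (fib Q ?XA) (fib Q ?XAA)
          (\<lambda>\<alpha>. re Q ?v \<alpha> \<sqinter>\<^bsub>fib Q ?XAA\<^esub> re Q ?w ?d) (re Q ?E)"
        using eq X by (simp add: is_equality_def Let_def)
      have we: "re P ?w ?e \<in> carrier (fib P ?XAA)" "h ?XAA (re P ?w ?e) = re Q ?w ?d"
        using cl[of ?w ?e] nat[of ?w ?e] ar e by auto
      show "left_adjoint (fib P ?XA) (fib P ?XAA)
          (\<lambda>\<alpha>. re P ?v \<alpha> \<sqinter>\<^bsub>fib P ?XAA\<^esub> re P ?w ?e) (re P ?E)"
      proof (rule left_adjoint_transport[OF adj iso[OF Ob(1)] iso[OF Ob(2)] po[OF Ob(1)] po[OF Ob(2)]])
        fix x assume x: "x \<in> carrier (fib P ?XA)"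
        then have vx: "re P ?v x \<in> carrier (fib P ?XAA)" "h ?XAA (re P ?v x) = re Q ?v (h ?XA x)"
          using cl[of ?v x] nat[of ?v x] ar by auto
        then show "re P ?v x \<sqinter>\<^bsub>fib P ?XAA\<^esub> re P ?w ?e \<in> carrier (fib P ?XAA)" using meet we Ob by blast
        show "h ?XAA (re P ?v x \<sqinter>\<^bsub>fib P ?XAA\<^esub> re P ?w ?e) = re Q ?v (h ?XA x) \<sqinter>\<^bsub>fib Q ?XAA\<^esub> re Q ?w ?d"
          using meet(1)[OF Ob(2) vx(1) we(1)] vx(2) we(2) by simp
      next
        fix y assume y: "y \<in> carrier (fib P ?XAA)"
        show "re P ?E y \<in> carrier (fib P ?XA)" "h ?XA (re P ?E y) = re Q ?E (h ?XAA y)"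
          using cl[of ?E y] nat[of ?E y] ar y by auto
      qed
    qed
    then show ?thesis by blast
  qed
  then show ?thesis using dP by (simp add: elementary_doctrine_def base)
qed

lemma re_order_iso:
  assumes P: "is_doctrine P" and k: "inverse_arrows (base P) k k'"
  shows "order_iso (fib P (Cod (base P) k)) (fib P (Dom (base P) k)) (re P k)"
proof -
  note p = doctrineD[OF P]
  interpret category "base P" by (rule p(1))
  have kk: "k \<in> Arr (base P)" "k' \<in> Arr (base P)" "Dom (base P) k' = Cod (base P) k" "Cod (base P) k' = Dom (base P) k"
     "k' \<cdot>\<^bsub>base P\<^esub> k = Id (base P) (Dom (base P) k)" "k \<cdot>\<^bsub>base P\<^esub> k' = Id (base P) (Cod (base P) k)"
    using k by (auto simp: inverse_arrows_def)
  have inv: "re P k' (re P k x) = x" if "x \<in> carrier (fib P (Cod (base P) k))" for x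
    using p(6)[of k' k x] that kk p(5) by simp
  have inv': "re P k (re P k' y) = y" if "y \<in> carrier (fib P (Dom (base P) k))" for y
    using p(6)[of k k' y] that kk p(5) by simp
  have c: "re P k x \<in> carrier (fib P (Dom (base P) k))" if "x \<in> carrier (fib P (Cod (base P) k))" for x
    using p(7)[OF kk(1)] that by simp
  have c': "re P k' x \<in> carrier (fib P (Cod (base P) k))" if "x \<in> carrier (fib P (Dom (base P) k))" for x
    using p(7)[OF kk(2)] that kk by simp
  show ?thesis
  proof (rule order_isoI)
    show "partial_order (fib P (Cod (base P) k))" "partial_order (fib P (Dom (base P) k))"
      by (rule inf_semilatticeD(1)[OF p(3)]; use kk in simp)+
    show "\<exists>x\<in>carrier (fib P (Cod (base P) k)). re P k x = y" if "y \<in> carrier (fib P (Dom (base P) k))" for y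
      using c'[OF that] inv'[OF that] by blast
    fix x y assume xy: "x \<in> carrier (fib P (Cod (base P) k))" "y \<in> carrier (fib P (Cod (base P) k))"
    have m: "infsl_hom (fib P (Cod (base P) k)) (fib P (Dom (base P) k)) (re P k)" using p(4) kk by auto
    have m': "infsl_hom (fib P (Dom (base P) k)) (fib P (Cod (base P) k)) (re P k')" using p(4)[of k'] kk by auto
    show "x \<sqsubseteq>\<^bsub>fib P (Cod (base P) k)\<^esub> y \<longleftrightarrow> re P k x \<sqsubseteq>\<^bsub>fib P (Dom (base P) k)\<^esub> re P k y"
      using infsl_hom_mono[OF m _ _ xy] infsl_hom_mono[OF m' _ _ c[OF xy(1)] c[OF xy(2)]] p(3) kk
        inv[OF xy(1)] inv[OF xy(2)] by auto
  qed (rule c)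
qed

lemma functorD:
  assumes "is_functor C D F"
  shows "category C" "category D" "A \<in> Ob C \<Longrightarrow> onOb F A \<in> Ob D"
    "f \<in> Arr C \<Longrightarrow> onArr F f \<in> Arr D"
    "f \<in> Arr C \<Longrightarrow> Dom D (onArr F f) = onOb F (Dom C f)"
    "f \<in> Arr C \<Longrightarrow> Cod D (onArr F f) = onOb F (Cod C f)"
    "A \<in> Ob C \<Longrightarrow> onArr F (Id C A) = Id D (onOb F A)"
    "\<lbrakk>f \<in> Arr C; g \<in> Arr C; Cod C f = Dom C g\<rbrakk> \<Longrightarrow> onArr F (g \<cdot>\<^bsub>C\<^esub> f) = onArr F g \<cdot>\<^bsub>D\<^esub> onArr F f"
  using assms by (auto simp: is_functor_def)

text \<open>The comparison \<open>F (A \<times> A) \<rightarrow> F A \<times> F A\<close> is invertible and carries \<open>F\<close> of the diagonal to the diagonal.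
  As the equality predicates are determined by the order and the diagonal, they correspond.\<close>

lemma ED_1arrowI:
  assumes P: "elementary_doctrine P" and Q: "elementary_doctrine Q"
    and F: "is_functor (base P) (base Q) F" and pp: "preserves_binary_products (base P) (base Q) F"
    and b: "\<And>A. A \<in> Ob (base P) \<Longrightarrow> order_iso (fib P A) (fib Q (onOb F A)) (b A)"
    and nat: "\<And>f \<beta>. \<lbrakk>f \<in> Arr (base P); \<beta> \<in> carrier (fib P (Cod (base P) f))\<rbrakk> \<Longrightarrow>
        b (Dom (base P) f) (re P f \<beta>) = re Q (onArr F f) (b (Cod (base P) f) \<beta>)"
  shows "ED_1arrow P Q (F, b)"
proof -
  let ?C = "base P" and ?D = "base Q"
  have dP: "is_doctrine P" and dQ: "is_doctrine Q" using P Q by (auto simp: elementary_doctrine_def)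
  note p = doctrineD[OF dP] and q = doctrineD[OF dQ] and f = functorD[OF F]
  interpret C: with_products ?C using p by (simp add: with_products_def with_products_axioms_def)
  interpret D: with_products ?D using q by (simp add: with_products_def with_products_axioms_def)
  have hom: "infsl_hom (fib P A) (fib Q (onOb F A)) (b A)" if "A \<in> Ob ?C" for A
    using order_iso_infsl_hom[OF p(3) q(3) b] that f(3) by simp
  have "b (prd ?C A A) (eqp P A) =
        re Q (pair ?D (onArr F (pr1 ?C A A)) (onArr F (pr2 ?C A A))) (eqp Q (onOb F A))"
    if A: "A \<in> Ob ?C" for A
  proof -
    let ?FA = "onOb F A" and ?AA = "prd ?C A A"
    let ?FAA = "onOb F ?AA" and ?B = "prd ?D (onOb F A) (onOb F A)"
    let ?p = "onArr F (pr1 ?C A A)" and ?q = "onArr F (pr2 ?C A A)"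
    let ?k = "pair ?D ?p ?q"
    let ?dC = "pair ?C (Id ?C A) (Id ?C A)" and ?dD = "pair ?D (Id ?D ?FA) (Id ?D ?FA)"
    have AA: "?AA \<in> Ob ?C" "?FA \<in> Ob ?D" "?FAA \<in> Ob ?D" "?B \<in> Ob ?D" using A f(3) by auto
    have pq: "?p \<in> Arr ?D" "?q \<in> Arr ?D" "Dom ?D ?p = ?FAA" "Dom ?D ?q = ?FAA" "Cod ?D ?p = ?FA" "Cod ?D ?q = ?FA"
      using A f by auto
    have k: "?k \<in> Arr ?D" "Dom ?D ?k = ?FAA" "Cod ?D ?k = ?B"
      "pr1 ?D ?FA ?FA \<cdot>\<^bsub>?D\<^esub> ?k = ?p" "pr2 ?D ?FA ?FA \<cdot>\<^bsub>?D\<^esub> ?k = ?q"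
      using pq D.pair_simps(1-3)[of ?p ?q] D.pr_pair[OF pq(1,2)] by auto
    have pr: "is_product ?D ?FA ?FA ?FAA ?p ?q"
      using pp C.chosen_product[OF A A] A unfolding preserves_binary_products_def by blast
    obtain k' where k': "k' \<in> Arr ?D" "Dom ?D k' = ?B" "Cod ?D k' = ?FAA"
      "?p \<cdot>\<^bsub>?D\<^esub> k' = pr1 ?D ?FA ?FA" "?q \<cdot>\<^bsub>?D\<^esub> k' = pr2 ?D ?FA ?FA"
      by (rule D.product_ex[OF pr, of "pr1 ?D ?FA ?FA" "pr2 ?D ?FA ?FA"]) (use AA in auto)
    have "?k \<cdot>\<^bsub>?D\<^esub> k' = Id ?D ?B"
      by (rule D.prd_eqI[of _ _ ?FA ?FA]) (use k k' AA in \<open>auto simp: D.extend_eq1[OF k(4)] D.extend_eq1[OF k(5)]\<close>)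
    moreover have "k' \<cdot>\<^bsub>?D\<^esub> ?k = Id ?D ?FAA"
      by (rule D.product_unique[OF pr])
         (use k k' AA pq in \<open>auto simp: D.extend_eq1[OF k'(4)] D.extend_eq1[OF k'(5)]\<close>)
    ultimately have inv: "inverse_arrows ?D ?k k'" using k k' by (simp add: inverse_arrows_def)
    have dC: "?dC \<in> Arr ?C" "Dom ?C ?dC = A" "Cod ?C ?dC = ?AA" using A by auto
    have dD: "?dD \<in> Arr ?D" "Dom ?D ?dD = ?FA" "Cod ?D ?dD = ?B" using AA by auto
    have FdC: "onArr F ?dC \<in> Arr ?D" "Dom ?D (onArr F ?dC) = ?FA" "Cod ?D (onArr F ?dC) = ?FAA" using dC f by auto
    have e: "?p \<cdot>\<^bsub>?D\<^esub> onArr F ?dC = Id ?D ?FA" "?q \<cdot>\<^bsub>?D\<^esub> onArr F ?dC = Id ?D ?FA"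
      using f(8)[of ?dC "pr1 ?C A A"] f(8)[of ?dC "pr2 ?C A A"] A f(7) by (auto simp: C.pr_pair)
    have "k' \<cdot>\<^bsub>?D\<^esub> ?dD = onArr F ?dC"
      by (rule D.product_unique[OF pr])
         (use k' AA pq dD FdC e in \<open>auto simp: D.extend_eq1[OF k'(4)] D.extend_eq1[OF k'(5)] D.pr_pair\<close>)
    note kd = this
    have eP: "is_equality P A (eqp P A)" and eQ: "is_equality Q ?FA (eqp Q ?FA)"
      using eqp_equality P Q A AA by auto
    have ePc: "eqp P A \<in> carrier (fib P ?AA)" and eQc: "eqp Q ?FA \<in> carrier (fib Q ?B)"
      using eP eQ by (auto simp: is_equality_def Let_def)
    have rk: "order_iso (fib Q ?B) (fib Q ?FAA) (re Q ?k)" using re_order_iso[OF dQ inv] k by simp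
    have main: "b ?AA (eqp P A) \<sqsubseteq>\<^bsub>fib Q ?FAA\<^esub> \<beta> \<longleftrightarrow> re Q ?k (eqp Q ?FA) \<sqsubseteq>\<^bsub>fib Q ?FAA\<^esub> \<beta>"
      if \<beta>: "\<beta> \<in> carrier (fib Q ?FAA)" for \<beta>
    proof -
      let ?g = "inv_into (carrier (fib P ?AA)) (b ?AA) \<beta>"
      have g: "?g \<in> carrier (fib P ?AA)" "b ?AA ?g = \<beta>" using order_isoD(4,5)[OF b[OF AA(1)] \<beta>] .
      have dg: "re P ?dC ?g \<in> carrier (fib P A)" using p(7)[OF dC(1), of ?g] g dC by simp
      have kb: "re Q k' \<beta> \<in> carrier (fib Q ?B)" "re Q ?k (re Q k' \<beta>) = \<beta>"
        using q(7)[OF k'(1), of \<beta>] \<beta> k' k q(6)[OF k(1) k'(1)] \<open>k' \<cdot>\<^bsub>?D\<^esub> ?k = Id ?D ?FAA\<close> q(5)[OF AA(3) \<beta>] by auto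
      have "b ?AA (eqp P A) \<sqsubseteq>\<^bsub>fib Q ?FAA\<^esub> \<beta> \<longleftrightarrow> eqp P A \<sqsubseteq>\<^bsub>fib P ?AA\<^esub> ?g"
        using order_isoD(2)[OF b[OF AA(1)] ePc g(1)] g(2) by simp
      also have "\<dots> \<longleftrightarrow> \<top>\<^bsub>fib P A\<^esub> \<sqsubseteq>\<^bsub>fib P A\<^esub> re P ?dC ?g"
        by (rule equality_least[OF dP eP A g(1)])
      also have "\<dots> \<longleftrightarrow> b A \<top>\<^bsub>fib P A\<^esub> \<sqsubseteq>\<^bsub>fib Q ?FA\<^esub> b A (re P ?dC ?g)"
        using order_isoD(2)[OF b[OF A] _ dg] inf_semilatticeD(2)[OF p(3)[OF A]] by simp
      also have "\<dots> \<longleftrightarrow> \<top>\<^bsub>fib Q ?FA\<^esub> \<sqsubseteq>\<^bsub>fib Q ?FA\<^esub> re Q (onArr F ?dC) \<beta>"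
        using hom[OF A] nat[OF dC(1), of ?g] g dC by (simp add: infsl_hom_def)
      also have "re Q (onArr F ?dC) \<beta> = re Q ?dD (re Q k' \<beta>)"
        using q(6)[OF dD(1) k'(1), of \<beta>] kd dD k' \<beta> by simp
      also have "\<top>\<^bsub>fib Q ?FA\<^esub> \<sqsubseteq>\<^bsub>fib Q ?FA\<^esub> re Q ?dD (re Q k' \<beta>) \<longleftrightarrow> eqp Q ?FA \<sqsubseteq>\<^bsub>fib Q ?B\<^esub> re Q k' \<beta>"
        using equality_least[OF dQ eQ AA(2) kb(1)] by simp
      also have "\<dots> \<longleftrightarrow> re Q ?k (eqp Q ?FA) \<sqsubseteq>\<^bsub>fib Q ?FAA\<^esub> \<beta>"
        using order_isoD(2)[OF rk eQc kb(1)] kb(2) by simp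
      finally show ?thesis .
    qed
    have po: "partial_order (fib Q ?FAA)" using q(3)[OF AA(3)] by (rule inf_semilatticeD(1))
    have c: "b ?AA (eqp P A) \<in> carrier (fib Q ?FAA)" "re Q ?k (eqp Q ?FA) \<in> carrier (fib Q ?FAA)"
      using order_isoD(1)[OF b[OF AA(1)] ePc] order_isoD(1)[OF rk eQc] .
    show ?thesis
      by (rule antisymD[OF po c]) (use main c reflD[OF po] in blast)+
  qed
  then show ?thesis
    using F pp hom nat by (simp add: ED_1arrow_def Let_def)
qed

lemma nat_transD:
  assumes "nat_trans C D F G \<theta>"
  shows "A \<in> Ob C \<Longrightarrow> \<theta> A \<in> Arr D" "A \<in> Ob C \<Longrightarrow> Dom D (\<theta> A) = onOb F A"
    "A \<in> Ob C \<Longrightarrow> Cod D (\<theta> A) = onOb G A"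
    "\<lbrakk>f \<in> Arr C; Dom C f = X; Cod C f = Y\<rbrakk> \<Longrightarrow> \<theta> Y \<cdot>\<^bsub>D\<^esub> onArr F f = onArr G f \<cdot>\<^bsub>D\<^esub> \<theta> X"
  using assms by (auto simp: nat_trans_def)

lemma inverse_transformationsD:
  assumes "inverse_transformations C D F G \<theta> \<theta>'"
  shows "A \<in> Ob C \<Longrightarrow> \<theta>' A \<cdot>\<^bsub>D\<^esub> \<theta> A = Id D (onOb F A)"
    "A \<in> Ob C \<Longrightarrow> \<theta> A \<cdot>\<^bsub>D\<^esub> \<theta>' A = Id D (onOb G A)"
  using assms by (auto simp: inverse_transformations_def)

lemma id_functor_simps [simp]: "onOb id_functor A = A" "onArr id_functor f = f"
  by (auto simp: id_functor_def)

lemma comp_functor_simps [simp]: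
  "onOb (comp_functor G F) A = onOb G (onOb F A)" "onArr (comp_functor G F) f = onArr G (onArr F f)"
  by (auto simp: comp_functor_def)

lemma comp_is_functor:
  "\<lbrakk>is_functor C D F; is_functor D E G\<rbrakk> \<Longrightarrow> is_functor C E (comp_functor G F)"
  by (simp add: is_functor_def Pi_iff)

lemma id_is_functor: "category C \<Longrightarrow> is_functor C C id_functor"
  using category.Dom_Ob category.Cod_Ob by (auto simp: is_functor_def)

lemma inverse_nat_trans:
  assumes F: "is_functor C D F" and G: "is_functor C D G" and t: "nat_trans C D F G \<theta>"
    and h: "\<And>A. A \<in> Ob C \<Longrightarrow> \<theta>' A \<in> hom D (onOb G A) (onOb F A)"
    and i: "inverse_transformations C D F G \<theta> \<theta>'"
  shows "nat_trans C D G F \<theta>'"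
  unfolding nat_trans_def
proof (intro conjI ballI)
  interpret C: category C using functorD[OF F] by simp
  interpret D: category D using functorD[OF F] by simp
  show "\<theta>' A \<in> hom D (onOb G A) (onOb F A)" if "A \<in> Ob C" for A by (rule h[OF that])
  fix f assume f: "f \<in> Arr C"
  note Fs = functorD[OF F] and Gs = functorD[OF G] and ts = nat_transD[OF t] and inv = inverse_transformationsD[OF i]
  let ?A = "Dom C f" and ?B = "Cod C f"
  have Ob: "?A \<in> Ob C" "?B \<in> Ob C" using f by auto
  have ar: "\<theta>' ?A \<in> Arr D" "\<theta>' ?B \<in> Arr D" "Dom D (\<theta>' ?A) = onOb G ?A" "Dom D (\<theta>' ?B) = onOb G ?B"
    "Cod D (\<theta>' ?A) = onOb F ?A" "Cod D (\<theta>' ?B) = onOb F ?B" using h Ob by auto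
  have tr: "\<theta> ?A \<in> Arr D" "\<theta> ?B \<in> Arr D" "Dom D (\<theta> ?A) = onOb F ?A" "Dom D (\<theta> ?B) = onOb F ?B"
    "Cod D (\<theta> ?A) = onOb G ?A" "Cod D (\<theta> ?B) = onOb G ?B" using ts Ob by auto
  have FG: "onArr F f \<in> Arr D" "onArr G f \<in> Arr D" "Dom D (onArr F f) = onOb F ?A" "Cod D (onArr F f) = onOb F ?B"
    "Dom D (onArr G f) = onOb G ?A" "Cod D (onArr G f) = onOb G ?B" using Fs Gs f by auto
  have n: "\<theta> ?B \<cdot>\<^bsub>D\<^esub> onArr F f = onArr G f \<cdot>\<^bsub>D\<^esub> \<theta> ?A" using ts f by auto
  have "\<theta>' ?B \<cdot>\<^bsub>D\<^esub> onArr G f = \<theta>' ?B \<cdot>\<^bsub>D\<^esub> (onArr G f \<cdot>\<^bsub>D\<^esub> (\<theta> ?A \<cdot>\<^bsub>D\<^esub> \<theta>' ?A))"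
    using inv(2)[OF Ob(1)] FG by simp
  also have "\<dots> = \<theta>' ?B \<cdot>\<^bsub>D\<^esub> (\<theta> ?B \<cdot>\<^bsub>D\<^esub> (onArr F f \<cdot>\<^bsub>D\<^esub> \<theta>' ?A))"
    using D.extend_eq[OF n, of "\<theta>' ?A"] FG ar tr by simp
  also have "\<dots> = onArr F f \<cdot>\<^bsub>D\<^esub> \<theta>' ?A"
    using D.extend_eq1[OF inv(1)[OF Ob(2)], of "onArr F f \<cdot>\<^bsub>D\<^esub> \<theta>' ?A"] FG ar tr by simp
  finally show "\<theta>' ?B \<cdot>\<^bsub>D\<^esub> onArr G f = onArr F f \<cdot>\<^bsub>D\<^esub> \<theta>' ?A" .
qed

text \<open>Improving an equivalence to an adjoint one: \<open>\<eta>\<close> is corrected by the discrepancy between \<open>\<epsilon>\<close> and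
  \<open>F \<eta>\<close>, so that the triangle identity \<open>F \<kappa> = \<epsilon> F\<close> holds.\<close>

lemma adjust_equivalence:
  assumes F: "is_functor C D F" and H: "is_functor D C H"
    and e: "nat_trans C C (comp_functor H F) id_functor \<eta>" "nat_trans C C id_functor (comp_functor H F) \<eta>'"
      "inverse_transformations C C (comp_functor H F) id_functor \<eta> \<eta>'"
    and c: "nat_trans D D (comp_functor F H) id_functor \<epsilon>" "nat_trans D D id_functor (comp_functor F H) \<epsilon>'"
      "inverse_transformations D D (comp_functor F H) id_functor \<epsilon> \<epsilon>'"
  obtains \<kappa> \<kappa>' where "nat_trans C C (comp_functor H F) id_functor \<kappa>"
    "nat_trans C C id_functor (comp_functor H F) \<kappa>'"
    "inverse_transformations C C (comp_functor H F) id_functor \<kappa> \<kappa>'"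
    "\<And>A. A \<in> Ob C \<Longrightarrow> onArr F (\<kappa> A) = \<epsilon> (onOb F A)"
proof -
  interpret C: category C using functorD[OF F] by simp
  interpret D: category D using functorD[OF F] by simp
  note Fs = functorD(3-)[OF F] and Hs = functorD(3-)[OF H]
  have n: "\<eta> A \<in> Arr C" "Dom C (\<eta> A) = onOb H (onOb F A)" "Cod C (\<eta> A) = A"
    "\<eta>' A \<in> Arr C" "Cod C (\<eta>' A) = onOb H (onOb F A)" "Dom C (\<eta>' A) = A"
    "\<eta> A \<cdot>\<^bsub>C\<^esub> \<eta>' A = Id C A" "\<eta>' A \<cdot>\<^bsub>C\<^esub> \<eta> A = Id C (onOb H (onOb F A))"
    if "A \<in> Ob C" for A
    using nat_transD(1-3)[OF e(1) that] nat_transD(1-3)[OF e(2) that]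
      inverse_transformationsD[OF e(3) that] by auto
  have nn: "\<eta> Y \<cdot>\<^bsub>C\<^esub> onArr H (onArr F f) = f \<cdot>\<^bsub>C\<^esub> \<eta> X"
     "\<eta>' Y \<cdot>\<^bsub>C\<^esub> f = onArr H (onArr F f) \<cdot>\<^bsub>C\<^esub> \<eta>' X"
    if "f \<in> Arr C" "Dom C f = X" "Cod C f = Y" for f X Y
    using nat_transD(4)[OF e(1) that] nat_transD(4)[OF e(2) that] by auto
  have m: "\<epsilon> A \<in> Arr D" "Dom D (\<epsilon> A) = onOb F (onOb H A)" "Cod D (\<epsilon> A) = A"
    "\<epsilon>' A \<in> Arr D" "Cod D (\<epsilon>' A) = onOb F (onOb H A)" "Dom D (\<epsilon>' A) = A"
    "\<epsilon> A \<cdot>\<^bsub>D\<^esub> \<epsilon>' A = Id D A" "\<epsilon>' A \<cdot>\<^bsub>D\<^esub> \<epsilon> A = Id D (onOb F (onOb H A))"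
    if "A \<in> Ob D" for A
    using nat_transD(1-3)[OF c(1) that] nat_transD(1-3)[OF c(2) that]
      inverse_transformationsD[OF c(3) that] by auto
  have mm: "\<epsilon> Y \<cdot>\<^bsub>D\<^esub> onArr F (onArr H f) = f \<cdot>\<^bsub>D\<^esub> \<epsilon> X"
    if "f \<in> Arr D" "Dom D f = X" "Cod D f = Y" for f X Y
    using nat_transD(4)[OF c(1) that] by auto
  have monic_n: "monic C (\<eta> A)" if "A \<in> Ob C" for A
    using C.split_monic[of "\<eta> A" "\<eta>' A"] n[OF that] by simp
  have monic_m: "monic D (\<epsilon> A)" if "A \<in> Ob D" for A
    using D.split_monic[of "\<epsilon> A" "\<epsilon>' A"] m[OF that] by simp
  \<comment> \<open>naturality of \<open>\<eta>\<close> at its own component, which is monic\<close>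
  have HFn: "onArr H (onArr F (\<eta> A)) = \<eta> (onOb H (onOb F A))" if A: "A \<in> Ob C" for A
    by (rule C.monicD[OF monic_n[OF A]])
      (use A n Fs Hs nn[OF n(1)[OF A] n(2)[OF A] n(3)[OF A]] in auto)
  have FHm: "onArr F (onArr H (\<epsilon> B)) = \<epsilon> (onOb F (onOb H B))" if B: "B \<in> Ob D" for B
    by (rule D.monicD[OF monic_m[OF B]])
      (use B m Fs Hs mm[OF m(1)[OF B] m(2)[OF B] m(3)[OF B]] in auto)
  define \<kappa> where "\<kappa> A = \<eta> A \<cdot>\<^bsub>C\<^esub> (onArr H (\<epsilon> (onOb F A)) \<cdot>\<^bsub>C\<^esub> \<eta>' (onOb H (onOb F A)))" for A
  define \<kappa>' where "\<kappa>' A = \<eta> (onOb H (onOb F A)) \<cdot>\<^bsub>C\<^esub> (onArr H (\<epsilon>' (onOb F A)) \<cdot>\<^bsub>C\<^esub> \<eta>' A)" for A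
  have k: "\<kappa> A \<in> Arr C" "Dom C (\<kappa> A) = onOb H (onOb F A)" "Cod C (\<kappa> A) = A"
    "\<kappa>' A \<in> Arr C" "Cod C (\<kappa>' A) = onOb H (onOb F A)" "Dom C (\<kappa>' A) = A" if "A \<in> Ob C" for A
    using that by (simp_all add: \<kappa>_def \<kappa>'_def n m Fs Hs)
  have inv: "inverse_transformations C C (comp_functor H F) id_functor \<kappa> \<kappa>'"
    unfolding inverse_transformations_def
  proof (intro ballI conjI)
    fix A assume A: "A \<in> Ob C"
    let ?A = "onOb H (onOb F A)"
    have A': "?A \<in> Ob C" "onOb F A \<in> Ob D" "onOb F ?A \<in> Ob D" using A Fs Hs by auto
    let ?e = "onArr H (\<epsilon> (onOb F A))" and ?e' = "onArr H (\<epsilon>' (onOb F A))"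
    have ea: "?e \<in> Arr C" "?e' \<in> Arr C" "Dom C ?e = onOb H (onOb F ?A)" "Cod C ?e = ?A"
      "Cod C ?e' = onOb H (onOb F ?A)" "Dom C ?e' = ?A"
      using A' m Hs by auto
    have ee: "?e \<cdot>\<^bsub>C\<^esub> ?e' = Id C ?A" "?e' \<cdot>\<^bsub>C\<^esub> ?e = Id C (onOb H (onOb F ?A))"
      using A' m Hs(6)[of "\<epsilon>' (onOb F A)" "\<epsilon> (onOb F A)"] Hs(6)[of "\<epsilon> (onOb F A)" "\<epsilon>' (onOb F A)"] Hs(5)
      by auto
    note r = n[OF A] n[OF A'(1)] ea ee C.extend_eq1[OF n(7)[OF A]] C.extend_eq1[OF n(8)[OF A]]
       C.extend_eq1[OF n(7)[OF A'(1)]] C.extend_eq1[OF n(8)[OF A'(1)]] C.extend_eq1[OF ee(1)] C.extend_eq1[OF ee(2)]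
    show "\<kappa>' A \<cdot>\<^bsub>C\<^esub> \<kappa> A = Id C (onOb (comp_functor H F) A)"
      unfolding \<kappa>_def \<kappa>'_def using A A' by (simp add: r)
    show "\<kappa> A \<cdot>\<^bsub>C\<^esub> \<kappa>' A = Id C (onOb id_functor A)"
      unfolding \<kappa>_def \<kappa>'_def using A A' by (simp add: r)
  qed
  have nt: "nat_trans C C (comp_functor H F) id_functor \<kappa>"
    unfolding nat_trans_def
  proof (intro conjI ballI)
    show "\<kappa> A \<in> hom C (onOb (comp_functor H F) A) (onOb id_functor A)" if "A \<in> Ob C" for A
      using k that by simp
    fix f assume f: "f \<in> Arr C"
    let ?A = "Dom C f" and ?B = "Cod C f"
    let ?HA = "onOb H (onOb F ?A)" and ?HB = "onOb H (onOb F ?B)" and ?Hf = "onArr H (onArr F f)"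
    have Ob: "?A \<in> Ob C" "?B \<in> Ob C" "?HA \<in> Ob C" "?HB \<in> Ob C" "onOb F ?A \<in> Ob D" "onOb F ?B \<in> Ob D"
      using f Fs Hs by auto
    have Hf: "?Hf \<in> Arr C" "Dom C ?Hf = ?HA" "Cod C ?Hf = ?HB" using f Fs Hs by auto
    let ?HHf = "onArr H (onArr F ?Hf)"
    have HHf: "?HHf \<in> Arr C" "Dom C ?HHf = onOb H (onOb F ?HA)" "Cod C ?HHf = onOb H (onOb F ?HB)" using Hf Fs Hs by auto
    let ?eA = "onArr H (\<epsilon> (onOb F ?A))" and ?eB = "onArr H (\<epsilon> (onOb F ?B))"
    have ea: "?eA \<in> Arr C" "Dom C ?eA = onOb H (onOb F ?HA)" "Cod C ?eA = ?HA"
       "?eB \<in> Arr C" "Dom C ?eB = onOb H (onOb F ?HB)" "Cod C ?eB = ?HB"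
      using Ob m Hs by auto
    have s1: "\<eta>' ?HB \<cdot>\<^bsub>C\<^esub> ?Hf = ?HHf \<cdot>\<^bsub>C\<^esub> \<eta>' ?HA" using nn(2)[OF Hf] .
    have "\<epsilon> (onOb F ?B) \<cdot>\<^bsub>D\<^esub> onArr F ?Hf = onArr F f \<cdot>\<^bsub>D\<^esub> \<epsilon> (onOb F ?A)"
      using mm[of "onArr F f" "onOb F ?A" "onOb F ?B"] f Fs by simp
    then have s2: "?eB \<cdot>\<^bsub>C\<^esub> ?HHf = ?Hf \<cdot>\<^bsub>C\<^esub> ?eA"
      using Hs(6)[of "onArr F ?Hf" "\<epsilon> (onOb F ?B)"] Hs(6)[of "\<epsilon> (onOb F ?A)" "onArr F f"] f Hf Fs m Ob by simp
    have s3: "\<eta> ?B \<cdot>\<^bsub>C\<^esub> ?Hf = f \<cdot>\<^bsub>C\<^esub> \<eta> ?A" using nn(1)[OF f] by simp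
    note nA = n[OF Ob(1)] n[OF Ob(2)] n[OF Ob(3)] n[OF Ob(4)]
    have "\<kappa> ?B \<cdot>\<^bsub>C\<^esub> ?Hf = \<eta> ?B \<cdot>\<^bsub>C\<^esub> (?eB \<cdot>\<^bsub>C\<^esub> (\<eta>' ?HB \<cdot>\<^bsub>C\<^esub> ?Hf))"
      unfolding \<kappa>_def by (simp add: nA Hf ea Ob)
    also have "\<dots> = \<eta> ?B \<cdot>\<^bsub>C\<^esub> (?eB \<cdot>\<^bsub>C\<^esub> (?HHf \<cdot>\<^bsub>C\<^esub> \<eta>' ?HA))" unfolding s1 ..
    also have "\<dots> = \<eta> ?B \<cdot>\<^bsub>C\<^esub> (?Hf \<cdot>\<^bsub>C\<^esub> (?eA \<cdot>\<^bsub>C\<^esub> \<eta>' ?HA))"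
      using C.extend_eq[OF s2, of "\<eta>' ?HA"] by (simp add: nA Hf ea Ob HHf)
    also have "\<dots> = f \<cdot>\<^bsub>C\<^esub> \<kappa> ?A"
      unfolding \<kappa>_def using C.extend_eq[OF s3, of "?eA \<cdot>\<^bsub>C\<^esub> \<eta>' ?HA"] by (simp add: nA Hf ea Ob f)
    finally show "\<kappa> ?B \<cdot>\<^bsub>C\<^esub> onArr (comp_functor H F) f = onArr id_functor f \<cdot>\<^bsub>C\<^esub> \<kappa> ?A" by simp
  qed
  have nt': "nat_trans C C id_functor (comp_functor H F) \<kappa>'"
    by (rule inverse_nat_trans[OF comp_is_functor[OF F H] id_is_functor[OF C.category_axioms] nt _ inv])
       (use k in simp)
  have "onArr F (\<kappa> A) = \<epsilon> (onOb F A)" if A: "A \<in> Ob C" for A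
  proof -
    let ?A = "onOb H (onOb F A)"
    have A': "?A \<in> Ob C" "onOb F A \<in> Ob D" "onOb F ?A \<in> Ob D" using A Fs Hs by auto
    note r = n[OF A] n[OF A'(1)] m[OF A'(2)] m[OF A'(3)]
    have "onArr F (\<kappa> A) = onArr F (\<eta> A) \<cdot>\<^bsub>D\<^esub> (\<epsilon> (onOb F ?A) \<cdot>\<^bsub>D\<^esub> onArr F (\<eta>' ?A))"
      unfolding \<kappa>_def using A A' FHm[OF A'(2)] by (simp add: r Fs Hs)
    also have "\<dots> = \<epsilon> (onOb F A) \<cdot>\<^bsub>D\<^esub> (onArr F (\<eta> ?A) \<cdot>\<^bsub>D\<^esub> onArr F (\<eta>' ?A))"
      using D.extend_eq[OF mm[of "onArr F (\<eta> A)" "onOb F ?A" "onOb F A", symmetric], of "onArr F (\<eta>' ?A)"] A A' HFn[OF A]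
      by (simp add: r Fs Hs)
    also have "onArr F (\<eta> ?A) \<cdot>\<^bsub>D\<^esub> onArr F (\<eta>' ?A) = Id D (onOb F ?A)"
      using Fs(6)[of "\<eta>' ?A" "\<eta> ?A"] A' Fs(5) by (simp add: r)
    finally show ?thesis using A' by (simp add: r)
  qed
  then show thesis using that nt nt' inv by blast
qed

lemma ED_isomorphic_id:
  assumes P: "is_doctrine P"
    and t: "nat_trans (base P) (base P) G id_functor \<theta>" "nat_trans (base P) (base P) id_functor G \<theta>'"
      "inverse_transformations (base P) (base P) G id_functor \<theta> \<theta>'"
    and g: "\<And>A \<alpha>. \<lbrakk>A \<in> Ob (base P); \<alpha> \<in> carrier (fib P A)\<rbrakk> \<Longrightarrow> g A \<alpha> = re P (\<theta> A) \<alpha>"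
  shows "ED_isomorphic_1arrows P P (G, g) ED_id"
proof -
  note p = doctrineD[OF P]
  interpret category "base P" by (rule p(1))
  have n: "\<theta> A \<in> Arr (base P)" "Dom (base P) (\<theta> A) = onOb G A" "Cod (base P) (\<theta> A) = A"
    "\<theta>' A \<in> Arr (base P)" "Cod (base P) (\<theta>' A) = onOb G A" "Dom (base P) (\<theta>' A) = A"
    "\<theta> A \<cdot>\<^bsub>base P\<^esub> \<theta>' A = Id (base P) A" if "A \<in> Ob (base P)" for A
    using nat_transD(1-3)[OF t(1) that] nat_transD(1-3)[OF t(2) that]
      inverse_transformationsD[OF t(3) that] by auto
  have po: "partial_order (fib P A)" if "A \<in> Ob (base P)" for A
    using p(3)[OF that] by (rule inf_semilatticeD(1))
  have "ED_2arrow P P (G, g) ED_id \<theta>"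
    unfolding ED_2arrow_def ED_id_def
  proof (clarsimp simp: t(1) g)
    fix A \<alpha> assume A: "A \<in> Ob (base P)" "\<alpha> \<in> carrier (fib P A)"
    have "onOb G A \<in> Ob (base P)" using n(1,2)[OF A(1)] Dom_Ob[of "\<theta> A"] by simp
    then show "re P (\<theta> A) \<alpha> \<sqsubseteq>\<^bsub>fib P (onOb G A)\<^esub> re P (\<theta> A) \<alpha>"
      using p(7)[of "\<theta> A" \<alpha>] n[OF A(1)] A by (intro reflD[OF po]) auto
  qed
  moreover have "ED_2arrow P P ED_id (G, g) \<theta>'"
    unfolding ED_2arrow_def ED_id_def
  proof (clarsimp simp: t(2) g)
    fix A \<alpha> assume A: "A \<in> Ob (base P)" "\<alpha> \<in> carrier (fib P A)"
    have "re P (\<theta>' A) (re P (\<theta> A) \<alpha>) = \<alpha>"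
      using p(6)[of "\<theta>' A" "\<theta> A" \<alpha>] n[OF A(1)] A p(5) by simp
    then show "\<alpha> \<sqsubseteq>\<^bsub>fib P A\<^esub> re P (\<theta>' A) (re P (\<theta> A) \<alpha>)"
      using reflD[OF po] A by simp
  qed
  ultimately show ?thesis
    unfolding ED_isomorphic_1arrows_def using t(3) by (auto simp: ED_id_def)
qed

text \<open>The inverse 1-arrow sends \<open>\<beta>\<close> over \<open>B\<close> to the element over \<open>H B\<close> that \<open>b\<close> maps to the reindexing of \<open>\<beta>\<close>
  along \<open>\<epsilon>\<^sub>B : F H B \<rightarrow> B\<close>. By the triangle identity both composites are then reindexing along the
  components of a natural isomorphism to the identity.\<close>

lemma ED_equivalentI:
  assumes P: "elementary_doctrine P" and Q: "elementary_doctrine Q"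
    and F: "is_functor (base P) (base Q) F" "preserves_binary_products (base P) (base Q) F"
    and H: "is_functor (base Q) (base P) H" "preserves_binary_products (base Q) (base P) H"
    and HF: "nat_isomorphic (base P) (base P) (comp_functor H F) id_functor"
    and FH: "nat_isomorphic (base Q) (base Q) (comp_functor F H) id_functor"
    and b: "\<And>A. A \<in> Ob (base P) \<Longrightarrow> order_iso (fib P A) (fib Q (onOb F A)) (b A)"
    and nat: "\<And>f \<beta>. \<lbrakk>f \<in> Arr (base P); \<beta> \<in> carrier (fib P (Cod (base P) f))\<rbrakk> \<Longrightarrow>
        b (Dom (base P) f) (re P f \<beta>) = re Q (onArr F f) (b (Cod (base P) f) \<beta>)"
  shows "ED_equivalent P Q"
proof -
  let ?C = "base P" and ?D = "base Q"
  have dP: "is_doctrine P" and dQ: "is_doctrine Q" using P Q by (auto simp: elementary_doctrine_def)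
  note p = doctrineD[OF dP] and q = doctrineD[OF dQ] and f = functorD(3-)[OF F(1)] and h = functorD(3-)[OF H(1)]
  interpret C: category ?C by (rule p(1))
  interpret D: category ?D by (rule q(1))
  obtain \<epsilon> \<epsilon>' where c: "nat_trans ?D ?D (comp_functor F H) id_functor \<epsilon>" "nat_trans ?D ?D id_functor (comp_functor F H) \<epsilon>'"
      "inverse_transformations ?D ?D (comp_functor F H) id_functor \<epsilon> \<epsilon>'"
    using FH by (auto simp: nat_isomorphic_def)
  obtain \<kappa> \<kappa>' where k: "nat_trans ?C ?C (comp_functor H F) id_functor \<kappa>"
    "nat_trans ?C ?C id_functor (comp_functor H F) \<kappa>'"
    "inverse_transformations ?C ?C (comp_functor H F) id_functor \<kappa> \<kappa>'"
    "\<And>A. A \<in> Ob ?C \<Longrightarrow> onArr F (\<kappa> A) = \<epsilon> (onOb F A)"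
    using HF c adjust_equivalence[OF F(1) H(1) _ _ _ c] unfolding nat_isomorphic_def by metis
  have e: "\<epsilon> B \<in> Arr ?D" "Dom ?D (\<epsilon> B) = onOb F (onOb H B)" "Cod ?D (\<epsilon> B) = B" "inverse_arrows ?D (\<epsilon> B) (\<epsilon>' B)"
    if "B \<in> Ob ?D" for B
    using nat_transD(1-3)[OF c(1) that] nat_transD(1-3)[OF c(2) that] inverse_transformationsD[OF c(3) that]
    by (auto simp: inverse_arrows_def)
  define g where "g B = inv_into (carrier (fib P (onOb H B))) (b (onOb H B)) \<circ> re Q (\<epsilon> B)" for B
  have g: "order_iso (fib Q B) (fib P (onOb H B)) (g B)" if B: "B \<in> Ob ?D" for B
    unfolding g_def
  proof (rule order_iso_comp[of _ "fib Q (onOb F (onOb H B))"])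
    show "order_iso (fib Q B) (fib Q (onOb F (onOb H B))) (re Q (\<epsilon> B))"
      using re_order_iso[OF dQ e(4)[OF B]] e(2,3)[OF B] by simp
    show "order_iso (fib Q (onOb F (onOb H B))) (fib P (onOb H B)) (inv_into (carrier (fib P (onOb H B))) (b (onOb H B)))"
      using order_iso_inv[OF b] h(1) B by simp
  qed
  have rc: "re Q (\<epsilon> B) \<beta> \<in> carrier (fib Q (onOb F (onOb H B)))" if "B \<in> Ob ?D" "\<beta> \<in> carrier (fib Q B)" for B \<beta>
    using q(7)[of "\<epsilon> B" \<beta>] e[OF that(1)] that by simp
  have bg: "b (onOb H B) (g B \<beta>) = re Q (\<epsilon> B) \<beta>" if "B \<in> Ob ?D" "\<beta> \<in> carrier (fib Q B)" for B \<beta>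
    unfolding g_def using order_isoD(5)[OF b[OF h(1)[OF that(1)]] rc[OF that]] by simp
  have gnat: "g (Dom ?D u) (re Q u \<beta>) = re P (onArr H u) (g (Cod ?D u) \<beta>)"
    if u: "u \<in> Arr ?D" "\<beta> \<in> carrier (fib Q (Cod ?D u))" for u \<beta>
  proof -
    let ?A = "Dom ?D u" and ?B = "Cod ?D u"
    have Ob: "?A \<in> Ob ?D" "?B \<in> Ob ?D" using u by auto
    have ru: "re Q u \<beta> \<in> carrier (fib Q ?A)" using q(7) u by blast
    have gb: "g ?B \<beta> \<in> carrier (fib P (onOb H ?B))" using order_isoD(1)[OF g[OF Ob(2)] u(2)] .
    have hu: "onArr H u \<in> Arr ?C" "Dom ?C (onArr H u) = onOb H ?A" "Cod ?C (onArr H u) = onOb H ?B" using h u by auto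
    show ?thesis
    proof (rule order_isoD(3)[OF b[OF h(1)[OF Ob(1)]]])
      show "g ?A (re Q u \<beta>) \<in> carrier (fib P (onOb H ?A))" using order_isoD(1)[OF g[OF Ob(1)] ru] .
      show "re P (onArr H u) (g ?B \<beta>) \<in> carrier (fib P (onOb H ?A))" using p(7)[OF hu(1), of "g ?B \<beta>"] gb hu by simp
      have "b (onOb H ?A) (g ?A (re Q u \<beta>)) = re Q (\<epsilon> ?A) (re Q u \<beta>)" by (rule bg[OF Ob(1) ru])
      also have "\<dots> = re Q (u \<cdot>\<^bsub>?D\<^esub> \<epsilon> ?A) \<beta>" using q(6)[of "\<epsilon> ?A" u \<beta>] e[OF Ob(1)] u by simp
      also have "u \<cdot>\<^bsub>?D\<^esub> \<epsilon> ?A = \<epsilon> ?B \<cdot>\<^bsub>?D\<^esub> onArr F (onArr H u)" using nat_transD(4)[OF c(1) u(1)] by simp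
      also have "re Q (\<epsilon> ?B \<cdot>\<^bsub>?D\<^esub> onArr F (onArr H u)) \<beta> = re Q (onArr F (onArr H u)) (re Q (\<epsilon> ?B) \<beta>)"
        using q(6)[of "onArr F (onArr H u)" "\<epsilon> ?B" \<beta>] e[OF Ob(2)] u hu f by simp
      also have "\<dots> = b (onOb H ?A) (re P (onArr H u) (g ?B \<beta>))"
        using nat[OF hu(1), of "g ?B \<beta>"] gb hu bg[OF Ob(2) u(2)] by simp
      finally show "b (onOb H ?A) (g ?A (re Q u \<beta>)) = b (onOb H ?A) (re P (onArr H u) (g ?B \<beta>))" .
    qed
  qed
  have "ED_1arrow P Q (F, b)" by (rule ED_1arrowI[OF P Q F b nat])
  moreover have "ED_1arrow Q P (H, g)" by (rule ED_1arrowI[OF Q P H g gnat])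
  moreover have "ED_isomorphic_1arrows P P (ED_comp (H, g) (F, b)) ED_id"
    unfolding ED_comp_def prod.case
  proof (rule ED_isomorphic_id[OF dP k(1-3)])
    fix A \<alpha> assume A: "A \<in> Ob ?C" "\<alpha> \<in> carrier (fib P A)"
    let ?HF = "onOb H (onOb F A)"
    have FA: "onOb F A \<in> Ob ?D" "?HF \<in> Ob ?C" using A f h by auto
    have ba: "b A \<alpha> \<in> carrier (fib Q (onOb F A))" using order_isoD(1)[OF b] A by simp
    have ka: "\<kappa> A \<in> Arr ?C" "Dom ?C (\<kappa> A) = ?HF" "Cod ?C (\<kappa> A) = A"
      using nat_transD(1-3)[OF k(1) A(1)] by auto
    show "(g (onOb F A) \<circ> b A) \<alpha> = re P (\<kappa> A) \<alpha>"
    proof (rule order_isoD(3)[OF b[OF FA(2)]])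
      show "(g (onOb F A) \<circ> b A) \<alpha> \<in> carrier (fib P ?HF)"
        using order_isoD(1)[OF g[OF FA(1)] ba] by simp
      show "re P (\<kappa> A) \<alpha> \<in> carrier (fib P ?HF)" using p(7)[OF ka(1), of \<alpha>] ka A by simp
      show "b ?HF ((g (onOb F A) \<circ> b A) \<alpha>) = b ?HF (re P (\<kappa> A) \<alpha>)"
        using bg[OF FA(1) ba] nat[OF ka(1), of \<alpha>] ka A k(4)[OF A(1)] by simp
    qed
  qed
  moreover have "ED_isomorphic_1arrows Q Q (ED_comp (F, b) (H, g)) ED_id"
    unfolding ED_comp_def prod.case
    by (rule ED_isomorphic_id[OF dQ c]) (use bg in simp)
  ultimately show ?thesis
    unfolding ED_equivalent_def using P Q by blast
qed

section \<open>The category of kernels of arrows\<close>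

locale weak_lex =
  fixes S :: "('o, 'a) cat" (structure)
  assumes cart: "cartesian_category S" and wpb: "has_weak_pullbacks S"
begin

sublocale with_products S
  using cart by (simp add: cartesian_category_def with_products_def with_products_axioms_def)

sublocale Psi: slice_doctrine S "Arr S" "is_weak_pullback S"
  using weak_slice[OF wpb] .

abbreviation "Psi \<equiv> weak_subobjects S"
abbreviation "D \<equiv> dp_cat Psi"
abbreviation "pt x \<equiv> Dom S (dp_incl x)"

lemma base_Psi [simp]: "base Psi = S" by (simp add: weak_subobjects_def)
lemma fib_Psi [simp]: "fib Psi = slice_poset S (Arr S)" by (simp add: weak_subobjects_def)

lemma wpb_ex:
  assumes "f \<in> Arr S" "g \<in> Arr S" "Cod S f = Cod S g"
  obtains p q where "is_weak_pullback S f g p q" "p \<in> Arr S" "q \<in> Arr S" "Dom S q = Dom S p"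
    "Cod S p = Dom S f" "Cod S q = Dom S g" "f \<cdot> p = g \<cdot> q"
proof -
  obtain p q where "is_weak_pullback S f g p q" using wpb assms unfolding has_weak_pullbacks_def by blast
  then show thesis using that weak_pullback_square[of f g p q] by (auto simp: commuting_square_def)
qed

lemma ker_closed: "c \<in> Arr S \<Longrightarrow> ker Psi c \<in> carrier (Psi.Sub (prd S (Dom S c) (Dom S c)))"
  unfolding ker_def weak_subobjects_slice by (rule Psi.re_closed) (auto intro: Psi.eqp_closed)

lemma belongs_ker:
  assumes "c \<in> Arr S" "z \<in> Arr S" "Cod S z = prd S (Dom S c) (Dom S c)"
  shows "belongs S (ker Psi c) z \<longleftrightarrow>
    c \<cdot> (pr1 S (Dom S c) (Dom S c) \<cdot> z) = c \<cdot> (pr2 S (Dom S c) (Dom S c) \<cdot> z)"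
  using assms by (simp add: ker_def weak_subobjects_slice Psi.belongs_re Psi.eqp_closed Psi.belongs_eqp pr_prod_arr)

lemma dp_rel_iff:
  assumes c: "c \<in> Arr S" and d: "d \<in> Arr S"
    and f: "f \<in> Arr S" "Dom S f = Dom S c" "Cod S f = Dom S d"
    and f': "f' \<in> Arr S" "Dom S f' = Dom S c" "Cod S f' = Dom S d"
  shows "dp_rel Psi c d f f' \<longleftrightarrow>
    (\<forall>u\<in>Arr S. \<forall>v\<in>Arr S. Cod S u = Dom S c \<and> Cod S v = Dom S c \<and> Dom S u = Dom S v \<and> c \<cdot> u = c \<cdot> v
       \<longrightarrow> d \<cdot> (f \<cdot> u) = d \<cdot> (f' \<cdot> v))" (is "_ \<longleftrightarrow> ?r")
proof -
  let ?X = "Dom S c"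
  let ?XX = "prd S ?X ?X"
  let ?p = "pr1 S ?X ?X" and ?q = "pr2 S ?X ?X"
  have X: "?X \<in> Ob S" using c by simp
  have ff: "prod_arr S f f' \<in> Arr S" "Dom S (prod_arr S f f') = ?XX"
    "Cod S (prod_arr S f f') = prd S (Dom S d) (Dom S d)" using f f' by auto
  have rc: "re Psi (prod_arr S f f') (ker Psi d) \<in> carrier (Psi.Sub ?XX)"
    unfolding weak_subobjects_slice by (rule Psi.re_closed) (use ff ker_closed[OF d] in \<open>auto simp: weak_subobjects_slice\<close>)
  have br: "belongs S (re Psi (prod_arr S f f') (ker Psi d)) z \<longleftrightarrow> d \<cdot> (f \<cdot> (?p \<cdot> z)) = d \<cdot> (f' \<cdot> (?q \<cdot> z))"
    if z: "z \<in> Arr S" "Cod S z = ?XX" for z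
  proof -
    have "belongs S (re Psi (prod_arr S f f') (ker Psi d)) z \<longleftrightarrow> belongs S (ker Psi d) (prod_arr S f f' \<cdot> z)"
      unfolding weak_subobjects_slice
      by (rule Psi.belongs_re) (use z ff ker_closed[OF d] in \<open>auto simp: weak_subobjects_slice\<close>)
    also have "\<dots> \<longleftrightarrow> d \<cdot> (f \<cdot> (?p \<cdot> z)) = d \<cdot> (f' \<cdot> (?q \<cdot> z))"
      using belongs_ker[OF d, of "prod_arr S f f' \<cdot> z"] z ff f f' by (simp add: pr_prod_arr)
    finally show ?thesis .
  qed
  have "dp_rel Psi c d f f' \<longleftrightarrow>
    (\<forall>z\<in>Arr S. Cod S z = ?XX \<longrightarrow> c \<cdot> (?p \<cdot> z) = c \<cdot> (?q \<cdot> z) \<longrightarrow> d \<cdot> (f \<cdot> (?p \<cdot> z)) = d \<cdot> (f' \<cdot> (?q \<cdot> z)))"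
    unfolding dp_rel_def Let_def base_Psi fib_Psi Psi.le_iff[OF ker_closed[OF c] rc]
    using br belongs_ker[OF c] by auto
  also have "\<dots> \<longleftrightarrow> ?r"
  proof
    assume l: "\<forall>z\<in>Arr S. Cod S z = ?XX \<longrightarrow> c \<cdot> (?p \<cdot> z) = c \<cdot> (?q \<cdot> z) \<longrightarrow> d \<cdot> (f \<cdot> (?p \<cdot> z)) = d \<cdot> (f' \<cdot> (?q \<cdot> z))"
    show ?r
    proof (intro ballI impI; elim conjE)
      fix u v assume uv: "u \<in> Arr S" "v \<in> Arr S" "Cod S u = ?X" "Cod S v = ?X" "Dom S u = Dom S v" "c \<cdot> u = c \<cdot> v"
      then have z: "pair S u v \<in> Arr S" "Cod S (pair S u v) = ?XX" "?p \<cdot> pair S u v = u" "?q \<cdot> pair S u v = v"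
        by (auto simp: pr_pair)
      show "d \<cdot> (f \<cdot> u) = d \<cdot> (f' \<cdot> v)" using l[rule_format, OF z(1,2)] uv(6) unfolding z(3,4) by blast
    qed
  next
    assume r: ?r
    show "\<forall>z\<in>Arr S. Cod S z = ?XX \<longrightarrow> c \<cdot> (?p \<cdot> z) = c \<cdot> (?q \<cdot> z) \<longrightarrow> d \<cdot> (f \<cdot> (?p \<cdot> z)) = d \<cdot> (f' \<cdot> (?q \<cdot> z))"
      using r X by auto
  qed
  finally show ?thesis .
qed

text \<open>\<open>f\<close> respects the kernels of the two objects; the kernels are tested on parallel pairs instead
  of a chosen weak kernel pair.\<close>

definition kmap :: "('o, 'a, 'a set) dp_ob \<Rightarrow> ('o, 'a, 'a set) dp_ob \<Rightarrow> 'a \<Rightarrow> bool" where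
  "kmap x y f \<longleftrightarrow> f \<in> Arr S \<and> Dom S f = pt x \<and> Cod S f = pt y \<and>
     (\<forall>u\<in>Arr S. \<forall>v\<in>Arr S. Cod S u = pt x \<and> Cod S v = pt x \<and> Dom S u = Dom S v \<and> dp_incl x \<cdot> u = dp_incl x \<cdot> v
       \<longrightarrow> dp_incl y \<cdot> (f \<cdot> u) = dp_incl y \<cdot> (f \<cdot> v))"

lemma kmapI:
  assumes "f \<in> Arr S" "Dom S f = pt x" "Cod S f = pt y"
    and "\<And>u v. \<lbrakk>u \<in> Arr S; v \<in> Arr S; Cod S u = pt x; Cod S v = pt x; Dom S u = Dom S v;
           dp_incl x \<cdot> u = dp_incl x \<cdot> v\<rbrakk> \<Longrightarrow> dp_incl y \<cdot> (f \<cdot> u) = dp_incl y \<cdot> (f \<cdot> v)"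
  shows "kmap x y f"
  unfolding kmap_def using assms by blast

lemma kmapD:
  assumes "kmap x y f"
  shows "f \<in> Arr S" "Dom S f = pt x" "Cod S f = pt y"
    "\<lbrakk>dp_incl x \<cdot> u = dp_incl x \<cdot> v; u \<in> Arr S; v \<in> Arr S; Cod S u = pt x; Cod S v = pt x; Dom S u = Dom S v\<rbrakk>
       \<Longrightarrow> dp_incl y \<cdot> (f \<cdot> u) = dp_incl y \<cdot> (f \<cdot> v)"
  using assms unfolding kmap_def by blast+

text \<open>An arrow is a weak comprehension of its own class, so every arrow of \<open>S\<close> gives an object.\<close>

definition ob :: "'a \<Rightarrow> ('o, 'a, 'a set) dp_ob" where
  "ob c = (Cod S c, Psi.cls c, c)"

lemma incl_ob [simp]: "dp_incl (ob c) = c" by (simp add: ob_def)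

lemma Ob_D: "Ob D = dp_obs Psi" by (simp add: dp_cat_def)

lemma incl_Arr [simp]: "x \<in> Ob D \<Longrightarrow> dp_incl x \<in> Arr S"
  by (auto simp: Ob_D dp_obs_def weak_comprehension_def Let_def)

lemma ob_Ob [simp]: assumes c: "c \<in> Arr S" shows "ob c \<in> Ob D"
proof -
  let ?X = "Dom S c"
  have X: "?X \<in> Ob S" using c by simp
  have cc: "Psi.cls c \<in> carrier (Psi.Sub (Cod S c))" using c by simp
  have rc: "re Psi g (Psi.cls c) \<in> carrier (Psi.Sub (Dom S g))" if "g \<in> Arr S" "Cod S g = Cod S c" for g
    unfolding weak_subobjects_slice by (rule Psi.re_closed) (use that cc in auto)
  have top: "\<top>\<^bsub>Psi.Sub (Dom S g)\<^esub> \<sqsubseteq>\<^bsub>Psi.Sub (Dom S g)\<^esub> re Psi g (Psi.cls c) \<longleftrightarrow>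
      (\<forall>u\<in>Arr S. Cod S u = Dom S g \<longrightarrow> factors_through S (g \<cdot> u) c)" if g: "g \<in> Arr S" "Cod S g = Cod S c" for g
  proof -
    have "belongs S (re Psi g (Psi.cls c)) u \<longleftrightarrow> factors_through S (g \<cdot> u) c" if "u \<in> Arr S" "Cod S u = Dom S g" for u
      using Psi.belongs_re[of g "Psi.cls c" u] that c cc g unfolding weak_subobjects_slice by simp
    then show ?thesis
      using Psi.le_iff[OF Psi.top_closed rc[OF g]] g Psi.belongs_top by simp
  qed
  have "weak_comprehension Psi (Cod S c) (Psi.cls c) c"
    unfolding weak_comprehension_def Let_def base_Psi fib_Psi
  proof (intro conjI ballI impI; (elim conjE)?)
    show "\<top>\<^bsub>Psi.Sub ?X\<^esub> \<sqsubseteq>\<^bsub>Psi.Sub ?X\<^esub> re Psi c (Psi.cls c)"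
      unfolding top[OF c refl] using c by (auto intro!: factors_throughI)
    fix g assume g: "g \<in> Arr S" "Cod S g = Cod S c"
      "\<top>\<^bsub>Psi.Sub (Dom S g)\<^esub> \<sqsubseteq>\<^bsub>Psi.Sub (Dom S g)\<^esub> re Psi g (Psi.cls c)"
    have "factors_through S g c"
      using g(3)[unfolded top[OF g(1,2)], rule_format, of "Id S (Dom S g)"] g(1) by simp
    then show "\<exists>h\<in>hom S (Dom S g) ?X. g = c \<cdot> h" by (simp add: factors_through_def)
  qed (use c in auto)
  then show ?thesis using c cc by (auto simp: Ob_D dp_obs_def ob_def)
qed

lemma maps_iff:
  assumes "x \<in> Ob D" "y \<in> Ob D"
  shows "f \<in> dp_maps Psi (dp_incl x) (dp_incl y) \<longleftrightarrow> kmap x y f"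
  using dp_rel_iff[OF incl_Arr incl_Arr, of x y f f] assms
  unfolding dp_maps_def kmap_def mem_Collect_eq base_Psi hom_iff by blast

text \<open>Evaluated at the identity pair, the relation that defines \<open>\<D>\<^sub>P\<close> compares composites into the codomain;
  for arrows that respect the kernels this one instance implies all others.\<close>

lemma rel_iff:
  assumes o: "x \<in> Ob D" "y \<in> Ob D" and f: "kmap x y f" and f': "kmap x y f'"
  shows "dp_rel Psi (dp_incl x) (dp_incl y) f f' \<longleftrightarrow> dp_incl y \<cdot> f = dp_incl y \<cdot> f'"
proof -
  note f = kmapD[OF f] and f' = kmapD[OF f']
  have X: "pt x \<in> Ob S" using o by simp
  have "dp_rel Psi (dp_incl x) (dp_incl y) f f' \<longleftrightarrow>
    (\<forall>u\<in>Arr S. \<forall>v\<in>Arr S. Cod S u = pt x \<and> Cod S v = pt x \<and> Dom S u = Dom S v \<and> dp_incl x \<cdot> u = dp_incl x \<cdot> v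
       \<longrightarrow> dp_incl y \<cdot> (f \<cdot> u) = dp_incl y \<cdot> (f' \<cdot> v))"
    using f f' o by (intro dp_rel_iff) auto
  also have "\<dots> \<longleftrightarrow> dp_incl y \<cdot> f = dp_incl y \<cdot> f'"
  proof
    assume "\<forall>u\<in>Arr S. \<forall>v\<in>Arr S. Cod S u = pt x \<and> Cod S v = pt x \<and> Dom S u = Dom S v \<and> dp_incl x \<cdot> u = dp_incl x \<cdot> v
       \<longrightarrow> dp_incl y \<cdot> (f \<cdot> u) = dp_incl y \<cdot> (f' \<cdot> v)"
    from this[rule_format, of "Id S (pt x)" "Id S (pt x)"]
    show "dp_incl y \<cdot> f = dp_incl y \<cdot> f'" using X f(1,2) f'(1,2) by simp
  next
    assume e: "dp_incl y \<cdot> f = dp_incl y \<cdot> f'"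
    show "\<forall>u\<in>Arr S. \<forall>v\<in>Arr S. Cod S u = pt x \<and> Cod S v = pt x \<and> Dom S u = Dom S v \<and> dp_incl x \<cdot> u = dp_incl x \<cdot> v
       \<longrightarrow> dp_incl y \<cdot> (f \<cdot> u) = dp_incl y \<cdot> (f' \<cdot> v)"
    proof (intro ballI impI; elim conjE)
      fix u v assume uv: "u \<in> Arr S" "v \<in> Arr S" "Cod S u = pt x" "Cod S v = pt x" "Dom S u = Dom S v"
         "dp_incl x \<cdot> u = dp_incl x \<cdot> v"
      have "dp_incl y \<cdot> (f \<cdot> u) = dp_incl y \<cdot> (f \<cdot> v)" using f(4)[OF uv(6,1-5)] .
      also have "\<dots> = dp_incl y \<cdot> (f' \<cdot> v)"
        by (rule extend_eq[OF e]) (use f(1-3) f'(1-3) o uv(1-5) in auto)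
      finally show "dp_incl y \<cdot> (f \<cdot> u) = dp_incl y \<cdot> (f' \<cdot> v)" .
    qed
  qed
  finally show ?thesis .
qed

text \<open>The arrow \<open>[f]\<close> of \<open>D\<close> from \<open>x\<close> to \<open>y\<close>.\<close>

definition ar where "ar x y f = (x, y, dp_class Psi (dp_incl x) (dp_incl y) f)"

lemma class_iff:
  assumes o: "x \<in> Ob D" "y \<in> Ob D" and f: "kmap x y f"
  shows "g \<in> dp_class Psi (dp_incl x) (dp_incl y) f \<longleftrightarrow> kmap x y g \<and> dp_incl y \<cdot> g = dp_incl y \<cdot> f"
  using rel_iff[OF o f, of g] maps_iff[OF o] by (auto simp: dp_class_def)

lemma ar_eq_iff:
  assumes o: "x \<in> Ob D" "y \<in> Ob D" and f: "kmap x y f" "kmap x y g"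
  shows "ar x y f = ar x y g \<longleftrightarrow> dp_incl y \<cdot> f = dp_incl y \<cdot> g"
  using class_iff[OF o f(1)] class_iff[OF o f(2)] f unfolding ar_def by auto

lemma Arr_D: "\<phi> \<in> Arr D \<longleftrightarrow> (\<exists>x y f. \<phi> = ar x y f \<and> x \<in> Ob D \<and> y \<in> Ob D \<and> kmap x y f)"
proof -
  have "\<phi> \<in> Arr D \<longleftrightarrow> (\<exists>x y f. \<phi> = ar x y f \<and> x \<in> dp_obs Psi \<and> y \<in> dp_obs Psi \<and>
      f \<in> dp_maps Psi (dp_incl x) (dp_incl y))"
    unfolding dp_cat_def ar_def cat.simps by blast
  then show ?thesis using maps_iff unfolding Ob_D by blast
qed

lemma Dom_Cod_ar [simp]: "Dom D (ar x y f) = x" "Cod D (ar x y f) = y"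
  by (simp_all add: dp_cat_def ar_def)

lemma ar_Arr [simp]: "\<lbrakk>x \<in> Ob D; y \<in> Ob D; kmap x y f\<rbrakk> \<Longrightarrow> ar x y f \<in> Arr D"
  unfolding Arr_D by blast

lemma arE:
  assumes "\<phi> \<in> Arr D"
  obtains f where "\<phi> = ar (Dom D \<phi>) (Cod D \<phi>) f" "kmap (Dom D \<phi>) (Cod D \<phi>) f" "Dom D \<phi> \<in> Ob D" "Cod D \<phi> \<in> Ob D"
  using assms Dom_Cod_ar unfolding Arr_D by metis

lemma arE':
  assumes "\<phi> \<in> Arr D"
  obtains x y f where "\<phi> = ar x y f" "kmap x y f" "x \<in> Ob D" "y \<in> Ob D"
  using assms unfolding Arr_D by blast

lemma kmap_comp:
  assumes o: "x \<in> Ob D" "y \<in> Ob D" "z \<in> Ob D" and f: "kmap x y f" and g: "kmap y z g"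
  shows "kmap x z (g \<cdot> f)"
proof (rule kmapI)
  note f = kmapD[OF f] and g = kmapD[OF g]
  show "g \<cdot> f \<in> Arr S" "Dom S (g \<cdot> f) = pt x" "Cod S (g \<cdot> f) = pt z" using f(1-3) g(1-3) by auto
  fix u v assume uv: "u \<in> Arr S" "v \<in> Arr S" "Cod S u = pt x" "Cod S v = pt x" "Dom S u = Dom S v"
         "dp_incl x \<cdot> u = dp_incl x \<cdot> v"
  have "dp_incl z \<cdot> (g \<cdot> (f \<cdot> u)) = dp_incl z \<cdot> (g \<cdot> (f \<cdot> v))"
    by (rule g(4)) (use f(1-3) uv(1-5) f(4)[OF uv(6,1-5)] in auto)
  then show "dp_incl z \<cdot> ((g \<cdot> f) \<cdot> u) = dp_incl z \<cdot> ((g \<cdot> f) \<cdot> v)"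
    using f(1-3) g(1-3) uv(1-5) by simp
qed

lemma ar_comp [simp]:
  assumes o: "x \<in> Ob D" "y \<in> Ob D" "z \<in> Ob D" and f: "kmap x y f" and g: "kmap y z g"
  shows "ar y z g \<cdot>\<^bsub>D\<^esub> ar x y f = ar x z (g \<cdot> f)"
proof -
  note gf = kmap_comp[OF o f g]
  have "dp_class Psi (dp_incl x) (dp_incl z) (g' \<cdot> f') = dp_class Psi (dp_incl x) (dp_incl z) (g \<cdot> f)"
    if "g' \<in> dp_class Psi (dp_incl y) (dp_incl z) g" "f' \<in> dp_class Psi (dp_incl x) (dp_incl y) f" for g' f'
  proof -
    have g': "kmap y z g'" "dp_incl z \<cdot> g' = dp_incl z \<cdot> g" using that(1) class_iff[OF o(2,3) g] by auto
    have f': "kmap x y f'" "dp_incl y \<cdot> f' = dp_incl y \<cdot> f" using that(2) class_iff[OF o(1,2) f] by auto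
    have "dp_incl z \<cdot> (g' \<cdot> f') = dp_incl z \<cdot> (g \<cdot> f')"
      by (rule extend_eq[OF g'(2)]) (use kmapD(1-3)[OF g'(1)] kmapD(1-3)[OF f'(1)] kmapD(1-3)[OF g] o in auto)
    also have "\<dots> = dp_incl z \<cdot> (g \<cdot> f)"
      by (rule kmapD(4)[OF g f'(2)]) (use kmapD(1-3)[OF f] kmapD(1-3)[OF f'(1)] in auto)
    finally have "ar x z (g' \<cdot> f') = ar x z (g \<cdot> f)"
      using ar_eq_iff[OF o(1,3) kmap_comp[OF o f'(1) g'(1)] gf] by simp
    then show ?thesis by (simp add: ar_def)
  qed
  moreover have "g \<in> dp_class Psi (dp_incl y) (dp_incl z) g" "f \<in> dp_class Psi (dp_incl x) (dp_incl y) f"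
    using class_iff[OF o(2,3) g] class_iff[OF o(1,2) f] f g by auto
  ultimately have "{dp_class Psi (dp_incl x) (dp_incl z) (g' \<cdot> f') | g' f'.
      g' \<in> dp_class Psi (dp_incl y) (dp_incl z) g \<and> f' \<in> dp_class Psi (dp_incl x) (dp_incl y) f}
     = {dp_class Psi (dp_incl x) (dp_incl z) (g \<cdot> f)}" by blast
  then show ?thesis by (simp add: dp_cat_def ar_def)
qed

lemma kmap_Id [simp]: "x \<in> Ob D \<Longrightarrow> kmap x x (Id S (pt x))"
  by (rule kmapI) auto

lemma Id_D: "Id D x = ar x x (Id S (pt x))"
  by (simp add: dp_cat_def ar_def)

sublocale D: category D
proof
  fix f A B assume "f \<in> hom D A B"
  then have f: "f \<in> Arr D" "Dom D f = A" "Cod D f = B" by auto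
  obtain f0 where f0: "f = ar A B f0" "kmap A B f0" "A \<in> Ob D" "B \<in> Ob D" using arE[OF f(1)] f by auto
  show "f \<cdot>\<^bsub>D\<^esub> Id D A = f" "Id D B \<cdot>\<^bsub>D\<^esub> f = f"
    unfolding Id_D f0(1) using f0 kmapD(1-3)[OF f0(2)] by auto
  fix g E assume "g \<in> hom D B E"
  then have g: "g \<in> Arr D" "Dom D g = B" "Cod D g = E" by auto
  obtain g0 where g0: "g = ar B E g0" "kmap B E g0" "E \<in> Ob D" using arE[OF g(1)] g by auto
  note gf0 = kmap_comp[OF f0(3,4) g0(3) f0(2) g0(2)]
  show "g \<cdot>\<^bsub>D\<^esub> f \<in> hom D A E" unfolding f0(1) g0(1) using f0 g0 gf0 by simp
  fix h G assume "h \<in> hom D E G"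
  then have h: "h \<in> Arr D" "Dom D h = E" "Cod D h = G" by auto
  obtain h0 where h0: "h = ar E G h0" "kmap E G h0" "G \<in> Ob D" using arE[OF h(1)] h by auto
  note hg0 = kmap_comp[OF f0(4) g0(3) h0(3) g0(2) h0(2)]
  show "h \<cdot>\<^bsub>D\<^esub> (g \<cdot>\<^bsub>D\<^esub> f) = h \<cdot>\<^bsub>D\<^esub> g \<cdot>\<^bsub>D\<^esub> f"
    unfolding f0(1) g0(1) h0(1) using f0 g0 h0 gf0 hg0 kmapD(1-3)[OF f0(2)] kmapD(1-3)[OF g0(2)] kmapD(1-3)[OF h0(2)]
    by simp
next
  fix f assume "f \<in> Arr D" then show "Dom D f \<in> Ob D" "Cod D f \<in> Ob D" using arE by blast+
next
  fix A assume "A \<in> Ob D" then show "Id D A \<in> hom D A A" by (simp add: Id_D)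
qed

subsection \<open>The embedding\<close>

abbreviation "jo A \<equiv> ob (Id S A)"

lemma jo_pt [simp]: "A \<in> Ob S \<Longrightarrow> pt (jo A) = A" by simp

lemma kmap_jo [simp]: "A \<in> Ob S \<Longrightarrow> kmap (jo A) y f \<longleftrightarrow> f \<in> Arr S \<and> Dom S f = A \<and> Cod S f = pt y"
  by (auto simp: kmap_def)

definition J :: "('o, 'a, ('o, 'a, 'a set) dp_ob, ('o, 'a, 'a set) dp_arr) functr" where
  "J = \<lparr>onOb = (\<lambda>A. jo A), onArr = (\<lambda>f. ar (jo (Dom S f)) (jo (Cod S f)) f)\<rparr>"

lemma J_simps [simp]: "onOb J A = jo A" "onArr J f = ar (jo (Dom S f)) (jo (Cod S f)) f"
  by (auto simp: J_def)

lemma J_functor: "is_functor S D J"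
  unfolding is_functor_def
  by (intro conjI ballI impI) (auto simp: Id_D category_axioms D.category_axioms)

lemma J_faithful: "\<lbrakk>f \<in> Arr S; g \<in> Arr S; onArr J f = onArr J g; Dom S f = Dom S g; Cod S f = Cod S g\<rbrakk> \<Longrightarrow> f = g"
  using ar_eq_iff[of "jo (Dom S f)" "jo (Cod S f)" f g] by simp

lemma J_full:
  assumes "\<phi> \<in> Arr D" "Dom D \<phi> = jo A" "Cod D \<phi> = jo B" "A \<in> Ob S" "B \<in> Ob S"
  obtains f where "f \<in> Arr S" "Dom S f = A" "Cod S f = B" "onArr J f = \<phi>"
proof -
  obtain f where f: "\<phi> = ar (jo A) (jo B) f" "kmap (jo A) (jo B) f" using arE[OF assms(1)] assms by metis
  then have "f \<in> Arr S" "Dom S f = A" "Cod S f = B" using assms by auto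
  then show thesis using that f by simp
qed

text \<open>Every object \<open>x\<close>, given by an arrow \<open>c\<close>, sits in the image factorization of \<open>J c\<close>: it is covered by \<open>J\<close>
  of the domain of \<open>c\<close> and embedded into \<open>J\<close> of the codomain.\<close>

definition cov where "cov x = ar (jo (pt x)) x (Id S (pt x))"
definition emb where "emb x = ar x (jo (Cod S (dp_incl x))) (dp_incl x)"

lemma kmap_emb [simp]: "x \<in> Ob D \<Longrightarrow> kmap x (jo (Cod S (dp_incl x))) (dp_incl x)"
  by (rule kmapI) auto

lemma cov_simps [simp]:
  assumes "x \<in> Ob D"
  shows "cov x \<in> Arr D" "Dom D (cov x) = jo (pt x)" "Cod D (cov x) = x"
    "emb x \<in> Arr D" "Dom D (emb x) = x" "Cod D (emb x) = jo (Cod S (dp_incl x))"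
    "emb x \<cdot>\<^bsub>D\<^esub> cov x = onArr J (dp_incl x)"
  using assms by (simp_all add: cov_def emb_def)

lemma ar_cov:
  assumes "x \<in> Ob D" "y \<in> Ob D" "kmap x y f"
  shows "ar x y f \<cdot>\<^bsub>D\<^esub> cov x = cov y \<cdot>\<^bsub>D\<^esub> onArr J f"
  using assms kmapD(1-3)[OF assms(3)] by (simp add: cov_def)

subsection \<open>Regularity\<close>

text \<open>Objects in the image of \<open>J\<close> suffice to test monomorphisms, and arrows out of them are arbitrary
  arrows of \<open>S\<close>.\<close>

lemma monic_D_iff:
  assumes o: "x \<in> Ob D" "y \<in> Ob D" and f: "kmap x y f"
  shows "monic D (ar x y f) \<longleftrightarrow>
    (\<forall>u\<in>Arr S. \<forall>v\<in>Arr S. Cod S u = pt x \<and> Cod S v = pt x \<and> Dom S u = Dom S v \<and>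
       dp_incl y \<cdot> (f \<cdot> u) = dp_incl y \<cdot> (f \<cdot> v) \<longrightarrow> dp_incl x \<cdot> u = dp_incl x \<cdot> v)"
proof (intro iffI ballI impI; (elim conjE)?)
  note fa = kmapD(1-3)[OF f]
  fix u v assume m: "monic D (ar x y f)" and uv: "u \<in> Arr S" "v \<in> Arr S" "Cod S u = pt x" "Cod S v = pt x"
    "Dom S u = Dom S v" "dp_incl y \<cdot> (f \<cdot> u) = dp_incl y \<cdot> (f \<cdot> v)"
  let ?t = "jo (Dom S v)"
  have t: "?t \<in> Ob D" "kmap ?t x u" "kmap ?t x v" "kmap ?t y (f \<cdot> u)" "kmap ?t y (f \<cdot> v)" using uv(1-5) fa by auto
  have "ar x y f \<cdot>\<^bsub>D\<^esub> ar ?t x u = ar x y f \<cdot>\<^bsub>D\<^esub> ar ?t x v"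
    using ar_eq_iff[OF t(1) o(2) t(4,5)] uv(6) t f o by simp
  then have "ar ?t x u = ar ?t x v"
    by (rule D.monicD[OF m]) (use t o f in auto)
  then show "dp_incl x \<cdot> u = dp_incl x \<cdot> v" using ar_eq_iff[OF t(1) o(1) t(2,3)] by simp
next
  note fa = kmapD(1-3)[OF f]
  assume r: "\<forall>u\<in>Arr S. \<forall>v\<in>Arr S. Cod S u = pt x \<and> Cod S v = pt x \<and> Dom S u = Dom S v \<and>
       dp_incl y \<cdot> (f \<cdot> u) = dp_incl y \<cdot> (f \<cdot> v) \<longrightarrow> dp_incl x \<cdot> u = dp_incl x \<cdot> v"
  show "monic D (ar x y f)"
  proof (rule D.monicI)
    show "ar x y f \<in> Arr D" using o f by simp
    fix \<phi> \<psi> assume a: "\<phi> \<in> Arr D" "\<psi> \<in> Arr D" "Cod D \<phi> = Dom D (ar x y f)" "Cod D \<psi> = Dom D (ar x y f)" "Dom D \<phi> = Dom D \<psi>"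
      "ar x y f \<cdot>\<^bsub>D\<^esub> \<phi> = ar x y f \<cdot>\<^bsub>D\<^esub> \<psi>"
    have c: "Cod D \<phi> = x" "Cod D \<psi> = x" using a(3,4) by auto
    obtain t u where u: "\<phi> = ar t x u" "kmap t x u" "t \<in> Ob D" using arE'[OF a(1)] c Dom_Cod_ar by metis
    obtain v where v: "\<psi> = ar t x v" "kmap t x v" using arE'[OF a(2)] a(5) c u(1) Dom_Cod_ar by metis
    have "ar t y (f \<cdot> u) = ar t y (f \<cdot> v)" using a(6) ar_comp[OF u(3) o u(2) f] ar_comp[OF u(3) o v(2) f] u(1) v(1) by metis
    then have "dp_incl y \<cdot> (f \<cdot> u) = dp_incl y \<cdot> (f \<cdot> v)"
      using ar_eq_iff[OF u(3) o(2) kmap_comp[OF u(3) o u(2) f] kmap_comp[OF u(3) o v(2) f]] by simp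
    then have "dp_incl x \<cdot> u = dp_incl x \<cdot> v" using r kmapD(1-3)[OF u(2)] kmapD(1-3)[OF v(2)] by metis
    then show "\<phi> = \<psi>" using ar_eq_iff[OF u(3) o(1) u(2) v(2)] u(1) v(1) by simp
  qed
qed

text \<open>A regular epimorphism is one that has a section up to the kernel of its codomain. Given such
  a section \<open>s\<close>, the arrow is the coequalizer of a weak kernel pair of \<open>d \<cdot> f\<close>, and factoring
  through it means precomposing with \<open>s\<close>.\<close>

lemma section_regular_epi:
  assumes o: "x \<in> Ob D" "y \<in> Ob D" and f: "kmap x y f"
    and s: "s \<in> Arr S" "Dom S s = pt y" "Cod S s = pt x" "dp_incl y \<cdot> (f \<cdot> s) = dp_incl y"
  shows "regular_epi D (ar x y f)"
proof -
  let ?c = "dp_incl x" and ?d = "dp_incl y"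
  note fa = kmapD(1-3)[OF f]
  have cd: "?c \<in> Arr S" "?d \<in> Arr S" using o by auto
  have df: "?d \<cdot> f \<in> Arr S" using fa cd by simp
  obtain k1 k2 where k: "is_weak_pullback S (?d \<cdot> f) (?d \<cdot> f) k1 k2" "k1 \<in> Arr S" "k2 \<in> Arr S"
    "Dom S k2 = Dom S k1" "Cod S k1 = Dom S (?d \<cdot> f)" "Cod S k2 = Dom S (?d \<cdot> f)" "(?d \<cdot> f) \<cdot> k1 = (?d \<cdot> f) \<cdot> k2"
    using wpb_ex[OF df df] by metis
  have kc: "Cod S k1 = pt x" "Cod S k2 = pt x" "?d \<cdot> (f \<cdot> k1) = ?d \<cdot> (f \<cdot> k2)" using k fa cd by auto
  let ?k = "jo (Dom S k1)"
  have ko: "?k \<in> Ob D" "kmap ?k x k1" "kmap ?k x k2" "kmap ?k y (f \<cdot> k1)" "kmap ?k y (f \<cdot> k2)" using k(2-4) kc fa by auto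
  have epi: "dp_incl z \<cdot> u = dp_incl z \<cdot> v" if h: "kmap y z u" "kmap y z v" "z \<in> Ob D"
      "dp_incl z \<cdot> (u \<cdot> f) = dp_incl z \<cdot> (v \<cdot> f)" for z u v
  proof -
    have *: "dp_incl z \<cdot> (w \<cdot> (f \<cdot> s)) = dp_incl z \<cdot> w" if "kmap y z w" for w
    proof -
      have "dp_incl z \<cdot> (w \<cdot> (f \<cdot> s)) = dp_incl z \<cdot> (w \<cdot> Id S (pt y))"
        by (rule kmapD(4)[OF that]) (use s fa cd in auto)
      then show ?thesis using kmapD(1-3)[OF that] by simp
    qed
    have e: "(dp_incl z \<cdot> u) \<cdot> f = (dp_incl z \<cdot> v) \<cdot> f" using h kmapD(1-3)[OF h(1)] kmapD(1-3)[OF h(2)] fa by simp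
    have "(dp_incl z \<cdot> u) \<cdot> (f \<cdot> s) = (dp_incl z \<cdot> v) \<cdot> (f \<cdot> s)"
      by (rule extend_eq[OF e]) (use h kmapD(1-3)[OF h(1)] kmapD(1-3)[OF h(2)] fa s(1-3) in auto)
    then show ?thesis using *[OF h(1)] *[OF h(2)] h kmapD(1-3)[OF h(1)] kmapD(1-3)[OF h(2)] fa s(1-3) by simp
  qed
  have "coequalizer D (ar ?k x k1) (ar ?k x k2) (ar x y f)"
    unfolding coequalizer_def
  proof (intro conjI ballI impI; (elim conjE)?)
    show "ar x y f \<cdot>\<^bsub>D\<^esub> ar ?k x k1 = ar x y f \<cdot>\<^bsub>D\<^esub> ar ?k x k2"
      using ar_eq_iff[OF ko(1) o(2) ko(4,5)] kc(3) ko o f by simp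
    fix \<tau> assume t: "\<tau> \<in> Arr D" "Dom D \<tau> = Cod D (ar ?k x k1)" "\<tau> \<cdot>\<^bsub>D\<^esub> ar ?k x k1 = \<tau> \<cdot>\<^bsub>D\<^esub> ar ?k x k2"
    have dt: "Dom D \<tau> = x" using t(2) by simp
    obtain z w where w: "\<tau> = ar x z w" "kmap x z w" "z \<in> Ob D" using arE'[OF t(1)] dt Dom_Cod_ar by metis
    let ?e = "dp_incl z"
    note wa = kmapD(1-3)[OF w(2)]
    have ea: "?e \<in> Arr S" using w(3) by simp
    have "ar ?k z (w \<cdot> k1) = ar ?k z (w \<cdot> k2)"
      using t(3) ar_comp[OF ko(1) o(1) w(3) ko(2) w(2)] ar_comp[OF ko(1) o(1) w(3) ko(3) w(2)] w(1) by metis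
    then have wk: "?e \<cdot> (w \<cdot> k1) = ?e \<cdot> (w \<cdot> k2)"
      using ar_eq_iff[OF ko(1) w(3) kmap_comp[OF ko(1) o(1) w(3) ko(2) w(2)] kmap_comp[OF ko(1) o(1) w(3) ko(3) w(2)]] by simp
    \<comment> \<open>\<open>w\<close> identifies everything that \<open>d \<cdot> f\<close> identifies\<close>
    have coeq: "?e \<cdot> (w \<cdot> a) = ?e \<cdot> (w \<cdot> b)"
      if ab: "a \<in> Arr S" "b \<in> Arr S" "Cod S a = pt x" "Cod S b = pt x" "Dom S a = Dom S b"
        "?d \<cdot> (f \<cdot> a) = ?d \<cdot> (f \<cdot> b)" for a b
    proof -
      obtain r where r: "r \<in> Arr S" "Dom S r = Dom S a" "Cod S r = Dom S k1" "k1 \<cdot> r = a" "k2 \<cdot> r = b"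
        by (rule weak_pullbackE[OF k(1) ab(1,2,5)]) (use ab fa cd in auto)
      have wk': "(?e \<cdot> w) \<cdot> k1 = (?e \<cdot> w) \<cdot> k2" using wk wa ea k(2-4) kc by simp
      have "(?e \<cdot> w) \<cdot> (k1 \<cdot> r) = (?e \<cdot> w) \<cdot> (k2 \<cdot> r)"
        by (rule extend_eq[OF wk']) (use wa ea k(2-4) kc r(1-3) in auto)
      then show ?thesis using wa ea ab(1-4) unfolding r(4,5) by simp
    qed
    have h: "kmap y z (w \<cdot> s)"
    proof (rule kmapI)
      show "w \<cdot> s \<in> Arr S" "Dom S (w \<cdot> s) = pt y" "Cod S (w \<cdot> s) = pt z" using wa s by auto
      fix u v assume uv: "u \<in> Arr S" "v \<in> Arr S" "Cod S u = pt y" "Cod S v = pt y" "Dom S u = Dom S v" "?d \<cdot> u = ?d \<cdot> v"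
      have s4: "(?d \<cdot> f) \<cdot> s = ?d" using s fa cd by simp
      have "(?d \<cdot> f) \<cdot> (s \<cdot> u) = ?d \<cdot> u" "(?d \<cdot> f) \<cdot> (s \<cdot> v) = ?d \<cdot> v"
        by (rule extend_eq1[OF s4]; use s(1-3) fa cd uv(1-4) in simp)+
      then have "?d \<cdot> (f \<cdot> (s \<cdot> u)) = ?d \<cdot> (f \<cdot> (s \<cdot> v))" using uv s(1-3) fa cd by simp
      then have "?e \<cdot> (w \<cdot> (s \<cdot> u)) = ?e \<cdot> (w \<cdot> (s \<cdot> v))"
        by (intro coeq) (use uv(1-5) s(1-3) in auto)
      then show "?e \<cdot> ((w \<cdot> s) \<cdot> u) = ?e \<cdot> ((w \<cdot> s) \<cdot> v)" using uv(1-5) wa s(1-3) by simp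
    qed
    have cz: "Cod D \<tau> = z" using w(1) by simp
    show "\<exists>!\<eta>. \<eta> \<in> hom D (Cod D (ar x y f)) (Cod D \<tau>) \<and> \<eta> \<cdot>\<^bsub>D\<^esub> ar x y f = \<tau>"
      unfolding cz
    proof (rule ex1I)
      have "?e \<cdot> (w \<cdot> (s \<cdot> f)) = ?e \<cdot> (w \<cdot> Id S (pt x))"
      proof (rule coeq)
        have s4: "(?d \<cdot> f) \<cdot> s = ?d" using s fa cd by simp
        have "(?d \<cdot> f) \<cdot> (s \<cdot> f) = ?d \<cdot> f" by (rule extend_eq1[OF s4]; use s(1-3) fa cd in simp)
        then show "?d \<cdot> (f \<cdot> (s \<cdot> f)) = ?d \<cdot> (f \<cdot> Id S (pt x))" using s(1-3) fa cd by simp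
      qed (use s(1-3) fa cd in auto)
      then have "ar x z ((w \<cdot> s) \<cdot> f) = ar x z w"
        using ar_eq_iff[OF o(1) w(3) kmap_comp[OF o w(3) f h] w(2)] wa s(1-3) fa by simp
      then show "ar y z (w \<cdot> s) \<in> hom D (Cod D (ar x y f)) z \<and> ar y z (w \<cdot> s) \<cdot>\<^bsub>D\<^esub> ar x y f = \<tau>"
        using ar_comp[OF o w(3) f h] h o f w by simp
      fix \<eta> assume "\<eta> \<in> hom D (Cod D (ar x y f)) z \<and> \<eta> \<cdot>\<^bsub>D\<^esub> ar x y f = \<tau>"
      then have n: "\<eta> \<in> Arr D" "Dom D \<eta> = y" "Cod D \<eta> = z" "\<eta> \<cdot>\<^bsub>D\<^esub> ar x y f = ar x z ((w \<cdot> s) \<cdot> f)"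
        using o f w(1) \<open>ar x z ((w \<cdot> s) \<cdot> f) = ar x z w\<close> by auto
      obtain v where v: "\<eta> = ar y z v" "kmap y z v" using arE[OF n(1)] n by metis
      have "ar x z (v \<cdot> f) = ar x z ((w \<cdot> s) \<cdot> f)" using n(4) ar_comp[OF o w(3) f v(2)] v(1) by simp
      then have "?e \<cdot> (v \<cdot> f) = ?e \<cdot> ((w \<cdot> s) \<cdot> f)"
        using ar_eq_iff[OF o(1) w(3) kmap_comp[OF o w(3) f v(2)] kmap_comp[OF o w(3) f h]] by simp
      then have "?e \<cdot> v = ?e \<cdot> (w \<cdot> s)" by (rule epi[OF v(2) h w(3)])
      then show "\<eta> = ar y z (w \<cdot> s)" using ar_eq_iff[OF o(2) w(3) v(2) h] v(1) by simp
    qed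
  qed (use ko o f in auto)
  then show ?thesis unfolding regular_epi_def by blast
qed

text \<open>Images in \<open>D\<close> exist by construction: the image of \<open>[f]\<close> is the object given by the
  composite \<open>d \<cdot> f\<close>.\<close>

lemma image_D:
  assumes o: "x \<in> Ob D" "y \<in> Ob D" and f: "kmap x y f"
  defines "z \<equiv> ob (dp_incl y \<cdot> f)"
  shows "z \<in> Ob D" "kmap x z (Id S (pt x))" "kmap z y f" "regular_epi D (ar x z (Id S (pt x)))"
    "monic D (ar z y f)" "ar z y f \<cdot>\<^bsub>D\<^esub> ar x z (Id S (pt x)) = ar x y f"
proof -
  note fa = kmapD(1-3)[OF f]
  have d: "dp_incl y \<in> Arr S" "dp_incl z = dp_incl y \<cdot> f" using o by (auto simp: z_def)
  have pz: "pt z = pt x" using d fa by simp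
  show z: "z \<in> Ob D" using d fa by (simp add: z_def)
  show e: "kmap x z (Id S (pt x))"
  proof (rule kmapI)
    fix u v assume uv: "u \<in> Arr S" "v \<in> Arr S" "Cod S u = pt x" "Cod S v = pt x" "Dom S u = Dom S v"
      "dp_incl x \<cdot> u = dp_incl x \<cdot> v"
    show "dp_incl z \<cdot> (Id S (pt x) \<cdot> u) = dp_incl z \<cdot> (Id S (pt x) \<cdot> v)"
      using kmapD(4)[OF f uv(6,1-5)] uv(1-4) d fa by simp
  qed (use o pz in auto)
  show m: "kmap z y f"
    by (rule kmapI) (use d o fa pz in auto)
  show "regular_epi D (ar x z (Id S (pt x)))"
    by (rule section_regular_epi[OF o(1) z e, of "Id S (pt x)"]) (use d o fa pz in auto)
  show "monic D (ar z y f)" unfolding monic_D_iff[OF z o(2) m] using d fa pz by auto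
  show "ar z y f \<cdot>\<^bsub>D\<^esub> ar x z (Id S (pt x)) = ar x y f"
    using ar_comp[OF o(1) z o(2) e m] fa by simp
qed

lemma regular_epi_D_iff:
  assumes o: "x \<in> Ob D" "y \<in> Ob D" and f: "kmap x y f"
  shows "regular_epi D (ar x y f) \<longleftrightarrow>
    (\<exists>s\<in>Arr S. Dom S s = pt y \<and> Cod S s = pt x \<and> dp_incl y \<cdot> (f \<cdot> s) = dp_incl y)"
proof
  assume r: "regular_epi D (ar x y f)"
  let ?z = "ob (dp_incl y \<cdot> f)"
  note im = image_D[OF o f]
  note fa = kmapD(1-3)[OF f]
  have d: "dp_incl y \<in> Arr S" "pt ?z = pt x" using o fa by auto
  have "iso D (ar ?z y f)"
    by (rule D.regular_epi_extremal[of _ "ar x ?z (Id S (pt x))"]) (use im r o in auto)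
  then obtain \<sigma> where "inverse_arrows D (ar ?z y f) \<sigma>" unfolding iso_def by blast
  then have s: "\<sigma> \<in> Arr D" "Dom D \<sigma> = y" "Cod D \<sigma> = ?z" "ar ?z y f \<cdot>\<^bsub>D\<^esub> \<sigma> = Id D y"
    unfolding inverse_arrows_def by simp_all
  obtain s where s': "\<sigma> = ar y ?z s" "kmap y ?z s" using arE[OF s(1)] s by metis
  have "ar y y (f \<cdot> s) = ar y y (Id S (pt y))" using s(4) ar_comp[OF o(2) im(1) o(2) s'(2) im(3)] s'(1) by (simp add: Id_D)
  then have "dp_incl y \<cdot> (f \<cdot> s) = dp_incl y"
    using ar_eq_iff[OF o(2,2) kmap_comp[OF o(2) im(1) o(2) s'(2) im(3)] kmap_Id[OF o(2)]] d by simp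
  then show "\<exists>s\<in>Arr S. Dom S s = pt y \<and> Cod S s = pt x \<and> dp_incl y \<cdot> (f \<cdot> s) = dp_incl y"
    using kmapD(1-3)[OF s'(2)] d by auto
next
  assume "\<exists>s\<in>Arr S. Dom S s = pt y \<and> Cod S s = pt x \<and> dp_incl y \<cdot> (f \<cdot> s) = dp_incl y"
  then show "regular_epi D (ar x y f)" using section_regular_epi[OF o f] by blast
qed

lemma cov_regular_epi: assumes "x \<in> Ob D" shows "regular_epi D (cov x)"
  unfolding cov_def by (rule section_regular_epi[of _ _ _ "Id S (pt x)"]) (use assms in auto)

lemma emb_monic: assumes "x \<in> Ob D" shows "monic D (emb x)"
  unfolding emb_def using assms by (subst monic_D_iff) auto

lemma terminal_D: assumes T: "is_terminal S T" shows "is_terminal D (jo T)"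
  unfolding is_terminal_def
proof (intro conjI ballI)
  have To: "T \<in> Ob S" using T by (rule terminal_Ob)
  then show jT: "jo T \<in> Ob D" by simp
  fix x assume x: "x \<in> Ob D"
  obtain t where t: "t \<in> Arr S" "Dom S t = pt x" "Cod S t = T" using terminal_ex[OF T, of "pt x"] x by auto
  have tm: "kmap x (jo T) t" if "t \<in> Arr S" "Dom S t = pt x" "Cod S t = T" for t
    by (rule kmapI) (use that To x in \<open>auto intro!: terminal_unique[OF T]\<close>)
  show "\<exists>!f. f \<in> hom D x (jo T)"
  proof (rule ex1I)
    show "ar x (jo T) t \<in> hom D x (jo T)" using tm[OF t] x jT by simp
    fix f assume "f \<in> hom D x (jo T)"
    then obtain u where u: "f = ar x (jo T) u" "kmap x (jo T) u" using arE[of f] by (metis hom_iff)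
    have "u = t" by (rule terminal_unique[OF T]) (use kmapD(1-3)[OF u(2)] t To in auto)
    then show "f = ar x (jo T) t" using u by simp
  qed
qed

text \<open>The arrow into the product of the codomains equips the weak pullback with the joint kernel of
  its two projections. This kernel provides the uniqueness that the weak pullback lacks.\<close>

lemma pullback_D:
  assumes o: "x \<in> Ob D" "y \<in> Ob D" "z \<in> Ob D" and f: "kmap x z f" and g: "kmap y z g"
    and w: "is_weak_pullback S (dp_incl z \<cdot> f) (dp_incl z \<cdot> g) p q"
  defines "v \<equiv> ob (pair S (dp_incl x \<cdot> p) (dp_incl y \<cdot> q))"
  shows "v \<in> Ob D" "pt v = Dom S p" "kmap v x p" "kmap v y q"
    "is_pullback D (ar x z f) (ar y z g) (ar v x p) (ar v y q)"
proof -
  let ?c = "dp_incl x" and ?d = "dp_incl y" and ?e = "dp_incl z"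
  note fa = kmapD(1-3)[OF f] and ga = kmapD(1-3)[OF g]
  have cd: "?c \<in> Arr S" "?d \<in> Arr S" "?e \<in> Arr S" using o by auto
  have pq: "p \<in> Arr S" "q \<in> Arr S" "Dom S q = Dom S p" "Cod S p = pt x" "Cod S q = pt y"
    "?e \<cdot> (f \<cdot> p) = ?e \<cdot> (g \<cdot> q)"
    using weak_pullback_square[OF w] fa ga cd by (auto simp: commuting_square_def)
  let ?i = "pair S (?c \<cdot> p) (?d \<cdot> q)"
  have i: "?i \<in> Arr S" "Dom S ?i = Dom S p" "Cod S ?i = prd S (Cod S ?c) (Cod S ?d)"
    "dp_incl v = ?i" using pq cd by (auto simp: v_def)
  \<comment> \<open>equality after the pairing is equality in both coordinates\<close>
  have ieq: "?i \<cdot> a = ?i \<cdot> b \<longleftrightarrow> ?c \<cdot> (p \<cdot> a) = ?c \<cdot> (p \<cdot> b) \<and> ?d \<cdot> (q \<cdot> a) = ?d \<cdot> (q \<cdot> b)"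
    if ab: "a \<in> Arr S" "b \<in> Arr S" "Cod S a = Dom S p" "Cod S b = Dom S p" "Dom S a = Dom S b" for a b
  proof -
    have *: "pr1 S (Cod S ?c) (Cod S ?d) \<cdot> (?i \<cdot> a) = ?c \<cdot> (p \<cdot> a)" "pr2 S (Cod S ?c) (Cod S ?d) \<cdot> (?i \<cdot> a) = ?d \<cdot> (q \<cdot> a)"
      if "a \<in> Arr S" "Cod S a = Dom S p" for a using that pq cd by (auto simp: pr_pair_comp)
    show ?thesis
    proof
      assume "?i \<cdot> a = ?i \<cdot> b"
      then show "?c \<cdot> (p \<cdot> a) = ?c \<cdot> (p \<cdot> b) \<and> ?d \<cdot> (q \<cdot> a) = ?d \<cdot> (q \<cdot> b)"
        using *[OF ab(1,3)] *[OF ab(2,4)] by metis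
    next
      assume h: "?c \<cdot> (p \<cdot> a) = ?c \<cdot> (p \<cdot> b) \<and> ?d \<cdot> (q \<cdot> a) = ?d \<cdot> (q \<cdot> b)"
      show "?i \<cdot> a = ?i \<cdot> b"
      proof (rule prd_eqI)
        show "pr1 S (Cod S ?c) (Cod S ?d) \<cdot> (?i \<cdot> a) = pr1 S (Cod S ?c) (Cod S ?d) \<cdot> (?i \<cdot> b)"
          unfolding *[OF ab(1,3)] *[OF ab(2,4)] using h by blast
        show "pr2 S (Cod S ?c) (Cod S ?d) \<cdot> (?i \<cdot> a) = pr2 S (Cod S ?c) (Cod S ?d) \<cdot> (?i \<cdot> b)"
          unfolding *[OF ab(1,3)] *[OF ab(2,4)] using h by blast
      qed (use ab i cd in auto)
    qed
  qed
  show vo: "v \<in> Ob D" using i by (simp add: v_def)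
  show vp: "pt v = Dom S p" using i by simp
  show mpp: "kmap v x p" by (rule kmapI) (use pq vp i ieq in auto)
  show mpq: "kmap v y q" by (rule kmapI) (use pq vp i ieq in auto)
  show "is_pullback D (ar x z f) (ar y z g) (ar v x p) (ar v y q)"
  proof (rule D.pullbackI)
    have "ar v z (f \<cdot> p) = ar v z (g \<cdot> q)"
      using ar_eq_iff[OF vo o(3) kmap_comp[OF vo o(1,3) mpp f] kmap_comp[OF vo o(2,3) mpq g]] pq by simp
    then show "commuting_square D (ar x z f) (ar y z g) (ar v x p) (ar v y q)"
      using o f g vo mpp mpq by (simp add: commuting_square_def)
  next
    fix \<alpha> \<beta> assume ab: "\<alpha> \<in> Arr D" "\<beta> \<in> Arr D" "Dom D \<alpha> = Dom D \<beta>" "Cod D \<alpha> = Dom D (ar x z f)"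
      "Cod D \<beta> = Dom D (ar y z g)" "ar x z f \<cdot>\<^bsub>D\<^esub> \<alpha> = ar y z g \<cdot>\<^bsub>D\<^esub> \<beta>"
    have c: "Cod D \<alpha> = x" "Cod D \<beta> = y" using ab(4,5) by auto
    obtain t a where a: "\<alpha> = ar t x a" "kmap t x a" "t \<in> Ob D" using arE'[OF ab(1)] c Dom_Cod_ar by metis
    obtain b where b: "\<beta> = ar t y b" "kmap t y b" using arE'[OF ab(2)] ab(3) c a(1) Dom_Cod_ar by metis
    note aa = kmapD(1-3)[OF a(2)] and ba = kmapD(1-3)[OF b(2)]
    have "ar t z (f \<cdot> a) = ar t z (g \<cdot> b)"
      using ab(6) ar_comp[OF a(3) o(1,3) a(2) f] ar_comp[OF a(3) o(2,3) b(2) g] a(1) b(1) by metis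
    then have e: "?e \<cdot> (f \<cdot> a) = ?e \<cdot> (g \<cdot> b)"
      using ar_eq_iff[OF a(3) o(3) kmap_comp[OF a(3) o(1,3) a(2) f] kmap_comp[OF a(3) o(2,3) b(2) g]] by simp
    obtain h where h: "h \<in> Arr S" "Dom S h = Dom S a" "Cod S h = Dom S p" "p \<cdot> h = a" "q \<cdot> h = b"
      by (rule weak_pullbackE[OF w aa(1) ba(1)]) (use aa ba e fa ga cd in auto)
    have mh: "kmap t v h"
    proof (rule kmapI)
      show "h \<in> Arr S" "Dom S h = pt t" "Cod S h = pt v" using h aa vp by auto
      fix r s assume rs: "r \<in> Arr S" "s \<in> Arr S" "Cod S r = pt t" "Cod S s = pt t" "Dom S r = Dom S s"
        "dp_incl t \<cdot> r = dp_incl t \<cdot> s"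
      have pr: "p \<cdot> (h \<cdot> r) = a \<cdot> r" "p \<cdot> (h \<cdot> s) = a \<cdot> s"
        by (rule extend_eq1[OF h(4)]; use h(1-3) aa pq rs(1-4) in simp)+
      have qr: "q \<cdot> (h \<cdot> r) = b \<cdot> r" "q \<cdot> (h \<cdot> s) = b \<cdot> s"
        by (rule extend_eq1[OF h(5)]; use h(1-3) aa pq rs(1-4) in simp)+
      have "?i \<cdot> (h \<cdot> r) = ?i \<cdot> (h \<cdot> s)"
        by (rule ieq[THEN iffD2])
          (use h(1-3) aa rs(1-5) kmapD(4)[OF a(2) rs(6,1-5)] kmapD(4)[OF b(2) rs(6,1-5)] in \<open>auto simp: pr qr\<close>)
      then show "dp_incl v \<cdot> (h \<cdot> r) = dp_incl v \<cdot> (h \<cdot> s)" using i by simp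
    qed
    show "\<exists>\<eta>. \<eta> \<in> hom D (Dom D \<alpha>) (Dom D (ar v x p)) \<and> ar v x p \<cdot>\<^bsub>D\<^esub> \<eta> = \<alpha> \<and> ar v y q \<cdot>\<^bsub>D\<^esub> \<eta> = \<beta>"
    proof (intro exI conjI)
      show "ar t v h \<in> hom D (Dom D \<alpha>) (Dom D (ar v x p))" using mh vo a(3) o mpp a(1) by simp
      show "ar v x p \<cdot>\<^bsub>D\<^esub> ar t v h = \<alpha>" using ar_comp[OF a(3) vo o(1) mh mpp] h(4) a(1) by simp
      show "ar v y q \<cdot>\<^bsub>D\<^esub> ar t v h = \<beta>" using ar_comp[OF a(3) vo o(2) mh mpq] h(5) b(1) by simp
    qed
  next
    fix \<alpha> \<beta> assume ab: "\<alpha> \<in> Arr D" "\<beta> \<in> Arr D" "Cod D \<alpha> = Dom D (ar v x p)" "Cod D \<beta> = Dom D (ar v x p)"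
      "Dom D \<alpha> = Dom D \<beta>" "ar v x p \<cdot>\<^bsub>D\<^esub> \<alpha> = ar v x p \<cdot>\<^bsub>D\<^esub> \<beta>" "ar v y q \<cdot>\<^bsub>D\<^esub> \<alpha> = ar v y q \<cdot>\<^bsub>D\<^esub> \<beta>"
    have c: "Cod D \<alpha> = v" "Cod D \<beta> = v" using ab(3,4) by auto
    obtain t a where a: "\<alpha> = ar t v a" "kmap t v a" "t \<in> Ob D" using arE'[OF ab(1)] c Dom_Cod_ar by metis
    obtain b where b: "\<beta> = ar t v b" "kmap t v b" using arE'[OF ab(2)] ab(5) c a(1) Dom_Cod_ar by metis
    note aa = kmapD(1-3)[OF a(2)] and ba = kmapD(1-3)[OF b(2)]
    have "ar t x (p \<cdot> a) = ar t x (p \<cdot> b)"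
      using ab(6) ar_comp[OF a(3) vo o(1) a(2) mpp] ar_comp[OF a(3) vo o(1) b(2) mpp] a(1) b(1) by metis
    then have 1: "?c \<cdot> (p \<cdot> a) = ?c \<cdot> (p \<cdot> b)"
      using ar_eq_iff[OF a(3) o(1) kmap_comp[OF a(3) vo o(1) a(2) mpp] kmap_comp[OF a(3) vo o(1) b(2) mpp]] by simp
    have "ar t y (q \<cdot> a) = ar t y (q \<cdot> b)"
      using ab(7) ar_comp[OF a(3) vo o(2) a(2) mpq] ar_comp[OF a(3) vo o(2) b(2) mpq] a(1) b(1) by metis
    then have 2: "?d \<cdot> (q \<cdot> a) = ?d \<cdot> (q \<cdot> b)"
      using ar_eq_iff[OF a(3) o(2) kmap_comp[OF a(3) vo o(2) a(2) mpq] kmap_comp[OF a(3) vo o(2) b(2) mpq]] by simp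
    have "?i \<cdot> a = ?i \<cdot> b" using ieq[OF aa(1) ba(1)] aa ba vp 1 2 by simp
    then have "ar t v a = ar t v b" using ar_eq_iff[OF a(3) vo a(2) b(2)] i by simp
    then show "\<alpha> = \<beta>" using a(1) b(1) by simp
  qed
qed

lemma pullback_D_ex:
  assumes "\<phi> \<in> Arr D" "\<gamma> \<in> Arr D" "Cod D \<phi> = Cod D \<gamma>"
  obtains x y z f g p q where "x \<in> Ob D" "y \<in> Ob D" "z \<in> Ob D" "kmap x z f" "kmap y z g"
    "\<phi> = ar x z f" "\<gamma> = ar y z g" "is_weak_pullback S (dp_incl z \<cdot> f) (dp_incl z \<cdot> g) p q"
proof -
  obtain x z f where f: "\<phi> = ar x z f" "kmap x z f" "x \<in> Ob D" "z \<in> Ob D" using arE'[OF assms(1)] by metis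
  obtain y g where g: "\<gamma> = ar y z g" "kmap y z g" "y \<in> Ob D" using arE'[OF assms(2)] assms(3) f(1) Dom_Cod_ar by metis
  obtain p q where "is_weak_pullback S (dp_incl z \<cdot> f) (dp_incl z \<cdot> g) p q"
    using wpb_ex[of "dp_incl z \<cdot> f" "dp_incl z \<cdot> g"] kmapD(1-3)[OF f(2)] kmapD(1-3)[OF g(2)] f(4)
    by (metis comp_simps(1,3) incl_Arr)
  then show thesis using that f g by metis
qed

lemma regular_D: "regular_category D"
  unfolding regular_category_def
proof (intro conjI ballI allI impI; (elim conjE)?)
  show "category D" by (rule D.category_axioms)
  have "has_pullbacks D"
    unfolding has_pullbacks_def by (metis pullback_D(5) pullback_D_ex)
  moreover obtain T where "is_terminal S T" using cart by (auto simp: cartesian_category_def)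
  ultimately show "has_finite_limits D" unfolding has_finite_limits_def using terminal_D by blast
next
  fix \<phi> assume "\<phi> \<in> Arr D"
  then obtain x y f where f: "\<phi> = ar x y f" "kmap x y f" "x \<in> Ob D" "y \<in> Ob D" by (rule arE')
  note im = image_D[OF f(3,4,2)]
  show "\<exists>e m. regular_epi D e \<and> monic D m \<and> Cod D e = Dom D m \<and> \<phi> = m \<cdot>\<^bsub>D\<^esub> e"
    using im f by (intro exI[of _ "ar x (ob (dp_incl y \<cdot> f)) (Id S (pt x))"] exI[of _ "ar (ob (dp_incl y \<cdot> f)) y f"]) simp
next
  fix \<phi> \<gamma> \<pi> \<kappa> assume pb: "is_pullback D \<phi> \<gamma> \<pi> \<kappa>" and r: "regular_epi D \<gamma>"
  have sq: "\<phi> \<in> Arr D" "\<gamma> \<in> Arr D" "\<pi> \<in> Arr D" "Cod D \<phi> = Cod D \<gamma>" "Cod D \<pi> = Dom D \<phi>"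
    using D.pullback_square[OF pb] by (auto simp: commuting_square_def)
  obtain x y z f g p q where o: "x \<in> Ob D" "y \<in> Ob D" "z \<in> Ob D" and f: "kmap x z f" and g: "kmap y z g"
    and fg: "\<phi> = ar x z f" "\<gamma> = ar y z g" and w: "is_weak_pullback S (dp_incl z \<cdot> f) (dp_incl z \<cdot> g) p q"
    using pullback_D_ex[OF sq(1,2,4)] by metis
  note fa = kmapD(1-3)[OF f] and ga = kmapD(1-3)[OF g]
  note P = pullback_D[OF o f g w]
  let ?v = "ob (pair S (dp_incl x \<cdot> p) (dp_incl y \<cdot> q))"
  obtain s where s: "s \<in> Arr S" "Dom S s = pt z" "Cod S s = pt y" "dp_incl z \<cdot> (g \<cdot> s) = dp_incl z"
    using r regular_epi_D_iff[OF o(2,3) g] fg by auto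
  have s4: "(dp_incl z \<cdot> g) \<cdot> s = dp_incl z" using s ga o by simp
  have sf: "(dp_incl z \<cdot> g) \<cdot> (s \<cdot> f) = dp_incl z \<cdot> f"
    by (rule extend_eq1[OF s4]) (use s(1-3) fa ga o in auto)
  obtain h where h: "h \<in> Arr S" "Dom S h = pt x" "Cod S h = Dom S p" "p \<cdot> h = Id S (pt x)"
    by (rule weak_pullbackE[OF w, of "Id S (pt x)" "s \<cdot> f"]) (use sf s(1-3) fa ga o in auto)
  have "commuting_square D \<phi> \<gamma> (ar ?v x p) (ar ?v y q)" using D.pullback_square[OF P(5)] fg by simp
  then have pq': "ar ?v x p \<in> Arr D" "ar ?v y q \<in> Arr D" "Dom D (ar ?v x p) = Dom D (ar ?v y q)"
    "Cod D (ar ?v x p) = Dom D \<phi>" "Cod D (ar ?v y q) = Dom D \<gamma>"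
    "\<phi> \<cdot>\<^bsub>D\<^esub> ar ?v x p = \<gamma> \<cdot>\<^bsub>D\<^esub> ar ?v y q"
    unfolding commuting_square_def by blast+
  obtain \<tau> where t: "\<tau> \<in> Arr D" "Dom D \<tau> = Dom D (ar ?v x p)" "Cod D \<tau> = Dom D \<pi>" "\<pi> \<cdot>\<^bsub>D\<^esub> \<tau> = ar ?v x p"
    by (rule D.weak_pullbackE[OF D.pullback_weak[OF pb] pq'])
  have cx: "Cod D \<pi> = x" using sq(5) fg by simp
  obtain w a where a: "\<pi> = ar w x a" "kmap w x a" "w \<in> Ob D" using arE'[OF sq(3)] cx Dom_Cod_ar by metis
  obtain b where b: "\<tau> = ar ?v w b" "kmap ?v w b" using arE'[OF t(1)] t(2,3) a(1) Dom_Cod_ar by metis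
  note aa = kmapD(1-3)[OF a(2)] and ba = kmapD(1-3)[OF b(2)]
  have "ar ?v x (a \<cdot> b) = ar ?v x p" using t(4) ar_comp[OF P(1) a(3) o(1) b(2) a(2)] a(1) b(1) by metis
  then have ab: "dp_incl x \<cdot> (a \<cdot> b) = dp_incl x \<cdot> p"
    using ar_eq_iff[OF P(1) o(1) kmap_comp[OF P(1) a(3) o(1) b(2) a(2)] P(3)] by simp
  have pq: "p \<in> Arr S" "Cod S p = pt x" using kmapD[OF P(3)] by auto
  have bd: "Dom S b = Dom S p" using ba P(2) by simp
  have "(dp_incl x \<cdot> (a \<cdot> b)) \<cdot> h = (dp_incl x \<cdot> p) \<cdot> h" unfolding ab ..
  then have "dp_incl x \<cdot> (a \<cdot> (b \<cdot> h)) = dp_incl x" using aa ba(1,3) bd h pq o by simp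
  then show "regular_epi D \<pi>" unfolding a(1) regular_epi_D_iff[OF a(3) o(1) a(2)]
    using aa ba(1,3) bd h(1-3) by (intro bexI[of _ "b \<cdot> h"]) auto
qed

sublocale D: regular_cat D
  using regular_D by (rule regular_catI)

text \<open>The limit \<open>M\<close> of a diagram from \<open>S\<close> is covered by some \<open>J X\<close>. As \<open>J\<close> is full and faithful, the resulting
  cone lies in \<open>S\<close> and factors through the weak limit \<open>W\<close>; hence the cover of \<open>M\<close> factors
  through \<open>k\<close>, and a last factor of a regular epimorphism is one.\<close>

lemma J_left_covering: "left_covering S D J"
  unfolding left_covering_def
proof (intro conjI J_functor allI impI; (elim conjE)?)
  fix I :: "(nat, nat) cat" and L W \<pi> M \<mu> k
  assume I: "category I" and L: "is_functor I S L" and W: "is_weak_limit I S L W \<pi>"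
    and M: "is_limit I D (comp_functor J L) M \<mu>" and k: "k \<in> hom D (onOb J W) M"
    and k\<pi>: "\<forall>j\<in>Ob I. \<mu> j \<cdot>\<^bsub>D\<^esub> k = onArr J (\<pi> j)"
  interpret I: category I by (rule I)
  note [simp del] = J_simps(2)
  note l = functorD(3-)[OF L]
  have cW: "W \<in> Ob S" "\<And>j. j \<in> Ob I \<Longrightarrow> \<pi> j \<in> Arr S \<and> Dom S (\<pi> j) = W \<and> Cod S (\<pi> j) = onOb L j"
    using W by (auto simp: is_weak_limit_def is_cone_def)
  have cM: "M \<in> Ob D" "\<And>j. j \<in> Ob I \<Longrightarrow> \<mu> j \<in> Arr D \<and> Dom D (\<mu> j) = M \<and> Cod D (\<mu> j) = jo (onOb L j)"
      "\<And>f. f \<in> Arr I \<Longrightarrow> onArr J (onArr L f) \<cdot>\<^bsub>D\<^esub> \<mu> (Dom I f) = \<mu> (Cod I f)"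
    using M by (auto simp: is_limit_def is_cone_def)
  let ?X = "pt M"
  have X: "?X \<in> Ob S" using cM(1) by simp
  have "\<exists>f. f \<in> Arr S \<and> Dom S f = ?X \<and> Cod S f = onOb L j \<and> onArr J f = \<mu> j \<cdot>\<^bsub>D\<^esub> cov M" if j: "j \<in> Ob I" for j
    by (rule J_full[of "\<mu> j \<cdot>\<^bsub>D\<^esub> cov M" ?X "onOb L j"]) (use j cM l X in auto)
  then obtain \<rho> where r: "\<And>j. j \<in> Ob I \<Longrightarrow> \<rho> j \<in> Arr S \<and> Dom S (\<rho> j) = ?X \<and> Cod S (\<rho> j) = onOb L j \<and>
      onArr J (\<rho> j) = \<mu> j \<cdot>\<^bsub>D\<^esub> cov M" by metis
  note Js = functorD(3-)[OF J_functor]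
  have "is_cone I S L ?X \<rho>"
    unfolding is_cone_def
  proof (intro conjI ballI)
    fix f assume f: "f \<in> Arr I"
    let ?a = "Dom I f" and ?b = "Cod I f"
    have ab: "?a \<in> Ob I" "?b \<in> Ob I" using f by auto
    have Lf: "onArr L f \<in> Arr S" "Dom S (onArr L f) = onOb L ?a" "Cod S (onArr L f) = onOb L ?b" using l f by auto
    have "onArr J (onArr L f \<cdot> \<rho> ?a) = onArr J (onArr L f) \<cdot>\<^bsub>D\<^esub> (\<mu> ?a \<cdot>\<^bsub>D\<^esub> cov M)"
      using Js(6)[of "\<rho> ?a" "onArr L f"] r[OF ab(1)] Lf by simp
    also have "\<dots> = \<mu> ?b \<cdot>\<^bsub>D\<^esub> cov M"
      by (rule D.extend_eq1[OF cM(3)[OF f]]) (use cM(1) cM(2)[OF ab(1)] Js(2,3,4)[OF Lf(1)] Lf in \<open>auto\<close>)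
    finally have e: "onArr J (onArr L f \<cdot> \<rho> ?a) = onArr J (\<rho> ?b)" using r[OF ab(2)] by simp
    show "onArr L f \<cdot> \<rho> ?a = \<rho> ?b"
      by (rule J_faithful[OF _ _ e]) (use r[OF ab(1)] r[OF ab(2)] Lf in auto)
  qed (use X r in auto)
  then have "\<exists>h. h \<in> hom S ?X W \<and> (\<forall>j\<in>Ob I. \<pi> j \<cdot> h = \<rho> j)"
    using W unfolding is_weak_limit_def by blast
  then obtain h where h: "h \<in> Arr S" "Dom S h = ?X" "Cod S h = W" "\<And>j. j \<in> Ob I \<Longrightarrow> \<pi> j \<cdot> h = \<rho> j"
    by auto
  have Jh: "onArr J h \<in> Arr D" "Dom D (onArr J h) = jo ?X" "Cod D (onArr J h) = jo W" using Js h by (auto)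
  have ka: "k \<in> Arr D" "Dom D k = jo W" "Cod D k = M" using k by auto
  have cone: "is_cone I D (comp_functor J L) (jo ?X) (\<lambda>j. \<mu> j \<cdot>\<^bsub>D\<^esub> cov M)"
    unfolding is_cone_def
  proof (intro conjI ballI)
    fix f assume f: "f \<in> Arr I"
    have ab: "Dom I f \<in> Ob I" "onArr L f \<in> Arr S" using f l by auto
    show "onArr (comp_functor J L) f \<cdot>\<^bsub>D\<^esub> (\<mu> (Dom I f) \<cdot>\<^bsub>D\<^esub> cov M) = \<mu> (Cod I f) \<cdot>\<^bsub>D\<^esub> cov M"
      unfolding comp_functor_simps
      by (rule D.extend_eq1[OF cM(3)[OF f]]) (use cM(1) cM(2)[OF ab(1)] Js(2,3,4)[OF ab(2)] l f in \<open>auto\<close>)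
  qed (use X cM in auto)
  then have "\<exists>!h. h \<in> hom D (jo ?X) M \<and> (\<forall>j\<in>Ob I. \<mu> j \<cdot>\<^bsub>D\<^esub> h = \<mu> j \<cdot>\<^bsub>D\<^esub> cov M)"
    using M unfolding is_limit_def by blast
  moreover have "k \<cdot>\<^bsub>D\<^esub> onArr J h \<in> hom D (jo ?X) M" using ka Jh by simp
  moreover have "\<mu> j \<cdot>\<^bsub>D\<^esub> (k \<cdot>\<^bsub>D\<^esub> onArr J h) = \<mu> j \<cdot>\<^bsub>D\<^esub> cov M" if j: "j \<in> Ob I" for j
  proof -
    have "\<mu> j \<cdot>\<^bsub>D\<^esub> (k \<cdot>\<^bsub>D\<^esub> onArr J h) = onArr J (\<pi> j) \<cdot>\<^bsub>D\<^esub> onArr J h"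
      by (rule D.extend_eq1[OF k\<pi>[rule_format, OF j]]) (use ka Jh cM(2)[OF j] in auto)
    also have "\<dots> = onArr J (\<rho> j)" using Js(6)[of h "\<pi> j"] h(1-3) h(4)[OF j] cW(2)[OF j] by simp
    finally show ?thesis using r[OF j] by simp
  qed
  moreover have "cov M \<in> hom D (jo ?X) M" using cM(1) by simp
  ultimately have "k \<cdot>\<^bsub>D\<^esub> onArr J h = cov M" by blast
  then show "regular_epi D k"
    using D.regular_epi_last_factor[of k "onArr J h"] cov_regular_epi[OF cM(1)] ka Jh by simp
qed

end

section \<open>Descent data are subobjects\<close>

context weak_lex
begin

sublocale SubD: slice_doctrine D "{m. monic D m}" "is_pullback D"
  by (rule D.subobject_slice)

text \<open>Membership in \<open>\<D>es\<close> in terms of generalized elements: \<open>\<alpha>\<close> is closed under the kernel of \<open>x\<close>.\<close>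

definition descent where
  "descent x \<alpha> \<longleftrightarrow> \<alpha> \<in> carrier (Psi.Sub (pt x)) \<and>
     (\<forall>u\<in>Arr S. \<forall>v\<in>Arr S. Cod S u = pt x \<and> Cod S v = pt x \<and> Dom S u = Dom S v \<and>
        dp_incl x \<cdot> u = dp_incl x \<cdot> v \<longrightarrow> belongs S \<alpha> u \<longrightarrow> belongs S \<alpha> v)"

lemma descentD:
  assumes "descent x \<alpha>"
  shows "\<alpha> \<in> carrier (Psi.Sub (pt x))"
    "\<lbrakk>dp_incl x \<cdot> u = dp_incl x \<cdot> v; belongs S \<alpha> u; u \<in> Arr S; v \<in> Arr S; Cod S u = pt x; Cod S v = pt x;
      Dom S u = Dom S v\<rbrakk> \<Longrightarrow> belongs S \<alpha> v"
  using assms unfolding descent_def by blast+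

lemma Des_iff:
  assumes x: "x \<in> Ob D"
  shows "\<alpha> \<in> Des Psi (pt x) (ker Psi (dp_incl x)) \<longleftrightarrow> descent x \<alpha>"
proof (cases "\<alpha> \<in> carrier (Psi.Sub (pt x))")
  case a: True
  let ?X = "pt x" and ?c = "dp_incl x"
  let ?XX = "prd S ?X ?X" and ?p = "pr1 S ?X ?X" and ?q = "pr2 S ?X ?X"
  have c: "?c \<in> Arr S" and X: "?X \<in> Ob S" "?XX \<in> Ob S" using x by auto
  have pq: "?p \<in> Arr S" "?q \<in> Arr S" "Dom S ?p = ?XX" "Dom S ?q = ?XX" "Cod S ?p = ?X" "Cod S ?q = ?X" using X by auto
  have rc: "re Psi ?p \<alpha> \<in> carrier (Psi.Sub ?XX)" "re Psi ?q \<alpha> \<in> carrier (Psi.Sub ?XX)"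
    unfolding weak_subobjects_slice by (rule Psi.re_closed; use a pq in simp)+
  have b: "belongs S (re Psi ?p \<alpha>) z \<longleftrightarrow> belongs S \<alpha> (?p \<cdot> z)" "belongs S (re Psi ?q \<alpha>) z \<longleftrightarrow> belongs S \<alpha> (?q \<cdot> z)"
    if "z \<in> Arr S" "Cod S z = ?XX" for z
    unfolding weak_subobjects_slice by (rule Psi.belongs_re; use a pq that in simp)+
  note kc = ker_closed[OF c]
  have "\<alpha> \<in> Des Psi ?X (ker Psi ?c) \<longleftrightarrow> re Psi ?p \<alpha> \<sqinter>\<^bsub>Psi.Sub ?XX\<^esub> ker Psi ?c \<sqsubseteq>\<^bsub>Psi.Sub ?XX\<^esub> re Psi ?q \<alpha>"
    using a by (simp add: Des_def Let_def)
  also have "\<dots> \<longleftrightarrow> (\<forall>z\<in>Arr S. Cod S z = ?XX \<longrightarrow>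
      belongs S \<alpha> (?p \<cdot> z) \<and> ?c \<cdot> (?p \<cdot> z) = ?c \<cdot> (?q \<cdot> z) \<longrightarrow> belongs S \<alpha> (?q \<cdot> z))"
    unfolding Psi.le_iff[OF Psi.meet_closed[OF X(2) rc(1) kc] rc(2)]
    using Psi.belongs_meet[OF X(2) rc(1) kc] b belongs_ker[OF c] by simp
  also have "\<dots> \<longleftrightarrow> descent x \<alpha>"
  proof
    assume l: "\<forall>z\<in>Arr S. Cod S z = ?XX \<longrightarrow>
      belongs S \<alpha> (?p \<cdot> z) \<and> ?c \<cdot> (?p \<cdot> z) = ?c \<cdot> (?q \<cdot> z) \<longrightarrow> belongs S \<alpha> (?q \<cdot> z)"
    show "descent x \<alpha>"
      unfolding descent_def
    proof (intro conjI a ballI impI; elim conjE)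
      fix u v assume uv: "u \<in> Arr S" "v \<in> Arr S" "Cod S u = ?X" "Cod S v = ?X" "Dom S u = Dom S v" "?c \<cdot> u = ?c \<cdot> v"
        "belongs S \<alpha> u"
      then have z: "pair S u v \<in> Arr S" "Cod S (pair S u v) = ?XX" "?p \<cdot> pair S u v = u" "?q \<cdot> pair S u v = v"
        by (auto simp: pr_pair)
      show "belongs S \<alpha> v" using l[rule_format, OF z(1,2)] uv(6,7) unfolding z(3,4) by blast
    qed
  next
    assume r: "descent x \<alpha>"
    show "\<forall>z\<in>Arr S. Cod S z = ?XX \<longrightarrow>
      belongs S \<alpha> (?p \<cdot> z) \<and> ?c \<cdot> (?p \<cdot> z) = ?c \<cdot> (?q \<cdot> z) \<longrightarrow> belongs S \<alpha> (?q \<cdot> z)"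
    proof (intro ballI impI; elim conjE)
      fix z assume z: "z \<in> Arr S" "Cod S z = ?XX" "belongs S \<alpha> (?p \<cdot> z)" "?c \<cdot> (?p \<cdot> z) = ?c \<cdot> (?q \<cdot> z)"
      show "belongs S \<alpha> (?q \<cdot> z)" by (rule descentD(2)[OF r z(4,3)]) (use z(1,2) pq in auto)
    qed
  qed
  finally show ?thesis .
qed (simp add: Des_def descent_def Let_def)

lemma base_r [simp]: "base (doctrine_r Psi) = D" by (simp add: doctrine_r_def)

lemma fib_r:
  assumes "x \<in> Ob D"
  shows "fib (doctrine_r Psi) x = (Psi.Sub (pt x))\<lparr>carrier := Collect (descent x)\<rparr>"
proof -
  have "Des Psi (pt x) (ker Psi (dp_incl x)) = Collect (descent x)" using Des_iff[OF assms] by blast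
  then show ?thesis by (cases x) (simp add: doctrine_r_def)
qed

lemma fib_r_simps [simp]:
  assumes "x \<in> Ob D"
  shows "\<alpha> \<in> carrier (fib (doctrine_r Psi) x) \<longleftrightarrow> descent x \<alpha>" "eq (fib (doctrine_r Psi) x) = (=)"
    "\<alpha> \<sqsubseteq>\<^bsub>fib (doctrine_r Psi) x\<^esub> \<beta> \<longleftrightarrow> \<alpha> \<sqsubseteq>\<^bsub>Psi.Sub (pt x)\<^esub> \<beta>"
  using assms by (simp_all add: fib_r)

lemma fib_r_po: assumes "x \<in> Ob D" shows "partial_order (fib (doctrine_r Psi) x)"
proof (rule partial_orderI)
  show "eq (fib (doctrine_r Psi) x) = (=)" using assms by simp
next
  fix \<alpha> assume "\<alpha> \<in> carrier (fib (doctrine_r Psi) x)"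
  then show "\<alpha> \<sqsubseteq>\<^bsub>fib (doctrine_r Psi) x\<^esub> \<alpha>"
    using assms reflD[OF Psi.Sub_po descentD(1)[of x \<alpha>]] by simp
next
  fix \<alpha> \<beta> assume "\<alpha> \<in> carrier (fib (doctrine_r Psi) x)" "\<beta> \<in> carrier (fib (doctrine_r Psi) x)"
    "\<alpha> \<sqsubseteq>\<^bsub>fib (doctrine_r Psi) x\<^esub> \<beta>" "\<beta> \<sqsubseteq>\<^bsub>fib (doctrine_r Psi) x\<^esub> \<alpha>"
  then show "\<alpha> = \<beta>"
    using assms antisymD[OF Psi.Sub_po descentD(1)[of x \<alpha>] descentD(1)[of x \<beta>]] by simp
next
  fix \<alpha> \<beta> \<gamma> assume "\<alpha> \<in> carrier (fib (doctrine_r Psi) x)" "\<beta> \<in> carrier (fib (doctrine_r Psi) x)"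
    "\<gamma> \<in> carrier (fib (doctrine_r Psi) x)"
    "\<alpha> \<sqsubseteq>\<^bsub>fib (doctrine_r Psi) x\<^esub> \<beta>" "\<beta> \<sqsubseteq>\<^bsub>fib (doctrine_r Psi) x\<^esub> \<gamma>"
  then show "\<alpha> \<sqsubseteq>\<^bsub>fib (doctrine_r Psi) x\<^esub> \<gamma>"
    using assms transD[OF Psi.Sub_po _ _ descentD(1)[of x \<alpha>] descentD(1)[of x \<beta>] descentD(1)[of x \<gamma>]] by simp
qed

text \<open>The values at all representatives agree, as \<open>the_elem\<close> requires: two representatives of \<open>[f]\<close> differ by the kernel of
  the codomain, under which \<open>\<beta>\<close> is closed.\<close>

lemma re_r:
  assumes o: "x \<in> Ob D" "y \<in> Ob D" and f: "kmap x y f" and b: "descent y \<beta>"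
  shows "re (doctrine_r Psi) (ar x y f) \<beta> = re Psi f \<beta>"
proof -
  have "re Psi g \<beta> = re Psi f \<beta>" if g: "kmap x y g" "dp_incl y \<cdot> g = dp_incl y \<cdot> f" for g
  proof (rule Psi.Sub_eqI)
    note fa = kmapD(1-3)[OF f] and ga = kmapD(1-3)[OF g(1)]
    show "re Psi g \<beta> \<in> carrier (Psi.Sub (pt x))" "re Psi f \<beta> \<in> carrier (Psi.Sub (pt x))"
      unfolding weak_subobjects_slice by (rule Psi.re_closed; use descentD(1)[OF b] fa ga in simp)+
    fix u assume u: "u \<in> Arr S" "Cod S u = pt x"
    have e: "dp_incl y \<cdot> (g \<cdot> u) = dp_incl y \<cdot> (f \<cdot> u)"
      by (rule extend_eq[OF g(2)]) (use fa ga u o in auto)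
    have "belongs S (re Psi g \<beta>) u \<longleftrightarrow> belongs S \<beta> (g \<cdot> u)"
      unfolding weak_subobjects_slice by (rule Psi.belongs_re) (use descentD(1)[OF b] fa ga u in simp_all)
    also have "\<dots> \<longleftrightarrow> belongs S \<beta> (f \<cdot> u)"
      using descentD(2)[OF b e] descentD(2)[OF b e[symmetric]] fa ga u by auto
    also have "\<dots> \<longleftrightarrow> belongs S (re Psi f \<beta>) u"
      unfolding weak_subobjects_slice by (rule Psi.belongs_re[symmetric]) (use descentD(1)[OF b] fa ga u in simp_all)
    finally show "belongs S (re Psi g \<beta>) u \<longleftrightarrow> belongs S (re Psi f \<beta>) u" .
  qed
  then have "re Psi g \<beta> = re Psi f \<beta>" if "g \<in> dp_class Psi (dp_incl x) (dp_incl y) f" for g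
    using that class_iff[OF o f] by blast
  moreover have "f \<in> dp_class Psi (dp_incl x) (dp_incl y) f" using class_iff[OF o f] f by blast
  ultimately have "(\<lambda>g. re Psi g \<beta>) ` dp_class Psi (dp_incl x) (dp_incl y) f = {re Psi f \<beta>}" by blast
  then show ?thesis by (simp add: doctrine_r_def ar_def)
qed

lemma descent_re:
  assumes o: "x \<in> Ob D" "y \<in> Ob D" and f: "kmap x y f" and b: "descent y \<beta>"
  shows "descent x (re Psi f \<beta>)"
    "\<lbrakk>u \<in> Arr S; Cod S u = pt x\<rbrakk> \<Longrightarrow> belongs S (re Psi f \<beta>) u \<longleftrightarrow> belongs S \<beta> (f \<cdot> u)"
proof -
  note fa = kmapD(1-3)[OF f]
  have br: "belongs S (re Psi f \<beta>) u \<longleftrightarrow> belongs S \<beta> (f \<cdot> u)" if "u \<in> Arr S" "Cod S u = pt x" for u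
    unfolding weak_subobjects_slice by (rule Psi.belongs_re) (use descentD(1)[OF b] fa that in simp_all)
  then show "\<lbrakk>u \<in> Arr S; Cod S u = pt x\<rbrakk> \<Longrightarrow> belongs S (re Psi f \<beta>) u \<longleftrightarrow> belongs S \<beta> (f \<cdot> u)" .
  show "descent x (re Psi f \<beta>)"
    unfolding descent_def
  proof (intro conjI ballI impI; (elim conjE)?)
    show "re Psi f \<beta> \<in> carrier (Psi.Sub (pt x))"
      unfolding weak_subobjects_slice by (rule Psi.re_closed; use descentD(1)[OF b] fa in simp)
    fix u v assume uv: "u \<in> Arr S" "v \<in> Arr S" "Cod S u = pt x" "Cod S v = pt x" "Dom S u = Dom S v"
      "dp_incl x \<cdot> u = dp_incl x \<cdot> v" "belongs S (re Psi f \<beta>) u"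
    have "dp_incl y \<cdot> (f \<cdot> u) = dp_incl y \<cdot> (f \<cdot> v)" by (rule kmapD(4)[OF f uv(6,1-5)])
    moreover have "belongs S \<beta> (f \<cdot> u)" using br[OF uv(1,3)] uv(7) by blast
    ultimately have "belongs S \<beta> (f \<cdot> v)" by (rule descentD(2)[OF b]) (use uv(1-5) fa in auto)
    then show "belongs S (re Psi f \<beta>) v" using br[OF uv(2,4)] by blast
  qed
qed

text \<open>The weak subobject \<open>a : Y \<rightarrow> X\<close> becomes the image of the arrow \<open>[a]\<close> from \<open>J Y\<close> to \<open>x\<close>, which is the
  object given by \<open>c \<cdot> a\<close>.\<close>

definition sub_arr where "sub_arr x a = ar (ob (dp_incl x \<cdot> a)) x a"
definition sub_of where "sub_of x \<alpha> = SubD.cls (sub_arr x (SOME a. a \<in> \<alpha>))"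

lemma sub_arr:
  assumes x: "x \<in> Ob D" and a: "a \<in> Arr S" "Cod S a = pt x"
  shows "ob (dp_incl x \<cdot> a) \<in> Ob D" "kmap (ob (dp_incl x \<cdot> a)) x a" "monic D (sub_arr x a)"
    "sub_arr x a \<in> Arr D" "Cod D (sub_arr x a) = x" "Dom D (sub_arr x a) = ob (dp_incl x \<cdot> a)"
proof -
  have c: "dp_incl x \<cdot> a \<in> Arr S" "dp_incl x \<in> Arr S" using assms by auto
  show o: "ob (dp_incl x \<cdot> a) \<in> Ob D" using c by simp
  show m: "kmap (ob (dp_incl x \<cdot> a)) x a" by (rule kmapI) (use a c in auto)
  show "monic D (sub_arr x a)" unfolding sub_arr_def monic_D_iff[OF o x m] using a c by auto
  show "sub_arr x a \<in> Arr D" "Cod D (sub_arr x a) = x" "Dom D (sub_arr x a) = ob (dp_incl x \<cdot> a)"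
    using o m x by (simp_all add: sub_arr_def)
qed

lemma descent_SOME:
  assumes "descent x \<alpha>"
  shows "(SOME a. a \<in> \<alpha>) \<in> Arr S" "Cod S (SOME a. a \<in> \<alpha>) = pt x" "\<alpha> = Psi.cls (SOME a. a \<in> \<alpha>)"
proof -
  have c: "\<alpha> \<in> carrier (Psi.Sub (pt x))" using descentD(1)[OF assms] .
  then obtain a where "a \<in> Arr S" "\<alpha> = Psi.cls a" by (auto elim: Psi.carrierE)
  then have "\<exists>a. a \<in> \<alpha>" using Psi.cls_self by blast
  then have "(SOME a. a \<in> \<alpha>) \<in> \<alpha>" by (rule someI_ex)
  then show "(SOME a. a \<in> \<alpha>) \<in> Arr S" "Cod S (SOME a. a \<in> \<alpha>) = pt x" "\<alpha> = Psi.cls (SOME a. a \<in> \<alpha>)"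
    using Psi.carrier_mem[OF c] by blast+
qed

lemma sub_of_closed: "\<lbrakk>x \<in> Ob D; descent x \<alpha>\<rbrakk> \<Longrightarrow> sub_of x \<alpha> \<in> carrier (SubD.Sub x)"
  unfolding sub_of_def using descent_SOME[of x \<alpha>] sub_arr[of x "SOME a. a \<in> \<alpha>"] by simp

text \<open>If \<open>[u]\<close> factors through \<open>[a]\<close> via some \<open>h\<close>, then \<open>u\<close> and \<open>a \<cdot> h\<close> agree only up to the kernel of \<open>x\<close>;
  descent is exactly what is needed to conclude that \<open>u\<close> belongs to \<open>\<alpha>\<close>.\<close>

lemma belongs_sub_of:
  assumes x: "x \<in> Ob D" and d: "descent x \<alpha>" and t: "t \<in> Ob D" "kmap t x u"
  shows "belongs D (sub_of x \<alpha>) (ar t x u) \<longleftrightarrow> belongs S \<alpha> u"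
proof -
  define a where "a = (SOME a. a \<in> \<alpha>)"
  have a: "a \<in> Arr S" "Cod S a = pt x" "\<alpha> = Psi.cls a" using descent_SOME[OF d] unfolding a_def by auto
  note s = sub_arr[OF x a(1,2)]
  let ?y = "ob (dp_incl x \<cdot> a)" and ?c = "dp_incl x"
  have y: "dp_incl ?y = ?c \<cdot> a" "pt ?y = Dom S a" using a x by auto
  have c: "?c \<in> Arr S" using x by simp
  note ua = kmapD(1-3)[OF t(2)]
  have "belongs D (sub_of x \<alpha>) (ar t x u) \<longleftrightarrow> factors_through D (ar t x u) (sub_arr x a)"
    unfolding sub_of_def a_def[symmetric] using s t x by simp
  also have "\<dots> \<longleftrightarrow> belongs S \<alpha> u"
  proof
    assume "factors_through D (ar t x u) (sub_arr x a)"
    then obtain \<eta> where n: "sub_arr x a \<cdot>\<^bsub>D\<^esub> \<eta> = ar t x u" "\<eta> \<in> Arr D" "Dom D \<eta> = Dom D (ar t x u)" "Cod D \<eta> = Dom D (sub_arr x a)"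
      by (rule factors_throughE)
    obtain h where h: "\<eta> = ar t ?y h" "kmap t ?y h" using arE[OF n(2)] n(3,4) s(6) Dom_Cod_ar by metis
    have "ar t x (a \<cdot> h) = ar t x u" using n(1) ar_comp[OF t(1) s(1) x h(2) s(2)] unfolding h(1) sub_arr_def by simp
    then have e: "?c \<cdot> (a \<cdot> h) = ?c \<cdot> u"
      using ar_eq_iff[OF t(1) x kmap_comp[OF t(1) s(1) x h(2) s(2)] t(2)] by simp
    note ha = kmapD(1-3)[OF h(2)]
    have "factors_through S (a \<cdot> h) a" by (rule factors_throughI[of _ _ _ h]) (use ha y a in auto)
    then have "belongs S \<alpha> (a \<cdot> h)" using a ha y by simp
    then show "belongs S \<alpha> u"
      by (rule descentD(2)[OF d e]) (use ha y a ua in auto)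
  next
    assume "belongs S \<alpha> u"
    then have "factors_through S u a" using a ua by simp
    then obtain h where h: "a \<cdot> h = u" "h \<in> Arr S" "Dom S h = Dom S u" "Cod S h = Dom S a" by (rule factors_throughE)
    have m: "kmap t ?y h"
    proof (rule kmapI)
      fix r v assume rv: "r \<in> Arr S" "v \<in> Arr S" "Cod S r = pt t" "Cod S v = pt t" "Dom S r = Dom S v" "dp_incl t \<cdot> r = dp_incl t \<cdot> v"
      have "a \<cdot> (h \<cdot> r) = u \<cdot> r" "a \<cdot> (h \<cdot> v) = u \<cdot> v"
        by (rule extend_eq1[OF h(1)]; use h(2-4) a rv ua in simp)+
      then show "dp_incl ?y \<cdot> (h \<cdot> r) = dp_incl ?y \<cdot> (h \<cdot> v)"
        using kmapD(4)[OF t(2) rv(6,1-5)] h(2-4) a(1,2) rv(1-4) ua c unfolding y(1) by simp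
    qed (use h y ua in auto)
    show "factors_through D (ar t x u) (sub_arr x a)"
    proof (rule factors_throughI)
      show "ar t x u = sub_arr x a \<cdot>\<^bsub>D\<^esub> ar t ?y h"
        unfolding sub_arr_def using ar_comp[OF t(1) s(1) x m s(2)] h(1) by simp
    qed (use m t s x in simp_all)
  qed
  finally show ?thesis .
qed

text \<open>Order is compared on generalized elements of the form \<open>[u]\<close>. For surjectivity, a subobject \<open>[m]\<close> is
  replaced by its saturation under the kernel of \<open>x\<close>, computed by a weak pullback; this
  saturation is a descent datum, and in \<open>D\<close> it is isomorphic to \<open>[m]\<close>.\<close>

lemma sub_of_order_iso:
  assumes x: "x \<in> Ob D" shows "order_iso (fib (doctrine_r Psi) x) (SubD.Sub x) (sub_of x)"
proof (rule order_isoI[OF fib_r_po[OF x] SubD.Sub_po])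
  let ?c = "dp_incl x"
  have c: "?c \<in> Arr S" using x by simp
  show "sub_of x \<alpha> \<in> carrier (SubD.Sub x)" if "\<alpha> \<in> carrier (fib (doctrine_r Psi) x)" for \<alpha>
    using that x sub_of_closed by simp
  fix \<alpha> \<beta> assume "\<alpha> \<in> carrier (fib (doctrine_r Psi) x)" "\<beta> \<in> carrier (fib (doctrine_r Psi) x)"
  then have d: "descent x \<alpha>" "descent x \<beta>" using x by auto
  show "\<alpha> \<sqsubseteq>\<^bsub>fib (doctrine_r Psi) x\<^esub> \<beta> \<longleftrightarrow> sub_of x \<alpha> \<sqsubseteq>\<^bsub>SubD.Sub x\<^esub> sub_of x \<beta>"
    unfolding fib_r_simps(3)[OF x] Psi.le_iff[OF descentD(1)[OF d(1)] descentD(1)[OF d(2)]]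
      SubD.le_iff[OF sub_of_closed[OF x d(1)] sub_of_closed[OF x d(2)]]
  proof (intro iffI ballI impI)
    fix \<phi> assume l: "\<forall>u\<in>Arr S. Cod S u = pt x \<longrightarrow> belongs S \<alpha> u \<longrightarrow> belongs S \<beta> u"
      and p: "\<phi> \<in> Arr D" "Cod D \<phi> = x" "belongs D (sub_of x \<alpha>) \<phi>"
    obtain t u where u: "\<phi> = ar t x u" "kmap t x u" "t \<in> Ob D" using arE'[OF p(1)] p(2) Dom_Cod_ar by metis
    show "belongs D (sub_of x \<beta>) \<phi>"
      using l p(3) kmapD(1-3)[OF u(2)] unfolding u(1) belongs_sub_of[OF x d(1) u(3,2)] belongs_sub_of[OF x d(2) u(3,2)] by blast
  next
    fix u assume l: "\<forall>\<phi>\<in>Arr D. Cod D \<phi> = x \<longrightarrow> belongs D (sub_of x \<alpha>) \<phi> \<longrightarrow> belongs D (sub_of x \<beta>) \<phi>"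
      and u: "u \<in> Arr S" "Cod S u = pt x" "belongs S \<alpha> u"
    let ?t = "jo (Dom S u)"
    have t: "?t \<in> Ob D" "kmap ?t x u" using u by auto
    have "ar ?t x u \<in> Arr D" "Cod D (ar ?t x u) = x" using t x by auto
    then show "belongs S \<beta> u"
      using l u(3) unfolding belongs_sub_of[OF x d(1) t, symmetric] belongs_sub_of[OF x d(2) t, symmetric] by blast
  qed
next
  let ?c = "dp_incl x"
  have c: "?c \<in> Arr S" using x by simp
  fix \<beta> assume b: "\<beta> \<in> carrier (SubD.Sub x)"
  obtain \<mu> where mu: "monic D \<mu>" "\<mu> \<in> Arr D" "Cod D \<mu> = x" "\<beta> = SubD.cls \<mu>" by (rule SubD.carrierE[OF b]) simp
  obtain y m where m: "\<mu> = ar y x m" "kmap y x m" "y \<in> Ob D" using arE'[OF mu(2)] mu(3) Dom_Cod_ar by metis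
  note ma = kmapD(1-3)[OF m(2)]
  have mono: "dp_incl y \<cdot> u = dp_incl y \<cdot> v"
    if "u \<in> Arr S" "v \<in> Arr S" "Cod S u = pt y" "Cod S v = pt y" "Dom S u = Dom S v" "?c \<cdot> (m \<cdot> u) = ?c \<cdot> (m \<cdot> v)" for u v
    using mu(1) that unfolding m(1) monic_D_iff[OF m(3) x m(2)] by blast
  have cm: "?c \<cdot> m \<in> Arr S" "Dom S (?c \<cdot> m) = pt y" "Cod S (?c \<cdot> m) = Cod S ?c" using ma c by auto
  \<comment> \<open>the saturation of \<open>m\<close> under the kernel of \<open>x\<close>\<close>
  obtain a w where aw: "is_weak_pullback S ?c (?c \<cdot> m) a w" "a \<in> Arr S" "w \<in> Arr S" "Dom S w = Dom S a"
    "Cod S a = pt x" "Cod S w = Dom S (?c \<cdot> m)" "?c \<cdot> a = (?c \<cdot> m) \<cdot> w"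
    using wpb_ex[OF c cm(1)] cm(3) by metis
  have w: "Cod S w = pt y" "?c \<cdot> (m \<cdot> w) = ?c \<cdot> a" using aw cm ma c by auto
  have fac: "factors_through S u a \<longleftrightarrow> (\<exists>r\<in>Arr S. Dom S r = Dom S u \<and> Cod S r = pt y \<and> ?c \<cdot> (m \<cdot> r) = ?c \<cdot> u)"
    if u: "u \<in> Arr S" "Cod S u = pt x" for u
  proof
    assume "factors_through S u a"
    then obtain h where h: "a \<cdot> h = u" "h \<in> Arr S" "Dom S h = Dom S u" "Cod S h = Dom S a" by (rule factors_throughE)
    have "(?c \<cdot> m) \<cdot> (w \<cdot> h) = ?c \<cdot> (a \<cdot> h)"
      by (rule extend_eq[OF aw(7)[symmetric]]) (use aw cm c h(2-4) in auto)
    then have "?c \<cdot> (m \<cdot> (w \<cdot> h)) = ?c \<cdot> u" unfolding h(1) using ma c w aw(3,4) h(2-4) by simp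
    then show "\<exists>r\<in>Arr S. Dom S r = Dom S u \<and> Cod S r = pt y \<and> ?c \<cdot> (m \<cdot> r) = ?c \<cdot> u"
      using w aw(3,4) h(2-4) by (intro bexI[of _ "w \<cdot> h"]) auto
  next
    assume "\<exists>r\<in>Arr S. Dom S r = Dom S u \<and> Cod S r = pt y \<and> ?c \<cdot> (m \<cdot> r) = ?c \<cdot> u"
    then obtain r where r: "r \<in> Arr S" "Dom S r = Dom S u" "Cod S r = pt y" "?c \<cdot> (m \<cdot> r) = ?c \<cdot> u" by blast
    obtain h where "h \<in> Arr S" "Dom S h = Dom S u" "Cod S h = Dom S a" "a \<cdot> h = u"
      by (rule weak_pullbackE[OF aw(1) u(1) r(1)]) (use r u ma c in auto)
    then show "factors_through S u a" using u aw(5) by (intro factors_throughI[of _ _ _ h]) auto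
  qed
  let ?\<alpha> = "Psi.cls a"
  have d: "descent x ?\<alpha>"
    unfolding descent_def
  proof (intro conjI ballI impI; (elim conjE)?)
    show "?\<alpha> \<in> carrier (Psi.Sub (pt x))" using aw by simp
    fix u v assume uv: "u \<in> Arr S" "v \<in> Arr S" "Cod S u = pt x" "Cod S v = pt x" "Dom S u = Dom S v"
      "?c \<cdot> u = ?c \<cdot> v" "belongs S ?\<alpha> u"
    have "factors_through S u a" using uv(1,7) aw(2) by simp
    then have "factors_through S v a" unfolding fac[OF uv(1,3)] fac[OF uv(2,4)] uv(5,6) .
    then show "belongs S ?\<alpha> v" using uv(2) aw(2) by simp
  qed
  have "sub_of x ?\<alpha> = \<beta>"
  proof (rule SubD.Sub_eqI[OF sub_of_closed[OF x d] b])
    fix \<phi> assume p: "\<phi> \<in> Arr D" "Cod D \<phi> = x"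
    obtain t u where u: "\<phi> = ar t x u" "kmap t x u" "t \<in> Ob D" using arE'[OF p(1)] p(2) Dom_Cod_ar by metis
    note ua = kmapD(1-3)[OF u(2)]
    have "belongs D (sub_of x ?\<alpha>) \<phi> \<longleftrightarrow> (\<exists>r\<in>Arr S. Dom S r = Dom S u \<and> Cod S r = pt y \<and> ?c \<cdot> (m \<cdot> r) = ?c \<cdot> u)"
      unfolding u(1) belongs_sub_of[OF x d u(3,2)] fac[OF ua(1,3), symmetric] using ua aw(2) by simp
    also have "\<dots> \<longleftrightarrow> factors_through D \<phi> \<mu>"
    proof
      assume "\<exists>r\<in>Arr S. Dom S r = Dom S u \<and> Cod S r = pt y \<and> ?c \<cdot> (m \<cdot> r) = ?c \<cdot> u"
      then obtain r where r: "r \<in> Arr S" "Dom S r = Dom S u" "Cod S r = pt y" "?c \<cdot> (m \<cdot> r) = ?c \<cdot> u" by blast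
      have mr: "kmap t y r"
      proof (rule kmapI)
        fix g h assume gh: "g \<in> Arr S" "h \<in> Arr S" "Cod S g = pt t" "Cod S h = pt t" "Dom S g = Dom S h" "dp_incl t \<cdot> g = dp_incl t \<cdot> h"
        have r4: "(?c \<cdot> m) \<cdot> r = ?c \<cdot> u" using r ma c by simp
        have "(?c \<cdot> m) \<cdot> (r \<cdot> g) = ?c \<cdot> (u \<cdot> g)" "(?c \<cdot> m) \<cdot> (r \<cdot> h) = ?c \<cdot> (u \<cdot> h)"
          by (rule extend_eq[OF r4]; use r(1-3) ua cm c gh(1-4) in simp)+
        then have "?c \<cdot> (m \<cdot> (r \<cdot> g)) = ?c \<cdot> (m \<cdot> (r \<cdot> h))"
          using kmapD(4)[OF u(2) gh(6,1-5)] r(1-3) ua ma c gh(1-4) by simp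
        then show "dp_incl y \<cdot> (r \<cdot> g) = dp_incl y \<cdot> (r \<cdot> h)"
          by (intro mono) (use r(1-3) ua gh(1-5) in auto)
      qed (use r ua in auto)
      have "ar t x (m \<cdot> r) = ar t x u"
        using ar_eq_iff[OF u(3) x kmap_comp[OF u(3) m(3) x mr m(2)] u(2)] r(4) by blast
      then have "\<phi> = \<mu> \<cdot>\<^bsub>D\<^esub> ar t y r" unfolding u(1) m(1) using ar_comp[OF u(3) m(3) x mr m(2)] by simp
      then show "factors_through D \<phi> \<mu>"
        by (rule factors_throughI) (use mr u m x in auto)
    next
      assume "factors_through D \<phi> \<mu>"
      then obtain \<eta> where n: "\<mu> \<cdot>\<^bsub>D\<^esub> \<eta> = \<phi>" "\<eta> \<in> Arr D" "Dom D \<eta> = Dom D \<phi>" "Cod D \<eta> = Dom D \<mu>"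
        by (rule factors_throughE)
      have "Dom D \<eta> = t" "Cod D \<eta> = y" using n(3,4) u(1) m(1) by simp_all
      then obtain r where r: "\<eta> = ar t y r" "kmap t y r" using arE[OF n(2)] by metis
      have "ar t x (m \<cdot> r) = ar t x u" using n(1) ar_comp[OF u(3) m(3) x r(2) m(2)] unfolding r(1) u(1) m(1) by simp
      then have "?c \<cdot> (m \<cdot> r) = ?c \<cdot> u"
        using ar_eq_iff[OF u(3) x kmap_comp[OF u(3) m(3) x r(2) m(2)] u(2)] by blast
      then show "\<exists>r\<in>Arr S. Dom S r = Dom S u \<and> Cod S r = pt y \<and> ?c \<cdot> (m \<cdot> r) = ?c \<cdot> u"
        using kmapD(1-3)[OF r(2)] ua by auto
    qed
    also have "\<dots> \<longleftrightarrow> belongs D \<beta> \<phi>" unfolding mu(4) using mu(1) p(1) by simp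
    finally show "belongs D (sub_of x ?\<alpha>) \<phi> \<longleftrightarrow> belongs D \<beta> \<phi>" .
  qed
  then show "\<exists>\<alpha>\<in>carrier (fib (doctrine_r Psi) x). sub_of x \<alpha> = \<beta>" using d x by (intro bexI[of _ ?\<alpha>]) auto
qed

lemma re_r_closed:
  assumes "\<phi> \<in> Arr D" "\<beta> \<in> carrier (fib (doctrine_r Psi) (Cod D \<phi>))"
  shows "re (doctrine_r Psi) \<phi> \<beta> \<in> carrier (fib (doctrine_r Psi) (Dom D \<phi>))"
proof -
  obtain x y f where f: "\<phi> = ar x y f" "kmap x y f" "x \<in> Ob D" "y \<in> Ob D" using arE'[OF assms(1)] .
  have b: "descent y \<beta>" using assms(2) f by simp
  then show ?thesis using descent_re(1)[OF f(3,4,2) b] f re_r[OF f(3,4,2) b] by simp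
qed

lemma sub_of_natural:
  assumes "\<phi> \<in> Arr D" "\<beta> \<in> carrier (fib (doctrine_r Psi) (Cod D \<phi>))"
  shows "sub_of (Dom D \<phi>) (re (doctrine_r Psi) \<phi> \<beta>) = re (subobjects D) \<phi> (sub_of (Cod D \<phi>) \<beta>)"
proof -
  obtain x y f where f: "\<phi> = ar x y f" "kmap x y f" "x \<in> Ob D" "y \<in> Ob D" using arE'[OF assms(1)] .
  have b: "descent y \<beta>" using assms(2) f by simp
  note dr = descent_re[OF f(3,4,2) b]
  have sc: "sub_of y \<beta> \<in> carrier (SubD.Sub (Cod D \<phi>))" using sub_of_closed[OF f(4) b] f by simp
  have "sub_of x (re Psi f \<beta>) = re (subobjects D) \<phi> (sub_of y \<beta>)"
    unfolding subobjects_slice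
  proof (rule SubD.Sub_eqI[OF sub_of_closed[OF f(3) dr(1)]])
    show "re SubD.Doc \<phi> (sub_of y \<beta>) \<in> carrier (SubD.Sub x)"
      by (rule SubD.re_closed[OF assms(1) sc]) (use f in simp)
    fix \<psi> assume p: "\<psi> \<in> Arr D" "Cod D \<psi> = x"
    obtain t u where u: "\<psi> = ar t x u" "kmap t x u" "t \<in> Ob D" using arE'[OF p(1)] p(2) Dom_Cod_ar by metis
    have "belongs D (sub_of x (re Psi f \<beta>)) \<psi> \<longleftrightarrow> belongs S \<beta> (f \<cdot> u)"
      unfolding u(1) belongs_sub_of[OF f(3) dr(1) u(3,2)] using dr(2) kmapD(1-3)[OF u(2)] by blast
    also have "\<dots> \<longleftrightarrow> belongs D (sub_of y \<beta>) (\<phi> \<cdot>\<^bsub>D\<^esub> \<psi>)"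
      unfolding u(1) f(1) ar_comp[OF u(3) f(3,4) u(2) f(2)]
      using belongs_sub_of[OF f(4) b u(3) kmap_comp[OF u(3) f(3,4) u(2) f(2)]] by simp
    also have "\<dots> \<longleftrightarrow> belongs D (re SubD.Doc \<phi> (sub_of y \<beta>)) \<psi>"
      by (rule SubD.belongs_re[symmetric, OF assms(1) sc p(1)]) (use p f in simp)
    finally show "belongs D (sub_of x (re Psi f \<beta>)) \<psi> \<longleftrightarrow> belongs D (re SubD.Doc \<phi> (sub_of y \<beta>)) \<psi>" .
  qed
  then show ?thesis using f re_r[OF f(3,4,2) b] by simp
qed

lemma subobjects_D_elementary: "elementary_doctrine (subobjects D)"
  unfolding subobjects_slice by (rule SubD.Doc_elementary)

lemma doctrine_r_elementary: "elementary_doctrine (doctrine_r Psi)"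
  by (rule elementary_transport[OF subobjects_D_elementary, where h = sub_of])
    (simp_all add: subobjects_slice sub_of_order_iso re_r_closed sub_of_natural[unfolded subobjects_slice] del: fib_r_simps(1))

end

section \<open>Left covering functors on simple diagrams\<close>

text \<open>The free category on the complete bipartite graph from \<open>A\<close> to \<open>B\<close>. As there is at most one arrow between
  two objects, an arrow is coded as the pair of its ends.\<close>

definition bip :: "nat set \<Rightarrow> nat set \<Rightarrow> (nat, nat) cat" where
  "bip A B = \<lparr>Ob = A \<union> B,
     Arr = prod_encode ` ({(i, i) | i. i \<in> A \<union> B} \<union> A \<times> B),
     Dom = fst \<circ> prod_decode, Cod = snd \<circ> prod_decode, Id = (\<lambda>i. prod_encode (i, i)),
     Comp = (\<lambda>g f. prod_encode (fst (prod_decode f), snd (prod_decode g)))\<rparr>"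

definition bip_diagram :: "('o, 'a) cat \<Rightarrow> (nat \<Rightarrow> 'o) \<Rightarrow> (nat \<Rightarrow> nat \<Rightarrow> 'a) \<Rightarrow> (nat, nat, 'o, 'a) functr" where
  "bip_diagram C d a = \<lparr>onOb = d,
     onArr = (\<lambda>e. let (i, j) = prod_decode e in if i = j then Id C (d i) else a i j)\<rparr>"

lemma bip_simps [simp]:
  "Ob (bip A B) = A \<union> B" "Dom (bip A B) (prod_encode (i, j)) = i" "Cod (bip A B) (prod_encode (i, j)) = j"
  "Id (bip A B) i = prod_encode (i, i)" "prod_encode (j, k) \<cdot>\<^bsub>bip A B\<^esub> prod_encode (i, j') = prod_encode (i, k)"
  by (auto simp: bip_def)

lemma bip_Arr: "e \<in> Arr (bip A B) \<longleftrightarrow> (\<exists>i j. e = prod_encode (i, j) \<and> (i = j \<and> i \<in> A \<union> B \<or> i \<in> A \<and> j \<in> B))"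
  by (auto simp: bip_def)

lemma bip_Arr_encode [simp]: "prod_encode (i, j) \<in> Arr (bip A B) \<longleftrightarrow> i = j \<and> i \<in> A \<union> B \<or> i \<in> A \<and> j \<in> B"
  by (auto simp: bip_Arr)

lemma bip_category: assumes "A \<inter> B = {}" shows "category (bip A B)"
proof
  fix f X Y assume "f \<in> hom (bip A B) X Y"
  then have f: "f = prod_encode (X, Y)" "X = Y \<and> X \<in> A \<union> B \<or> X \<in> A \<and> Y \<in> B" by (auto simp: bip_Arr)
  then show "f \<cdot>\<^bsub>bip A B\<^esub> Id (bip A B) X = f" "Id (bip A B) Y \<cdot>\<^bsub>bip A B\<^esub> f = f" by auto
  fix g Z assume "g \<in> hom (bip A B) Y Z"
  then have g: "g = prod_encode (Y, Z)" "Y = Z \<and> Y \<in> A \<union> B \<or> Y \<in> A \<and> Z \<in> B" by (auto simp: bip_Arr)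
  then show "g \<cdot>\<^bsub>bip A B\<^esub> f \<in> hom (bip A B) X Z" using f assms by auto
  fix h V assume "h \<in> hom (bip A B) Z V"
  then have "h = prod_encode (Z, V)" by (auto simp: bip_Arr)
  then show "h \<cdot>\<^bsub>bip A B\<^esub> (g \<cdot>\<^bsub>bip A B\<^esub> f) = h \<cdot>\<^bsub>bip A B\<^esub> g \<cdot>\<^bsub>bip A B\<^esub> f" using f g by simp
qed (auto simp: bip_Arr)

lemma bip_diagram_simps [simp]:
  "onOb (bip_diagram C d a) i = d i"
  "onArr (bip_diagram C d a) (prod_encode (i, j)) = (if i = j then Id C (d i) else a i j)"
  by (auto simp: bip_diagram_def)

lemma bip_diagram_functor:
  assumes C: "category C" and AB: "A \<inter> B = {}" and d: "\<And>i. i \<in> A \<union> B \<Longrightarrow> d i \<in> Ob C"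
    and a: "\<And>i j. i \<in> A \<Longrightarrow> j \<in> B \<Longrightarrow> a i j \<in> hom C (d i) (d j)"
  shows "is_functor (bip A B) C (bip_diagram C d a)"
proof -
  interpret category C by (rule C)
  have ne: "i \<noteq> j" if "i \<in> A" "j \<in> B" for i j using that AB by auto
  show ?thesis
    unfolding is_functor_def
  proof (intro conjI ballI impI)
    show "category (bip A B)" by (rule bip_category[OF AB])
    fix f assume "f \<in> Arr (bip A B)"
    then obtain i j where f: "f = prod_encode (i, j)" "i = j \<and> i \<in> A \<union> B \<or> i \<in> A \<and> j \<in> B" by (auto simp: bip_Arr)
    then show "onArr (bip_diagram C d a) f \<in> hom C (onOb (bip_diagram C d a) (Dom (bip A B) f))
           (onOb (bip_diagram C d a) (Cod (bip A B) f))" using d a ne by auto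
    fix g assume "g \<in> Arr (bip A B)" and fg: "Cod (bip A B) f = Dom (bip A B) g"
    then obtain k where g: "g = prod_encode (j, k)" "j = k \<and> j \<in> A \<union> B \<or> j \<in> A \<and> k \<in> B" using f by (auto simp: bip_Arr)
    show "onArr (bip_diagram C d a) (g \<cdot>\<^bsub>bip A B\<^esub> f) = onArr (bip_diagram C d a) g \<cdot>\<^bsub>C\<^esub> onArr (bip_diagram C d a) f"
      using f g d a[of i k] a[of i j] a[of j k] ne AB by (auto split: if_splits)
  qed (use d C in auto)
qed

text \<open>Cones over bipartite diagrams, with the identity arrows of the shape left out.\<close>

definition bicone :: "('o, 'a) cat \<Rightarrow> nat set \<Rightarrow> nat set \<Rightarrow> (nat \<Rightarrow> 'o) \<Rightarrow> (nat \<Rightarrow> nat \<Rightarrow> 'a) \<Rightarrow>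
    'o \<Rightarrow> (nat \<Rightarrow> 'a) \<Rightarrow> bool" where
  "bicone C A B d a W \<pi> \<longleftrightarrow> W \<in> Ob C \<and> (\<forall>i\<in>A \<union> B. \<pi> i \<in> hom C W (d i)) \<and>
     (\<forall>i\<in>A. \<forall>j\<in>B. a i j \<cdot>\<^bsub>C\<^esub> \<pi> i = \<pi> j)"

lemma bicone_iff:
  assumes C: "category C" and AB: "A \<inter> B = {}"
    and L: "\<And>i. i \<in> A \<union> B \<Longrightarrow> onOb L i = d i" "\<And>i. i \<in> A \<union> B \<Longrightarrow> onArr L (prod_encode (i, i)) = Id C (d i)"
      "\<And>i j. i \<in> A \<Longrightarrow> j \<in> B \<Longrightarrow> onArr L (prod_encode (i, j)) = a i j"
  shows "is_cone (bip A B) C L W \<pi> \<longleftrightarrow> bicone C A B d a W \<pi>"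
proof
  interpret category C by (rule C)
  assume *: "is_cone (bip A B) C L W \<pi>"
  have "a i j \<cdot>\<^bsub>C\<^esub> \<pi> i = \<pi> j" if "i \<in> A" "j \<in> B" for i j
  proof -
    have "prod_encode (i, j) \<in> Arr (bip A B)" using that by simp
    then have "onArr L (prod_encode (i, j)) \<cdot>\<^bsub>C\<^esub> \<pi> (Dom (bip A B) (prod_encode (i, j))) = \<pi> (Cod (bip A B) (prod_encode (i, j)))"
      using * unfolding is_cone_def by blast
    then show ?thesis using L(3) that by simp
  qed
  then show "bicone C A B d a W \<pi>" using * L(1) by (simp add: is_cone_def bicone_def)
next
  interpret category C by (rule C)
  assume *: "bicone C A B d a W \<pi>"
  show "is_cone (bip A B) C L W \<pi>"
    unfolding is_cone_def
  proof (intro conjI ballI)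
    fix f assume "f \<in> Arr (bip A B)"
    then consider i where "f = prod_encode (i, i)" "i \<in> A \<union> B" | i j where "f = prod_encode (i, j)" "i \<in> A" "j \<in> B"
      by (auto simp: bip_Arr)
    then show "onArr L f \<cdot>\<^bsub>C\<^esub> \<pi> (Dom (bip A B) f) = \<pi> (Cod (bip A B) f)"
      using * L(2,3) by cases (auto simp: bicone_def)
  qed (use * L(1) in \<open>auto simp: bicone_def\<close>)
qed

lemma left_covering_bip:
  fixes d :: "nat \<Rightarrow> 'o" and a :: "nat \<Rightarrow> nat \<Rightarrow> 'a"
  assumes lc: "left_covering S E G" and fin: "finite A" "finite B" and AB: "A \<inter> B = {}"
    and d: "\<And>i. i \<in> A \<union> B \<Longrightarrow> d i \<in> Ob S"
    and a: "\<And>i j. i \<in> A \<Longrightarrow> j \<in> B \<Longrightarrow> a i j \<in> hom S (d i) (d j)"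
    and W: "bicone S A B d a W \<pi>"
      "\<And>V \<rho>. bicone S A B d a V \<rho> \<Longrightarrow> \<exists>h. h \<in> hom S V W \<and> (\<forall>i\<in>A \<union> B. \<pi> i \<cdot>\<^bsub>S\<^esub> h = \<rho> i)"
    and M: "bicone E A B (\<lambda>i. onOb G (d i)) (\<lambda>i j. onArr G (a i j)) M \<mu>"
      "\<And>V \<rho>. bicone E A B (\<lambda>i. onOb G (d i)) (\<lambda>i j. onArr G (a i j)) V \<rho> \<Longrightarrow>
         \<exists>!h. h \<in> hom E V M \<and> (\<forall>i\<in>A \<union> B. \<mu> i \<cdot>\<^bsub>E\<^esub> h = \<rho> i)"
    and k: "k \<in> hom E (onOb G W) M" "\<And>i. i \<in> A \<union> B \<Longrightarrow> \<mu> i \<cdot>\<^bsub>E\<^esub> k = onArr G (\<pi> i)"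
  shows "regular_epi E k"
proof -
  have G: "is_functor S E G" using lc by (simp add: left_covering_def)
  note g = functorD[OF G]
  have ne: "i \<noteq> j" if "i \<in> A" "j \<in> B" for i j using that AB by auto
  let ?L = "bip_diagram S d a"
  have c1: "is_cone (bip A B) S ?L V \<rho> \<longleftrightarrow> bicone S A B d a V \<rho>" for V \<rho>
    by (rule bicone_iff[OF g(1) AB]) (use ne in auto)
  have c2: "is_cone (bip A B) E (comp_functor G ?L) V \<rho> \<longleftrightarrow>
      bicone E A B (\<lambda>i. onOb G (d i)) (\<lambda>i j. onArr G (a i j)) V \<rho>" for V \<rho>
    by (rule bicone_iff[OF g(2) AB]) (use ne g(7) d in auto)
  have "is_weak_limit (bip A B) S ?L W \<pi>"
    unfolding is_weak_limit_def c1 using W by simp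
  moreover have "is_limit (bip A B) E (comp_functor G ?L) M \<mu>"
    unfolding is_limit_def c2 bip_simps using M by blast
  moreover have "finite (Arr (bip A B))"
  proof -
    have "{(i, i) | i. i \<in> A \<union> B} = (\<lambda>i. (i, i)) ` (A \<union> B)" by auto
    then show ?thesis using fin by (simp add: bip_def)
  qed
  moreover have "finite (Ob (bip A B))" using fin by simp
  moreover have "\<forall>j\<in>Ob (bip A B). \<mu> j \<cdot>\<^bsub>E\<^esub> k = onArr G (\<pi> j)" using k(2) by simp
  ultimately show ?thesis
    using lc bip_category[OF AB] bip_diagram_functor[where d = d and a = a, OF g(1) AB d a] k(1)
    unfolding left_covering_def by blast
qed

locale left_cov = weak_lex S + E: regular_cat E
  for S :: "('o, 'a) cat" (structure) and E :: "('p, 'b) cat" +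
  fixes G :: "('o, 'a, 'p, 'b) functr"
  assumes lc: "left_covering S E G"
begin

lemma G_functor: "is_functor S E G" using lc by (simp add: left_covering_def)
lemmas G_simps [simp] = functorD(3-)[OF G_functor]

text \<open>The weak limit of a pair of objects with \<open>n\<close> common targets: products for \<open>n = 0\<close>,
  pullbacks for \<open>n = 1\<close>, and joint kernel pairs for \<open>n = 2\<close>.\<close>

lemma cover_span:
  fixes f g :: "nat \<Rightarrow> 'a"
  assumes XY: "X \<in> Ob S" "Y \<in> Ob S"
    and f: "\<And>j. j < n \<Longrightarrow> f j \<in> hom S X (b j)" and g: "\<And>j. j < n \<Longrightarrow> g j \<in> hom S Y (b j)"
    and pq: "p \<in> hom S W X" "q \<in> hom S W Y" "\<And>j. j < n \<Longrightarrow> f j \<cdot> p = g j \<cdot> q"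
    and weak: "\<And>u v. \<lbrakk>u \<in> Arr S; v \<in> Arr S; Dom S u = Dom S v; Cod S u = X; Cod S v = Y;
         \<And>j. j < n \<Longrightarrow> f j \<cdot> u = g j \<cdot> v\<rbrakk> \<Longrightarrow> \<exists>h. h \<in> hom S (Dom S v) W \<and> p \<cdot> h = u \<and> q \<cdot> h = v"
    and PQ: "P \<in> hom E M (onOb G X)" "Q \<in> hom E M (onOb G Y)"
      "\<And>j. j < n \<Longrightarrow> onArr G (f j) \<cdot>\<^bsub>E\<^esub> P = onArr G (g j) \<cdot>\<^bsub>E\<^esub> Q"
    and lim: "\<And>u v. \<lbrakk>u \<in> Arr E; v \<in> Arr E; Dom E u = Dom E v; Cod E u = onOb G X; Cod E v = onOb G Y;
         \<And>j. j < n \<Longrightarrow> onArr G (f j) \<cdot>\<^bsub>E\<^esub> u = onArr G (g j) \<cdot>\<^bsub>E\<^esub> v\<rbrakk>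
         \<Longrightarrow> \<exists>!h. h \<in> hom E (Dom E v) M \<and> P \<cdot>\<^bsub>E\<^esub> h = u \<and> Q \<cdot>\<^bsub>E\<^esub> h = v"
    and k: "k \<in> hom E (onOb G W) M" "P \<cdot>\<^bsub>E\<^esub> k = onArr G p" "Q \<cdot>\<^bsub>E\<^esub> k = onArr G q"
  shows "regular_epi E k"
proof -
  let ?A = "{0, 1::nat}" and ?B = "(\<lambda>j. j + 2) ` {..<n}"
  let ?d = "\<lambda>i. if i = 0 then X else if i = 1 then Y else b (i - 2)"
  let ?a = "\<lambda>i j. if i = 0 then f (j - 2) else g (j - 2)"
  let ?pi = "\<lambda>i. if i = 0 then p else if i = 1 then q else f (i - 2) \<cdot> p"
  let ?mu = "\<lambda>i. if i = 0 then P else if i = 1 then Q else onArr G (f (i - 2)) \<cdot>\<^bsub>E\<^esub> P"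
  have bOb: "b j \<in> Ob S" if "j < n" for j using f[OF that] Cod_Ob[of "f j"] by simp
  have bS: "bicone S ?A ?B ?d ?a V \<rho> \<longleftrightarrow> V \<in> Ob S \<and> \<rho> 0 \<in> hom S V X \<and> \<rho> 1 \<in> hom S V Y \<and>
      (\<forall>j<n. \<rho> (j + 2) \<in> hom S V (b j) \<and> f j \<cdot> \<rho> 0 = \<rho> (j + 2) \<and> g j \<cdot> \<rho> 1 = \<rho> (j + 2))" for V \<rho>
    unfolding bicone_def by auto
  have bE: "bicone E ?A ?B (\<lambda>i. onOb G (?d i)) (\<lambda>i j. onArr G (?a i j)) V \<rho> \<longleftrightarrow>
      V \<in> Ob E \<and> \<rho> 0 \<in> hom E V (onOb G X) \<and> \<rho> 1 \<in> hom E V (onOb G Y) \<and>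
      (\<forall>j<n. \<rho> (j + 2) \<in> hom E V (onOb G (b j)) \<and> onArr G (f j) \<cdot>\<^bsub>E\<^esub> \<rho> 0 = \<rho> (j + 2) \<and>
         onArr G (g j) \<cdot>\<^bsub>E\<^esub> \<rho> 1 = \<rho> (j + 2))" for V \<rho>
    unfolding bicone_def by auto
  have WM: "W \<in> Ob S" "M \<in> Ob E" using pq(1) PQ(1) Dom_Ob[of p] E.Dom_Ob[of P] by auto
  show ?thesis
  proof (rule left_covering_bip[OF lc, of ?A ?B ?d ?a W ?pi M ?mu])
    show "?d i \<in> Ob S" if "i \<in> ?A \<union> ?B" for i using that XY bOb by auto
    show "?a i j \<in> hom S (?d i) (?d j)" if "i \<in> ?A" "j \<in> ?B" for i j using that f g by auto
    show "bicone S ?A ?B ?d ?a W ?pi" unfolding bS using WM pq f g by auto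
    show "bicone E ?A ?B (\<lambda>i. onOb G (?d i)) (\<lambda>i j. onArr G (?a i j)) M ?mu" unfolding bE using WM PQ f g by auto
    show "k \<in> hom E (onOb G W) M" by (rule k)
    show "?mu i \<cdot>\<^bsub>E\<^esub> k = onArr G (?pi i)" if i: "i \<in> ?A \<union> ?B" for i
    proof -
      have "(onArr G (f j) \<cdot>\<^bsub>E\<^esub> P) \<cdot>\<^bsub>E\<^esub> k = onArr G (f j \<cdot> p)" if "j < n" for j
        using f[OF that] pq PQ(1) k by simp
      then show ?thesis using i k by auto
    qed
  next
    fix V \<rho> assume "bicone S ?A ?B ?d ?a V \<rho>"
    then have r: "V \<in> Ob S" "\<rho> 0 \<in> hom S V X" "\<rho> 1 \<in> hom S V Y"
      "\<And>j. j < n \<Longrightarrow> f j \<cdot> \<rho> 0 = \<rho> (j + 2)" "\<And>j. j < n \<Longrightarrow> g j \<cdot> \<rho> 1 = \<rho> (j + 2)"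
      unfolding bS by blast+
    have "\<exists>h. h \<in> hom S (Dom S (\<rho> 1)) W \<and> p \<cdot> h = \<rho> 0 \<and> q \<cdot> h = \<rho> 1"
      by (rule weak) (use r in auto)
    then obtain h where h: "h \<in> Arr S" "Dom S h = V" "Cod S h = W" "p \<cdot> h = \<rho> 0" "q \<cdot> h = \<rho> 1"
      using r(3) by auto
    have "?pi i \<cdot> h = \<rho> i" if i: "i \<in> ?A \<union> ?B" for i
    proof -
      have "(f j \<cdot> p) \<cdot> h = \<rho> (j + 2)" if "j < n" for j
        using f[OF that] pq(1) h r(4)[OF that] by simp
      then show ?thesis using i h(4,5) by auto
    qed
    then show "\<exists>h. h \<in> hom S V W \<and> (\<forall>i\<in>?A \<union> ?B. ?pi i \<cdot> h = \<rho> i)" using h(1-3) by (intro exI[of _ h]) simp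
  next
    fix V \<rho> assume "bicone E ?A ?B (\<lambda>i. onOb G (?d i)) (\<lambda>i j. onArr G (?a i j)) V \<rho>"
    then have r: "V \<in> Ob E" "\<rho> 0 \<in> hom E V (onOb G X)" "\<rho> 1 \<in> hom E V (onOb G Y)"
      "\<And>j. j < n \<Longrightarrow> onArr G (f j) \<cdot>\<^bsub>E\<^esub> \<rho> 0 = \<rho> (j + 2)" "\<And>j. j < n \<Longrightarrow> onArr G (g j) \<cdot>\<^bsub>E\<^esub> \<rho> 1 = \<rho> (j + 2)"
      unfolding bE by blast+
    have u: "\<exists>!h. h \<in> hom E (Dom E (\<rho> 1)) M \<and> P \<cdot>\<^bsub>E\<^esub> h = \<rho> 0 \<and> Q \<cdot>\<^bsub>E\<^esub> h = \<rho> 1"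
      by (rule lim) (use r in auto)
    have V: "Dom E (\<rho> 1) = V" using r(3) by simp
    have "(\<forall>i\<in>?A \<union> ?B. ?mu i \<cdot>\<^bsub>E\<^esub> h = \<rho> i) \<longleftrightarrow> P \<cdot>\<^bsub>E\<^esub> h = \<rho> 0 \<and> Q \<cdot>\<^bsub>E\<^esub> h = \<rho> 1" if h: "h \<in> hom E V M" for h
    proof -
      have "(onArr G (f j) \<cdot>\<^bsub>E\<^esub> P) \<cdot>\<^bsub>E\<^esub> h = \<rho> (j + 2)" if "j < n" "P \<cdot>\<^bsub>E\<^esub> h = \<rho> 0" for j
        using f[OF that(1)] PQ(1) h r(4)[OF that(1)] that(2) by simp
      then show ?thesis by auto
    qed
    then show "\<exists>!h. h \<in> hom E V M \<and> (\<forall>i\<in>?A \<union> ?B. ?mu i \<cdot>\<^bsub>E\<^esub> h = \<rho> i)"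
      using u unfolding V by (metis (no_types, lifting))
  qed auto
qed

lemma cover_pullback:
  assumes w: "is_weak_pullback S f g p q" and pb: "is_pullback E (onArr G f) (onArr G g) P Q"
    and k: "k \<in> Arr E" "Dom E k = onOb G (Dom S p)" "Cod E k = Dom E P" "P \<cdot>\<^bsub>E\<^esub> k = onArr G p" "Q \<cdot>\<^bsub>E\<^esub> k = onArr G q"
  shows "regular_epi E k"
proof -
  have s: "f \<in> Arr S" "g \<in> Arr S" "p \<in> Arr S" "q \<in> Arr S" "Cod S f = Cod S g"
     "Dom S p = Dom S q" "Cod S p = Dom S f" "Cod S q = Dom S g" "f \<cdot> p = g \<cdot> q"
    using weak_pullback_square[OF w] by (auto simp: commuting_square_def)
  have t: "P \<in> Arr E" "Q \<in> Arr E" "Dom E P = Dom E Q" "Cod E P = onOb G (Dom S f)" "Cod E Q = onOb G (Dom S g)"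
    "onArr G f \<cdot>\<^bsub>E\<^esub> P = onArr G g \<cdot>\<^bsub>E\<^esub> Q"
    using E.pullback_square[OF pb] s by (auto simp: commuting_square_def)
  show ?thesis
  proof (rule cover_span[of "Dom S f" "Dom S g" 1 "\<lambda>_. f" "\<lambda>_. Cod S g" "\<lambda>_. g" p "Dom S p" q P "Dom E P" Q])
    fix u v assume uv: "u \<in> Arr S" "v \<in> Arr S" "Dom S u = Dom S v" "Cod S u = Dom S f" "Cod S v = Dom S g"
      and e: "\<And>j. j < (1::nat) \<Longrightarrow> f \<cdot> u = g \<cdot> v"
    have "f \<cdot> u = g \<cdot> v" using e[of 0] by simp
    from weak_pullbackE[OF w uv this] uv(3)
    show "\<exists>h. h \<in> hom S (Dom S v) (Dom S p) \<and> p \<cdot> h = u \<and> q \<cdot> h = v" by (metis hom_iff)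
  next
    fix u v assume uv: "u \<in> Arr E" "v \<in> Arr E" "Dom E u = Dom E v" "Cod E u = onOb G (Dom S f)" "Cod E v = onOb G (Dom S g)"
      and e: "\<And>j. j < (1::nat) \<Longrightarrow> onArr G f \<cdot>\<^bsub>E\<^esub> u = onArr G g \<cdot>\<^bsub>E\<^esub> v"
    have "commuting_square E (onArr G f) (onArr G g) u v" using e[of 0] uv s by (simp add: commuting_square_def)
    then have "\<exists>!h. h \<in> hom E (Dom E u) (Dom E P) \<and> P \<cdot>\<^bsub>E\<^esub> h = u \<and> Q \<cdot>\<^bsub>E\<^esub> h = v"
      using pb unfolding is_pullback_def by blast
    then show "\<exists>!h. h \<in> hom E (Dom E v) (Dom E P) \<and> P \<cdot>\<^bsub>E\<^esub> h = u \<and> Q \<cdot>\<^bsub>E\<^esub> h = v" unfolding uv(3) .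
  qed (use s t k in auto)
qed

text \<open>Although only weak limits are covered, strict ones keep their uniqueness: for a limit the
  weak limit of the doubled diagram is the diagonal, so the two projections of the doubled
  diagram in \<open>E\<close> agree after a regular epimorphism.\<close>

lemma G_terminal: assumes T: "is_terminal S T" shows "is_terminal E (onOb G T)"
proof -
  have To: "T \<in> Ob S" using T by (rule terminal_Ob)
  obtain T' where T': "is_terminal E T'" using E.finite_limits by (auto simp: has_finite_limits_def)
  obtain k where k: "k \<in> Arr E" "Dom E k = onOb G T" "Cod E k = T'" using E.terminal_ex[OF T', of "onOb G T"] To by auto
  have re: "regular_epi E k"
  proof (rule left_covering_bip[OF lc, of "{}" "{}" "\<lambda>_. T" "\<lambda>_ _. Id S T" T "\<lambda>_. Id S T" T' "\<lambda>_. Id E T'"])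
    fix V and \<rho> :: "nat \<Rightarrow> 'a"
    assume "bicone S {} {} (\<lambda>_. T) (\<lambda>_ _. Id S T) V \<rho>"
    then have "V \<in> Ob S" by (simp add: bicone_def)
    then show "\<exists>h. h \<in> hom S V T \<and> (\<forall>i\<in>{} \<union> {}. Id S T \<cdot> h = \<rho> i)" using terminal_ex[OF T] by (metis Un_empty empty_iff hom_iff)
  next
    fix V and \<rho> :: "nat \<Rightarrow> 'b"
    assume "bicone E {} {} (\<lambda>_. onOb G T) (\<lambda>_ _. onArr G (Id S T)) V \<rho>"
    then have "V \<in> Ob E" by (simp add: bicone_def)
    then have "\<exists>!h. h \<in> hom E V T'" using T' unfolding is_terminal_def by blast
    then show "\<exists>!h. h \<in> hom E V T' \<and> (\<forall>i\<in>{} \<union> {}. Id E T' \<cdot>\<^bsub>E\<^esub> h = \<rho> i)" by simp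
  qed (use To E.terminal_Ob[OF T'] k in \<open>auto simp: bicone_def\<close>)
  let ?X = "onOb G T"
  have X: "?X \<in> Ob E" using To by simp
  let ?d = "pair E (Id E ?X) (Id E ?X)"
  have d: "?d \<in> Arr E" "Dom E ?d = ?X" "Cod E ?d = prd E ?X ?X" using X by auto
  have "regular_epi E ?d"
  proof (rule cover_span[of T T 0 "\<lambda>_. Id S T" "\<lambda>_. T" "\<lambda>_. Id S T" "Id S T" T "Id S T" "pr1 E ?X ?X" "prd E ?X ?X" "pr2 E ?X ?X"])
    fix u v assume "u \<in> Arr S" "v \<in> Arr S" "Dom S u = Dom S v" "Cod S u = T" "Cod S v = T"
    then show "\<exists>h. h \<in> hom S (Dom S v) T \<and> Id S T \<cdot> h = u \<and> Id S T \<cdot> h = v"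
      using terminal_unique[OF T, of u v] by (intro exI[of _ v]) simp
  next
    fix u v assume uv: "u \<in> Arr E" "v \<in> Arr E" "Dom E u = Dom E v" "Cod E u = ?X" "Cod E v = ?X"
    show "\<exists>!h. h \<in> hom E (Dom E v) (prd E ?X ?X) \<and> pr1 E ?X ?X \<cdot>\<^bsub>E\<^esub> h = u \<and> pr2 E ?X ?X \<cdot>\<^bsub>E\<^esub> h = v"
      using E.chosen_product[OF X X] uv E.Dom_Ob[OF uv(2)] unfolding is_product_def by (simp del: hom_iff add: hom_def)
  qed (use To X d in \<open>auto simp: E.pr_pair\<close>)
  then have "pr1 E ?X ?X = pr2 E ?X ?X"
    using X d by - (rule E.epicD[OF E.regular_epi_epic], auto simp: E.pr_pair)
  note eq = this
  have "monic E k"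
  proof (rule E.monicI[OF k(1)])
    fix u v assume uv: "u \<in> Arr E" "v \<in> Arr E" "Cod E u = Dom E k" "Cod E v = Dom E k" "Dom E u = Dom E v"
    have "pr1 E ?X ?X \<cdot>\<^bsub>E\<^esub> pair E u v = u" "pr2 E ?X ?X \<cdot>\<^bsub>E\<^esub> pair E u v = v"
      by (rule E.pr_pair; use uv k in simp)+
    then show "u = v" using eq by simp
  qed
  then have "iso E k" using re E.regular_epi_monic_iso by blast
  then obtain j where j: "inverse_arrows E k j" unfolding iso_def by blast
  have "is_terminal E (Cod E j)"
    by (rule E.terminal_iso[OF T' E.inverse_arrows_sym[OF j]]) (use j k in \<open>simp add: inverse_arrows_def\<close>)
  then show ?thesis using j k by (simp add: inverse_arrows_def)
qed

text \<open>Two arrows that agree in both coordinates form an element of the joint kernel pair \<open>(P, Q)\<close>, and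
  \<open>P = Q\<close> because the weak limit of the doubled diagram is the product itself.\<close>

lemma G_product_joint_monic:
  assumes V: "is_product S A B V p q"
    and uv: "u \<in> Arr E" "v \<in> Arr E" "Cod E u = onOb G V" "Cod E v = onOb G V" "Dom E u = Dom E v"
    and e: "onArr G p \<cdot>\<^bsub>E\<^esub> u = onArr G p \<cdot>\<^bsub>E\<^esub> v" "onArr G q \<cdot>\<^bsub>E\<^esub> u = onArr G q \<cdot>\<^bsub>E\<^esub> v"
  shows "u = v"
proof -
  note pq = productD[OF V]
  let ?p = "onArr G p" and ?q = "onArr G q"
  have ga: "?p \<in> Arr E" "?q \<in> Arr E" "Dom E ?p = onOb G V" "Dom E ?q = onOb G V" "Cod E ?p = onOb G A" "Cod E ?q = onOb G B"
    using pq by auto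
  let ?w = "pair E ?p ?q"
  have w: "?w \<in> Arr E" "Dom E ?w = onOb G V" "Cod E ?w = prd E (onOb G A) (onOb G B)" using E.pair_simps(1-3)[of ?p ?q] ga by auto
  have weq: "?w \<cdot>\<^bsub>E\<^esub> x = ?w \<cdot>\<^bsub>E\<^esub> y \<longleftrightarrow> ?p \<cdot>\<^bsub>E\<^esub> x = ?p \<cdot>\<^bsub>E\<^esub> y \<and> ?q \<cdot>\<^bsub>E\<^esub> x = ?q \<cdot>\<^bsub>E\<^esub> y"
    if xy: "x \<in> Arr E" "y \<in> Arr E" "Cod E x = onOb G V" "Cod E y = onOb G V" "Dom E x = Dom E y" for x y
  proof -
    have *: "pr1 E (onOb G A) (onOb G B) \<cdot>\<^bsub>E\<^esub> (?w \<cdot>\<^bsub>E\<^esub> x) = ?p \<cdot>\<^bsub>E\<^esub> x"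
      "pr2 E (onOb G A) (onOb G B) \<cdot>\<^bsub>E\<^esub> (?w \<cdot>\<^bsub>E\<^esub> x) = ?q \<cdot>\<^bsub>E\<^esub> x"
      if "x \<in> Arr E" "Cod E x = onOb G V" for x
      by (rule E.pr_pair_comp; use that ga in simp)+
    have o: "onOb G A \<in> Ob E" "onOb G B \<in> Ob E" using E.Cod_Ob[OF ga(1)] E.Cod_Ob[OF ga(2)] ga by simp_all
    show ?thesis
    proof
      assume "?w \<cdot>\<^bsub>E\<^esub> x = ?w \<cdot>\<^bsub>E\<^esub> y"
      then show "?p \<cdot>\<^bsub>E\<^esub> x = ?p \<cdot>\<^bsub>E\<^esub> y \<and> ?q \<cdot>\<^bsub>E\<^esub> x = ?q \<cdot>\<^bsub>E\<^esub> y"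
        using *[OF xy(1,3)] *[OF xy(2,4)] by metis
    next
      assume h: "?p \<cdot>\<^bsub>E\<^esub> x = ?p \<cdot>\<^bsub>E\<^esub> y \<and> ?q \<cdot>\<^bsub>E\<^esub> x = ?q \<cdot>\<^bsub>E\<^esub> y"
      show "?w \<cdot>\<^bsub>E\<^esub> x = ?w \<cdot>\<^bsub>E\<^esub> y"
      proof (rule E.prd_eqI[of _ _ "onOb G A" "onOb G B"])
        show "pr1 E (onOb G A) (onOb G B) \<cdot>\<^bsub>E\<^esub> (?w \<cdot>\<^bsub>E\<^esub> x) = pr1 E (onOb G A) (onOb G B) \<cdot>\<^bsub>E\<^esub> (?w \<cdot>\<^bsub>E\<^esub> y)"
          unfolding *[OF xy(1,3)] *[OF xy(2,4)] using h by blast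
        show "pr2 E (onOb G A) (onOb G B) \<cdot>\<^bsub>E\<^esub> (?w \<cdot>\<^bsub>E\<^esub> x) = pr2 E (onOb G A) (onOb G B) \<cdot>\<^bsub>E\<^esub> (?w \<cdot>\<^bsub>E\<^esub> y)"
          unfolding *[OF xy(1,3)] *[OF xy(2,4)] using h by blast
      qed (use xy w o in auto)
    qed
  qed
  obtain P Q where pb: "is_pullback E ?w ?w P Q" using E.pullback_ex[OF w(1) w(1)] by metis
  have t: "P \<in> Arr E" "Q \<in> Arr E" "Dom E P = Dom E Q" "Cod E P = onOb G V" "Cod E Q = onOb G V"
    "?w \<cdot>\<^bsub>E\<^esub> P = ?w \<cdot>\<^bsub>E\<^esub> Q"
    using E.pullback_square[OF pb] w by (auto simp: commuting_square_def)
  have tp: "?p \<cdot>\<^bsub>E\<^esub> P = ?p \<cdot>\<^bsub>E\<^esub> Q" "?q \<cdot>\<^bsub>E\<^esub> P = ?q \<cdot>\<^bsub>E\<^esub> Q" using weq[OF t(1,2,4,5,3)] t(6) by blast+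
  let ?I = "Id E (onOb G V)"
  have I: "?I \<in> Arr E" "Dom E ?I = onOb G V" "Cod E ?I = onOb G V" using pq by auto
  obtain k where k: "k \<in> Arr E" "Dom E k = Dom E ?I" "Cod E k = Dom E P" "P \<cdot>\<^bsub>E\<^esub> k = ?I" "Q \<cdot>\<^bsub>E\<^esub> k = ?I"
    by (rule E.weak_pullbackE[OF E.pullback_weak[OF pb] I(1) I(1)]) (use I w in auto)
  have "regular_epi E k"
  proof (rule cover_span[of V V 2 "\<lambda>j. if j = 0 then p else q" "\<lambda>j. if j = 0 then A else B" "\<lambda>j. if j = 0 then p else q"
      "Id S V" V "Id S V" P "Dom E P" Q])
    fix a b assume ab: "a \<in> Arr S" "b \<in> Arr S" "Dom S a = Dom S b" "Cod S a = V" "Cod S b = V"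
      and e: "\<And>j. j < (2::nat) \<Longrightarrow> (if j = 0 then p else q) \<cdot> a = (if j = 0 then p else q) \<cdot> b"
    have "p \<cdot> a = p \<cdot> b" "q \<cdot> a = q \<cdot> b" using e[of 0] e[of 1] by simp_all
    then have "a = b" by (rule product_unique[OF V ab])
    then show "\<exists>h. h \<in> hom S (Dom S b) V \<and> Id S V \<cdot> h = a \<and> Id S V \<cdot> h = b"
      using ab by (intro exI[of _ b]) simp
  next
    fix a b assume ab: "a \<in> Arr E" "b \<in> Arr E" "Dom E a = Dom E b" "Cod E a = onOb G V" "Cod E b = onOb G V"
      and e: "\<And>j. j < (2::nat) \<Longrightarrow> onArr G (if j = 0 then p else q) \<cdot>\<^bsub>E\<^esub> a = onArr G (if j = 0 then p else q) \<cdot>\<^bsub>E\<^esub> b"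
    have "?p \<cdot>\<^bsub>E\<^esub> a = ?p \<cdot>\<^bsub>E\<^esub> b" "?q \<cdot>\<^bsub>E\<^esub> a = ?q \<cdot>\<^bsub>E\<^esub> b" using e[of 0] e[of 1] by simp_all
    then have "?w \<cdot>\<^bsub>E\<^esub> a = ?w \<cdot>\<^bsub>E\<^esub> b" using weq[OF ab(1,2,4,5,3)] by blast
    then have "commuting_square E ?w ?w a b" using ab w by (simp add: commuting_square_def)
    then have "\<exists>!h. h \<in> hom E (Dom E a) (Dom E P) \<and> P \<cdot>\<^bsub>E\<^esub> h = a \<and> Q \<cdot>\<^bsub>E\<^esub> h = b"
      using pb unfolding is_pullback_def by blast
    then show "\<exists>!h. h \<in> hom E (Dom E b) (Dom E P) \<and> P \<cdot>\<^bsub>E\<^esub> h = a \<and> Q \<cdot>\<^bsub>E\<^esub> h = b" unfolding ab(3) .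
  qed (use pq t tp k I in auto)
  then have PQ: "P = Q"
    by (rule E.epicD[OF E.regular_epi_epic]) (use t k in auto)
  have "?w \<cdot>\<^bsub>E\<^esub> u = ?w \<cdot>\<^bsub>E\<^esub> v" using weq[OF uv] e by blast
  then obtain h where "h \<in> Arr E" "P \<cdot>\<^bsub>E\<^esub> h = u" "Q \<cdot>\<^bsub>E\<^esub> h = v"
    by (rule E.weak_pullbackE[OF E.pullback_weak[OF pb] uv(1,2,5), rotated 2]) (use uv w in auto)
  then show ?thesis using PQ by simp
qed

end

section \<open>Extending a left covering functor\<close>

context left_cov
begin

lemma image_factorization:
  assumes "c \<in> Arr S"
  shows "\<exists>e m. regular_epi E e \<and> monic E m \<and> Cod E e = Dom E m \<and> onArr G c = m \<cdot>\<^bsub>E\<^esub> e"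
  using E.image_ex[of "onArr G c"] assms by (metis G_simps(2))

definition im_epi where "im_epi c = (SOME e. \<exists>m. regular_epi E e \<and> monic E m \<and> Cod E e = Dom E m \<and> onArr G c = m \<cdot>\<^bsub>E\<^esub> e)"
definition im_mono where "im_mono c = (SOME m. regular_epi E (im_epi c) \<and> monic E m \<and> Cod E (im_epi c) = Dom E m \<and> onArr G c = m \<cdot>\<^bsub>E\<^esub> im_epi c)"

lemma im_epi_mono:
  assumes c: "c \<in> Arr S"
  shows "regular_epi E (im_epi c)" "monic E (im_mono c)" "Dom E (im_mono c) = Cod E (im_epi c)" "im_mono c \<cdot>\<^bsub>E\<^esub> im_epi c = onArr G c"
    "im_epi c \<in> Arr E" "im_mono c \<in> Arr E" "Dom E (im_epi c) = onOb G (Dom S c)" "Cod E (im_mono c) = onOb G (Cod S c)"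
proof -
  have "\<exists>m. regular_epi E (im_epi c) \<and> monic E m \<and> Cod E (im_epi c) = Dom E m \<and> onArr G c = m \<cdot>\<^bsub>E\<^esub> im_epi c"
    unfolding im_epi_def by (rule someI_ex[OF image_factorization[OF c]])
  then have *: "regular_epi E (im_epi c) \<and> monic E (im_mono c) \<and> Cod E (im_epi c) = Dom E (im_mono c) \<and> onArr G c = im_mono c \<cdot>\<^bsub>E\<^esub> im_epi c"
    unfolding im_mono_def by (rule someI_ex)
  then show 1: "regular_epi E (im_epi c)" "monic E (im_mono c)" "Dom E (im_mono c) = Cod E (im_epi c)" "im_mono c \<cdot>\<^bsub>E\<^esub> im_epi c = onArr G c"
    by simp_all
  show 2: "im_epi c \<in> Arr E" "im_mono c \<in> Arr E" using 1 by auto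
  have "Dom E (im_mono c \<cdot>\<^bsub>E\<^esub> im_epi c) = Dom E (im_epi c)" "Cod E (im_mono c \<cdot>\<^bsub>E\<^esub> im_epi c) = Cod E (im_mono c)"
    using 1(3) 2 by simp_all
  then show "Dom E (im_epi c) = onOb G (Dom S c)" "Cod E (im_mono c) = onOb G (Cod S c)"
    unfolding 1(4) using c by simp_all
qed

definition Fext_ob where "Fext_ob x = Cod E (im_epi (dp_incl x))"
definition Fext_arr where "Fext_arr \<phi> = (THE w. w \<in> hom E (Fext_ob (Dom D \<phi>)) (Fext_ob (Cod D \<phi>)) \<and>
   (\<exists>f. kmap (Dom D \<phi>) (Cod D \<phi>) f \<and> \<phi> = ar (Dom D \<phi>) (Cod D \<phi>) f \<and>
      w \<cdot>\<^bsub>E\<^esub> im_epi (dp_incl (Dom D \<phi>)) = im_epi (dp_incl (Cod D \<phi>)) \<cdot>\<^bsub>E\<^esub> onArr G f))"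

text \<open>The second factor of \<open>G c\<close> is monic, so equality in the image can be tested in \<open>E\<close> on \<open>G c\<close>.\<close>

lemma im_epi_eq_iff:
  assumes y: "y \<in> Ob D" and u: "u \<in> Arr E" "v \<in> Arr E" "Dom E u = Dom E v" "Cod E u = onOb G (pt y)" "Cod E v = onOb G (pt y)"
  shows "im_epi (dp_incl y) \<cdot>\<^bsub>E\<^esub> u = im_epi (dp_incl y) \<cdot>\<^bsub>E\<^esub> v \<longleftrightarrow> onArr G (dp_incl y) \<cdot>\<^bsub>E\<^esub> u = onArr G (dp_incl y) \<cdot>\<^bsub>E\<^esub> v"
proof -
  note em = im_epi_mono[OF incl_Arr[OF y]]
  have *: "onArr G (dp_incl y) \<cdot>\<^bsub>E\<^esub> w = im_mono (dp_incl y) \<cdot>\<^bsub>E\<^esub> (im_epi (dp_incl y) \<cdot>\<^bsub>E\<^esub> w)"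
    if "w \<in> Arr E" "Cod E w = onOb G (pt y)" for w
    using E.extend_eq1[OF em(4), of w] em that by simp
  show ?thesis
    unfolding *[OF u(1,4)] *[OF u(2,5)]
  proof
    assume "im_mono (dp_incl y) \<cdot>\<^bsub>E\<^esub> (im_epi (dp_incl y) \<cdot>\<^bsub>E\<^esub> u) = im_mono (dp_incl y) \<cdot>\<^bsub>E\<^esub> (im_epi (dp_incl y) \<cdot>\<^bsub>E\<^esub> v)"
    then show "im_epi (dp_incl y) \<cdot>\<^bsub>E\<^esub> u = im_epi (dp_incl y) \<cdot>\<^bsub>E\<^esub> v"
      by (rule E.monicD[OF em(2)]) (use u em in auto)
  qed simp
qed

text \<open>The image of \<open>c\<close> is a quotient by the kernel pair of the image of \<open>c\<close> in \<open>E\<close>, and left covering says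
  that the latter is covered by the weak kernel pair in \<open>S\<close>, which \<open>f\<close> respects.\<close>

lemma Fext_arr_ex:
  assumes o: "x \<in> Ob D" "y \<in> Ob D" and f: "kmap x y f"
  obtains w where "w \<in> Arr E" "Dom E w = Fext_ob x" "Cod E w = Fext_ob y"
    "w \<cdot>\<^bsub>E\<^esub> im_epi (dp_incl x) = im_epi (dp_incl y) \<cdot>\<^bsub>E\<^esub> onArr G f"
proof -
  let ?c = "dp_incl x" and ?d = "dp_incl y"
  have cd: "?c \<in> Arr S" "?d \<in> Arr S" using o by auto
  note fa = kmapD(1-3)[OF f]
  note ec = im_epi_mono[OF cd(1)] and ed = im_epi_mono[OF cd(2)]
  have Gf: "onArr G f \<in> Arr E" "Dom E (onArr G f) = onOb G (pt x)" "Cod E (onArr G f) = onOb G (pt y)" using fa by auto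
  have Gc: "onArr G ?c \<in> Arr E" "Dom E (onArr G ?c) = onOb G (pt x)" using cd by auto
  have Gd: "onArr G ?d \<in> Arr E" "Dom E (onArr G ?d) = onOb G (pt y)" using cd by auto
  obtain k1 k2 where k: "is_weak_pullback S ?c ?c k1 k2" "k1 \<in> Arr S" "k2 \<in> Arr S" "Dom S k2 = Dom S k1"
    "Cod S k1 = pt x" "Cod S k2 = pt x" "?c \<cdot> k1 = ?c \<cdot> k2"
    using wpb_ex[OF cd(1) cd(1) refl] by metis
  have Gk: "onArr G k1 \<in> Arr E" "onArr G k2 \<in> Arr E" "Dom E (onArr G k1) = onOb G (Dom S k1)"
    "Dom E (onArr G k2) = onOb G (Dom S k1)" "Cod E (onArr G k1) = onOb G (pt x)" "Cod E (onArr G k2) = onOb G (pt x)"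
    using k by auto
  have dk: "?d \<cdot> (f \<cdot> k1) = ?d \<cdot> (f \<cdot> k2)" by (rule kmapD(4)[OF f k(7)]) (use k in auto)
  have "onArr G (?c \<cdot> k1) = onArr G (?c \<cdot> k2)" unfolding k(7) ..
  then have ck: "onArr G ?c \<cdot>\<^bsub>E\<^esub> onArr G k1 = onArr G ?c \<cdot>\<^bsub>E\<^esub> onArr G k2" using k(2-6) cd by simp
  have "onArr G (?d \<cdot> (f \<cdot> k1)) = onArr G (?d \<cdot> (f \<cdot> k2))" unfolding dk ..
  then have dfk: "onArr G ?d \<cdot>\<^bsub>E\<^esub> (onArr G f \<cdot>\<^bsub>E\<^esub> onArr G k1) = onArr G ?d \<cdot>\<^bsub>E\<^esub> (onArr G f \<cdot>\<^bsub>E\<^esub> onArr G k2)"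
    using k(2-6) cd fa by simp
  obtain P1 P2 where pb: "is_pullback E (onArr G ?c) (onArr G ?c) P1 P2" using E.pullback_ex[OF Gc(1) Gc(1)] by metis
  have P: "P1 \<in> Arr E" "P2 \<in> Arr E" "Dom E P1 = Dom E P2" "Cod E P1 = onOb G (pt x)" "Cod E P2 = onOb G (pt x)"
    using E.pullback_square[OF pb] Gc by (auto simp: commuting_square_def)
  obtain k where k': "k \<in> Arr E" "Dom E k = Dom E (onArr G k1)" "Cod E k = Dom E P1" "P1 \<cdot>\<^bsub>E\<^esub> k = onArr G k1" "P2 \<cdot>\<^bsub>E\<^esub> k = onArr G k2"
    by (rule E.weak_pullbackE[OF E.pullback_weak[OF pb] Gk(1,2)]) (use ck Gk Gc in auto)
  have "regular_epi E k"
    by (rule cover_pullback[OF k(1) pb k'(1)]) (use k' Gk in auto)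
  then have epi: "epic E k" by (rule E.regular_epi_epic)
  let ?g = "onArr G ?d \<cdot>\<^bsub>E\<^esub> onArr G f"
  have g: "?g \<in> Arr E" "Dom E ?g = onOb G (pt x)" using Gd Gf by auto
  have gP: "?g \<cdot>\<^bsub>E\<^esub> P1 = ?g \<cdot>\<^bsub>E\<^esub> P2"
  proof (rule E.epicD[OF epi])
    show "(?g \<cdot>\<^bsub>E\<^esub> P1) \<cdot>\<^bsub>E\<^esub> k = (?g \<cdot>\<^bsub>E\<^esub> P2) \<cdot>\<^bsub>E\<^esub> k"
      using Gd Gf P k' dfk by simp
  qed (use g P k' in auto)
  obtain w where w: "w \<in> Arr E" "Dom E w = Cod E (im_epi ?c)" "Cod E w = Cod E (im_epi ?d \<cdot>\<^bsub>E\<^esub> onArr G f)"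
     "w \<cdot>\<^bsub>E\<^esub> im_epi ?c = im_epi ?d \<cdot>\<^bsub>E\<^esub> onArr G f"
  proof (rule E.regular_epi_descend[OF ec(1), of "im_epi ?d \<cdot>\<^bsub>E\<^esub> onArr G f"])
    fix u v assume uv: "u \<in> Arr E" "v \<in> Arr E" "Cod E u = Dom E (im_epi ?c)" "Cod E v = Dom E (im_epi ?c)" "Dom E u = Dom E v"
      "im_epi ?c \<cdot>\<^bsub>E\<^esub> u = im_epi ?c \<cdot>\<^bsub>E\<^esub> v"
    have uv': "Cod E u = onOb G (pt x)" "Cod E v = onOb G (pt x)" using uv ec by auto
    have e: "onArr G ?c \<cdot>\<^bsub>E\<^esub> u = onArr G ?c \<cdot>\<^bsub>E\<^esub> v" using im_epi_eq_iff[OF o(1) uv(1,2,5) uv'] uv(6) by blast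
    obtain h where h: "h \<in> Arr E" "Dom E h = Dom E u" "Cod E h = Dom E P1" "P1 \<cdot>\<^bsub>E\<^esub> h = u" "P2 \<cdot>\<^bsub>E\<^esub> h = v"
      by (rule E.weak_pullbackE[OF E.pullback_weak[OF pb] uv(1,2,5)]) (use e uv' Gc in auto)
    have "?g \<cdot>\<^bsub>E\<^esub> (P1 \<cdot>\<^bsub>E\<^esub> h) = ?g \<cdot>\<^bsub>E\<^esub> (P2 \<cdot>\<^bsub>E\<^esub> h)"
      by (rule E.extend_eq[OF gP]) (use g P h(1-3) in auto)
    then have "onArr G ?d \<cdot>\<^bsub>E\<^esub> (onArr G f \<cdot>\<^bsub>E\<^esub> u) = onArr G ?d \<cdot>\<^bsub>E\<^esub> (onArr G f \<cdot>\<^bsub>E\<^esub> v)"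
      unfolding h(4,5) using Gd Gf uv(1,2) uv' by simp
    then have "im_epi ?d \<cdot>\<^bsub>E\<^esub> (onArr G f \<cdot>\<^bsub>E\<^esub> u) = im_epi ?d \<cdot>\<^bsub>E\<^esub> (onArr G f \<cdot>\<^bsub>E\<^esub> v)"
      using im_epi_eq_iff[OF o(2), of "onArr G f \<cdot>\<^bsub>E\<^esub> u" "onArr G f \<cdot>\<^bsub>E\<^esub> v"] Gf uv(1,2,5) uv' by simp
    then show "(im_epi ?d \<cdot>\<^bsub>E\<^esub> onArr G f) \<cdot>\<^bsub>E\<^esub> u = (im_epi ?d \<cdot>\<^bsub>E\<^esub> onArr G f) \<cdot>\<^bsub>E\<^esub> v"
      using ed Gf uv(1,2) uv' by simp
  qed (use ec ed Gf in auto)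
  then show thesis using that[of w] ed Gf by (simp add: Fext_ob_def)
qed

lemma Fext_ob_Ob [simp]: "x \<in> Ob D \<Longrightarrow> Fext_ob x \<in> Ob E"
  using im_epi_mono(5)[OF incl_Arr, of x] by (simp add: Fext_ob_def)

lemma Fext_arr:
  assumes o: "x \<in> Ob D" "y \<in> Ob D" and f: "kmap x y f"
  shows "Fext_arr (ar x y f) \<in> Arr E" "Dom E (Fext_arr (ar x y f)) = Fext_ob x" "Cod E (Fext_arr (ar x y f)) = Fext_ob y"
    "Fext_arr (ar x y f) \<cdot>\<^bsub>E\<^esub> im_epi (dp_incl x) = im_epi (dp_incl y) \<cdot>\<^bsub>E\<^esub> onArr G f"
proof -
  note ec = im_epi_mono[OF incl_Arr[OF o(1)]] and ed = im_epi_mono[OF incl_Arr[OF o(2)]]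
  note fa = kmapD(1-3)[OF f]
  have indep: "im_epi (dp_incl y) \<cdot>\<^bsub>E\<^esub> onArr G g = im_epi (dp_incl y) \<cdot>\<^bsub>E\<^esub> onArr G f" if g: "kmap x y g" "ar x y f = ar x y g" for g
  proof -
    note ga = kmapD(1-3)[OF g(1)]
    have "dp_incl y \<cdot> f = dp_incl y \<cdot> g" using ar_eq_iff[OF o f g(1)] g(2) by blast
    then have "onArr G (dp_incl y \<cdot> f) = onArr G (dp_incl y \<cdot> g)" by simp
    then have "onArr G (dp_incl y) \<cdot>\<^bsub>E\<^esub> onArr G g = onArr G (dp_incl y) \<cdot>\<^bsub>E\<^esub> onArr G f"
      using fa ga o by simp
    then show ?thesis using im_epi_eq_iff[OF o(2), of "onArr G g" "onArr G f"] fa ga by simp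
  qed
  obtain w where w: "w \<in> Arr E" "Dom E w = Fext_ob x" "Cod E w = Fext_ob y"
    "w \<cdot>\<^bsub>E\<^esub> im_epi (dp_incl x) = im_epi (dp_incl y) \<cdot>\<^bsub>E\<^esub> onArr G f"
    using Fext_arr_ex[OF o f] by metis
  have "Fext_arr (ar x y f) = w"
    unfolding Fext_arr_def Dom_Cod_ar
  proof (rule the_equality)
    show "w \<in> hom E (Fext_ob x) (Fext_ob y) \<and> (\<exists>g. kmap x y g \<and> ar x y f = ar x y g \<and>
        w \<cdot>\<^bsub>E\<^esub> im_epi (dp_incl x) = im_epi (dp_incl y) \<cdot>\<^bsub>E\<^esub> onArr G g)" using w f by auto
    fix w' assume w': "w' \<in> hom E (Fext_ob x) (Fext_ob y) \<and> (\<exists>g. kmap x y g \<and> ar x y f = ar x y g \<and>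
        w' \<cdot>\<^bsub>E\<^esub> im_epi (dp_incl x) = im_epi (dp_incl y) \<cdot>\<^bsub>E\<^esub> onArr G g)"
    then have "w' \<cdot>\<^bsub>E\<^esub> im_epi (dp_incl x) = im_epi (dp_incl y) \<cdot>\<^bsub>E\<^esub> onArr G f" using indep by auto
    then have "w' \<cdot>\<^bsub>E\<^esub> im_epi (dp_incl x) = w \<cdot>\<^bsub>E\<^esub> im_epi (dp_incl x)" using w(4) by simp
    then show "w' = w"
      by (rule E.epicD[OF E.regular_epi_epic[OF ec(1)]]) (use w w' in \<open>auto simp: Fext_ob_def\<close>)
  qed
  then show "Fext_arr (ar x y f) \<in> Arr E" "Dom E (Fext_arr (ar x y f)) = Fext_ob x" "Cod E (Fext_arr (ar x y f)) = Fext_ob y"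
    "Fext_arr (ar x y f) \<cdot>\<^bsub>E\<^esub> im_epi (dp_incl x) = im_epi (dp_incl y) \<cdot>\<^bsub>E\<^esub> onArr G f"
    using w by auto
qed

lemma Fext_arr_eqI:
  assumes o: "x \<in> Ob D" "y \<in> Ob D" and f: "kmap x y f" and w: "w \<in> Arr E" "Dom E w = Fext_ob x" "Cod E w = Fext_ob y"
    and e: "w \<cdot>\<^bsub>E\<^esub> im_epi (dp_incl x) = im_epi (dp_incl y) \<cdot>\<^bsub>E\<^esub> onArr G f"
  shows "Fext_arr (ar x y f) = w"
proof (rule E.epicD[OF E.regular_epi_epic[OF im_epi_mono(1)[OF incl_Arr[OF o(1)]]]])
  show "Fext_arr (ar x y f) \<cdot>\<^bsub>E\<^esub> im_epi (dp_incl x) = w \<cdot>\<^bsub>E\<^esub> im_epi (dp_incl x)" using Fext_arr(4)[OF o f] e by simp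
qed (use Fext_arr(1-3)[OF o f] w in \<open>auto simp: Fext_ob_def\<close>)

definition Fext :: "(('o, 'a, 'a set) dp_ob, ('o, 'a, 'a set) dp_arr, 'p, 'b) functr" where
  "Fext = \<lparr>onOb = Fext_ob, onArr = Fext_arr\<rparr>"

lemma Fext_simps [simp]: "onOb Fext x = Fext_ob x" "onArr Fext \<phi> = Fext_arr \<phi>"
  by (auto simp: Fext_def)

lemma Fext_arr_comp:
  assumes o: "x \<in> Ob D" "y \<in> Ob D" "z \<in> Ob D" and f: "kmap x y f" and g: "kmap y z g"
  shows "Fext_arr (ar x z (g \<cdot> f)) = Fext_arr (ar y z g) \<cdot>\<^bsub>E\<^esub> Fext_arr (ar x y f)"
proof (rule Fext_arr_eqI[OF o(1,3) kmap_comp[OF o f g]])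
  note Ff = Fext_arr[OF o(1,2) f] and Fg = Fext_arr[OF o(2,3) g]
  note ex = im_epi_mono[OF incl_Arr[OF o(1)]] and ey = im_epi_mono[OF incl_Arr[OF o(2)]] and ez = im_epi_mono[OF incl_Arr[OF o(3)]]
  note fa = kmapD(1-3)[OF f] and ga = kmapD(1-3)[OF g]
  have "(Fext_arr (ar y z g) \<cdot>\<^bsub>E\<^esub> Fext_arr (ar x y f)) \<cdot>\<^bsub>E\<^esub> im_epi (dp_incl x) = Fext_arr (ar y z g) \<cdot>\<^bsub>E\<^esub> (im_epi (dp_incl y) \<cdot>\<^bsub>E\<^esub> onArr G f)"
    using Ff Fg ex by (simp add: Fext_ob_def)
  also have "\<dots> = im_epi (dp_incl z) \<cdot>\<^bsub>E\<^esub> (onArr G g \<cdot>\<^bsub>E\<^esub> onArr G f)"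
    by (rule E.extend_eq[OF Fg(4)]) (use Fg ey ez fa ga in \<open>auto simp: Fext_ob_def\<close>)
  finally show "(Fext_arr (ar y z g) \<cdot>\<^bsub>E\<^esub> Fext_arr (ar x y f)) \<cdot>\<^bsub>E\<^esub> im_epi (dp_incl x) = im_epi (dp_incl z) \<cdot>\<^bsub>E\<^esub> onArr G (g \<cdot> f)"
    using fa ga by simp
qed (use Fext_arr(1-3)[OF o(1,2) f] Fext_arr(1-3)[OF o(2,3) g] in auto)

lemma Fext_functor: "is_functor D E Fext"
  unfolding is_functor_def
proof (intro conjI ballI impI)
  show "category D" "category E" by (rule D.category_axioms E.category_axioms)+
  show "onOb Fext \<in> Ob D \<rightarrow> Ob E" by simp
  fix \<phi> assume p: "\<phi> \<in> Arr D"
  obtain x y f where f: "\<phi> = ar x y f" "kmap x y f" "x \<in> Ob D" "y \<in> Ob D" using arE'[OF p] .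
  show "onArr Fext \<phi> \<in> hom E (onOb Fext (Dom D \<phi>)) (onOb Fext (Cod D \<phi>))"
    using Fext_arr(1-3)[OF f(3,4,2)] unfolding f(1) by simp
  fix \<gamma> assume q: "\<gamma> \<in> Arr D" "Cod D \<phi> = Dom D \<gamma>"
  obtain z g where g: "\<gamma> = ar y z g" "kmap y z g" "z \<in> Ob D" using arE'[OF q(1)] q(2) f(1) Dom_Cod_ar by metis
  show "onArr Fext (\<gamma> \<cdot>\<^bsub>D\<^esub> \<phi>) = onArr Fext \<gamma> \<cdot>\<^bsub>E\<^esub> onArr Fext \<phi>"
    unfolding f(1) g(1) Fext_simps ar_comp[OF f(3,4) g(3) f(2) g(2)] by (rule Fext_arr_comp[OF f(3,4) g(3) f(2) g(2)])
next
  fix x assume x: "x \<in> Ob D"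
  show "onArr Fext (Id D x) = Id E (onOb Fext x)"
    unfolding Id_D Fext_simps
    by (rule Fext_arr_eqI[OF x x kmap_Id[OF x]]) (use x im_epi_mono[OF incl_Arr[OF x]] in \<open>auto simp: Fext_ob_def\<close>)
qed

lemma Fext_J: "nat_isomorphic S E (comp_functor Fext J) G"
proof -
  have i: "im_mono (Id S A) \<in> Arr E" "im_epi (Id S A) \<in> Arr E" "Dom E (im_mono (Id S A)) = Fext_ob (jo A)" "Cod E (im_mono (Id S A)) = onOb G A"
    "Dom E (im_epi (Id S A)) = onOb G A" "Cod E (im_epi (Id S A)) = Fext_ob (jo A)"
    "im_mono (Id S A) \<cdot>\<^bsub>E\<^esub> im_epi (Id S A) = Id E (onOb G A)" "im_epi (Id S A) \<cdot>\<^bsub>E\<^esub> im_mono (Id S A) = Id E (Fext_ob (jo A))" if A: "A \<in> Ob S" for A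
  proof -
    note em = im_epi_mono[OF Id_simps(1)[OF A]]
    show 1: "im_mono (Id S A) \<in> Arr E" "im_epi (Id S A) \<in> Arr E" "Dom E (im_mono (Id S A)) = Fext_ob (jo A)" "Cod E (im_mono (Id S A)) = onOb G A"
      "Dom E (im_epi (Id S A)) = onOb G A" "Cod E (im_epi (Id S A)) = Fext_ob (jo A)"
      "im_mono (Id S A) \<cdot>\<^bsub>E\<^esub> im_epi (Id S A) = Id E (onOb G A)" using em A by (auto simp: Fext_ob_def)
    then show "im_epi (Id S A) \<cdot>\<^bsub>E\<^esub> im_mono (Id S A) = Id E (Fext_ob (jo A))"
      using E.monic_split_epi_iso[OF em(2), of "im_epi (Id S A)"] by (simp add: inverse_arrows_def)
  qed
  have FJ: "is_functor S E (comp_functor Fext J)" by (rule comp_is_functor[OF J_functor Fext_functor])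
  have nt: "nat_trans S E (comp_functor Fext J) G (\<lambda>A. im_mono (Id S A))"
    unfolding nat_trans_def
  proof (intro conjI ballI)
    fix f assume f: "f \<in> Arr S"
    let ?A = "Dom S f" and ?B = "Cod S f"
    have AB: "?A \<in> Ob S" "?B \<in> Ob S" using f by auto
    have m: "kmap (jo ?A) (jo ?B) f" using f by simp
    note F = Fext_arr[OF ob_Ob ob_Ob m, simplified]
    have F': "Fext_arr (ar (jo ?A) (jo ?B) f) \<in> Arr E" "Dom E (Fext_arr (ar (jo ?A) (jo ?B) f)) = Fext_ob (jo ?A)"
      "Cod E (Fext_arr (ar (jo ?A) (jo ?B) f)) = Fext_ob (jo ?B)"
      "Fext_arr (ar (jo ?A) (jo ?B) f) \<cdot>\<^bsub>E\<^esub> im_epi (Id S ?A) = im_epi (Id S ?B) \<cdot>\<^bsub>E\<^esub> onArr G f"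
      using F AB by auto
    have "im_mono (Id S ?B) \<cdot>\<^bsub>E\<^esub> Fext_arr (ar (jo ?A) (jo ?B) f) = onArr G f \<cdot>\<^bsub>E\<^esub> im_mono (Id S ?A)"
    proof (rule E.epicD[OF E.regular_epi_epic[OF im_epi_mono(1)[OF Id_simps(1)[OF AB(1)]]]])
      show "(im_mono (Id S ?B) \<cdot>\<^bsub>E\<^esub> Fext_arr (ar (jo ?A) (jo ?B) f)) \<cdot>\<^bsub>E\<^esub> im_epi (Id S ?A) = (onArr G f \<cdot>\<^bsub>E\<^esub> im_mono (Id S ?A)) \<cdot>\<^bsub>E\<^esub> im_epi (Id S ?A)"
        using F' i[OF AB(1)] i[OF AB(2)] f E.extend_eq1[OF i(7)[OF AB(2)], of "onArr G f"] by simp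
    qed (use F' i[OF AB(1)] i[OF AB(2)] f in auto)
    then show "im_mono (Id S ?B) \<cdot>\<^bsub>E\<^esub> onArr (comp_functor Fext J) f = onArr G f \<cdot>\<^bsub>E\<^esub> im_mono (Id S ?A)" by simp
  qed (use i in auto)
  have inv: "inverse_transformations S E (comp_functor Fext J) G (\<lambda>A. im_mono (Id S A)) (\<lambda>A. im_epi (Id S A))"
    unfolding inverse_transformations_def using i by simp
  show ?thesis
    unfolding nat_isomorphic_def using nt inv inverse_nat_trans[OF FJ G_functor nt _ inv] i by auto
qed

text \<open>The section \<open>s\<close> of \<open>f\<close> up to the kernel of \<open>y\<close> becomes a genuine factorization of the cover of \<open>y\<close>
  through the image of \<open>\<phi>\<close>.\<close>

lemma Fext_regular_epi:
  assumes "regular_epi D \<phi>" shows "regular_epi E (Fext_arr \<phi>)"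
proof -
  obtain x y f where f: "\<phi> = ar x y f" "kmap x y f" "x \<in> Ob D" "y \<in> Ob D" using arE'[of \<phi>] assms by (metis D.regular_epi_Arr)
  note fa = kmapD(1-3)[OF f(2)]
  note F = Fext_arr[OF f(3,4,2)] and ex = im_epi_mono[OF incl_Arr[OF f(3)]] and ey = im_epi_mono[OF incl_Arr[OF f(4)]]
  obtain s where s: "s \<in> Arr S" "Dom S s = pt y" "Cod S s = pt x" "dp_incl y \<cdot> (f \<cdot> s) = dp_incl y"
    using assms unfolding f(1) regular_epi_D_iff[OF f(3,4,2)] by blast
  have "onArr G (dp_incl y \<cdot> (f \<cdot> s)) = onArr G (dp_incl y)" unfolding s(4) ..
  then have "onArr G (dp_incl y) \<cdot>\<^bsub>E\<^esub> onArr G (f \<cdot> s) = onArr G (dp_incl y) \<cdot>\<^bsub>E\<^esub> Id E (onOb G (pt y))"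
    using s(1-3) fa f(4) by simp
  then have e: "im_epi (dp_incl y) \<cdot>\<^bsub>E\<^esub> onArr G (f \<cdot> s) = im_epi (dp_incl y)"
    using im_epi_eq_iff[OF f(4), of "onArr G (f \<cdot> s)" "Id E (onOb G (pt y))"] s(1-3) fa ey f(4) by simp
  have "Fext_arr \<phi> \<cdot>\<^bsub>E\<^esub> (im_epi (dp_incl x) \<cdot>\<^bsub>E\<^esub> onArr G s) = im_epi (dp_incl y) \<cdot>\<^bsub>E\<^esub> (onArr G f \<cdot>\<^bsub>E\<^esub> onArr G s)"
    unfolding f(1) by (rule E.extend_eq[OF F(4)]) (use F ex ey s fa in \<open>auto simp: Fext_ob_def\<close>)
  then have "Fext_arr \<phi> \<cdot>\<^bsub>E\<^esub> (im_epi (dp_incl x) \<cdot>\<^bsub>E\<^esub> onArr G s) = im_epi (dp_incl y)" using e s fa by simp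
  then show ?thesis
    using E.regular_epi_last_factor[of "Fext_arr \<phi>" "im_epi (dp_incl x) \<cdot>\<^bsub>E\<^esub> onArr G s"] ey(1) F ex s unfolding f(1)
    by (simp add: Fext_ob_def)
qed

lemma Fext_terminal:
  assumes T: "is_terminal D x" shows "is_terminal E (Fext_ob x)"
proof -
  obtain t where t: "is_terminal S t" using cart by (auto simp: cartesian_category_def)
  note jt = terminal_D[OF t]
  have to: "t \<in> Ob S" using t by (rule terminal_Ob)
  note F = functorD(3-)[OF Fext_functor, simplified]
  have jo: "jo t \<in> Ob D" using to by simp
  obtain i where i: "i \<in> Arr D" "Dom D i = jo t" "Cod D i = x" by (rule D.terminal_ex[OF T jo])
  obtain j where j: "j \<in> Arr D" "Dom D j = x" "Cod D j = jo t" using D.terminal_ex[OF jt D.terminal_Ob[OF T]] by metis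
  have xo: "x \<in> Ob D" using T by (rule D.terminal_Ob)
  have "j \<cdot>\<^bsub>D\<^esub> i = Id D (jo t)" by (rule D.terminal_unique[OF jt]) (use i j to in auto)
  moreover have "i \<cdot>\<^bsub>D\<^esub> j = Id D x" by (rule D.terminal_unique[OF T]) (use i j xo in auto)
  ultimately have inv: "inverse_arrows E (Fext_arr i) (Fext_arr j)"
    unfolding inverse_arrows_def using i j F(6)[of i j] F(6)[of j i] F(2-5) to xo by simp
  obtain \<theta> \<theta>' where th: "nat_trans S E (comp_functor Fext J) G \<theta>" "nat_trans S E G (comp_functor Fext J) \<theta>'"
    "inverse_transformations S E (comp_functor Fext J) G \<theta> \<theta>'" using Fext_J by (auto simp: nat_isomorphic_def)
  have "inverse_arrows E (\<theta>' t) (\<theta> t)"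
    unfolding inverse_arrows_def
    using nat_transD(1-3)[OF th(1) to] nat_transD(1-3)[OF th(2) to] inverse_transformationsD[OF th(3) to] by simp
  then have "is_terminal E (Fext_ob (jo t))"
    using E.terminal_iso[OF G_terminal[OF t], of "\<theta>' t" "\<theta> t"] nat_transD(1-3)[OF th(2) to] by simp
  then show ?thesis
    using E.terminal_iso[OF _ inv] F(3,4)[OF i(1)] i by simp
qed

text \<open>Let \<open>Q\<close> be the pullback in \<open>E\<close> of the images and \<open>t\<close> the comparison into \<open>Q\<close> from the image of the pullback.
  It is monic because the latter embeds into \<open>G\<close> of a product, whose projections stay jointly monic.
  It is a regular epimorphism because the pullback of \<open>G X\<close> and \<open>G Y\<close> covers \<open>Q\<close>, by stability, and is
  itself covered by \<open>G\<close> of the weak pullback.\<close>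

lemma Fext_pullback:
  assumes pb: "is_pullback D \<phi> \<gamma> \<pi> \<kappa>" shows "is_pullback E (Fext_arr \<phi>) (Fext_arr \<gamma>) (Fext_arr \<pi>) (Fext_arr \<kappa>)"
proof -
  have sq: "\<phi> \<in> Arr D" "\<gamma> \<in> Arr D" "Cod D \<phi> = Cod D \<gamma>"
    using D.pullback_square[OF pb] by (auto simp: commuting_square_def)
  obtain x y z f g p q where o: "x \<in> Ob D" "y \<in> Ob D" "z \<in> Ob D" and f: "kmap x z f" and g: "kmap y z g"
    and fg: "\<phi> = ar x z f" "\<gamma> = ar y z g" and wp: "is_weak_pullback S (dp_incl z \<cdot> f) (dp_incl z \<cdot> g) p q"
    using pullback_D_ex[OF sq] by metis
  let ?c = "dp_incl x" and ?d = "dp_incl y" and ?e = "dp_incl z"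
  note fa = kmapD(1-3)[OF f] and ga = kmapD(1-3)[OF g]
  note PD = pullback_D[OF o f g wp]
  define v where "v = ob (pair S (?c \<cdot> p) (?d \<cdot> q))"
  note v = PD[folded v_def]
  have cd: "?c \<in> Arr S" "?d \<in> Arr S" "?e \<in> Arr S" using o by auto
  have pq: "p \<in> Arr S" "q \<in> Arr S" "Dom S q = Dom S p" "Cod S p = pt x" "Cod S q = pt y"
    using weak_pullback_square[OF wp] fa ga cd by (auto simp: commuting_square_def)
  let ?i = "pair S (?c \<cdot> p) (?d \<cdot> q)"
  have i: "?i \<in> Arr S" "Dom S ?i = Dom S p" "Cod S ?i = prd S (Cod S ?c) (Cod S ?d)"
    "dp_incl v = ?i" "pr1 S (Cod S ?c) (Cod S ?d) \<cdot> ?i = ?c \<cdot> p" "pr2 S (Cod S ?c) (Cod S ?d) \<cdot> ?i = ?d \<cdot> q"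
    using pq cd by (auto simp: v_def pr_pair)
  note F1 = Fext_arr[OF o(1,3) f] and F2 = Fext_arr[OF o(2,3) g] and Fp = Fext_arr[OF v(1) o(1) v(3)] and Fq = Fext_arr[OF v(1) o(2) v(4)]
  let ?Ff = "Fext_arr (ar x z f)" and ?Fg = "Fext_arr (ar y z g)" and ?Fp = "Fext_arr (ar v x p)" and ?Fq = "Fext_arr (ar v y q)"
  note ex = im_epi_mono[OF cd(1)] and ey = im_epi_mono[OF cd(2)] and ez = im_epi_mono[OF cd(3)] and ev = im_epi_mono[OF incl_Arr[OF v(1)]]
  let ?ex = "im_epi ?c" and ?ey = "im_epi ?d" and ?ez = "im_epi ?e" and ?ev = "im_epi (dp_incl v)" and ?mv = "im_mono (dp_incl v)"
  have evd: "Dom E ?ev = onOb G (Dom S p)" "Cod E ?ev = Fext_ob v" "Dom E ?mv = Fext_ob v" "Cod E ?mv = onOb G (Cod S ?i)"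
    using ev i by (auto simp: Fext_ob_def)
  have exd: "Cod E ?ex = Fext_ob x" "Cod E ?ey = Fext_ob y" "Cod E ?ez = Fext_ob z" by (simp_all add: Fext_ob_def)
  \<comment> \<open>the pullback of the images, and the comparison with the image of the pullback\<close>
  obtain Q1 Q2 where Q: "is_pullback E ?Ff ?Fg Q1 Q2" using E.pullback_ex[OF F1(1) F2(1)] F1(3) F2(3) by metis
  have Qa: "Q1 \<in> Arr E" "Q2 \<in> Arr E" "Dom E Q2 = Dom E Q1" "Cod E Q1 = Fext_ob x" "Cod E Q2 = Fext_ob y" "?Ff \<cdot>\<^bsub>E\<^esub> Q1 = ?Fg \<cdot>\<^bsub>E\<^esub> Q2"
    using E.pullback_square[OF Q] F1 F2 by (auto simp: commuting_square_def)
  have "?Ff \<cdot>\<^bsub>E\<^esub> ?Fp = ?Fg \<cdot>\<^bsub>E\<^esub> ?Fq"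
  proof -
    have "ar x z f \<cdot>\<^bsub>D\<^esub> ar v x p = ar y z g \<cdot>\<^bsub>D\<^esub> ar v y q"
      using D.pullback_square[OF v(5)] by (simp add: commuting_square_def)
    then show ?thesis
      using Fext_arr_comp[OF v(1) o(1,3) v(3) f] Fext_arr_comp[OF v(1) o(2,3) v(4) g]
        ar_comp[OF v(1) o(1,3) v(3) f] ar_comp[OF v(1) o(2,3) v(4) g] by simp
  qed
  then obtain t where t: "t \<in> Arr E" "Dom E t = Dom E ?Fp" "Cod E t = Dom E Q1" "Q1 \<cdot>\<^bsub>E\<^esub> t = ?Fp" "Q2 \<cdot>\<^bsub>E\<^esub> t = ?Fq"
    by (rule E.weak_pullbackE[OF E.pullback_weak[OF Q] Fp(1) Fq(1), rotated 3]) (use Fp Fq F1 F2 in auto)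
  have td: "Dom E t = Fext_ob v" using t(2) Fp by simp
  let ?r1 = "onArr G (pr1 S (Cod S ?c) (Cod S ?d))" and ?r2 = "onArr G (pr2 S (Cod S ?c) (Cod S ?d))"
  have ro: "Cod S ?c \<in> Ob S" "Cod S ?d \<in> Ob S" using cd by auto
  have r: "?r1 \<in> Arr E" "?r2 \<in> Arr E" "Dom E ?r1 = onOb G (Cod S ?i)" "Dom E ?r2 = onOb G (Cod S ?i)"
    "Cod E ?r1 = onOb G (Cod S ?c)" "Cod E ?r2 = onOb G (Cod S ?d)"
    using ro i(3) by auto
  have tm: "monic E t"
  proof (rule E.monicI[OF t(1)])
    have ri: "?r1 \<cdot>\<^bsub>E\<^esub> onArr G ?i = onArr G ?c \<cdot>\<^bsub>E\<^esub> onArr G p" "?r2 \<cdot>\<^bsub>E\<^esub> onArr G ?i = onArr G ?d \<cdot>\<^bsub>E\<^esub> onArr G q"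
      using G_simps(6)[of ?i "pr1 S (Cod S ?c) (Cod S ?d)"] G_simps(6)[of ?i "pr2 S (Cod S ?c) (Cod S ?d)"]
        G_simps(6)[of p ?c] G_simps(6)[of q ?d] i ro pq cd by simp_all
    have m1: "?r1 \<cdot>\<^bsub>E\<^esub> ?mv = im_mono ?c \<cdot>\<^bsub>E\<^esub> ?Fp"
    proof (rule E.epicD[OF E.regular_epi_epic[OF ev(1)]])
      have "(im_mono ?c \<cdot>\<^bsub>E\<^esub> ?Fp) \<cdot>\<^bsub>E\<^esub> ?ev = onArr G ?c \<cdot>\<^bsub>E\<^esub> onArr G p"
        using Fp ev(5) evd ex exd pq E.extend_eq1[OF ex(4), of "onArr G p"] by simp
      moreover have "(?r1 \<cdot>\<^bsub>E\<^esub> ?mv) \<cdot>\<^bsub>E\<^esub> ?ev = ?r1 \<cdot>\<^bsub>E\<^esub> onArr G ?i"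
        using r ev(4,5,6) evd i(4) by simp
      ultimately show "(?r1 \<cdot>\<^bsub>E\<^esub> ?mv) \<cdot>\<^bsub>E\<^esub> ?ev = (im_mono ?c \<cdot>\<^bsub>E\<^esub> ?Fp) \<cdot>\<^bsub>E\<^esub> ?ev" using ri(1) by simp
    qed (use r ev(6) evd Fp(1-3) ex exd in auto)
    have m2: "?r2 \<cdot>\<^bsub>E\<^esub> ?mv = im_mono ?d \<cdot>\<^bsub>E\<^esub> ?Fq"
    proof (rule E.epicD[OF E.regular_epi_epic[OF ev(1)]])
      have "(im_mono ?d \<cdot>\<^bsub>E\<^esub> ?Fq) \<cdot>\<^bsub>E\<^esub> ?ev = onArr G ?d \<cdot>\<^bsub>E\<^esub> onArr G q"
        using Fq ev(5) evd ey exd pq E.extend_eq1[OF ey(4), of "onArr G q"] by simp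
      moreover have "(?r2 \<cdot>\<^bsub>E\<^esub> ?mv) \<cdot>\<^bsub>E\<^esub> ?ev = ?r2 \<cdot>\<^bsub>E\<^esub> onArr G ?i"
        using r ev(4,5,6) evd i(4) by simp
      ultimately show "(?r2 \<cdot>\<^bsub>E\<^esub> ?mv) \<cdot>\<^bsub>E\<^esub> ?ev = (im_mono ?d \<cdot>\<^bsub>E\<^esub> ?Fq) \<cdot>\<^bsub>E\<^esub> ?ev" using ri(2) by simp
    qed (use r ev(6) evd Fq(1-3) ey exd in auto)
    fix a b assume ab: "a \<in> Arr E" "b \<in> Arr E" "Cod E a = Dom E t" "Cod E b = Dom E t" "Dom E a = Dom E b" "t \<cdot>\<^bsub>E\<^esub> a = t \<cdot>\<^bsub>E\<^esub> b"
    have av: "Cod E a = Fext_ob v" "Cod E b = Fext_ob v" using ab td by auto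
    have F: "?Fp \<cdot>\<^bsub>E\<^esub> a = ?Fp \<cdot>\<^bsub>E\<^esub> b" "?Fq \<cdot>\<^bsub>E\<^esub> a = ?Fq \<cdot>\<^bsub>E\<^esub> b"
    proof -
      have "Q1 \<cdot>\<^bsub>E\<^esub> (t \<cdot>\<^bsub>E\<^esub> a) = Q1 \<cdot>\<^bsub>E\<^esub> (t \<cdot>\<^bsub>E\<^esub> b)" "Q2 \<cdot>\<^bsub>E\<^esub> (t \<cdot>\<^bsub>E\<^esub> a) = Q2 \<cdot>\<^bsub>E\<^esub> (t \<cdot>\<^bsub>E\<^esub> b)" unfolding ab(6) by simp_all
      moreover have "Q1 \<cdot>\<^bsub>E\<^esub> (t \<cdot>\<^bsub>E\<^esub> w) = ?Fp \<cdot>\<^bsub>E\<^esub> w" "Q2 \<cdot>\<^bsub>E\<^esub> (t \<cdot>\<^bsub>E\<^esub> w) = ?Fq \<cdot>\<^bsub>E\<^esub> w" if "w \<in> Arr E" "Cod E w = Fext_ob v" for w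
        using that t(1,3) td Qa E.extend_eq1[OF t(4), of w] E.extend_eq1[OF t(5), of w] by simp_all
      ultimately show "?Fp \<cdot>\<^bsub>E\<^esub> a = ?Fp \<cdot>\<^bsub>E\<^esub> b" "?Fq \<cdot>\<^bsub>E\<^esub> a = ?Fq \<cdot>\<^bsub>E\<^esub> b" using ab(1,2) av by simp_all
    qed
    have "?mv \<cdot>\<^bsub>E\<^esub> a = ?mv \<cdot>\<^bsub>E\<^esub> b"
    proof (rule G_product_joint_monic[OF chosen_product[OF ro]])
      have "?r1 \<cdot>\<^bsub>E\<^esub> (?mv \<cdot>\<^bsub>E\<^esub> w) = im_mono ?c \<cdot>\<^bsub>E\<^esub> (?Fp \<cdot>\<^bsub>E\<^esub> w)" if "w \<in> Arr E" "Cod E w = Fext_ob v" for w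
        by (rule E.extend_eq[OF m1]) (use that r ev(6) evd Fp(1-3) ex exd in auto)
      then show "?r1 \<cdot>\<^bsub>E\<^esub> (?mv \<cdot>\<^bsub>E\<^esub> a) = ?r1 \<cdot>\<^bsub>E\<^esub> (?mv \<cdot>\<^bsub>E\<^esub> b)" using F(1) ab(1,2) av by simp
      have "?r2 \<cdot>\<^bsub>E\<^esub> (?mv \<cdot>\<^bsub>E\<^esub> w) = im_mono ?d \<cdot>\<^bsub>E\<^esub> (?Fq \<cdot>\<^bsub>E\<^esub> w)" if "w \<in> Arr E" "Cod E w = Fext_ob v" for w
        by (rule E.extend_eq[OF m2]) (use that r ev(6) evd Fq(1-3) ey exd in auto)
      then show "?r2 \<cdot>\<^bsub>E\<^esub> (?mv \<cdot>\<^bsub>E\<^esub> a) = ?r2 \<cdot>\<^bsub>E\<^esub> (?mv \<cdot>\<^bsub>E\<^esub> b)" using F(2) ab(1,2) av by simp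
    qed (use ab(1,2,5) av ev(6) evd i(3) in auto)
    then show "a = b"
      by (rule E.monicD[OF ev(2)]) (use ab(1,2,5) av evd in auto)
  qed
  have tr: "regular_epi E t"
  proof -
    have ef: "?e \<cdot> f \<in> Arr S" "?e \<cdot> g \<in> Arr S" "Dom S (?e \<cdot> f) = pt x" "Dom S (?e \<cdot> g) = pt y" "Cod S (?e \<cdot> f) = Cod S ?e" "Cod S (?e \<cdot> g) = Cod S ?e"
      using fa ga cd by auto
    have Gef: "onArr G (?e \<cdot> f) \<cdot>\<^bsub>E\<^esub> u = onArr G ?e \<cdot>\<^bsub>E\<^esub> (onArr G f \<cdot>\<^bsub>E\<^esub> u)" if "u \<in> Arr E" "Cod E u = onOb G (pt x)" for u
      using that fa cd by simp
    have Geg: "onArr G (?e \<cdot> g) \<cdot>\<^bsub>E\<^esub> u = onArr G ?e \<cdot>\<^bsub>E\<^esub> (onArr G g \<cdot>\<^bsub>E\<^esub> u)" if "u \<in> Arr E" "Cod E u = onOb G (pt y)" for u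
      using that ga cd by simp
    have Gfa: "onArr G f \<in> Arr E" "Dom E (onArr G f) = onOb G (pt x)" "Cod E (onArr G f) = onOb G (pt z)"
      "onArr G g \<in> Arr E" "Dom E (onArr G g) = onOb G (pt y)" "Cod E (onArr G g) = onOb G (pt z)" using fa ga by auto
    \<comment> \<open>a pair of elements over \<open>G X\<close> and \<open>G Y\<close> agrees in \<open>F z\<close> iff it agrees in \<open>G\<close> of the codomain of \<open>z\<close>\<close>
    have agree: "onArr G (?e \<cdot> f) \<cdot>\<^bsub>E\<^esub> a = onArr G (?e \<cdot> g) \<cdot>\<^bsub>E\<^esub> b \<longleftrightarrow> ?Ff \<cdot>\<^bsub>E\<^esub> (?ex \<cdot>\<^bsub>E\<^esub> a) = ?Fg \<cdot>\<^bsub>E\<^esub> (?ey \<cdot>\<^bsub>E\<^esub> b)"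
      if ab: "a \<in> Arr E" "b \<in> Arr E" "Cod E a = onOb G (pt x)" "Cod E b = onOb G (pt y)" "Dom E a = Dom E b" for a b
    proof -
      have "?Ff \<cdot>\<^bsub>E\<^esub> (?ex \<cdot>\<^bsub>E\<^esub> a) = ?ez \<cdot>\<^bsub>E\<^esub> (onArr G f \<cdot>\<^bsub>E\<^esub> a)"
        by (rule E.extend_eq[OF F1(4)]) (use F1 ex ez exd Gfa ab in auto)
      moreover have "?Fg \<cdot>\<^bsub>E\<^esub> (?ey \<cdot>\<^bsub>E\<^esub> b) = ?ez \<cdot>\<^bsub>E\<^esub> (onArr G g \<cdot>\<^bsub>E\<^esub> b)"
        by (rule E.extend_eq[OF F2(4)]) (use F2 ey ez exd Gfa ab in auto)
      ultimately show ?thesis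
        using im_epi_eq_iff[OF o(3), of "onArr G f \<cdot>\<^bsub>E\<^esub> a" "onArr G g \<cdot>\<^bsub>E\<^esub> b"] Gef[OF ab(1,3)] Geg[OF ab(2,4)] Gfa ab by simp
    qed
    obtain P1 P2 where P: "is_pullback E (onArr G (?e \<cdot> f)) (onArr G (?e \<cdot> g)) P1 P2"
      using E.pullback_ex[of "onArr G (?e \<cdot> f)" "onArr G (?e \<cdot> g)"] ef by (metis G_simps(2,4))
    have Pa: "P1 \<in> Arr E" "P2 \<in> Arr E" "Dom E P1 = Dom E P2" "Cod E P1 = onOb G (pt x)" "Cod E P2 = onOb G (pt y)"
      "onArr G (?e \<cdot> f) \<cdot>\<^bsub>E\<^esub> P1 = onArr G (?e \<cdot> g) \<cdot>\<^bsub>E\<^esub> P2"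
      using E.pullback_square[OF P] ef by (auto simp: commuting_square_def simp del: G_simps(6))
    have GP: "Dom E (onArr G (?e \<cdot> f)) = onOb G (pt x)" "Dom E (onArr G (?e \<cdot> g)) = onOb G (pt y)" using G_simps(3)[OF ef(1)] G_simps(3)[OF ef(2)] ef by simp_all
    have Gp: "onArr G p \<in> Arr E" "onArr G q \<in> Arr E" "Dom E (onArr G p) = onOb G (Dom S p)" "Dom E (onArr G q) = onOb G (Dom S p)"
      "Cod E (onArr G p) = onOb G (pt x)" "Cod E (onArr G q) = onOb G (pt y)" using pq by auto
    have "(?e \<cdot> f) \<cdot> p = (?e \<cdot> g) \<cdot> q" using weak_pullback_square[OF wp] by (simp add: commuting_square_def)
    then have "onArr G ((?e \<cdot> f) \<cdot> p) = onArr G ((?e \<cdot> g) \<cdot> q)" by simp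
    then have Gpq: "onArr G (?e \<cdot> f) \<cdot>\<^bsub>E\<^esub> onArr G p = onArr G (?e \<cdot> g) \<cdot>\<^bsub>E\<^esub> onArr G q"
      using G_simps(6)[of p "?e \<cdot> f"] G_simps(6)[of q "?e \<cdot> g"] pq ef by metis
    obtain k where k: "k \<in> Arr E" "Dom E k = Dom E (onArr G p)" "Cod E k = Dom E P1" "P1 \<cdot>\<^bsub>E\<^esub> k = onArr G p" "P2 \<cdot>\<^bsub>E\<^esub> k = onArr G q"
      by (rule E.weak_pullbackE[OF E.pullback_weak[OF P] Gp(1,2) _ _ _ Gpq]) (simp_all only: Gp GP)
    have kr: "regular_epi E k"
      by (rule cover_pullback[OF wp P k(1) _ k(3,4,5)]) (simp add: k Gp)
    have "?Ff \<cdot>\<^bsub>E\<^esub> (?ex \<cdot>\<^bsub>E\<^esub> P1) = ?Fg \<cdot>\<^bsub>E\<^esub> (?ey \<cdot>\<^bsub>E\<^esub> P2)" using agree[OF Pa(1,2,4,5,3)] Pa(6) by blast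
    then obtain s where s: "s \<in> Arr E" "Dom E s = Dom E (?ex \<cdot>\<^bsub>E\<^esub> P1)" "Cod E s = Dom E Q1" "Q1 \<cdot>\<^bsub>E\<^esub> s = ?ex \<cdot>\<^bsub>E\<^esub> P1" "Q2 \<cdot>\<^bsub>E\<^esub> s = ?ey \<cdot>\<^bsub>E\<^esub> P2"
      by (rule E.weak_pullbackE[OF E.pullback_weak[OF Q], rotated 5]) (use Pa(1-5) ex ey exd F1 F2 in auto)
    have sd: "Dom E s = Dom E P1" using s(2) Pa ex by simp
    have ska: "s \<cdot>\<^bsub>E\<^esub> k = t \<cdot>\<^bsub>E\<^esub> ?ev"
    proof (rule E.pullback_joint_monic[OF Q])
      have "Q1 \<cdot>\<^bsub>E\<^esub> (s \<cdot>\<^bsub>E\<^esub> k) = ?ex \<cdot>\<^bsub>E\<^esub> (P1 \<cdot>\<^bsub>E\<^esub> k)"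
        by (rule E.extend_eq[OF s(4)]) (use s(1,3) sd Qa Pa ex k(1-3) in auto)
      moreover have "Q1 \<cdot>\<^bsub>E\<^esub> (t \<cdot>\<^bsub>E\<^esub> ?ev) = ?Fp \<cdot>\<^bsub>E\<^esub> ?ev"
        by (rule E.extend_eq1[OF t(4)]) (use t(1,3) td Qa ev(5) evd in auto)
      ultimately show "Q1 \<cdot>\<^bsub>E\<^esub> (s \<cdot>\<^bsub>E\<^esub> k) = Q1 \<cdot>\<^bsub>E\<^esub> (t \<cdot>\<^bsub>E\<^esub> ?ev)" using k(4) Fp(4) by simp
      have "Q2 \<cdot>\<^bsub>E\<^esub> (s \<cdot>\<^bsub>E\<^esub> k) = ?ey \<cdot>\<^bsub>E\<^esub> (P2 \<cdot>\<^bsub>E\<^esub> k)"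
        by (rule E.extend_eq[OF s(5)]) (use s(1,3) sd Qa Pa ey k(1-3) in auto)
      moreover have "Q2 \<cdot>\<^bsub>E\<^esub> (t \<cdot>\<^bsub>E\<^esub> ?ev) = ?Fq \<cdot>\<^bsub>E\<^esub> ?ev"
        by (rule E.extend_eq1[OF t(5)]) (use t(1,3) td Qa ev(5) evd in auto)
      ultimately show "Q2 \<cdot>\<^bsub>E\<^esub> (s \<cdot>\<^bsub>E\<^esub> k) = Q2 \<cdot>\<^bsub>E\<^esub> (t \<cdot>\<^bsub>E\<^esub> ?ev)" using k(5) Fq(4) by simp
    qed (use s(1,3) sd k(1-3) t(1,3) td ev(5) evd Gp in auto)
    \<comment> \<open>the pullback of \<open>G X\<close> and \<open>G Y\<close> covers the pullback of their images\<close>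
    have "regular_epi E s"
    proof -
      obtain a1 a2 where A: "is_pullback E Q1 ?ex a1 a2" using E.pullback_ex[OF Qa(1) ex(5)] Qa exd by metis
      have Aa: "a1 \<in> Arr E" "a2 \<in> Arr E" "Dom E a2 = Dom E a1" "Cod E a1 = Dom E Q1" "Cod E a2 = onOb G (pt x)" "Q1 \<cdot>\<^bsub>E\<^esub> a1 = ?ex \<cdot>\<^bsub>E\<^esub> a2"
        using E.pullback_square[OF A] ex by (auto simp: commuting_square_def)
      have Ar: "regular_epi E a1" by (rule E.pullback_regular_epi[OF A ex(1)])
      obtain b1 b2 where B: "is_pullback E (Q2 \<cdot>\<^bsub>E\<^esub> a1) ?ey b1 b2" using E.pullback_ex[of "Q2 \<cdot>\<^bsub>E\<^esub> a1" ?ey] ey Qa Aa exd by (metis E.comp_simps(1,3))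
      have Ba: "b1 \<in> Arr E" "b2 \<in> Arr E" "Dom E b2 = Dom E b1" "Cod E b1 = Dom E a1" "Cod E b2 = onOb G (pt y)" "(Q2 \<cdot>\<^bsub>E\<^esub> a1) \<cdot>\<^bsub>E\<^esub> b1 = ?ey \<cdot>\<^bsub>E\<^esub> b2"
        using E.pullback_square[OF B] ey Qa Aa by (auto simp: commuting_square_def)
      have Br: "regular_epi E b1" by (rule E.pullback_regular_epi[OF B ey(1)])
      have Q1b: "Q1 \<cdot>\<^bsub>E\<^esub> (a1 \<cdot>\<^bsub>E\<^esub> b1) = ?ex \<cdot>\<^bsub>E\<^esub> (a2 \<cdot>\<^bsub>E\<^esub> b1)"
        by (rule E.extend_eq[OF Aa(6)]) (use Aa(1-5) Ba(1-5) Qa ex in auto)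
      have Q2b: "Q2 \<cdot>\<^bsub>E\<^esub> (a1 \<cdot>\<^bsub>E\<^esub> b1) = ?ey \<cdot>\<^bsub>E\<^esub> b2" using Ba Aa(1-5) Qa by simp
      have ab: "a2 \<cdot>\<^bsub>E\<^esub> b1 \<in> Arr E" "b2 \<in> Arr E" "Cod E (a2 \<cdot>\<^bsub>E\<^esub> b1) = onOb G (pt x)" "Cod E b2 = onOb G (pt y)" "Dom E (a2 \<cdot>\<^bsub>E\<^esub> b1) = Dom E b2"
        using Aa(1-5) Ba(1-5) by auto
      have "?Ff \<cdot>\<^bsub>E\<^esub> (Q1 \<cdot>\<^bsub>E\<^esub> (a1 \<cdot>\<^bsub>E\<^esub> b1)) = ?Fg \<cdot>\<^bsub>E\<^esub> (Q2 \<cdot>\<^bsub>E\<^esub> (a1 \<cdot>\<^bsub>E\<^esub> b1))"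
        by (rule E.extend_eq[OF Qa(6)]) (use Qa F1 F2 Aa(1-5) Ba(1-5) in auto)
      then have "onArr G (?e \<cdot> f) \<cdot>\<^bsub>E\<^esub> (a2 \<cdot>\<^bsub>E\<^esub> b1) = onArr G (?e \<cdot> g) \<cdot>\<^bsub>E\<^esub> b2"
        unfolding agree[OF ab] Q1b Q2b .
      then obtain h where h: "h \<in> Arr E" "Dom E h = Dom E (a2 \<cdot>\<^bsub>E\<^esub> b1)" "Cod E h = Dom E P1" "P1 \<cdot>\<^bsub>E\<^esub> h = a2 \<cdot>\<^bsub>E\<^esub> b1" "P2 \<cdot>\<^bsub>E\<^esub> h = b2"
        by (rule E.weak_pullbackE[OF E.pullback_weak[OF P] ab(1,2,5), rotated 2]) (use ab GP in simp_all)
      have hd: "Dom E h = Dom E b1" using h(2) Aa Ba by simp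
      have "s \<cdot>\<^bsub>E\<^esub> h = a1 \<cdot>\<^bsub>E\<^esub> b1"
      proof (rule E.pullback_joint_monic[OF Q])
        have "Q1 \<cdot>\<^bsub>E\<^esub> (s \<cdot>\<^bsub>E\<^esub> h) = ?ex \<cdot>\<^bsub>E\<^esub> (P1 \<cdot>\<^bsub>E\<^esub> h)"
          by (rule E.extend_eq[OF s(4)]) (use s(1,3) sd Qa Pa ex h(1-3) in auto)
        then show "Q1 \<cdot>\<^bsub>E\<^esub> (s \<cdot>\<^bsub>E\<^esub> h) = Q1 \<cdot>\<^bsub>E\<^esub> (a1 \<cdot>\<^bsub>E\<^esub> b1)" using h(4) Q1b by simp
        have "Q2 \<cdot>\<^bsub>E\<^esub> (s \<cdot>\<^bsub>E\<^esub> h) = ?ey \<cdot>\<^bsub>E\<^esub> (P2 \<cdot>\<^bsub>E\<^esub> h)"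
          by (rule E.extend_eq[OF s(5)]) (use s(1,3) sd Qa Pa ey h(1-3) in auto)
        then show "Q2 \<cdot>\<^bsub>E\<^esub> (s \<cdot>\<^bsub>E\<^esub> h) = Q2 \<cdot>\<^bsub>E\<^esub> (a1 \<cdot>\<^bsub>E\<^esub> b1)" using h(5) Q2b by simp
      qed (use s(1,3) sd h(1,3) hd Aa(1-5) Ba(1-5) in auto)
      moreover have "regular_epi E (a1 \<cdot>\<^bsub>E\<^esub> b1)" by (rule E.regular_epi_comp[OF Ar Br Ba(4)])
      ultimately show "regular_epi E s" using E.regular_epi_last_factor[of s h] s(1) sd h(1,3) by simp
    qed
    then have "regular_epi E (s \<cdot>\<^bsub>E\<^esub> k)" by (rule E.regular_epi_comp[OF _ kr]) (use k(3) sd in simp)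
    then show "regular_epi E t"
      unfolding ska by (rule E.regular_epi_last_factor) (use t(1) td ev(5) evd in auto)
  qed
  have "iso E t" by (rule E.regular_epi_monic_iso[OF tr tm])
  then obtain t' where t': "inverse_arrows E t t'" by (auto simp: iso_def)
  have std: "is_pullback E ?Ff ?Fg ?Fp ?Fq"
    using E.pullback_iso_comparison[OF Q t' t(3)] t(4,5) by simp
  have "is_pullback D (ar x z f) (ar y z g) \<pi> \<kappa>" using pb fg by simp
  then obtain \<tau> \<tau>' where tau: "inverse_arrows D \<tau> \<tau>'" "Dom D \<tau> = Dom D \<pi>" "Cod D \<tau> = Dom D (ar v x p)" "ar v x p \<cdot>\<^bsub>D\<^esub> \<tau> = \<pi>" "ar v y q \<cdot>\<^bsub>D\<^esub> \<tau> = \<kappa>"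
    by (rule D.pullback_compare[OF v(5)])
  note F = functorD(3-)[OF Fext_functor, simplified]
  have tau': "\<tau> \<in> Arr D" "\<tau>' \<in> Arr D" "Dom D \<tau>' = Cod D \<tau>" "Cod D \<tau>' = Dom D \<tau>" "Cod D \<tau> = v"
    "\<tau>' \<cdot>\<^bsub>D\<^esub> \<tau> = Id D (Dom D \<tau>)" "\<tau> \<cdot>\<^bsub>D\<^esub> \<tau>' = Id D (Cod D \<tau>)"
    using tau(1,3) by (auto simp: inverse_arrows_def)
  have "inverse_arrows E (Fext_arr \<tau>) (Fext_arr \<tau>')"
    unfolding inverse_arrows_def using tau' F(6)[of \<tau> \<tau>'] F(6)[of \<tau>' \<tau>] F(2-5) v(1) by simp
  then have "is_pullback E ?Ff ?Fg (?Fp \<cdot>\<^bsub>E\<^esub> Fext_arr \<tau>) (?Fq \<cdot>\<^bsub>E\<^esub> Fext_arr \<tau>)"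
    by (rule E.pullback_iso_comparison[OF std]) (use F(4)[OF tau'(1)] tau' Fp in simp)
  moreover have "?Fp \<cdot>\<^bsub>E\<^esub> Fext_arr \<tau> = Fext_arr \<pi>" "?Fq \<cdot>\<^bsub>E\<^esub> Fext_arr \<tau> = Fext_arr \<kappa>"
    using F(6)[of \<tau> "ar v x p"] F(6)[of \<tau> "ar v y q"] tau' tau(4,5) v(1,3,4) o by simp_all
  ultimately show ?thesis using fg by simp
qed

lemma Fext_regular: "regular_functor D E Fext"
  unfolding regular_functor_def
  using Fext_functor Fext_terminal Fext_pullback Fext_regular_epi by simp

end

section \<open>Regular functors and natural isomorphisms\<close>

lemma (in category) monic_iff_pullback:
  assumes m: "m \<in> Arr C"
  shows "monic C m \<longleftrightarrow> is_pullback C m m (Id C (Dom C m)) (Id C (Dom C m))"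
proof
  assume mm: "monic C m"
  show "is_pullback C m m (Id C (Dom C m)) (Id C (Dom C m))"
  proof (rule pullbackI)
    show "commuting_square C m m (Id C (Dom C m)) (Id C (Dom C m))" using m by (simp add: commuting_square_def)
    fix u v assume uv: "u \<in> Arr C" "v \<in> Arr C" "Dom C u = Dom C v" "Cod C u = Dom C m" "Cod C v = Dom C m" "m \<cdot> u = m \<cdot> v"
    have "u = v" by (rule monicD[OF mm uv(6,1,2,4,5,3)])
    then show "\<exists>h. h \<in> hom C (Dom C u) (Dom C (Id C (Dom C m))) \<and> Id C (Dom C m) \<cdot> h = u \<and> Id C (Dom C m) \<cdot> h = v"
      using uv(2,5) m by (intro exI[of _ v]) simp
  qed (use m in simp)
next
  assume pb: "is_pullback C m m (Id C (Dom C m)) (Id C (Dom C m))"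
  show "monic C m"
  proof (rule monicI[OF m])
    fix u v assume uv: "u \<in> Arr C" "v \<in> Arr C" "Cod C u = Dom C m" "Cod C v = Dom C m" "Dom C u = Dom C v" "m \<cdot> u = m \<cdot> v"
    obtain h where h: "h \<in> Arr C" "Dom C h = Dom C u" "Cod C h = Dom C (Id C (Dom C m))" "Id C (Dom C m) \<cdot> h = u" "Id C (Dom C m) \<cdot> h = v"
      by (rule weak_pullbackE[OF pullback_weak[OF pb] uv(1,2,5,3,4,6)])
    show "u = v" using h(4) unfolding h(5) by simp
  qed
qed

lemma regular_functorD:
  assumes "regular_functor C D F"
  shows "is_functor C D F" "is_terminal C T \<Longrightarrow> is_terminal D (onOb F T)"
    "is_pullback C f g p q \<Longrightarrow> is_pullback D (onArr F f) (onArr F g) (onArr F p) (onArr F q)"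
    "regular_epi C e \<Longrightarrow> regular_epi D (onArr F e)"
  using assms unfolding regular_functor_def by blast+

lemma regular_functor_comp:
  assumes "regular_functor C D F" "regular_functor D E G" shows "regular_functor C E (comp_functor G F)"
  using regular_functorD[OF assms(1)] regular_functorD[OF assms(2)]
  unfolding regular_functor_def comp_functor_simps by (blast intro: comp_is_functor)

lemma regular_functor_id: "category C \<Longrightarrow> regular_functor C C id_functor"
  unfolding regular_functor_def id_functor_simps using id_is_functor by blast

lemma regular_functor_monic:
  assumes F: "regular_functor C D F" and m: "monic C m" shows "monic D (onArr F m)"
proof -
  note Fs = regular_functorD[OF F]
  note f = functorD[OF Fs(1)]
  interpret C: category C by (rule f(1))
  interpret D: category D by (rule f(2))
  have ma: "m \<in> Arr C" using m by simp
  show ?thesis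
    using Fs(3) m f(3-7) ma unfolding C.monic_iff_pullback[OF ma] D.monic_iff_pullback[OF f(4)[OF ma]]
    by (metis C.Dom_Ob)
qed

lemma regular_functor_products:
  assumes F: "regular_functor C D F" and T: "is_terminal C T" shows "preserves_binary_products C D F"
  unfolding preserves_binary_products_def
proof (intro allI impI; elim conjE)
  note Fs = regular_functorD[OF F]
  note f = functorD[OF Fs(1)]
  interpret C: category C by (rule f(1))
  interpret D: category D by (rule f(2))
  fix A B V p q assume AB: "A \<in> Ob C" "B \<in> Ob C" and P: "is_product C A B V p q"
  obtain a where a: "a \<in> Arr C" "Dom C a = A" "Cod C a = T" by (rule C.terminal_ex[OF T AB(1)])
  obtain b where b: "b \<in> Arr C" "Dom C b = B" "Cod C b = T" by (rule C.terminal_ex[OF T AB(2)])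
  have ab: "a \<in> hom C A T" "b \<in> hom C B T" using a b by simp_all
  have Fab: "onArr F a \<in> hom D (onOb F A) (onOb F T)" "onArr F b \<in> hom D (onOb F B) (onOb F T)"
    using a b f by simp_all
  note pq = C.productD[OF P]
  have "is_pullback C a b p q" using C.product_iff_pullback[OF T ab] P by blast
  then have "is_pullback D (onArr F a) (onArr F b) (onArr F p) (onArr F q)" by (rule Fs(3))
  moreover have "onArr F p \<in> hom D (onOb F V) (onOb F A)" "onArr F q \<in> hom D (onOb F V) (onOb F B)"
    using pq f by simp_all
  ultimately show "is_product D (onOb F A) (onOb F B) (onOb F V) (onArr F p) (onArr F q)"
    using D.product_iff_pullback[OF Fs(2)[OF T] Fab] by blast
qed

lemma (in category) inverse_arrows_comp:
  assumes "inverse_arrows C f f'" "inverse_arrows C g g'" "Cod C f = Dom C g"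
  shows "inverse_arrows C (g \<cdot> f) (f' \<cdot> g')"
proof -
  have f: "f \<in> Arr C" "f' \<in> Arr C" "Dom C f' = Cod C f" "Cod C f' = Dom C f" "f' \<cdot> f = Id C (Dom C f)" "f \<cdot> f' = Id C (Cod C f)"
    using assms by (auto simp: inverse_arrows_def)
  have g: "g \<in> Arr C" "g' \<in> Arr C" "Dom C g' = Cod C g" "Cod C g' = Dom C g" "g' \<cdot> g = Id C (Dom C g)" "g \<cdot> g' = Id C (Cod C g)"
    using assms by (auto simp: inverse_arrows_def)
  show ?thesis
    using f g assms(3) extend_eq1[OF g(5), of f] extend_eq1[OF f(6), of g'] by (simp add: inverse_arrows_def)
qed

lemma nat_isomorphicI:
  assumes F: "is_functor C D F" and G: "is_functor C D G" and t: "nat_trans C D F G \<theta>"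
    and i: "\<And>A. A \<in> Ob C \<Longrightarrow> inverse_arrows D (\<theta> A) (\<theta>' A)"
  shows "nat_isomorphic C D F G"
proof -
  have iv: "inverse_transformations C D F G \<theta> \<theta>'"
    unfolding inverse_transformations_def using i nat_transD(1-3)[OF t] by (simp add: inverse_arrows_def)
  have h: "\<theta>' A \<in> hom D (onOb G A) (onOb F A)" if "A \<in> Ob C" for A
    using i[OF that] nat_transD(1-3)[OF t that] by (simp add: inverse_arrows_def)
  show ?thesis
    unfolding nat_isomorphic_def using t iv inverse_nat_trans[OF F G t h iv] by blast
qed

lemma nat_isomorphicE:
  assumes "nat_isomorphic C D F G"
  obtains \<theta> \<theta>' where "nat_trans C D F G \<theta>" "nat_trans C D G F \<theta>'"
    "\<And>A. A \<in> Ob C \<Longrightarrow> inverse_arrows D (\<theta> A) (\<theta>' A)"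
proof -
  obtain \<theta> \<theta>' where t: "nat_trans C D F G \<theta>" "nat_trans C D G F \<theta>'" "inverse_transformations C D F G \<theta> \<theta>'"
    using assms unfolding nat_isomorphic_def by blast
  have "inverse_arrows D (\<theta> A) (\<theta>' A)" if A: "A \<in> Ob C" for A
    unfolding inverse_arrows_def
    using nat_transD(1-3)[OF t(1) A] nat_transD(1-3)[OF t(2) A] inverse_transformationsD[OF t(3) A] by simp
  then show thesis using that t by blast
qed

lemma nat_trans_comp:
  assumes F: "is_functor C D F" and G: "is_functor C D G" and H: "is_functor C D H"
    and s: "nat_trans C D F G \<sigma>" and t: "nat_trans C D G H \<theta>"
  shows "nat_trans C D F H (\<lambda>A. \<theta> A \<cdot>\<^bsub>D\<^esub> \<sigma> A)"
proof -
  interpret C: category C using functorD[OF F] by simp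
  interpret D: category D using functorD[OF F] by simp
  show ?thesis
    unfolding nat_trans_def
  proof (intro conjI ballI)
    fix f assume f: "f \<in> Arr C"
    let ?A = "Dom C f" and ?B = "Cod C f"
    have Ob: "?A \<in> Ob C" "?B \<in> Ob C" using f by auto
    note n = nat_transD(1-3)[OF s Ob(1)] nat_transD(1-3)[OF s Ob(2)] nat_transD(1-3)[OF t Ob(1)] nat_transD(1-3)[OF t Ob(2)]
    note Ff = functorD(4-6)[OF F f] functorD(4-6)[OF G f] functorD(4-6)[OF H f]
    have "(\<theta> ?B \<cdot>\<^bsub>D\<^esub> \<sigma> ?B) \<cdot>\<^bsub>D\<^esub> onArr F f = \<theta> ?B \<cdot>\<^bsub>D\<^esub> (onArr G f \<cdot>\<^bsub>D\<^esub> \<sigma> ?A)"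
      using n Ff nat_transD(4)[OF s f refl refl] by simp
    also have "\<dots> = onArr H f \<cdot>\<^bsub>D\<^esub> (\<theta> ?A \<cdot>\<^bsub>D\<^esub> \<sigma> ?A)"
      by (rule D.extend_eq[OF nat_transD(4)[OF t f refl refl]]) (use n Ff in auto)
    finally show "(\<theta> ?B \<cdot>\<^bsub>D\<^esub> \<sigma> ?B) \<cdot>\<^bsub>D\<^esub> onArr F f = onArr H f \<cdot>\<^bsub>D\<^esub> (\<theta> ?A \<cdot>\<^bsub>D\<^esub> \<sigma> ?A)" .
  next
    fix A assume A: "A \<in> Ob C"
    show "\<theta> A \<cdot>\<^bsub>D\<^esub> \<sigma> A \<in> hom D (onOb F A) (onOb H A)"
      using nat_transD(1-3)[OF s A] nat_transD(1-3)[OF t A] by simp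
  qed
qed

lemma nat_trans_id:
  assumes F: "is_functor C D F" shows "nat_trans C D F F (\<lambda>A. Id D (onOb F A))"
proof -
  interpret C: category C using functorD[OF F] by simp
  interpret D: category D using functorD[OF F] by simp
  show ?thesis using functorD(3-)[OF F] by (simp add: nat_trans_def)
qed

lemma nat_isomorphic_trans:
  assumes F: "is_functor C D F" and G: "is_functor C D G" and H: "is_functor C D H"
    and FG: "nat_isomorphic C D F G" and GH: "nat_isomorphic C D G H"
  shows "nat_isomorphic C D F H"
proof -
  interpret D: category D using functorD[OF F] by simp
  obtain \<sigma> \<sigma>' where s: "nat_trans C D F G \<sigma>" "\<And>A. A \<in> Ob C \<Longrightarrow> inverse_arrows D (\<sigma> A) (\<sigma>' A)"
    by (rule nat_isomorphicE[OF FG]) blast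
  obtain \<theta> \<theta>' where t: "nat_trans C D G H \<theta>" "\<And>A. A \<in> Ob C \<Longrightarrow> inverse_arrows D (\<theta> A) (\<theta>' A)"
    by (rule nat_isomorphicE[OF GH]) blast
  show ?thesis
  proof (rule nat_isomorphicI[OF F H nat_trans_comp[OF F G H s(1) t(1)]])
    fix A assume A: "A \<in> Ob C"
    show "inverse_arrows D (\<theta> A \<cdot>\<^bsub>D\<^esub> \<sigma> A) (\<sigma>' A \<cdot>\<^bsub>D\<^esub> \<theta>' A)"
      by (rule D.inverse_arrows_comp[OF s(2)[OF A] t(2)[OF A]])
        (use nat_transD(3)[OF s(1) A] nat_transD(2)[OF t(1) A] in simp)
  qed
qed

lemma nat_isomorphic_whisker:
  assumes F: "is_functor C D F" and G: "is_functor C D G" and H: "is_functor D E H"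
    and FG: "nat_isomorphic C D F G"
  shows "nat_isomorphic C E (comp_functor H F) (comp_functor H G)"
proof -
  interpret C: category C using functorD[OF F] by simp
  interpret D: category D using functorD[OF F] by simp
  note h = functorD(3-)[OF H]
  obtain \<theta> \<theta>' where t: "nat_trans C D F G \<theta>" "\<And>A. A \<in> Ob C \<Longrightarrow> inverse_arrows D (\<theta> A) (\<theta>' A)"
    by (rule nat_isomorphicE[OF FG]) blast
  show ?thesis
  proof (rule nat_isomorphicI[OF comp_is_functor[OF F H] comp_is_functor[OF G H]])
    show "nat_trans C E (comp_functor H F) (comp_functor H G) (\<lambda>A. onArr H (\<theta> A))"
      unfolding nat_trans_def
    proof (intro conjI ballI)
      fix f assume f: "f \<in> Arr C"
      let ?A = "Dom C f" and ?B = "Cod C f"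
      have Ob: "?A \<in> Ob C" "?B \<in> Ob C" using f by auto
      note n = nat_transD(1-3)[OF t(1) Ob(1)] nat_transD(1-3)[OF t(1) Ob(2)]
      have "onArr H (\<theta> ?B \<cdot>\<^bsub>D\<^esub> onArr F f) = onArr H (onArr G f \<cdot>\<^bsub>D\<^esub> \<theta> ?A)"
        unfolding nat_transD(4)[OF t(1) f refl refl] ..
      then show "onArr H (\<theta> ?B) \<cdot>\<^bsub>E\<^esub> onArr (comp_functor H F) f = onArr (comp_functor H G) f \<cdot>\<^bsub>E\<^esub> onArr H (\<theta> ?A)"
        using n functorD(4-6)[OF F f] functorD(4-6)[OF G f] h(6) by simp
    next
      fix A assume A: "A \<in> Ob C"
      show "onArr H (\<theta> A) \<in> hom E (onOb (comp_functor H F) A) (onOb (comp_functor H G) A)"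
        using nat_transD(1-3)[OF t(1) A] h by simp
    qed
    fix A assume A: "A \<in> Ob C"
    have i: "\<theta> A \<in> Arr D" "\<theta>' A \<in> Arr D" "Dom D (\<theta>' A) = Cod D (\<theta> A)" "Cod D (\<theta>' A) = Dom D (\<theta> A)"
      "\<theta>' A \<cdot>\<^bsub>D\<^esub> \<theta> A = Id D (Dom D (\<theta> A))" "\<theta> A \<cdot>\<^bsub>D\<^esub> \<theta>' A = Id D (Cod D (\<theta> A))"
      using t(2)[OF A] by (auto simp: inverse_arrows_def)
    show "inverse_arrows E (onArr H (\<theta> A)) (onArr H (\<theta>' A))"
      unfolding inverse_arrows_def
      using i h(2-4) h(5)[of "Dom D (\<theta> A)"] h(5)[of "Cod D (\<theta> A)"] h(6)[of "\<theta> A" "\<theta>' A"] h(6)[of "\<theta>' A" "\<theta> A"] by simp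
  qed
qed

text \<open>Both directions of the given isomorphism extend along \<open>\<Gamma>\<close>. Their composites restrict to identities
  on the generators, hence are identities by the uniqueness of extensions.\<close>

lemma free_regular_nat_iso:
  fixes S :: "('o, 'a) cat" and R :: "('p, 'b) cat" and E :: "('x, 'y) cat"
  assumes free: "free_regular_wrt TYPE(('x, 'y) cat) S R \<Gamma>" and E: "regular_category E"
    and H: "regular_functor R E H" and K: "regular_functor R E K"
    and HK: "nat_isomorphic S E (comp_functor H \<Gamma>) (comp_functor K \<Gamma>)"
  shows "nat_isomorphic R E H K"
proof -
  interpret E: category E using E by (simp add: regular_category_def)
  have G: "is_functor S R \<Gamma>" using free by (simp add: free_regular_wrt_def left_covering_def)
  note g = functorD(3)[OF G]
  have ext: "\<exists>\<tau>. nat_trans R E H K \<tau> \<and> (\<forall>X\<in>Ob S. \<tau> (onOb \<Gamma> X) = \<theta> X) \<and>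
              (\<forall>\<sigma>. nat_trans R E H K \<sigma> \<and> (\<forall>X\<in>Ob S. \<sigma> (onOb \<Gamma> X) = \<theta> X) \<longrightarrow> (\<forall>Y\<in>Ob R. \<sigma> Y = \<tau> Y))"
    if "regular_functor R E H" "regular_functor R E K" "nat_trans S E (comp_functor H \<Gamma>) (comp_functor K \<Gamma>) \<theta>" for H K \<theta>
    using free E that unfolding free_regular_wrt_def by blast
  have unique: "\<sigma> Y = Id E (onOb H Y)"
    if H: "regular_functor R E H" and s: "nat_trans R E H H \<sigma>" "\<And>X. X \<in> Ob S \<Longrightarrow> \<sigma> (onOb \<Gamma> X) = Id E (onOb H (onOb \<Gamma> X))"
      and Y: "Y \<in> Ob R" for H \<sigma> Y
  proof -
    note hf = regular_functorD(1)[OF H]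
    have "nat_trans S E (comp_functor H \<Gamma>) (comp_functor H \<Gamma>) (\<lambda>X. Id E (onOb H (onOb \<Gamma> X)))"
      using nat_trans_id[OF comp_is_functor[OF G hf]] by simp
    from ext[OF H H this] obtain \<tau> where "\<And>\<sigma>. nat_trans R E H H \<sigma> \<Longrightarrow> (\<forall>X\<in>Ob S. \<sigma> (onOb \<Gamma> X) = Id E (onOb H (onOb \<Gamma> X))) \<Longrightarrow> (\<forall>Y\<in>Ob R. \<sigma> Y = \<tau> Y)"
      by blast
    from this[OF s(1)] this[OF nat_trans_id[OF hf]] s(2) Y show ?thesis by simp
  qed
  note hf = regular_functorD(1)[OF H] and kf = regular_functorD(1)[OF K]
  obtain \<theta> \<theta>' where t: "nat_trans S E (comp_functor H \<Gamma>) (comp_functor K \<Gamma>) \<theta>" "nat_trans S E (comp_functor K \<Gamma>) (comp_functor H \<Gamma>) \<theta>'"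
    and i: "\<And>A. A \<in> Ob S \<Longrightarrow> inverse_arrows E (\<theta> A) (\<theta>' A)" by (rule nat_isomorphicE[OF HK]) blast
  obtain \<tau> where tau: "nat_trans R E H K \<tau>" "\<And>X. X \<in> Ob S \<Longrightarrow> \<tau> (onOb \<Gamma> X) = \<theta> X" using ext[OF H K t(1)] by blast
  obtain \<tau>' where tau': "nat_trans R E K H \<tau>'" "\<And>X. X \<in> Ob S \<Longrightarrow> \<tau>' (onOb \<Gamma> X) = \<theta>' X" using ext[OF K H t(2)] by blast
  show ?thesis
  proof (rule nat_isomorphicI[OF hf kf tau(1)])
    fix Y assume Y: "Y \<in> Ob R"
    have ii: "\<theta>' X \<cdot>\<^bsub>E\<^esub> \<theta> X = Id E (onOb H (onOb \<Gamma> X))" "\<theta> X \<cdot>\<^bsub>E\<^esub> \<theta>' X = Id E (onOb K (onOb \<Gamma> X))" if "X \<in> Ob S" for X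
      using i[OF that] nat_transD(2,3)[OF t(1) that] by (auto simp: inverse_arrows_def)
    have "\<tau>' Y \<cdot>\<^bsub>E\<^esub> \<tau> Y = Id E (onOb H Y)"
      by (rule unique[OF H nat_trans_comp[OF hf kf hf tau(1) tau'(1)] _ Y]) (simp add: tau tau' ii)
    moreover have "\<tau> Y \<cdot>\<^bsub>E\<^esub> \<tau>' Y = Id E (onOb K Y)"
      by (rule unique[OF K nat_trans_comp[OF kf hf kf tau'(1) tau(1)] _ Y]) (simp add: tau tau' ii)
    ultimately show "inverse_arrows E (\<tau> Y) (\<tau>' Y)"
      using nat_transD(1-3)[OF tau(1) Y] nat_transD(1-3)[OF tau'(1) Y] by (simp add: inverse_arrows_def)
  qed
qed

text \<open>A natural transformation extends from \<open>J\<close> to \<open>D\<close> by filling in between the covers and the embeddings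
  of each object.\<close>

lemma (in weak_lex) extend_transformation:
  assumes K: "is_functor D E K" and L: "is_functor D E L"
    and Kr: "\<And>\<phi>. regular_epi D \<phi> \<Longrightarrow> regular_epi E (onArr K \<phi>)"
    and Lm: "\<And>\<phi>. monic D \<phi> \<Longrightarrow> monic E (onArr L \<phi>)"
    and t: "nat_trans S E (comp_functor K J) (comp_functor L J) \<theta>"
  obtains \<tau> where "nat_trans D E K L \<tau>"
    "\<And>x. x \<in> Ob D \<Longrightarrow> \<tau> x \<cdot>\<^bsub>E\<^esub> onArr K (cov x) = onArr L (cov x) \<cdot>\<^bsub>E\<^esub> \<theta> (pt x)"
proof -
  interpret E: category E using functorD[OF K] by simp
  note [simp del] = J_simps(2)
  note k = functorD(3-)[OF K] and l = functorD(3-)[OF L] and j = functorD(3-)[OF J_functor]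
  have n: "\<theta> A \<in> Arr E" "Dom E (\<theta> A) = onOb K (jo A)" "Cod E (\<theta> A) = onOb L (jo A)" if "A \<in> Ob S" for A
    using nat_transD(1-3)[OF t that] by auto
  have nn: "\<theta> Y \<cdot>\<^bsub>E\<^esub> onArr K (onArr J f) = onArr L (onArr J f) \<cdot>\<^bsub>E\<^esub> \<theta> X" if "f \<in> Arr S" "Dom S f = X" "Cod S f = Y" for f X Y
    using nat_transD(4)[OF t that] by simp
  have "\<exists>w. w \<in> Arr E \<and> Dom E w = onOb K x \<and> Cod E w = onOb L x \<and> w \<cdot>\<^bsub>E\<^esub> onArr K (cov x) = onArr L (cov x) \<cdot>\<^bsub>E\<^esub> \<theta> (pt x)"
    if x: "x \<in> Ob D" for x
  proof -
    let ?c = "dp_incl x"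
    let ?A = "Cod S ?c"
    have c: "?c \<in> Arr S" "pt x \<in> Ob S" "?A \<in> Ob S" using x by auto
    note cv = cov_simps[OF x]
    have kc: "onArr K (cov x) \<in> Arr E" "Dom E (onArr K (cov x)) = onOb K (jo (pt x))" "Cod E (onArr K (cov x)) = onOb K x"
      "onArr K (emb x) \<in> Arr E" "Dom E (onArr K (emb x)) = onOb K x" "Cod E (onArr K (emb x)) = onOb K (jo ?A)"
      using cv k by auto
    have lc: "onArr L (cov x) \<in> Arr E" "Dom E (onArr L (cov x)) = onOb L (jo (pt x))" "Cod E (onArr L (cov x)) = onOb L x"
      "onArr L (emb x) \<in> Arr E" "Dom E (onArr L (emb x)) = onOb L x" "Cod E (onArr L (emb x)) = onOb L (jo ?A)"
      using cv l by auto
    have km: "onArr K (emb x) \<cdot>\<^bsub>E\<^esub> onArr K (cov x) = onArr K (onArr J ?c)"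
      using k(6)[of "cov x" "emb x"] cv by simp
    have lm: "onArr L (emb x) \<cdot>\<^bsub>E\<^esub> onArr L (cov x) = onArr L (onArr J ?c)"
      using l(6)[of "cov x" "emb x"] cv by simp
    have "onArr L (emb x) \<cdot>\<^bsub>E\<^esub> (onArr L (cov x) \<cdot>\<^bsub>E\<^esub> \<theta> (pt x)) = onArr L (onArr J ?c) \<cdot>\<^bsub>E\<^esub> \<theta> (pt x)"
      by (rule E.extend_eq1[OF lm]) (use lc n[OF c(2)] in auto)
    also have "\<dots> = (\<theta> ?A \<cdot>\<^bsub>E\<^esub> onArr K (emb x)) \<cdot>\<^bsub>E\<^esub> onArr K (cov x)"
      using nn[OF c(1) refl refl] km kc n[OF c(3)] by simp
    finally have sq: "onArr L (emb x) \<cdot>\<^bsub>E\<^esub> (onArr L (cov x) \<cdot>\<^bsub>E\<^esub> \<theta> (pt x)) = (\<theta> ?A \<cdot>\<^bsub>E\<^esub> onArr K (emb x)) \<cdot>\<^bsub>E\<^esub> onArr K (cov x)" .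
    obtain w where "w \<in> Arr E" "Dom E w = Cod E (onArr K (cov x))" "Cod E w = Dom E (onArr L (emb x))"
      "w \<cdot>\<^bsub>E\<^esub> onArr K (cov x) = onArr L (cov x) \<cdot>\<^bsub>E\<^esub> \<theta> (pt x)"
      by (rule E.regular_epi_fill[OF Kr[OF cov_regular_epi[OF x]] Lm[OF emb_monic[OF x]] _ _ sq])
        (use kc lc n[OF c(2)] n[OF c(3)] in auto)
    then show ?thesis using kc lc by auto
  qed
  then obtain \<tau> where tau: "\<And>x. x \<in> Ob D \<Longrightarrow> \<tau> x \<in> Arr E" "\<And>x. x \<in> Ob D \<Longrightarrow> Dom E (\<tau> x) = onOb K x"
    "\<And>x. x \<in> Ob D \<Longrightarrow> Cod E (\<tau> x) = onOb L x"
    "\<And>x. x \<in> Ob D \<Longrightarrow> \<tau> x \<cdot>\<^bsub>E\<^esub> onArr K (cov x) = onArr L (cov x) \<cdot>\<^bsub>E\<^esub> \<theta> (pt x)"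
    by metis
  have "nat_trans D E K L \<tau>"
    unfolding nat_trans_def
  proof (intro conjI ballI)
    show "\<tau> x \<in> hom E (onOb K x) (onOb L x)" if "x \<in> Ob D" for x using tau(1-3)[OF that] by simp
    fix \<phi> assume p: "\<phi> \<in> Arr D"
    obtain x y f where f: "\<phi> = ar x y f" "kmap x y f" "x \<in> Ob D" "y \<in> Ob D" using arE'[OF p] .
    have d: "Dom D \<phi> = x" "Cod D \<phi> = y" using f(1) by simp_all
    note fa = kmapD(1-3)[OF f(2)]
    have o: "pt x \<in> Ob S" "pt y \<in> Ob S" using f by auto
    note cx = cov_simps(1-3)[OF f(3)] and cy = cov_simps(1-3)[OF f(4)]
    have Jf: "onArr J f \<in> Arr D" "Dom D (onArr J f) = jo (pt x)" "Cod D (onArr J f) = jo (pt y)" using j fa by auto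
    have e: "\<phi> \<cdot>\<^bsub>D\<^esub> cov x = cov y \<cdot>\<^bsub>D\<^esub> onArr J f" unfolding f(1) by (rule ar_cov[OF f(3,4,2)])
    have eK: "onArr K \<phi> \<cdot>\<^bsub>E\<^esub> onArr K (cov x) = onArr K (cov y) \<cdot>\<^bsub>E\<^esub> onArr K (onArr J f)"
      using k(6)[of "cov x" \<phi>] k(6)[of "onArr J f" "cov y"] e cx cy Jf p d by simp
    have eL: "onArr L \<phi> \<cdot>\<^bsub>E\<^esub> onArr L (cov x) = onArr L (cov y) \<cdot>\<^bsub>E\<^esub> onArr L (onArr J f)"
      using l(6)[of "cov x" \<phi>] l(6)[of "onArr J f" "cov y"] e cx cy Jf p d by simp
    note ka = k(2-4)[OF p] k(2-4)[OF cx(1)] k(2-4)[OF cy(1)] k(2-4)[OF Jf(1)]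
    note la = l(2-4)[OF p] l(2-4)[OF cx(1)] l(2-4)[OF cy(1)] l(2-4)[OF Jf(1)]
    note tx = tau(1-3)[OF f(3)] and ty = tau(1-3)[OF f(4)]
    have "\<tau> y \<cdot>\<^bsub>E\<^esub> onArr K \<phi> = onArr L \<phi> \<cdot>\<^bsub>E\<^esub> \<tau> x"
    proof (rule E.epicD[OF E.regular_epi_epic[OF Kr[OF cov_regular_epi[OF f(3)]]]])
      have "(\<tau> y \<cdot>\<^bsub>E\<^esub> onArr K \<phi>) \<cdot>\<^bsub>E\<^esub> onArr K (cov x) = \<tau> y \<cdot>\<^bsub>E\<^esub> (onArr K (cov y) \<cdot>\<^bsub>E\<^esub> onArr K (onArr J f))"
        using eK ka ty cx d by simp
      also have "\<dots> = onArr L (cov y) \<cdot>\<^bsub>E\<^esub> (\<theta> (pt y) \<cdot>\<^bsub>E\<^esub> onArr K (onArr J f))"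
        by (rule E.extend_eq[OF tau(4)[OF f(4)]]) (use ka la ty cy Jf n[OF o(2)] in auto)
      also have "\<dots> = onArr L (cov y) \<cdot>\<^bsub>E\<^esub> (onArr L (onArr J f) \<cdot>\<^bsub>E\<^esub> \<theta> (pt x))"
        unfolding nn[OF fa] ..
      also have "\<dots> = onArr L \<phi> \<cdot>\<^bsub>E\<^esub> (onArr L (cov x) \<cdot>\<^bsub>E\<^esub> \<theta> (pt x))"
        by (rule E.extend_eq[OF eL[symmetric]]) (use la cx cy Jf d n[OF o(1)] in auto)
      also have "\<dots> = (onArr L \<phi> \<cdot>\<^bsub>E\<^esub> \<tau> x) \<cdot>\<^bsub>E\<^esub> onArr K (cov x)"
        using tau(4)[OF f(3)] la ka tx cx d by simp
      finally show "(\<tau> y \<cdot>\<^bsub>E\<^esub> onArr K \<phi>) \<cdot>\<^bsub>E\<^esub> onArr K (cov x) = (onArr L \<phi> \<cdot>\<^bsub>E\<^esub> \<tau> x) \<cdot>\<^bsub>E\<^esub> onArr K (cov x)" .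
    qed (use ka la tx ty cx d in auto)
    then show "\<tau> (Cod D \<phi>) \<cdot>\<^bsub>E\<^esub> onArr K \<phi> = onArr L \<phi> \<cdot>\<^bsub>E\<^esub> \<tau> (Dom D \<phi>)" unfolding d .
  qed
  then show thesis using that tau(4) by blast
qed

text \<open>As for the free regular category; here the composites are identities because every object is
  covered by one in the image of \<open>J\<close>, and covers are preserved by regular functors.\<close>

lemma (in weak_lex) extension_unique:
  assumes K: "regular_functor D E K" and L: "regular_functor D E L"
    and t: "nat_isomorphic S E (comp_functor K J) (comp_functor L J)"
  shows "nat_isomorphic D E K L"
proof -
  note kf = regular_functorD(1)[OF K] and lf = regular_functorD(1)[OF L]
  note k = functorD(3-)[OF kf] and l = functorD(3-)[OF lf]
  interpret E: category E using functorD[OF kf] by simp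
  obtain \<theta> \<theta>' where th: "nat_trans S E (comp_functor K J) (comp_functor L J) \<theta>" "nat_trans S E (comp_functor L J) (comp_functor K J) \<theta>'"
    and i: "\<And>A. A \<in> Ob S \<Longrightarrow> inverse_arrows E (\<theta> A) (\<theta>' A)" by (rule nat_isomorphicE[OF t]) blast
  obtain \<tau> where tau: "nat_trans D E K L \<tau>" "\<And>x. x \<in> Ob D \<Longrightarrow> \<tau> x \<cdot>\<^bsub>E\<^esub> onArr K (cov x) = onArr L (cov x) \<cdot>\<^bsub>E\<^esub> \<theta> (pt x)"
    by (rule extend_transformation[OF kf lf regular_functorD(4)[OF K] regular_functor_monic[OF L] th(1)]) blast+
  obtain \<tau>' where tau': "nat_trans D E L K \<tau>'" "\<And>x. x \<in> Ob D \<Longrightarrow> \<tau>' x \<cdot>\<^bsub>E\<^esub> onArr L (cov x) = onArr K (cov x) \<cdot>\<^bsub>E\<^esub> \<theta>' (pt x)"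
    by (rule extend_transformation[OF lf kf regular_functorD(4)[OF L] regular_functor_monic[OF K] th(2)]) blast+
  show ?thesis
  proof (rule nat_isomorphicI[OF kf lf tau(1)])
    fix x assume x: "x \<in> Ob D"
    have X: "pt x \<in> Ob S" using x by simp
    note c = cov_simps(1-3)[OF x]
    note n = nat_transD(1-3)[OF th(1) X, simplified] nat_transD(1-3)[OF th(2) X, simplified]
    note tx = nat_transD(1-3)[OF tau(1) x] nat_transD(1-3)[OF tau'(1) x]
    note ka = k(2-4)[OF c(1)] and la = l(2-4)[OF c(1)]
    have ii: "\<theta>' (pt x) \<cdot>\<^bsub>E\<^esub> \<theta> (pt x) = Id E (onOb K (jo (pt x)))" "\<theta> (pt x) \<cdot>\<^bsub>E\<^esub> \<theta>' (pt x) = Id E (onOb L (jo (pt x)))"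
      using i[OF X] n by (auto simp: inverse_arrows_def)
    have "\<tau>' x \<cdot>\<^bsub>E\<^esub> \<tau> x = Id E (onOb K x)"
    proof (rule E.epicD[OF E.regular_epi_epic[OF regular_functorD(4)[OF K cov_regular_epi[OF x]]]])
      have "(\<tau>' x \<cdot>\<^bsub>E\<^esub> \<tau> x) \<cdot>\<^bsub>E\<^esub> onArr K (cov x) = \<tau>' x \<cdot>\<^bsub>E\<^esub> (onArr L (cov x) \<cdot>\<^bsub>E\<^esub> \<theta> (pt x))"
        using tau(2)[OF x] tx ka c by simp
      also have "\<dots> = onArr K (cov x) \<cdot>\<^bsub>E\<^esub> (\<theta>' (pt x) \<cdot>\<^bsub>E\<^esub> \<theta> (pt x))"
        by (rule E.extend_eq[OF tau'(2)[OF x]]) (use tx ka la c n in auto)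
      finally show "(\<tau>' x \<cdot>\<^bsub>E\<^esub> \<tau> x) \<cdot>\<^bsub>E\<^esub> onArr K (cov x) = Id E (onOb K x) \<cdot>\<^bsub>E\<^esub> onArr K (cov x)"
        using ii ka c by simp
    qed (use tx ka c k(1)[OF x] in auto)
    moreover have "\<tau> x \<cdot>\<^bsub>E\<^esub> \<tau>' x = Id E (onOb L x)"
    proof (rule E.epicD[OF E.regular_epi_epic[OF regular_functorD(4)[OF L cov_regular_epi[OF x]]]])
      have "(\<tau> x \<cdot>\<^bsub>E\<^esub> \<tau>' x) \<cdot>\<^bsub>E\<^esub> onArr L (cov x) = \<tau> x \<cdot>\<^bsub>E\<^esub> (onArr K (cov x) \<cdot>\<^bsub>E\<^esub> \<theta>' (pt x))"
        using tau'(2)[OF x] tx la c by simp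
      also have "\<dots> = onArr L (cov x) \<cdot>\<^bsub>E\<^esub> (\<theta> (pt x) \<cdot>\<^bsub>E\<^esub> \<theta>' (pt x))"
        by (rule E.extend_eq[OF tau(2)[OF x]]) (use tx ka la c n in auto)
      finally show "(\<tau> x \<cdot>\<^bsub>E\<^esub> \<tau>' x) \<cdot>\<^bsub>E\<^esub> onArr L (cov x) = Id E (onOb L x) \<cdot>\<^bsub>E\<^esub> onArr L (cov x)"
        using ii la c by simp
    qed (use tx la c l(1)[OF x] in auto)
    ultimately show "inverse_arrows E (\<tau> x) (\<tau>' x)" using tx by (simp add: inverse_arrows_def)
  qed
qed

section \<open>Subobjects along an equivalence\<close>

lemma equivalence_faithful:
  assumes F: "is_functor C D F" and HF: "nat_isomorphic C C (comp_functor H F) id_functor"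
    and uv: "u \<in> Arr C" "v \<in> Arr C" "Dom C u = Dom C v" "Cod C u = Cod C v" "onArr F u = onArr F v"
  shows "u = v"
proof -
  interpret C: category C using functorD[OF F] by simp
  obtain \<eta> \<eta>' where n: "nat_trans C C (comp_functor H F) id_functor \<eta>" "\<And>A. A \<in> Ob C \<Longrightarrow> inverse_arrows C (\<eta> A) (\<eta>' A)"
    by (rule nat_isomorphicE[OF HF]) blast
  let ?A = "Dom C v"
  have A: "?A \<in> Ob C" using uv by simp
  have e: "\<eta> ?A \<in> Arr C" "\<eta>' ?A \<in> Arr C" "Cod C (\<eta> ?A) = ?A" "Dom C (\<eta>' ?A) = ?A" "Cod C (\<eta>' ?A) = Dom C (\<eta> ?A)"
    "\<eta> ?A \<cdot>\<^bsub>C\<^esub> \<eta>' ?A = Id C ?A"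
    using nat_transD(1-3)[OF n(1) A] n(2)[OF A] by (auto simp: inverse_arrows_def)
  have "u \<cdot>\<^bsub>C\<^esub> \<eta> ?A = v \<cdot>\<^bsub>C\<^esub> \<eta> ?A"
    using nat_transD(4)[OF n(1) uv(1,3,4)] nat_transD(4)[OF n(1) uv(2) refl refl] uv(5) by simp
  then have "u \<cdot>\<^bsub>C\<^esub> (\<eta> ?A \<cdot>\<^bsub>C\<^esub> \<eta>' ?A) = v \<cdot>\<^bsub>C\<^esub> (\<eta> ?A \<cdot>\<^bsub>C\<^esub> \<eta>' ?A)"
    by (rule C.extend_eq) (use uv(1-4) e in auto)
  then show ?thesis using uv(1-4) unfolding e(6) by simp
qed

lemma equivalence_full:
  assumes F: "is_functor C D F" and H: "is_functor D C H"
    and HF: "nat_isomorphic C C (comp_functor H F) id_functor" and FH: "nat_isomorphic D D (comp_functor F H) id_functor"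
    and AB: "A \<in> Ob C" "B \<in> Ob C" and w: "w \<in> Arr D" "Dom D w = onOb F A" "Cod D w = onOb F B"
  obtains u where "u \<in> Arr C" "Dom C u = A" "Cod C u = B" "onArr F u = w"
proof -
  interpret C: category C using functorD[OF F] by simp
  interpret D: category D using functorD[OF F] by simp
  note f = functorD(3-)[OF F] and h = functorD(3-)[OF H]
  obtain \<eta> \<eta>' where n: "nat_trans C C (comp_functor H F) id_functor \<eta>" "\<And>A. A \<in> Ob C \<Longrightarrow> inverse_arrows C (\<eta> A) (\<eta>' A)"
    by (rule nat_isomorphicE[OF HF]) blast
  have e: "\<eta> X \<in> Arr C" "\<eta>' X \<in> Arr C" "Cod C (\<eta> X) = X" "Dom C (\<eta> X) = onOb H (onOb F X)" "Dom C (\<eta>' X) = X" "Cod C (\<eta>' X) = onOb H (onOb F X)"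
    "\<eta>' X \<cdot>\<^bsub>C\<^esub> \<eta> X = Id C (onOb H (onOb F X))"
    if "X \<in> Ob C" for X
    using nat_transD(1-3)[OF n(1) that] n(2)[OF that] by (auto simp: inverse_arrows_def)
  have hw: "onArr H w \<in> Arr C" "Dom C (onArr H w) = onOb H (onOb F A)" "Cod C (onArr H w) = onOb H (onOb F B)"
    using h w by auto
  let ?u = "\<eta> B \<cdot>\<^bsub>C\<^esub> (onArr H w \<cdot>\<^bsub>C\<^esub> \<eta>' A)"
  have u: "?u \<in> Arr C" "Dom C ?u = A" "Cod C ?u = B" using hw e[OF AB(1)] e[OF AB(2)] by auto
  have Fu: "onArr F ?u \<in> Arr D" "Dom D (onArr F ?u) = onOb F A" "Cod D (onArr F ?u) = onOb F B"
    using f(2-4)[OF u(1)] u by simp_all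
  have "onArr H (onArr F ?u) = onArr H w"
  proof (rule C.monicD[OF C.iso_monic])
    show "iso C (\<eta> B)" unfolding iso_def using n(2)[OF AB(2)] by blast
    have "\<eta> B \<cdot>\<^bsub>C\<^esub> onArr H (onArr F ?u) = ?u \<cdot>\<^bsub>C\<^esub> \<eta> A" using nat_transD(4)[OF n(1) u] by simp
    also have "\<dots> = \<eta> B \<cdot>\<^bsub>C\<^esub> onArr H w" using hw e[OF AB(1)] e[OF AB(2)] by simp
    finally show "\<eta> B \<cdot>\<^bsub>C\<^esub> onArr H (onArr F ?u) = \<eta> B \<cdot>\<^bsub>C\<^esub> onArr H w" .
  qed (use h(2-4)[OF Fu(1)] Fu hw e[OF AB(2)] in auto)
  then have "onArr F ?u = w"
    by (rule equivalence_faithful[OF H FH Fu(1) w(1), rotated 2]) (use Fu w in auto)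
  then show thesis using that u by blast
qed

text \<open>The choice is immaterial, since functors preserve factorizations.\<close>

definition sub_image where
  "sub_image D F \<alpha> = slice_class D {m. monic D m} (onArr F (SOME m. m \<in> \<alpha>))"

locale regular_equivalence = C: regular_cat C + D: regular_cat D
  for C :: "('o, 'a) cat" and D :: "('p, 'b) cat" +
  fixes F :: "('o, 'a, 'p, 'b) functr" and H :: "('p, 'b, 'o, 'a) functr"
  assumes F: "regular_functor C D F" and H: "is_functor D C H"
    and HF: "nat_isomorphic C C (comp_functor H F) id_functor"
    and FH: "nat_isomorphic D D (comp_functor F H) id_functor"
begin

lemmas F_functor = regular_functorD(1)[OF F]
lemmas F_simps [simp] = functorD(3-)[OF F_functor]

sublocale SC: slice_doctrine C "{m. monic C m}" "is_pullback C" by (rule C.subobject_slice)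
sublocale SD: slice_doctrine D "{m. monic D m}" "is_pullback D" by (rule D.subobject_slice)

lemma factors_F:
  assumes u: "u \<in> Arr C" "v \<in> Arr C" "Cod C u = Cod C v"
  shows "factors_through D (onArr F u) (onArr F v) \<longleftrightarrow> factors_through C u v"
proof
  assume "factors_through D (onArr F u) (onArr F v)"
  then obtain h where h: "onArr F v \<cdot>\<^bsub>D\<^esub> h = onArr F u" "h \<in> Arr D" "Dom D h = Dom D (onArr F u)" "Cod D h = Dom D (onArr F v)"
    by (rule factors_throughE)
  have hd: "Dom D h = onOb F (Dom C u)" "Cod D h = onOb F (Dom C v)" using h u by simp_all
  obtain k where k: "k \<in> Arr C" "Dom C k = Dom C u" "Cod C k = Dom C v" "onArr F k = h"
    by (rule equivalence_full[OF F_functor H HF FH _ _ h(2) hd]) (use u in auto)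
  have "u = v \<cdot>\<^bsub>C\<^esub> k"
    by (rule equivalence_faithful[OF F_functor HF]) (use u k h(1) in auto)
  then show "factors_through C u v"
    by (rule factors_throughI) (use u k in auto)
next
  assume "factors_through C u v"
  then obtain h where h: "v \<cdot>\<^bsub>C\<^esub> h = u" "h \<in> Arr C" "Dom C h = Dom C u" "Cod C h = Dom C v" by (rule factors_throughE)
  have "onArr F (v \<cdot>\<^bsub>C\<^esub> h) = onArr F v \<cdot>\<^bsub>D\<^esub> onArr F h" using h(2,4) u by simp
  then show "factors_through D (onArr F u) (onArr F v)"
    unfolding h(1) by (rule factors_throughI) (use u h(2-4) in auto)
qed

lemma F_monic: "monic C m \<Longrightarrow> monic D (onArr F m)"
  by (rule regular_functor_monic[OF F])

lemma sub_image_cls: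
  assumes a: "monic C a" shows "sub_image D F (SC.cls a) = SD.cls (onArr F a)"
proof -
  have "a \<in> SC.cls a" using SC.cls_self a by simp
  then have "(SOME m. m \<in> SC.cls a) \<in> SC.cls a" by (rule someI)
  then have m: "monic C (SOME m. m \<in> SC.cls a)" "factors_through C a (SOME m. m \<in> SC.cls a)" "factors_through C (SOME m. m \<in> SC.cls a) a"
    using SC.clsD by auto
  then show ?thesis
    unfolding sub_image_def using a F_monic
    by (intro SD.cls_eqI) (auto simp: factors_F factors_through_def[of C])
qed

text \<open>Order is reflected by fullness and faithfulness. A subobject of \<open>F x\<close> has a domain isomorphic to
  some \<open>F H V\<close>, so it is the image of an arrow into \<open>x\<close>, and that arrow is monic by faithfulness.\<close>

lemma sub_image_order_iso:
  assumes x: "x \<in> Ob C" shows "order_iso (SC.Sub x) (SD.Sub (onOb F x)) (sub_image D F)"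
proof (rule order_isoI[OF SC.Sub_po SD.Sub_po])
  fix \<alpha> assume "\<alpha> \<in> carrier (SC.Sub x)"
  then obtain a where a: "monic C a" "Cod C a = x" "\<alpha> = SC.cls a" by (auto elim: SC.carrierE)
  show "sub_image D F \<alpha> \<in> carrier (SD.Sub (onOb F x))"
    unfolding a(3) sub_image_cls[OF a(1)] using a F_monic by simp
  fix \<beta> assume "\<beta> \<in> carrier (SC.Sub x)"
  then obtain b where b: "monic C b" "Cod C b = x" "\<beta> = SC.cls b" by (auto elim: SC.carrierE)
  have C: "SC.cls a \<sqsubseteq>\<^bsub>SC.Sub x\<^esub> SC.cls b \<longleftrightarrow> factors_through C a b"
  proof
    assume "SC.cls a \<sqsubseteq>\<^bsub>SC.Sub x\<^esub> SC.cls b"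
    then show "factors_through C a b" using a b C.factors_refl[of a] by (simp add: SC.le_iff)
  next
    assume "factors_through C a b"
    then show "SC.cls a \<sqsubseteq>\<^bsub>SC.Sub x\<^esub> SC.cls b"
      using SC.cls_self[of a] SC.cls_self[of b] a b by (auto simp: slice_poset_def)
  qed
  have D: "SD.cls (onArr F a) \<sqsubseteq>\<^bsub>SD.Sub (onOb F x)\<^esub> SD.cls (onArr F b) \<longleftrightarrow> factors_through D (onArr F a) (onArr F b)"
  proof
    assume "SD.cls (onArr F a) \<sqsubseteq>\<^bsub>SD.Sub (onOb F x)\<^esub> SD.cls (onArr F b)"
    then show "factors_through D (onArr F a) (onArr F b)" using a b F_monic D.factors_refl[of "onArr F a"] by (simp add: SD.le_iff)
  next
    assume "factors_through D (onArr F a) (onArr F b)"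
    then show "SD.cls (onArr F a) \<sqsubseteq>\<^bsub>SD.Sub (onOb F x)\<^esub> SD.cls (onArr F b)"
      using SD.cls_self[of "onArr F a"] SD.cls_self[of "onArr F b"] a b F_monic by (auto simp: slice_poset_def)
  qed
  show "\<alpha> \<sqsubseteq>\<^bsub>SC.Sub x\<^esub> \<beta> \<longleftrightarrow> sub_image D F \<alpha> \<sqsubseteq>\<^bsub>SD.Sub (onOb F x)\<^esub> sub_image D F \<beta>"
    unfolding a(3) b(3) sub_image_cls[OF a(1)] sub_image_cls[OF b(1)] C D using factors_F[of a b] a b by simp
next
  fix \<beta> assume "\<beta> \<in> carrier (SD.Sub (onOb F x))"
  then obtain n where n: "monic D n" "n \<in> Arr D" "Cod D n = onOb F x" "\<beta> = SD.cls n" by (auto elim: SD.carrierE)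
  let ?V = "Dom D n"
  have V: "?V \<in> Ob D" using n by simp
  obtain \<epsilon> \<epsilon>' where e: "nat_trans D D (comp_functor F H) id_functor \<epsilon>" "\<And>A. A \<in> Ob D \<Longrightarrow> inverse_arrows D (\<epsilon> A) (\<epsilon>' A)"
    by (rule nat_isomorphicE[OF FH]) blast
  have ev: "\<epsilon> ?V \<in> Arr D" "\<epsilon>' ?V \<in> Arr D" "Cod D (\<epsilon> ?V) = ?V" "Dom D (\<epsilon> ?V) = onOb F (onOb H ?V)" "Dom D (\<epsilon>' ?V) = ?V"
    "Cod D (\<epsilon>' ?V) = onOb F (onOb H ?V)" "\<epsilon> ?V \<cdot>\<^bsub>D\<^esub> \<epsilon>' ?V = Id D ?V"
    using nat_transD(1-3)[OF e(1) V] e(2)[OF V] by (auto simp: inverse_arrows_def)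
  have em: "monic D (\<epsilon> ?V)" by (rule D.iso_monic) (use e(2)[OF V] in \<open>auto simp: iso_def\<close>)
  let ?n = "n \<cdot>\<^bsub>D\<^esub> \<epsilon> ?V"
  have nm: "monic D ?n" by (rule D.monic_comp[OF n(1) em ev(3)])
  have na: "?n \<in> Arr D" "Dom D ?n = onOb F (onOb H ?V)" "Cod D ?n = onOb F x" using n ev by auto
  have HV: "onOb H ?V \<in> Ob C" using functorD(3)[OF H V] .
  obtain m where m: "m \<in> Arr C" "Dom C m = onOb H ?V" "Cod C m = x" "onArr F m = ?n"
    by (rule equivalence_full[OF F_functor H HF FH HV x na])
  have mm: "monic C m"
  proof (rule C.monicI[OF m(1)])
    fix u v assume uv: "u \<in> Arr C" "v \<in> Arr C" "Cod C u = Dom C m" "Cod C v = Dom C m" "Dom C u = Dom C v" "m \<cdot>\<^bsub>C\<^esub> u = m \<cdot>\<^bsub>C\<^esub> v"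
    have "onArr F (m \<cdot>\<^bsub>C\<^esub> u) = onArr F (m \<cdot>\<^bsub>C\<^esub> v)" using uv(6) by simp
    then have "onArr F m \<cdot>\<^bsub>D\<^esub> onArr F u = onArr F m \<cdot>\<^bsub>D\<^esub> onArr F v" using uv(1-5) m(1) by simp
    then have "?n \<cdot>\<^bsub>D\<^esub> onArr F u = ?n \<cdot>\<^bsub>D\<^esub> onArr F v" unfolding m(4) .
    then have "onArr F u = onArr F v" by (rule D.monicD[OF nm]) (use uv(1-5) m(1,2) na in auto)
    then show "u = v" by (rule equivalence_faithful[OF F_functor HF uv(1,2), rotated 2]) (use uv in auto)
  qed
  have "sub_image D F (SC.cls m) = \<beta>"
    unfolding n(4) sub_image_cls[OF mm] m(4)
  proof (rule SD.cls_eqI)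
    show "factors_through D ?n n" by (rule factors_throughI[of _ _ _ "\<epsilon> ?V"]) (use n ev in auto)
    have "n = ?n \<cdot>\<^bsub>D\<^esub> \<epsilon>' ?V" using n(2) ev by simp
    then show "factors_through D n ?n" by (rule factors_throughI) (use n ev na in auto)
  qed (use nm n in auto)
  then show "\<exists>\<alpha>\<in>carrier (SC.Sub x). sub_image D F \<alpha> = \<beta>" using mm m by (intro bexI[of _ "SC.cls m"]) auto
qed

lemma sub_image_natural:
  assumes f: "f \<in> Arr C" and "\<alpha> \<in> carrier (SC.Sub (Cod C f))"
  shows "sub_image D F (re SC.Doc f \<alpha>) = re SD.Doc (onArr F f) (sub_image D F \<alpha>)"
proof -
  obtain a where a: "monic C a" "a \<in> Arr C" "Cod C a = Cod C f" "\<alpha> = SC.cls a" using assms by (auto elim: SC.carrierE)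
  obtain p q where pb: "is_pullback C f a p q" using C.pullback_ex[OF f a(2)] a(3) by metis
  have "re SC.Doc f \<alpha> = SC.cls p" unfolding a(4) by (rule SC.re_cls[OF pb]) (use a in simp)
  moreover have "re SD.Doc (onArr F f) (SD.cls (onArr F a)) = SD.cls (onArr F p)"
    by (rule SD.re_cls[OF regular_functorD(3)[OF F pb]]) (use a F_monic in simp)
  ultimately show ?thesis
    using sub_image_cls[OF a(1)] sub_image_cls[OF C.pullback_monic[OF pb a(1)]] a(4) by simp
qed

end

section \<open>The comparison with the free regular category\<close>

lemma comp_functor_assoc: "comp_functor (comp_functor H G) F = comp_functor H (comp_functor G F)"
  by (simp add: comp_functor_def o_assoc)

lemma comp_id_functor: "comp_functor id_functor F = F"
  by (simp add: comp_functor_def id_functor_def)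

theorem mainTheorem6:
  fixes S :: "('o, 'a) cat"
    and R :: "('p, 'b) cat"
    and \<Gamma> :: "('o, 'a, 'p, 'b) functr"
  assumes "cartesian_category S"
    and "has_weak_pullbacks S"
    and "free_regular_wrt TYPE(('p, 'b) cat) S R \<Gamma>"
    and "free_regular_wrt TYPE((('o, 'a, 'a set) dp_ob, ('o, 'a, 'a set) dp_arr) cat) S R \<Gamma>"
  shows "ED_equivalent (doctrine_r (weak_subobjects S)) (subobjects R)"
proof -
  have R: "regular_category R" and lc: "left_covering S R \<Gamma>" using assms(3) by (simp_all add: free_regular_wrt_def)
  interpret weak_lex S using assms(1,2) by unfold_locales
  interpret R: regular_cat R using R by (rule regular_catI)
  interpret left_cov S R \<Gamma> using lc by unfold_locales
  let ?F = Fext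
  note Ff = regular_functorD(1)[OF Fext_regular]
  have "\<exists>H. regular_functor R D H \<and> nat_isomorphic S D (comp_functor H \<Gamma>) J"
    using assms(4) regular_D J_left_covering unfolding free_regular_wrt_def by blast
  then obtain H where H: "regular_functor R D H" and HJ: "nat_isomorphic S D (comp_functor H \<Gamma>) J" by blast
  note Hf = regular_functorD(1)[OF H]
  note FJ = comp_is_functor[OF J_functor Ff] and HG = comp_is_functor[OF G_functor Hf]
  have "nat_isomorphic S D (comp_functor (comp_functor H ?F) J) (comp_functor id_functor J)"
    unfolding comp_functor_assoc comp_id_functor
    by (rule nat_isomorphic_trans[OF comp_is_functor[OF FJ Hf] HG J_functor
          nat_isomorphic_whisker[OF FJ G_functor Hf Fext_J] HJ])
  then have HF: "nat_isomorphic D D (comp_functor H ?F) id_functor"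
    by (rule extension_unique[OF regular_functor_comp[OF Fext_regular H] regular_functor_id[OF D.category_axioms]])
  have "nat_isomorphic S R (comp_functor (comp_functor ?F H) \<Gamma>) (comp_functor id_functor \<Gamma>)"
    unfolding comp_functor_assoc comp_id_functor
    by (rule nat_isomorphic_trans[OF comp_is_functor[OF HG Ff] FJ G_functor
          nat_isomorphic_whisker[OF HG J_functor Ff HJ] Fext_J])
  then have FH: "nat_isomorphic R R (comp_functor ?F H) id_functor"
    by (rule free_regular_nat_iso[OF assms(3) R regular_functor_comp[OF H Fext_regular]
          regular_functor_id[OF R.category_axioms]])
  interpret Eq: regular_equivalence D R ?F H
    using Fext_regular Hf HF FH by unfold_locales
  obtain T where T: "is_terminal S T" using assms(1) by (auto simp: cartesian_category_def)
  obtain T' where T': "is_terminal R T'" using R.finite_limits by (auto simp: has_finite_limits_def)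
  have Q: "elementary_doctrine (subobjects R)"
    unfolding subobjects_slice by (rule Eq.SD.Doc_elementary)
  have [simp]: "base (subobjects R) = R" "fib (subobjects R) = Eq.SD.Sub" by (simp_all add: subobjects_slice)
  show ?thesis
  proof (rule ED_equivalentI[OF doctrine_r_elementary Q, where F = ?F and H = H and b = "\<lambda>x. sub_image R ?F \<circ> sub_of x"];
      unfold base_r \<open>base (subobjects R) = R\<close> \<open>fib (subobjects R) = Eq.SD.Sub\<close>)
    show "is_functor D R ?F" "is_functor R D H" by (rule Ff Hf)+
    show "preserves_binary_products D R ?F" by (rule regular_functor_products[OF Fext_regular terminal_D[OF T]])
    show "preserves_binary_products R D H" by (rule regular_functor_products[OF H T'])
    show "nat_isomorphic D D (comp_functor H ?F) id_functor" "nat_isomorphic R R (comp_functor ?F H) id_functor" by (rule HF FH)+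
    fix x assume x: "x \<in> Ob D"
    show "order_iso (fib (doctrine_r Psi) x) (Eq.SD.Sub (onOb ?F x)) (sub_image R ?F \<circ> sub_of x)"
      by (rule order_iso_comp[OF sub_of_order_iso[OF x] Eq.sub_image_order_iso[OF x]])
  next
    fix \<phi> \<beta> assume p: "\<phi> \<in> Arr D" and b: "\<beta> \<in> carrier (fib (doctrine_r Psi) (Cod D \<phi>))"
    have "sub_of (Cod D \<phi>) \<beta> \<in> carrier (SubD.Sub (Cod D \<phi>))"
      by (rule order_isoD(1)[OF sub_of_order_iso b]) (use p in simp)
    then show "(sub_image R ?F \<circ> sub_of (Dom D \<phi>)) (re (doctrine_r Psi) \<phi> \<beta>) =
        re (subobjects R) (onArr ?F \<phi>) ((sub_image R ?F \<circ> sub_of (Cod D \<phi>)) \<beta>)"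
      using sub_of_natural[OF p b] Eq.sub_image_natural[OF p] by (simp add: subobjects_slice)
  qed
qed

end
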